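(* Let $F$ be a Galois extension of $\mathbb{Q}$ with a (possibly trivial) involution, let $\epsilon\in\{+1,-1\}$, and let $\tau\in\widetilde{L}_0(F(t),\epsilon)$. Then $\tau=0$ in $\widetilde{L}_0(F(t),\epsilon)$ if and only if $\mathrm{sign}(\rho(\tau)(z))=0$ for all $\rho\in G_0(F)$ and all transcendental $z\in S^1$.
   Context: **Witt groups.** Let $R$ be a ring with (possibly trivial) involution $r\mapsto\bar r$ and let $\epsilon=\pm1$. An $\epsilon$-hermitian form is a sesquilinear map $\theta:V\times V\to R$ on a finitely generated free $R$-module $V$ with $\theta(ra,b)=\bar r\,\theta(a,b)$, $\theta(a,rb)=\theta(a,b)r$ and $\theta(a,b)=\epsilon\,\overline{\theta(b,a)}$ for all $a,b\in V$, $r\in R$. It is non-singular if $V\to\mathrm{Hom}(V,R)$, $a\mapsto(b\mapsto\theta(b,a))$ is an isomorphism. $L_0(R,\epsilon)$ is the Witt group of non-singular $\epsilon$-hermitian forms: the direct-sum monoid of such forms modulo the equivalence relation generated by setting to zero every form $(V,\theta)$ having a submodule of half rank on which $\theta$ vanishes. Put $\widetilde{L}_0(R,\epsilon):=L_0(R,\epsilon)\otimes_{\mathbb{Z}}\mathbb{Q}$. **Involutions.** $\overline{\mathbb{Q}}\subset\mathbb{C}$ is the algebraic closure of $\mathbb{Q}$ in $\mathbb{C}$; $\mathbb{C}$ and $\overline{\mathbb{Q}}$ carry complex conjugation. For a field $F$ with involution, $F(t)$ carries the involution extending that of $F$ with $\bar t=t^{-1}$; the same applies to $\overline{\mathbb{Q}}(t)$.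 **Signature.** For $[(V,\theta)]\in L_0(\mathbb{C},\epsilon)$ let $\mathrm{sign}:=\dim V^+-\dim V^-$, where $V^+$ (resp. $V^-$) is a maximal positive (resp. negative) subspace for the hermitian form $\sqrt{\epsilon}\,\theta$ (with $\sqrt{1}=1$, $\sqrt{-1}=i$). This is well defined and extends $\mathbb{Q}$-linearly to $\mathrm{sign}:\widetilde{L}_0(\mathbb{C},\epsilon)\to\mathbb{Q}$. **Embeddings.** $G(F)$ is the set of all $\mathbb{Q}$-linear field embeddings $\rho:F\to\overline{\mathbb{Q}}$ that preserve the involution (i.e. $\rho(\bar a)=\overline{\rho(a)}$). $G_0(F)\subset G(F)$ is any fixed subset such that for each $\rho\in G(F)$ there is precisely one $\tilde\rho\in G_0(F)$ with $\tilde\rho=\rho$ or $\tilde\rho=\bar\rho$. Each $\rho\in G(F)$ induces, by applying $\rho$ to coefficients (extension of scalars), a map $\rho:\widetilde{L}_0(F(t),\epsilon)\to\widetilde{L}_0(\overline{\mathbb{Q}}(t),\epsilon)$. **Evaluation.** Let $\tau=[(V,\theta)]\otimes\frac pq\in\widetilde{L}_0(\overline{\mathbb{Q}}(t),\epsilon)$ and let $z\in S^1=\{z\in\mathbb{C}:|z|=1\}$ be transcendental (over $\mathbb{Q}$). View $\mathbb{C}$ as a $\overline{\mathbb{Q}}(t)$-module via $f(t)\cdot w:=f(z)w$. Then $\tau(z):=[(V\otimes_{\overline{\mathbb{Q}}(t)}\mathbb{C},\theta_z)]\otimes\frac pq\in\widetilde{L}_0(\mathbb{C},\epsilon)$, where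 $\theta_z(v_1\otimes w_1,v_2\otimes w_2)=\bar w_1\,\theta(v_1,v_2)|_{t=z}\,w_2$; this is independent of the choice of $(V,\theta)$. *)

theory Defs
  imports
    "HOL-Algebra.Free_Abelian_Groups"
    "HOL-Algebra.Finite_Extensions"
    "Jordan_Normal_Form.VS_Connect"
    "HOL-Computational_Algebra.Polynomial_Factorial"
begin

section \<open>The algebraic closure of the rationals inside the complex numbers\<close>

lemma subfield_Rats: "subfield (\<rat> :: complex set) class_ring"
proof (rule field.subfieldI'[OF class_field])
  show "subring (\<rat> :: complex set) class_ring"
    by (rule ring.subringI[OF class_ring.ring_axioms]) (auto simp: class_ring_simps)
next
  fix k :: complex assume k: "k \<in> \<rat> - {\<zero>\<^bsub>class_ring\<^esub>}"
  hence "inv\<^bsub>class_ring\<^esub> k = inverse k"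
    by (intro comm_monoid.comm_inv_char[OF cring.axioms(2)[OF class_cring.cring_axioms]]) auto
  thus "inv\<^bsub>class_ring\<^esub> k \<in> \<rat>" using k by auto
qed

lemma eval_class_ring:
  "ring.eval (class_ring :: complex ring) p x = poly (Poly (rev p)) x"
proof (induction p)
  case Nil
  show ?case by (simp add: ring.eval.simps[OF class_ring.ring_axioms])
next
  case (Cons a p)
  thus ?case
    by (simp add: ring.eval.simps[OF class_ring.ring_axioms] class_ring_simps
        Poly_append poly_monom)
qed

lemma algebraic_iff_over_Rats:
  "algebraic (x :: complex) \<longleftrightarrow> (ring.algebraic class_ring over \<rat>) x"
proof
  assume "algebraic x"
  then obtain p where p: "\<And>i. coeff p i \<in> \<rat>" "p \<noteq> 0" "poly p x = 0"
    by (auto simp: algebraic_altdef)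
  let ?l = "rev (coeffs p)"
  have "set (coeffs p) \<subseteq> \<rat>"
  proof
    fix a assume "a \<in> set (coeffs p)"
    hence "a \<in> range (coeff p)" unfolding range_coeff by simp
    thus "a \<in> \<rat>" using p(1) by auto
  qed
  moreover have "hd ?l \<noteq> 0"
    using p(2) by (simp add: hd_rev last_coeffs_eq_coeff_degree)
  ultimately have "?l \<in> carrier (univ_poly class_ring \<rat>)"
    by (simp add: univ_poly_def polynomial_def)
  moreover have "?l \<noteq> []" using p by simp
  moreover have "ring.eval class_ring ?l x = 0"
    using p by (simp add: eval_class_ring)
  ultimately show "(ring.algebraic class_ring over \<rat>) x"
    by (intro ring.algebraicI[OF class_ring.ring_axioms]) simp_all
next
  assume "(ring.algebraic class_ring over \<rat>) x"
  then obtain p where p: "p \<in> carrier (univ_poly class_ring \<rat>)" "p \<noteq> []"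
    "ring.eval class_ring p x = 0"
    using domain.algebraicE[OF field.axioms(1)[OF class_field] subfieldE(1)[OF subfield_Rats], of x]
    by (metis UNIV_I partial_object.select_convs(1) ring.simps(1))
  have 1: "set p \<subseteq> \<rat>" "hd p \<noteq> 0"
    using p by (auto simp: univ_poly_def polynomial_def)
  show "algebraic x"
  proof (rule algebraicI')
    show "coeff (Poly (rev p)) i \<in> \<rat>" for i
      using 1 by (auto simp: nth_default_def rev_nth subset_iff)
    show "Poly (rev p) \<noteq> 0"
    proof
      assume "Poly (rev p) = 0"
      then obtain n where "rev p = replicate n 0" by (auto simp: Poly_eq_0)
      hence "\<forall>a\<in>set p. a = 0" by (metis in_set_replicate set_rev)
      thus False using 1 p(2) by (metis hd_in_set)
    qed
    show "poly (Poly (rev p)) x = 0" using p by (simp add: eval_class_ring)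
  qed
qed

lemma subfield_algebraic: "subfield {x :: complex. algebraic x} class_ring"
proof -
  have "{x :: complex. algebraic x} =
      {x \<in> carrier class_ring. (ring.algebraic class_ring over \<rat>) x}"
    by (simp only: algebraic_iff_over_Rats) simp
  thus ?thesis
    using field.subfield_of_algebraics[OF class_field subfield_Rats] by (simp only:)
qed

lemma algebraic_add_complex: "algebraic x \<Longrightarrow> algebraic y \<Longrightarrow> algebraic (x + y :: complex)"
  and algebraic_mult_complex: "algebraic x \<Longrightarrow> algebraic y \<Longrightarrow> algebraic (x * y :: complex)"
  using subringE(7,6)[OF subfieldE(1)[OF subfield_algebraic], of x y] by simp_all

typedef qbar = "{x :: complex. algebraic x}"
  morphisms of_qbar to_qbar by auto

setup_lifting type_definition_qbar

instantiation qbar :: field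
begin

lift_definition zero_qbar :: qbar is 0 by simp
lift_definition one_qbar :: qbar is 1 by simp
lift_definition plus_qbar :: "qbar \<Rightarrow> qbar \<Rightarrow> qbar" is "(+)" by (rule algebraic_add_complex)
lift_definition times_qbar :: "qbar \<Rightarrow> qbar \<Rightarrow> qbar" is "(*)" by (rule algebraic_mult_complex)
lift_definition uminus_qbar :: "qbar \<Rightarrow> qbar" is uminus by auto
lift_definition minus_qbar :: "qbar \<Rightarrow> qbar \<Rightarrow> qbar" is "(-)"
  by (metis algebraic_add_complex algebraic_minus_iff diff_conv_add_uminus)
lift_definition inverse_qbar :: "qbar \<Rightarrow> qbar" is inverse by auto
lift_definition divide_qbar :: "qbar \<Rightarrow> qbar \<Rightarrow> qbar" is "(/)"
  by (simp add: divide_inverse algebraic_mult_complex algebraic_inverse)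

instance
  by (standard; transfer; simp add: algebra_simps divide_inverse)

end

instance qbar :: field_char_0
proof
  have of_nat: "of_qbar (of_nat n) = of_nat n" for n
    by (induction n) (simp_all add: zero_qbar.rep_eq one_qbar.rep_eq plus_qbar.rep_eq)
  show "inj (of_nat :: nat \<Rightarrow> qbar)"
    by (rule injI) (metis of_nat of_nat_eq_iff)
qed

lift_definition cnj_qbar :: "qbar \<Rightarrow> qbar" is cnj by auto


section \<open>Fields with involution, rational functions\<close>

definition field_involution :: "('k::field \<Rightarrow> 'k) \<Rightarrow> bool" where
  "field_involution \<sigma> \<longleftrightarrow> field_hom \<sigma> \<and> (\<forall>x. \<sigma> (\<sigma> x) = x)"

text \<open>
  A field extension of the rationals is the same thing as a field of characteristic 0, and every
  homomorphism between two such fields is linear over the rationals. The extension is Galois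
  (possibly of infinite degree) if it is algebraic and the fixed field of its automorphism group
  is the field of rationals.
\<close>
definition galois_over_Rats :: "'f::field_char_0 itself \<Rightarrow> bool" where
  "galois_over_Rats _ \<longleftrightarrow>
     (\<forall>x::'f. algebraic x) \<and>
     {x::'f. \<forall>g. field_hom g \<and> bij g \<longrightarrow> g x = x} = \<rat>"

definition embeddings :: "('f::field_char_0 \<Rightarrow> 'f) \<Rightarrow> ('f \<Rightarrow> qbar) set" where
  "embeddings \<sigma> = {\<rho>. field_hom \<rho> \<and> (\<forall>a. \<rho> (\<sigma> a) = cnj_qbar (\<rho> a))}"

definition embeddings_up_to_cnj :: "('f::field_char_0 \<Rightarrow> 'f) \<Rightarrow> ('f \<Rightarrow> qbar) set \<Rightarrow> bool" where
  "embeddings_up_to_cnj \<sigma> G0 \<longleftrightarrow> G0 \<subseteq> embeddings \<sigma> \<and>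
     (\<forall>\<rho>\<in>embeddings \<sigma>. \<exists>!\<rho>'. \<rho>' \<in> G0 \<and> (\<rho>' = \<rho> \<or> \<rho>' = cnj_qbar \<circ> \<rho>))"

text \<open>
  The field of rational functions over \<open>'k\<close> is the type \<open>'k poly fract\<close>.
  The extension to fractions of a ring homomorphism \<open>h\<close> that is injective:
\<close>
definition fract_lift :: "('a::idom \<Rightarrow> 'b::field) \<Rightarrow> 'a fract \<Rightarrow> 'b" where
  "fract_lift h x = (THE y. \<exists>a b. b \<noteq> 0 \<and> x = Fraction_Field.Fract a b \<and> y = h a / h b)"

lemma fract_lift_Fract:
  assumes "comm_ring_hom h" "\<And>a. h a = 0 \<Longrightarrow> a = 0" "b \<noteq> 0"
  shows "fract_lift h (Fraction_Field.Fract a b) = h a / h b"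
proof -
  interpret comm_ring_hom h by fact
  have "h c / h d = h a / h b"
    if "d \<noteq> 0" "Fraction_Field.Fract a b = Fraction_Field.Fract c d" for c d
  proof -
    have "a * d = c * b" using that assms(3) by (simp add: eq_fract)
    hence "h a * h d = h c * h b" by (metis hom_mult)
    moreover have "h b \<noteq> 0" "h d \<noteq> 0" using assms that by blast+
    ultimately show ?thesis by (simp add: field_simps)
  qed
  thus ?thesis using assms(3) unfolding fract_lift_def by (intro the_equality) blast+
qed

text \<open>The involution extending \<open>\<sigma>\<close> and sending the variable to its inverse:\<close>
definition ratfun_inv :: "('k::field \<Rightarrow> 'k) \<Rightarrow> 'k poly fract \<Rightarrow> 'k poly fract" where
  "ratfun_inv \<sigma> =
     fract_lift (\<lambda>p. poly (map_poly (\<lambda>c. to_fract [:\<sigma> c:]) p) (inverse (to_fract [:0, 1:])))"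

definition ratfun_map :: "('k::field \<Rightarrow> 'l::field) \<Rightarrow> 'k poly fract \<Rightarrow> 'l poly fract" where
  "ratfun_map \<rho> = fract_lift (\<lambda>p. to_fract (map_poly \<rho> p))"

text \<open>Evaluation at a transcendental number \<open>z\<close> (only then is it defined on all fractions):\<close>
definition ratfun_eval :: "complex \<Rightarrow> qbar poly fract \<Rightarrow> complex" where
  "ratfun_eval z = fract_lift (\<lambda>p. poly (map_poly of_qbar p) z)"


section \<open>Hermitian forms and Witt groups over a field with involution\<close>

text \<open>
  Every finitely generated free module over a field is isomorphic to some \<open>carrier_vec n\<close>,
  and the Witt group depends on forms up to isometry only. Hence the forms considered are pairs
  of a dimension \<open>n\<close> and a form on \<open>carrier_vec n\<close> (whose values elsewhere are irrelevant).
\<close>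
type_synonym 'k form = "nat \<times> ('k vec \<Rightarrow> 'k vec \<Rightarrow> 'k)"

abbreviation vec_subspace :: "nat \<Rightarrow> 'k::field vec set \<Rightarrow> bool" where
  "vec_subspace n W \<equiv> VectorSpace.subspace class_ring W (module_vec TYPE('k) n)"

abbreviation vec_dim :: "nat \<Rightarrow> 'k::field vec set \<Rightarrow> nat" where
  "vec_dim n W \<equiv> vectorspace.dim class_ring ((module_vec TYPE('k) n)\<lparr>carrier := W\<rparr>)"

fun hermitian_form :: "('k::field \<Rightarrow> 'k) \<Rightarrow> int \<Rightarrow> 'k form \<Rightarrow> bool" where
  "hermitian_form \<sigma> \<epsilon> (n, \<theta>) \<longleftrightarrow>
     (\<forall>a\<in>carrier_vec n. \<forall>b\<in>carrier_vec n. \<forall>c\<in>carrier_vec n.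
        \<theta> (a + b) c = \<theta> a c + \<theta> b c \<and> \<theta> a (b + c) = \<theta> a b + \<theta> a c) \<and>
     (\<forall>r. \<forall>a\<in>carrier_vec n. \<forall>b\<in>carrier_vec n.
        \<theta> (r \<cdot>\<^sub>v a) b = \<sigma> r * \<theta> a b \<and> \<theta> a (r \<cdot>\<^sub>v b) = \<theta> a b * r) \<and>
     (\<forall>a\<in>carrier_vec n. \<forall>b\<in>carrier_vec n. \<theta> a b = of_int \<epsilon> * \<sigma> (\<theta> b a))"

text \<open>
  For fixed \<open>a\<close> the map sending \<open>b\<close> to \<open>\<theta> b a\<close> is conjugate-linear,
  so the dual module here consists of the conjugate-linear functionals. The map of the module into
  its dual is always linear.
\<close>
definition conj_dual :: "('k::field \<Rightarrow> 'k) \<Rightarrow> nat \<Rightarrow> ('k vec \<Rightarrow> 'k) set" where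
  "conj_dual \<sigma> n = {f \<in> extensional (carrier_vec n).
     (\<forall>a\<in>carrier_vec n. \<forall>b\<in>carrier_vec n. f (a + b) = f a + f b) \<and>
     (\<forall>r. \<forall>a\<in>carrier_vec n. f (r \<cdot>\<^sub>v a) = \<sigma> r * f a)}"

fun nonsingular :: "('k::field \<Rightarrow> 'k) \<Rightarrow> 'k form \<Rightarrow> bool" where
  "nonsingular \<sigma> (n, \<theta>) \<longleftrightarrow>
     bij_betw (\<lambda>a. restrict (\<lambda>b. \<theta> b a) (carrier_vec n)) (carrier_vec n) (conj_dual \<sigma> n)"

definition herm_forms :: "('k::field \<Rightarrow> 'k) \<Rightarrow> int \<Rightarrow> 'k form set" where
  "herm_forms \<sigma> \<epsilon> = {x. hermitian_form \<sigma> \<epsilon> x \<and> nonsingular \<sigma> x}"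

fun isometric :: "'k::field form \<Rightarrow> 'k form \<Rightarrow> bool" where
  "isometric (n, \<theta>) (m, \<eta>) \<longleftrightarrow>
     (\<exists>T. linear_map class_ring (module_vec TYPE('k) n) (module_vec TYPE('k) m) T \<and>
          bij_betw T (carrier_vec n) (carrier_vec m) \<and>
          (\<forall>a\<in>carrier_vec n. \<forall>b\<in>carrier_vec n. \<eta> (T a) (T b) = \<theta> a b))"

fun form_sum :: "'k::field form \<Rightarrow> 'k form \<Rightarrow> 'k form" where
  "form_sum (n, \<theta>) (m, \<eta>) =
     (n + m, \<lambda>a b. \<theta> (vec_first a n) (vec_first b n) + \<eta> (vec_last a m) (vec_last b m))"

definition zero_form :: "'k::field form" where
  "zero_form = (0, \<lambda>_ _. 0)"

fun metabolic :: "'k::field form \<Rightarrow> bool" where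
  "metabolic (n, \<theta>) \<longleftrightarrow>
     (\<exists>W. vec_subspace n W \<and> 2 * vec_dim n W = n \<and> (\<forall>a\<in>W. \<forall>b\<in>W. \<theta> a b = 0))"

text \<open>
  The congruence on the direct-sum monoid of isometry classes that is generated by setting the
  metabolic forms to zero, as a relation between forms:
\<close>
inductive_set witt_rel :: "('k::field \<Rightarrow> 'k) \<Rightarrow> int \<Rightarrow> 'k form rel"
  for \<sigma> :: "'k \<Rightarrow> 'k" and \<epsilon> :: int where
  isometric:
    "\<lbrakk>x \<in> herm_forms \<sigma> \<epsilon>; y \<in> herm_forms \<sigma> \<epsilon>; isometric x y\<rbrakk> \<Longrightarrow> (x, y) \<in> witt_rel \<sigma> \<epsilon>"
| metabolic:
    "\<lbrakk>x \<in> herm_forms \<sigma> \<epsilon>; metabolic x\<rbrakk> \<Longrightarrow> (x, zero_form) \<in> witt_rel \<sigma> \<epsilon>"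
| sym: "(x, y) \<in> witt_rel \<sigma> \<epsilon> \<Longrightarrow> (y, x) \<in> witt_rel \<sigma> \<epsilon>"
| trans: "\<lbrakk>(x, y) \<in> witt_rel \<sigma> \<epsilon>; (y, z) \<in> witt_rel \<sigma> \<epsilon>\<rbrakk> \<Longrightarrow> (x, z) \<in> witt_rel \<sigma> \<epsilon>"
| sum: "\<lbrakk>(x, y) \<in> witt_rel \<sigma> \<epsilon>; (x', y') \<in> witt_rel \<sigma> \<epsilon>\<rbrakk>
    \<Longrightarrow> (form_sum x x', form_sum y y') \<in> witt_rel \<sigma> \<epsilon>"

definition witt_group :: "('k::field \<Rightarrow> 'k) \<Rightarrow> int \<Rightarrow> 'k form set monoid" where
  "witt_group \<sigma> \<epsilon> =
     \<lparr>carrier = herm_forms \<sigma> \<epsilon> // witt_rel \<sigma> \<epsilon>,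
      monoid.mult = (\<lambda>A B. witt_rel \<sigma> \<epsilon> `` {form_sum x y | x y. x \<in> A \<and> y \<in> B}),
      one = witt_rel \<sigma> \<epsilon> `` {zero_form}\<rparr>"

text \<open>
  Extension of scalars along a field homomorphism \<open>h\<close> into a field with involution \<open>\<sigma>\<close>:
  on the standard basis the extended form has the values \<open>h (\<theta> e\<^sub>i e\<^sub>j)\<close>.
\<close>
fun form_ext :: "('k::field \<Rightarrow> 'l::field) \<Rightarrow> ('l \<Rightarrow> 'l) \<Rightarrow> 'k form \<Rightarrow> 'l form" where
  "form_ext h \<sigma> (n, \<theta>) =
     (n, \<lambda>a b. \<Sum>i<n. \<Sum>j<n. \<sigma> (a $ i) * h (\<theta> (unit_vec n i) (unit_vec n j)) * b $ j)"

definition witt_ext ::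
  "('k::field \<Rightarrow> 'l::field) \<Rightarrow> ('l \<Rightarrow> 'l) \<Rightarrow> int \<Rightarrow> 'k form set \<Rightarrow> 'l form set" where
  "witt_ext h \<sigma> \<epsilon> A = witt_rel \<sigma> \<epsilon> `` (form_ext h \<sigma> ` A)"


section \<open>Signatures of forms over the complex numbers\<close>

text \<open>\<open>csqrt 1 = 1\<close> and \<open>csqrt (- 1) = \<i>\<close>; the values of the scaled form on the diagonal are real.\<close>
fun positive_subspace :: "int \<Rightarrow> complex form \<Rightarrow> complex vec set \<Rightarrow> bool" where
  "positive_subspace \<epsilon> (n, \<theta>) W \<longleftrightarrow>
     vec_subspace n W \<and> (\<forall>a\<in>W. a \<noteq> 0\<^sub>v n \<longrightarrow> Re (csqrt (of_int \<epsilon>) * \<theta> a a) > 0)"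

fun negative_subspace :: "int \<Rightarrow> complex form \<Rightarrow> complex vec set \<Rightarrow> bool" where
  "negative_subspace \<epsilon> (n, \<theta>) W \<longleftrightarrow>
     vec_subspace n W \<and> (\<forall>a\<in>W. a \<noteq> 0\<^sub>v n \<longrightarrow> Re (csqrt (of_int \<epsilon>) * \<theta> a a) < 0)"

definition signature :: "int \<Rightarrow> complex form \<Rightarrow> int" where
  "signature \<epsilon> x = (THE s. \<exists>W W'.
     positive_subspace \<epsilon> x W \<and> (\<forall>U. positive_subspace \<epsilon> x U \<and> W \<subseteq> U \<longrightarrow> U = W) \<and>
     negative_subspace \<epsilon> x W' \<and> (\<forall>U. negative_subspace \<epsilon> x U \<and> W' \<subseteq> U \<longrightarrow> U = W') \<and>
     s = int (vec_dim (fst x) W) - int (vec_dim (fst x) W'))"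

definition witt_signature :: "int \<Rightarrow> complex form set \<Rightarrow> int" where
  "witt_signature \<epsilon> A = (THE s. \<forall>x\<in>A. signature \<epsilon> x = s)"


section \<open>Tensor products of abelian groups\<close>

text \<open>Abelian groups are written multiplicatively, as in HOL-Algebra.\<close>

definition tensor_relations ::
  "('a, 'c) monoid_scheme \<Rightarrow> ('b, 'd) monoid_scheme \<Rightarrow> ('a \<times> 'b \<Rightarrow>\<^sub>0 int) set" where
  "tensor_relations G H =
     {frag_of (a \<otimes>\<^bsub>G\<^esub> a', b) - frag_of (a, b) - frag_of (a', b) | a a' b.
        a \<in> carrier G \<and> a' \<in> carrier G \<and> b \<in> carrier H} \<union>
     {frag_of (a, b \<otimes>\<^bsub>H\<^esub> b') - frag_of (a, b) - frag_of (a, b') | a b b'.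
        a \<in> carrier G \<and> b \<in> carrier H \<and> b' \<in> carrier H}"

definition tensor_kernel ::
  "('a, 'c) monoid_scheme \<Rightarrow> ('b, 'd) monoid_scheme \<Rightarrow> ('a \<times> 'b \<Rightarrow>\<^sub>0 int) set" where
  "tensor_kernel G H =
     generate (free_Abelian_group (carrier G \<times> carrier H)) (tensor_relations G H)"

definition tensor_product ::
  "('a, 'c) monoid_scheme \<Rightarrow> ('b, 'd) monoid_scheme \<Rightarrow> ('a \<times> 'b \<Rightarrow>\<^sub>0 int) set monoid" where
  "tensor_product G H =
     free_Abelian_group (carrier G \<times> carrier H) Mod tensor_kernel G H"

definition pure_tensor ::
  "('a, 'c) monoid_scheme \<Rightarrow> ('b, 'd) monoid_scheme \<Rightarrow> 'a \<Rightarrow> 'b \<Rightarrow> ('a \<times> 'b \<Rightarrow>\<^sub>0 int) set" where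
  "pure_tensor G H a b =
     tensor_kernel G H #>\<^bsub>free_Abelian_group (carrier G \<times> carrier H)\<^esub> frag_of (a, b)"

text \<open>The homomorphism out of a tensor product induced by a bilinear map:\<close>
definition tensor_lift ::
  "('a, 'c) monoid_scheme \<Rightarrow> ('b, 'd) monoid_scheme \<Rightarrow> ('e, 'f) monoid_scheme \<Rightarrow>
     ('a \<Rightarrow> 'b \<Rightarrow> 'e) \<Rightarrow> ('a \<times> 'b \<Rightarrow>\<^sub>0 int) set \<Rightarrow> 'e" where
  "tensor_lift G H K B = (THE f.
     f \<in> hom (tensor_product G H) K \<and> f \<in> extensional (carrier (tensor_product G H)) \<and>
     (\<forall>a\<in>carrier G. \<forall>b\<in>carrier H. f (pure_tensor G H a b) = B a b))"

lemma tensor_relations_subset: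
  assumes "group G" "group H"
  shows "tensor_relations G H \<subseteq> carrier (free_Abelian_group (carrier G \<times> carrier H))"
proof -
  interpret G: group G by fact
  interpret H: group H by fact
  have diff: "Poly_Mapping.keys (x - y) \<subseteq> S"
    if "Poly_Mapping.keys x \<subseteq> S" "Poly_Mapping.keys y \<subseteq> S"
    for x y :: "'x \<Rightarrow>\<^sub>0 int" and S
    using that keys_diff[of x y] by blast
  show ?thesis
  proof
    fix r assume "r \<in> tensor_relations G H"
    thus "r \<in> carrier (free_Abelian_group (carrier G \<times> carrier H))"
      unfolding tensor_relations_def carrier_free_Abelian_group_iff
      by (elim UnE CollectE exE conjE; hypsubst; intro diff) simp_all
  qed
qed

lemma tensor_kernel_normal:
  assumes "group G" "group H"
  shows "tensor_kernel G H \<lhd> free_Abelian_group (carrier G \<times> carrier H)"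
  unfolding tensor_kernel_def
  by (intro comm_group.normal_iff_subgroup[THEN iffD2] abelian_free_Abelian_group
        group.generate_is_subgroup group_free_Abelian_group tensor_relations_subset assms)

lemma tensor_lift_ex1:
  assumes "group G" "group H" "comm_group K"
    and B: "\<And>a b. a \<in> carrier G \<Longrightarrow> b \<in> carrier H \<Longrightarrow> B a b \<in> carrier K"
    and B1: "\<And>a a' b. a \<in> carrier G \<Longrightarrow> a' \<in> carrier G \<Longrightarrow> b \<in> carrier H \<Longrightarrow>
      B (a \<otimes>\<^bsub>G\<^esub> a') b = B a b \<otimes>\<^bsub>K\<^esub> B a' b"
    and B2: "\<And>a b b'. a \<in> carrier G \<Longrightarrow> b \<in> carrier H \<Longrightarrow> b' \<in> carrier H \<Longrightarrow>
      B a (b \<otimes>\<^bsub>H\<^esub> b') = B a b \<otimes>\<^bsub>K\<^esub> B a b'"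
  shows "\<exists>!f. f \<in> hom (tensor_product G H) K \<and> f \<in> extensional (carrier (tensor_product G H)) \<and>
     (\<forall>a\<in>carrier G. \<forall>b\<in>carrier H. f (pure_tensor G H a b) = B a b)"
proof -
  interpret G: group G by fact
  interpret H: group H by fact
  interpret K: comm_group K by fact
  let ?S = "carrier G \<times> carrier H"
  let ?A = "free_Abelian_group ?S"
  let ?N = "tensor_kernel G H"
  have N: "?N \<lhd> ?A" by (rule tensor_kernel_normal) fact+
  obtain h where h: "h \<in> hom ?A K" "\<And>x. x \<in> ?S \<Longrightarrow> h (frag_of x) = case_prod B x"
  proof -
    have "case_prod B ` ?S \<subseteq> carrier K" using B by auto
    thus ?thesis using that K.free_Abelian_group_universal[of "case_prod B" ?S] by metis
  qed
  interpret h: group_hom ?A K h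
    using h(1) by (simp add: group_hom_def group_hom_axioms_def)
  have hd: "h (x - y) = h x \<otimes>\<^bsub>K\<^esub> inv\<^bsub>K\<^esub> h y" if "x \<in> carrier ?A" "y \<in> carrier ?A" for x y
  proof -
    have "h (x - y) = h (x \<otimes>\<^bsub>?A\<^esub> inv\<^bsub>?A\<^esub> y)" using that by simp
    also have "\<dots> = h x \<otimes>\<^bsub>K\<^esub> inv\<^bsub>K\<^esub> h y"
      using that by (simp only: h.hom_mult h.hom_inv h.G.inv_closed)
    finally show ?thesis .
  qed
  have fd: "frag_of x - frag_of y \<in> carrier ?A" if "x \<in> ?S" "y \<in> ?S" for x y
    using that keys_diff[of "frag_of x" "frag_of y"] by auto
  have fo: "frag_of x \<in> carrier ?A" if "x \<in> ?S" for x using that by simp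
  have canc: "x \<otimes>\<^bsub>K\<^esub> y \<otimes>\<^bsub>K\<^esub> inv\<^bsub>K\<^esub> x \<otimes>\<^bsub>K\<^esub> inv\<^bsub>K\<^esub> y = \<one>\<^bsub>K\<^esub>"
    if "x \<in> carrier K" "y \<in> carrier K" for x y
  proof -
    have "x \<otimes>\<^bsub>K\<^esub> y \<otimes>\<^bsub>K\<^esub> inv\<^bsub>K\<^esub> x \<otimes>\<^bsub>K\<^esub> inv\<^bsub>K\<^esub> y =
        (x \<otimes>\<^bsub>K\<^esub> inv\<^bsub>K\<^esub> x) \<otimes>\<^bsub>K\<^esub> (y \<otimes>\<^bsub>K\<^esub> inv\<^bsub>K\<^esub> y)"
      using that by (simp only: K.m_ac K.inv_closed K.m_closed)
    thus ?thesis using that by simp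
  qed
  have "tensor_relations G H \<subseteq> kernel ?A K h"
  proof
    fix r assume r: "r \<in> tensor_relations G H"
    have rA: "r \<in> carrier ?A" using r tensor_relations_subset[OF assms(1,2)] by blast
    have "h r = \<one>\<^bsub>K\<^esub>"
      using r unfolding tensor_relations_def
    proof (elim UnE CollectE exE conjE)
      fix a a' b assume *: "r = frag_of (a \<otimes>\<^bsub>G\<^esub> a', b) - frag_of (a, b) - frag_of (a', b)"
        "a \<in> carrier G" "a' \<in> carrier G" "b \<in> carrier H"
      show ?thesis unfolding *(1) using * B
        by (subst hd[OF fd fo] hd[OF fo fo]; simp add: h(2) B1 canc)+
    next
      fix a b b' assume *: "r = frag_of (a, b \<otimes>\<^bsub>H\<^esub> b') - frag_of (a, b) - frag_of (a, b')"
        "a \<in> carrier G" "b \<in> carrier H" "b' \<in> carrier H"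
      show ?thesis unfolding *(1) using * B
        by (subst hd[OF fd fo] hd[OF fo fo]; simp add: h(2) B2 canc)+
    qed
    thus "r \<in> kernel ?A K h" using rA by (simp add: kernel_def)
  qed
  hence "?N \<subseteq> kernel ?A K h"
    unfolding tensor_kernel_def by (intro h.G.generate_subgroup_incl h.subgroup_kernel)
  then obtain g where g: "g \<in> hom (?A Mod ?N) K"
      "\<And>x. x \<in> carrier ?A \<Longrightarrow> g (?N #>\<^bsub>?A\<^esub> x) = h x"
    using h.FactGroup_universal_kernel[OF N] by blast
  show ?thesis
  proof (rule ex1I[of _ "restrict g (carrier (tensor_product G H))"], intro conjI ballI)
    interpret T: group "tensor_product G H"
      unfolding tensor_product_def using N by (rule normal.factorgroup_is_group)
    show "restrict g (carrier (tensor_product G H)) \<in> hom (tensor_product G H) K"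
      using g(1) unfolding tensor_product_def[symmetric] by (auto simp: hom_def Pi_iff)
    show "restrict g (carrier (tensor_product G H)) (pure_tensor G H a b) = B a b"
      if "a \<in> carrier G" "b \<in> carrier H" for a b
    proof -
      have "pure_tensor G H a b \<in> carrier (tensor_product G H)"
        using fo[of "(a, b)"] that
        by (auto simp: tensor_product_def pure_tensor_def carrier_FactGroup)
      thus ?thesis using g(2)[OF fo[of "(a, b)"]] h(2)[of "(a, b)"] that
        by (simp add: pure_tensor_def)
    qed
  next
    fix f assume f: "f \<in> hom (tensor_product G H) K \<and>
      f \<in> extensional (carrier (tensor_product G H)) \<and>
      (\<forall>a\<in>carrier G. \<forall>b\<in>carrier H. f (pure_tensor G H a b) = B a b)"
    interpret N: normal ?N ?A by (fact N)
    interpret T: group "?A Mod ?N" by (rule N.factorgroup_is_group)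
    interpret f: group_hom "?A Mod ?N" K f
      using f by (simp add: group_hom_def group_hom_axioms_def T.group_axioms
          tensor_product_def)
    have coset: "(#>\<^bsub>?A\<^esub>) ?N \<in> hom ?A (?A Mod ?N)" by (rule N.r_coset_hom_Mod)
    interpret c: group_hom ?A "?A Mod ?N" "(#>\<^bsub>?A\<^esub>) ?N"
      using coset by (simp add: group_hom_def group_hom_axioms_def T.group_axioms)
    have eq: "f (?N #>\<^bsub>?A\<^esub> x) = h x" if "x \<in> carrier ?A" for x
    proof (rule free_Abelian_group_induct[of x ?S])
      show "Poly_Mapping.keys x \<subseteq> ?S" using that by simp
    next
      show "f (?N #>\<^bsub>?A\<^esub> 0) = h 0"
        using f.hom_one c.hom_one h.hom_one by (metis one_free_Abelian_group)
    next
      fix x y assume xy: "Poly_Mapping.keys x \<subseteq> ?S" "Poly_Mapping.keys y \<subseteq> ?S"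
        and IH: "f (?N #>\<^bsub>?A\<^esub> x) = h x" "f (?N #>\<^bsub>?A\<^esub> y) = h y"
      have xy': "x \<in> carrier ?A" "y \<in> carrier ?A" using xy by auto
      have "x - y = x \<otimes>\<^bsub>?A\<^esub> inv\<^bsub>?A\<^esub> y" using xy by simp
      thus "f (?N #>\<^bsub>?A\<^esub> (x - y)) = h (x - y)" using IH xy'
        by (simp only: c.hom_mult f.hom_mult c.hom_inv f.hom_inv h.hom_mult h.hom_inv
            h.G.inv_closed c.hom_closed T.inv_closed)
    next
      fix a assume a: "a \<in> ?S"
      obtain p q where "a = (p, q)" by (cases a)
      thus "f (?N #>\<^bsub>?A\<^esub> frag_of a) = h (frag_of a)"
        using f h(2)[of "(p, q)"] a by (simp add: pure_tensor_def)
    qed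
    show "f = restrict g (carrier (tensor_product G H))"
    proof (rule extensionalityI[of _ "carrier (tensor_product G H)"])
      fix Y assume Y: "Y \<in> carrier (tensor_product G H)"
      then obtain x where "x \<in> carrier ?A" "Y = ?N #>\<^bsub>?A\<^esub> x"
        by (auto simp: tensor_product_def carrier_FactGroup)
      thus "f Y = restrict g (carrier (tensor_product G H)) Y"
        using Y eq g(2) by simp
    qed (use f in auto)
  qed auto
qed

definition rat_group :: "rat monoid" where
  "rat_group = \<lparr>carrier = UNIV, monoid.mult = (+), one = 0\<rparr>"


section \<open>Rational Witt groups\<close>

type_synonym 'k rat_witt = "('k form set \<times> rat \<Rightarrow>\<^sub>0 int) set"

definition rat_witt_group :: "('k::field \<Rightarrow> 'k) \<Rightarrow> int \<Rightarrow> 'k rat_witt monoid" where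
  "rat_witt_group \<sigma> \<epsilon> = tensor_product (witt_group \<sigma> \<epsilon>) rat_group"

text \<open>
  Extension of scalars along \<open>h\<close>, from a field with involution \<open>\<sigma>\<close> to a field with
  involution \<open>\<sigma>'\<close>, tensored with the rationals:
\<close>
definition rat_witt_ext ::
  "('k::field \<Rightarrow> 'k) \<Rightarrow> ('l::field \<Rightarrow> 'l) \<Rightarrow> ('k \<Rightarrow> 'l) \<Rightarrow> int \<Rightarrow> 'k rat_witt \<Rightarrow> 'l rat_witt" where
  "rat_witt_ext \<sigma> \<sigma>' h \<epsilon> =
     tensor_lift (witt_group \<sigma> \<epsilon>) rat_group (rat_witt_group \<sigma>' \<epsilon>)
       (\<lambda>A q. pure_tensor (witt_group \<sigma>' \<epsilon>) rat_group (witt_ext h \<sigma>' \<epsilon> A) q)"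

definition embed_coeffs ::
  "('f::field_char_0 \<Rightarrow> 'f) \<Rightarrow> ('f \<Rightarrow> qbar) \<Rightarrow> int \<Rightarrow>
     'f poly fract rat_witt \<Rightarrow> qbar poly fract rat_witt" where
  "embed_coeffs \<sigma> \<rho> \<epsilon> = rat_witt_ext (ratfun_inv \<sigma>) (ratfun_inv cnj_qbar) (ratfun_map \<rho>) \<epsilon>"

definition eval_at :: "complex \<Rightarrow> int \<Rightarrow> qbar poly fract rat_witt \<Rightarrow> complex rat_witt" where
  "eval_at z \<epsilon> = rat_witt_ext (ratfun_inv cnj_qbar) cnj (ratfun_eval z) \<epsilon>"

definition rat_signature :: "int \<Rightarrow> complex rat_witt \<Rightarrow> rat" where
  "rat_signature \<epsilon> =
     tensor_lift (witt_group cnj \<epsilon>) rat_group rat_group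
       (\<lambda>A q. of_int (witt_signature \<epsilon> A) * q)"

end

theory Submission imports Defs "HOL-Analysis.Continuum_Not_Denumerable" "Jordan_Normal_Form.Char_Poly" begin

text \<open>
  Let \<open>K0\<close> be the subfield of \<open>F(t)\<close> that is fixed by the involution. Every form is isometric to a
  diagonal one, and after division by a fixed \<open>\<epsilon>\<close>-symmetric element its entries lie in \<open>K0\<close>. One
  direction of the theorem is clear because evaluation and signature are homomorphisms. For the other one
  a class \<open>v\<close> of infinite order has to be detected by a signature. This is done in two steps.

  The first step is algebraic and produces an ordering of \<open>K0\<close> in which all norms \<open>x * J x\<close> are
  positive and in which the diagonal entries of \<open>v\<close> do not have as many positive as negative signs
  (\<open>nontorsion_ordering\<close>). The group of non-zero elements of \<open>K0\<close> acts on the Witt group by scaling,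
  and squares and norms act trivially. Rationally, the Witt group hence decomposes into
  simultaneous eigenspaces for the entries \<open>a\<close> of \<open>v\<close>, on which \<open>a\<close> acts as \<open>1\<close> or as
  inversion. A projection to an eigenspace in which \<open>v\<close> survives turns \<open>v\<close> into a signed number of
  copies of one class. The scalars that fix this class up to torsion are closed under addition, by the isometry between
  \<open>[c, d]\<close> and \<open>[c + d, c * d * (c + d)]\<close>, so that they form a preordering; it is extended to an
  ordering by Zorn's lemma, and there the signed number is the number of positive minus the number of negative entries.

  The second step is analytic and realises the signs of finitely many elements in the ordering at a point of the circle
  (\<open>positive_point_on_circle\<close>). Taking the standard part with respect to the ordering gives a real
  embedding of the fixed field of \<open>\<sigma>\<close>, since constants are algebraic over the rationals and therefore finite,
  and it extends to an embedding \<open>\<rho>\<close> of \<open>F\<close> that preserves the involutions, since norms are positive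
  (\<open>complex_embedding\<close>). The circle is parametrised by a real coordinate: \<open>u = t + inverse t\<close> if the
  involution of \<open>F\<close> is trivial and a Moebius transformation of \<open>t\<close> otherwise. The elements of \<open>K0\<close>
  are, up to squares, polynomials in \<open>u\<close>, and polynomials that are positive at \<open>u\<close> are positive on a whole
  interval at the standard part of \<open>u\<close> (\<open>positive_interval\<close>). The interval is uncountable, so it contains
  a point that corresponds to a transcendental \<open>z\<close> on the circle. The signature of \<open>\<rho>(v)(z)\<close> is then up to
  sign the number of positive minus the number of negative entries of \<open>v\<close>, which is not zero. Replacing \<open>\<rho>\<close>
  by its conjugate corresponds to replacing \<open>z\<close> by its conjugate and does not change the signs, so
  that \<open>\<rho>\<close> can be taken from \<open>G0\<close>.
\<close>

section \<open>Linear algebra in coordinate spaces\<close>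

lemma homogeneous_solution:
  fixes f :: "'i \<Rightarrow> 'j \<Rightarrow> 'a::field"
  assumes "finite I" "finite J" "card I < card J"
  shows "\<exists>c. (\<exists>j\<in>J. c j \<noteq> 0) \<and> (\<forall>i\<in>I. (\<Sum>j\<in>J. f i j * c j) = 0)"
  using assms
proof (induction I arbitrary: J f rule: finite_induct)
  case empty
  hence "\<exists>j. j \<in> J" by (metis card_gt_0_iff card.empty ex_in_conv)
  thus ?case by (intro exI[of _ "\<lambda>_. 1"]) auto
next
  case (insert i I)
  show ?case
  proof (cases "\<forall>j\<in>J. f i j = 0")
    case True
    have "card I < card J" using insert by simp
    then obtain c where "\<exists>j\<in>J. c j \<noteq> 0" "\<forall>i\<in>I. (\<Sum>j\<in>J. f i j * c j) = 0"
      using insert.IH[of J f] insert.prems by blast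
    thus ?thesis using True by (intro exI[of _ c]) auto
  next
    case False
    then obtain k where k: "k \<in> J" "f i k \<noteq> 0" by blast
    let ?J = "J - {k}"
    have "card I < card ?J" using insert k by simp
    then obtain c where c: "\<exists>j\<in>?J. c j \<noteq> 0"
      "\<forall>l\<in>I. (\<Sum>j\<in>?J. (f l j - f l k * f i j / f i k) * c j) = 0"
      using insert.IH[of ?J "\<lambda>l j. f l j - f l k * f i j / f i k"] insert.prems by auto
    define d where "d = c(k := - (\<Sum>j\<in>?J. f i j * c j) / f i k)"
    have d: "(\<Sum>j\<in>J. f l j * d j) = (\<Sum>j\<in>?J. (f l j - f l k * f i j / f i k) * c j)" for l
    proof -
      have "(\<Sum>j\<in>J. f l j * d j) = f l k * d k + (\<Sum>j\<in>?J. f l j * d j)"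
        using k insert.prems by (simp add: sum.remove)
      also have "(\<Sum>j\<in>?J. f l j * d j) = (\<Sum>j\<in>?J. f l j * c j)"
        by (rule sum.cong) (auto simp: d_def)
      also have "f l k * d k = - (\<Sum>j\<in>?J. (f l k * f i j / f i k) * c j)"
        by (simp add: d_def sum_distrib_left sum_divide_distrib mult.assoc)
      finally show ?thesis by (simp add: algebra_simps sum_subtractf)
    qed
    have "(\<Sum>j\<in>J. f l j * d j) = 0" if "l \<in> insert i I" for l
      using that c(2) k(2) unfolding d by auto
    moreover have "\<exists>j\<in>J. d j \<noteq> 0" using c(1) by (auto simp: d_def)
    ultimately show ?thesis by blast
  qed
qed

lemma vec_subspace_iff:
  "vec_subspace n (W :: 'a::field vec set) \<longleftrightarrow> W \<subseteq> carrier_vec n \<and> 0\<^sub>v n \<in> W \<and>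
     (\<forall>a\<in>W. \<forall>b\<in>W. a + b \<in> W) \<and> (\<forall>r. \<forall>a\<in>W. r \<cdot>\<^sub>v a \<in> W)"
  using vec_vs[where 'a='a, of n] vec_module[where 'a='a, of n]
  unfolding subspace_def submodule_def
  by (auto simp: module_vec_simps)

lemma linear_map_vec_iff:
  "linear_map class_ring (module_vec TYPE('a::field) n) (module_vec TYPE('a) m) T \<longleftrightarrow>
     T \<in> carrier_vec n \<rightarrow> carrier_vec m \<and>
     (\<forall>a\<in>carrier_vec n. \<forall>b\<in>carrier_vec n. T (a + b) = T a + T b) \<and>
     (\<forall>r. \<forall>a\<in>carrier_vec n. T (r \<cdot>\<^sub>v a) = r \<cdot>\<^sub>v T a)"
  using vec_vs[where 'a='a, of n] vec_module[where 'a='a, of n]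
   vec_vs[where 'a='a, of m] vec_module[where 'a='a, of m]
  unfolding linear_map_def mod_hom_def mod_hom_axioms_def module_hom_def
  by (auto simp: module_vec_simps)

definition lincomb_vec :: "nat \<Rightarrow> nat \<Rightarrow> (nat \<Rightarrow> 'a::field vec) \<Rightarrow> (nat \<Rightarrow> 'a) \<Rightarrow> 'a vec" where
  "lincomb_vec n k v c = vec n (\<lambda>i. \<Sum>j<k. c j * v j $ i)"

lemma lincomb_vec_carrier [simp]: "lincomb_vec n k v c \<in> carrier_vec n"
  by (simp add: lincomb_vec_def)

lemma lincomb_vec_cong:
  "(\<And>j. j < k \<Longrightarrow> c j = d j) \<Longrightarrow> (\<And>j. j < k \<Longrightarrow> v j = w j) \<Longrightarrow>
     lincomb_vec n k v c = lincomb_vec n k w d"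
  unfolding lincomb_vec_def by (intro eq_vecI) simp_all

lemma lincomb_vec_0 [simp]: "lincomb_vec n 0 v c = 0\<^sub>v n"
  by (auto simp: lincomb_vec_def)

lemma lincomb_vec_Suc:
  "v k \<in> carrier_vec n \<Longrightarrow> lincomb_vec n (Suc k) v c = lincomb_vec n k v c + c k \<cdot>\<^sub>v v k"
  by (auto simp: lincomb_vec_def)

lemma lincomb_vec_add:
  "lincomb_vec n k v (\<lambda>j. c j + d j) = lincomb_vec n k v c + lincomb_vec n k v d"
  by (intro eq_vecI) (simp_all add: lincomb_vec_def algebra_simps sum.distrib)

lemma lincomb_vec_smult:
  "lincomb_vec n k v (\<lambda>j. r * c j) = r \<cdot>\<^sub>v lincomb_vec n k v c"
  by (intro eq_vecI) (simp_all add: lincomb_vec_def mult.assoc sum_distrib_left)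

lemma lincomb_vec_linear:
  "linear_map class_ring (module_vec TYPE('a::field) k) (module_vec TYPE('a) n)
     (\<lambda>a. lincomb_vec n k v (($) a))"
  unfolding linear_map_vec_iff
proof (intro conjI ballI allI Pi_I)
  fix a b :: "'a vec" assume *: "a \<in> carrier_vec k" "b \<in> carrier_vec k"
  show "lincomb_vec n k v (($) (a + b)) = lincomb_vec n k v (($) a) + lincomb_vec n k v (($) b)"
    unfolding lincomb_vec_add[symmetric] using * by (intro lincomb_vec_cong) auto
next
  fix r :: 'a and a :: "'a vec" assume *: "a \<in> carrier_vec k"
  show "lincomb_vec n k v (($) (r \<cdot>\<^sub>v a)) = r \<cdot>\<^sub>v lincomb_vec n k v (($) a)"
    unfolding lincomb_vec_smult[symmetric] using * by (intro lincomb_vec_cong) auto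
qed simp

lemma lincomb_vec_in_subspace:
  assumes "vec_subspace n W" "\<And>j. j < k \<Longrightarrow> v j \<in> W"
  shows "lincomb_vec n k v c \<in> W"
  using assms(2)
proof (induction k)
  case 0
  thus ?case using assms(1) by (simp add: vec_subspace_iff)
next
  case (Suc k)
  have "v k \<in> carrier_vec n" using assms(1) Suc.prems[of k] by (auto simp: vec_subspace_iff)
  thus ?case using assms(1) Suc by (simp add: lincomb_vec_Suc vec_subspace_iff)
qed

definition indep_family :: "nat \<Rightarrow> nat \<Rightarrow> (nat \<Rightarrow> 'a::field vec) \<Rightarrow> bool" where
  "indep_family n k v \<longleftrightarrow> (\<forall>j<k. v j \<in> carrier_vec n) \<and>
     (\<forall>c. lincomb_vec n k v c = 0\<^sub>v n \<longrightarrow> (\<forall>j<k. c j = 0))"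

lemma indep_family_le:
  assumes "indep_family n k v"
  shows "k \<le> n"
proof (rule ccontr)
  assume "\<not> k \<le> n"
  then obtain c where c: "\<exists>j<k. c j \<noteq> 0" "\<forall>i<n. (\<Sum>j<k. v j $ i * c j) = 0"
    using homogeneous_solution[of "{..<n}" "{..<k}" "\<lambda>i j. v j $ i"] by auto
  hence "lincomb_vec n k v c = 0\<^sub>v n"
    by (auto simp: lincomb_vec_def mult.commute)
  thus False using assms c(1) by (auto simp: indep_family_def)
qed

lemma indep_family_Suc:
  assumes "indep_family n k v" "u \<in> carrier_vec n" "\<And>c. u \<noteq> lincomb_vec n k v c"
  shows "indep_family n (Suc k) (v(k := u))"
  unfolding indep_family_def
proof (intro conjI allI impI)
  show "(v(k := u)) j \<in> carrier_vec n" if "j < Suc k" for j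
    using assms that by (auto simp: indep_family_def)
  fix c j assume c: "lincomb_vec n (Suc k) (v(k := u)) c = 0\<^sub>v n" and j: "j < Suc k"
  have eq: "lincomb_vec n (Suc k) (v(k := u)) c = lincomb_vec n k v c + c k \<cdot>\<^sub>v u"
    using assms(2) lincomb_vec_cong[of k c c "v(k := u)" v n] by (subst lincomb_vec_Suc) auto
  have ck: "c k = 0"
  proof (rule ccontr)
    assume ck: "c k \<noteq> 0"
    have "u = lincomb_vec n k v (\<lambda>j. - c j / c k)"
    proof
      show "dim_vec u = dim_vec (lincomb_vec n k v (\<lambda>j. - c j / c k))"
        using assms(2) by (simp add: lincomb_vec_def)
      fix i assume "i < dim_vec (lincomb_vec n k v (\<lambda>j. - c j / c k))"
      hence i: "i < n" by (simp add: lincomb_vec_def)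
      have "(lincomb_vec n k v c + c k \<cdot>\<^sub>v u) $ i = 0" using c i unfolding eq by simp
      hence "(\<Sum>j<k. c j * v j $ i) + c k * u $ i = 0"
        using i assms(2) by (simp add: lincomb_vec_def)
      hence "u $ i = - (\<Sum>j<k. c j * v j $ i) / c k"
        using ck by (simp add: field_simps eq_neg_iff_add_eq_0)
      thus "u $ i = lincomb_vec n k v (\<lambda>j. - c j / c k) $ i"
        using i by (simp add: lincomb_vec_def sum_negf sum_divide_distrib)
    qed
    thus False using assms(3) by blast
  qed
  hence "c k \<cdot>\<^sub>v u = 0\<^sub>v n" using assms(2) by auto
  hence "lincomb_vec n k v c = 0\<^sub>v n" using c unfolding eq
    by (metis lincomb_vec_carrier right_zero_vec)
  thus "c j = 0" using assms(1) j ck by (auto simp: indep_family_def less_Suc_eq)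
qed

text \<open>
  A family of maximal length spans: the length is bounded by the dimension \<open>n\<close>, and a vector outside the span can be added.
\<close>
lemma indep_family_extend:
  assumes "indep_family n k v" "vec_subspace n W" "\<And>j. j < k \<Longrightarrow> v j \<in> W"
  shows "\<exists>l w. k \<le> l \<and> indep_family n l w \<and> (\<forall>j<k. w j = v j) \<and> (\<forall>j<l. w j \<in> W) \<and>
    W = range (lincomb_vec n l w)"
proof -
  let ?P = "\<lambda>l. \<exists>w. k \<le> l \<and> indep_family n l w \<and> (\<forall>j<k. w j = v j) \<and> (\<forall>j<l. w j \<in> W)"
  have "?P k" using assms by blast
  moreover have "\<forall>l. ?P l \<longrightarrow> l \<le> n" using indep_family_le by blast
  ultimately have "\<exists>l. ?P l \<and> (\<forall>l'. ?P l' \<longrightarrow> l' \<le> l)"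
    by (rule Nat.ex_has_greatest_nat)
  then obtain l w where w: "k \<le> l" "indep_family n l w" "\<forall>j<k. w j = v j" "\<forall>j<l. w j \<in> W"
    and max: "\<And>l'. ?P l' \<Longrightarrow> l' \<le> l" by metis
  have "W \<subseteq> range (lincomb_vec n l w)"
  proof (rule ccontr)
    assume "\<not> W \<subseteq> range (lincomb_vec n l w)"
    then obtain u where u: "u \<in> W" "\<And>c. u \<noteq> lincomb_vec n l w c" by blast
    have "u \<in> carrier_vec n" using u(1) assms(2) by (auto simp: vec_subspace_iff)
    hence "indep_family n (Suc l) (w(l := u))" using w(2) u(2) by (intro indep_family_Suc)
    hence "?P (Suc l)" using w u(1) by (intro exI[of _ "w(l := u)"]) auto
    thus False using max[of "Suc l"] by simp
  qed
  moreover have "range (lincomb_vec n l w) \<subseteq> W"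
    using w(4) lincomb_vec_in_subspace[OF assms(2)] by blast
  ultimately show ?thesis using w by blast
qed

lemma indep_family_injD:
  assumes "indep_family n k v" "lincomb_vec n k v c = lincomb_vec n k v d" "j < k"
  shows "c j = d j"
proof -
  have "lincomb_vec n k v (\<lambda>j. c j - d j) = lincomb_vec n k v c - lincomb_vec n k v d"
    by (auto simp: lincomb_vec_def algebra_simps sum_subtractf)
  hence "lincomb_vec n k v (\<lambda>j. c j - d j) = 0\<^sub>v n" using assms(2)
    by (metis lincomb_vec_carrier minus_cancel_vec)
  thus ?thesis using assms(1,3) by (auto simp: indep_family_def)
qed

lemma vec_dim_eq:
  fixes v :: "nat \<Rightarrow> 'a::field vec"
  assumes "indep_family n k v"
  shows "vec_dim n (range (lincomb_vec n k v)) = k"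
proof -
  interpret k: vec_space "TYPE('a)" k .
  let ?T = "\<lambda>a. lincomb_vec n k v (($) a)"
  interpret T: linear_map class_ring "module_vec TYPE('a) k" "module_vec TYPE('a) n" ?T
    by (rule lincomb_vec_linear)
  have "T.kerT = {0\<^sub>v k}"
  proof
    show "T.kerT \<subseteq> {0\<^sub>v k}"
    proof
      fix a assume "a \<in> T.kerT"
      hence a: "a \<in> carrier_vec k" "?T a = 0\<^sub>v n"
        by (auto simp: T.ker_def module_vec_simps)
      hence "\<forall>j<k. a $ j = 0" using assms by (auto simp: indep_family_def)
      thus "a \<in> {0\<^sub>v k}" using a(1) by auto
    qed
    show "{0\<^sub>v k} \<subseteq> T.kerT"
      using T.f0_is_0 by (auto simp: T.ker_def module_vec_simps)
  qed
  moreover have "vec_dim k {0\<^sub>v k :: 'a vec} = 0"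
  proof -
    interpret Z: vectorspace class_ring "(module_vec TYPE('a) k)\<lparr>carrier := {0\<^sub>v k}\<rparr>"
      by (rule vectorspace.subspace_is_vs[OF vec_vs]) (use T.kerT_is_subspace calculation in simp)
    have "Z.lin_indpt {}" unfolding Z.lin_dep_def by blast
    moreover have "Z.span {} = {0\<^sub>v k}"
      unfolding Z.span_def Z.lincomb_def
      by (auto simp: module_vec_simps intro!: exI[of _ "{}"])
    ultimately have "Z.basis {}"
      by (simp add: Z.basis_def)
    thus ?thesis using Z.dim_basis[of "{}"] by simp
  qed
  moreover have "T.imT = range (lincomb_vec n k v)"
  proof
    show "T.imT \<subseteq> range (lincomb_vec n k v)" by (auto simp: T.im_def)
    show "range (lincomb_vec n k v) \<subseteq> T.imT"
    proof
      fix x assume "x \<in> range (lincomb_vec n k v)"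
      then obtain c where "x = lincomb_vec n k v c" by blast
      hence "x = ?T (vec k c)" using lincomb_vec_cong[of k c "($) (vec k c)" v v n] by simp
      thus "x \<in> T.imT" by (auto simp: T.im_def module_vec_simps)
    qed
  qed
  ultimately show ?thesis
    using T.rank_nullity k.fin_dim k.dim_is_n by simp
qed

lemma vec_subspace_basis:
  fixes W :: "'a::field vec set"
  assumes "vec_subspace n W"
  obtains v where "indep_family n (vec_dim n W) v" "\<And>j. j < vec_dim n W \<Longrightarrow> v j \<in> W"
    "W = range (lincomb_vec n (vec_dim n W) v)"
proof -
  have "indep_family n 0 (\<lambda>_. 0\<^sub>v n :: 'a vec)" by (auto simp: indep_family_def)
  then obtain l w where
    w: "indep_family n l w" "\<forall>j<l. w j \<in> W" "W = range (lincomb_vec n l w)"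
    using indep_family_extend[OF _ assms, of 0 "\<lambda>_. 0\<^sub>v n"] by auto
  have "vec_dim n W = l" unfolding w(3) by (rule vec_dim_eq[OF w(1)])
  thus ?thesis using that w by blast
qed

lemma vec_dim_lt_exists:
  fixes W :: "'a::field vec set"
  assumes "vec_subspace n W" "finite I" "card I < vec_dim n W"
    and lin: "\<And>i a b. i \<in> I \<Longrightarrow> a \<in> carrier_vec n \<Longrightarrow> b \<in> carrier_vec n \<Longrightarrow> f i (a + b) = f i a + f i b"
    "\<And>i r a. i \<in> I \<Longrightarrow> a \<in> carrier_vec n \<Longrightarrow> f i (r \<cdot>\<^sub>v a) = r * f i a"
  shows "\<exists>a\<in>W. a \<noteq> 0\<^sub>v n \<and> (\<forall>i\<in>I. f i a = (0 :: 'a))"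
proof -
  let ?d = "vec_dim n W"
  obtain v where v: "indep_family n ?d v" "\<And>j. j < ?d \<Longrightarrow> v j \<in> W"
    "W = range (lincomb_vec n ?d v)" using vec_subspace_basis[OF assms(1)] by metis
  obtain c where c: "\<exists>j<?d. c j \<noteq> 0" "\<forall>i\<in>I. (\<Sum>j<?d. f i (v j) * c j) = 0"
    using homogeneous_solution[of I "{..<?d}" "\<lambda>i j. f i (v j)"] assms(2,3) by auto
  have vc: "v j \<in> carrier_vec n" if "j < ?d" for j
    using that v(1) by (auto simp: indep_family_def)
  have f: "f i (lincomb_vec n k v c) = (\<Sum>j<k. f i (v j) * c j)" if "i \<in> I" "k \<le> ?d" for i k
    using that(2)
  proof (induction k)
    case 0
    have "0 \<cdot>\<^sub>v 0\<^sub>v n = (0\<^sub>v n :: 'a vec)" by auto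
    hence "f i (0\<^sub>v n) = 0" using lin(2)[OF that(1), of "0\<^sub>v n" 0] by simp
    thus ?case by simp
  next
    case (Suc k)
    thus ?case using lin that(1) vc[of k] by (simp add: lincomb_vec_Suc mult.commute)
  qed
  have "lincomb_vec n ?d v c \<noteq> 0\<^sub>v n" using v(1) c(1) by (auto simp: indep_family_def)
  moreover have "lincomb_vec n ?d v c \<in> W" using v(3) by blast
  ultimately show ?thesis using f[of _ ?d] c(2) by force
qed

section \<open>Hermitian forms and their diagonalization\<close>

lemma range_lincomb_subspace: "vec_subspace n (range (lincomb_vec n k v))"
  unfolding vec_subspace_iff
proof (intro conjI ballI allI)
  show "0\<^sub>v n \<in> range (lincomb_vec n k v)"
    by (rule range_eqI[of _ _ "\<lambda>_. 0"]) (auto simp: lincomb_vec_def)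
  show "a + b \<in> range (lincomb_vec n k v)"
    if "a \<in> range (lincomb_vec n k v)" "b \<in> range (lincomb_vec n k v)" for a b
    using that by (auto simp flip: lincomb_vec_add)
  show "r \<cdot>\<^sub>v a \<in> range (lincomb_vec n k v)" if "a \<in> range (lincomb_vec n k v)" for r a
    using that by (auto simp flip: lincomb_vec_smult)
qed auto

declare hermitian_form.simps [simp del] nonsingular.simps [simp del]

lemma zero_smult_vec: "v \<in> carrier_vec n \<Longrightarrow> 0 \<cdot>\<^sub>v v = (0\<^sub>v n :: 'a::field vec)"
  by (intro eq_vecI) auto

lemma isometric_iff:
  "isometric (n, \<theta>) (m, \<eta> :: 'k::field vec \<Rightarrow> 'k vec \<Rightarrow> 'k) \<longleftrightarrow>
     (\<exists>T. T \<in> carrier_vec n \<rightarrow> carrier_vec m \<and>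
       (\<forall>a\<in>carrier_vec n. \<forall>b\<in>carrier_vec n. T (a + b) = T a + T b) \<and>
       (\<forall>r. \<forall>a\<in>carrier_vec n. T (r \<cdot>\<^sub>v a) = r \<cdot>\<^sub>v T a) \<and>
       bij_betw T (carrier_vec n) (carrier_vec m) \<and>
       (\<forall>a\<in>carrier_vec n. \<forall>b\<in>carrier_vec n. \<eta> (T a) (T b) = \<theta> a b))"
  by (simp add: linear_map_vec_iff)

lemma isometric_same_dim:
  assumes "\<And>a b. a \<in> carrier_vec n \<Longrightarrow> b \<in> carrier_vec n \<Longrightarrow> \<eta> a b = \<theta> a b"
  shows "isometric (n, \<theta>) (n, \<eta>)"
  unfolding isometric_iff by (rule exI[of _ "\<lambda>a. a"]) (auto simp: assms bij_betw_def)

lemma isometric_refl: "isometric x x"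
  by (cases x) (auto intro: isometric_same_dim simp del: isometric.simps)

lemma isometric_trans:
  assumes "isometric x y" "isometric y z"
  shows "isometric x z"
proof -
  obtain n \<theta> m \<eta> k \<zeta> where xyz: "x = (n, \<theta>)" "y = (m, \<eta>)" "z = (k, \<zeta>)"
    by (metis surj_pair)
  obtain T where T: "T \<in> carrier_vec n \<rightarrow> carrier_vec m"
       "\<forall>a\<in>carrier_vec n. \<forall>b\<in>carrier_vec n. T (a + b) = T a + T b"
       "\<forall>r. \<forall>a\<in>carrier_vec n. T (r \<cdot>\<^sub>v a) = r \<cdot>\<^sub>v T a"
       "bij_betw T (carrier_vec n) (carrier_vec m)"
       "\<forall>a\<in>carrier_vec n. \<forall>b\<in>carrier_vec n. \<eta> (T a) (T b) = \<theta> a b"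
    using assms(1) unfolding xyz isometric_iff by blast
  obtain S where S: "S \<in> carrier_vec m \<rightarrow> carrier_vec k"
       "\<forall>a\<in>carrier_vec m. \<forall>b\<in>carrier_vec m. S (a + b) = S a + S b"
       "\<forall>r. \<forall>a\<in>carrier_vec m. S (r \<cdot>\<^sub>v a) = r \<cdot>\<^sub>v S a"
       "bij_betw S (carrier_vec m) (carrier_vec k)"
       "\<forall>a\<in>carrier_vec m. \<forall>b\<in>carrier_vec m. \<zeta> (S a) (S b) = \<eta> a b"
    using assms(2) unfolding xyz isometric_iff by blast
  have c: "T a \<in> carrier_vec m" if "a \<in> carrier_vec n" for a using T(1) that by blast
  show ?thesis unfolding xyz isometric_iff
    using S T c bij_betw_trans[OF T(4) S(4)]
    by (intro exI[of _ "S \<circ> T"]) (auto simp: Pi_iff)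
qed

lemma linear_bij_inverse:
  fixes T :: "'k::field vec \<Rightarrow> 'k vec"
  assumes T: "T \<in> carrier_vec n \<rightarrow> carrier_vec m"
       "\<forall>a\<in>carrier_vec n. \<forall>b\<in>carrier_vec n. T (a + b) = T a + T b"
       "\<forall>r. \<forall>a\<in>carrier_vec n. T (r \<cdot>\<^sub>v a) = r \<cdot>\<^sub>v T a"
       "bij_betw T (carrier_vec n) (carrier_vec m)"
  obtains S where "S \<in> carrier_vec m \<rightarrow> carrier_vec n"
       "\<forall>a\<in>carrier_vec m. \<forall>b\<in>carrier_vec m. S (a + b) = S a + S b"
       "\<forall>r. \<forall>a\<in>carrier_vec m. S (r \<cdot>\<^sub>v a) = r \<cdot>\<^sub>v S a"
       "bij_betw S (carrier_vec m) (carrier_vec n)"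
       "\<forall>a\<in>carrier_vec n. S (T a) = a" "\<forall>b\<in>carrier_vec m. T (S b) = b"
proof -
  define S where "S = the_inv_into (carrier_vec n) T"
  have inj: "inj_on T (carrier_vec n)" and im: "T ` carrier_vec n = carrier_vec m"
    using T(4) by (auto simp: bij_betw_def)
  have ST: "S (T a) = a" if "a \<in> carrier_vec n" for a
    unfolding S_def using that inj by (rule the_inv_into_f_f[rotated])
  have ex: "\<exists>a\<in>carrier_vec n. b = T a" if "b \<in> carrier_vec m" for b using that im by blast
  have Sadd: "S (a + b) = S a + S b" if ab: "a \<in> carrier_vec m" "b \<in> carrier_vec m" for a b
  proof -
    obtain a' b' where *: "a' \<in> carrier_vec n" "b' \<in> carrier_vec n" "a = T a'" "b = T b'"
      using ex ab by metis
    have "a + b = T (a' + b')" using * T(2) by simp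
    thus ?thesis using * by (simp add: ST)
  qed
  have Ssm: "S (r \<cdot>\<^sub>v b) = r \<cdot>\<^sub>v S b" if b: "b \<in> carrier_vec m" for r b
  proof -
    obtain b' where *: "b' \<in> carrier_vec n" "b = T b'" using ex b by metis
    have "r \<cdot>\<^sub>v b = T (r \<cdot>\<^sub>v b')" using * T(3) by simp
    thus ?thesis using * by (simp add: ST)
  qed
  have bij: "bij_betw S (carrier_vec m) (carrier_vec n)"
    unfolding S_def by (rule bij_betw_the_inv_into[OF T(4)])
  have TS: "T (S b) = b" if "b \<in> carrier_vec m" for b using ex[OF that] by (auto simp: ST)
  show ?thesis
  proof (rule that[of S])
    show "S \<in> carrier_vec m \<rightarrow> carrier_vec n" using bij by (simp add: bij_betw_imp_funcset)
  qed (use ST TS Sadd Ssm bij in auto)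
qed

lemma isometric_sym:
  assumes "isometric x y"
  shows "isometric y x"
proof -
  obtain n \<theta> m \<eta> where xy: "x = (n, \<theta>)" "y = (m, \<eta>)" by (metis surj_pair)
  obtain T where T: "T \<in> carrier_vec n \<rightarrow> carrier_vec m"
       "\<forall>a\<in>carrier_vec n. \<forall>b\<in>carrier_vec n. T (a + b) = T a + T b"
       "\<forall>r. \<forall>a\<in>carrier_vec n. T (r \<cdot>\<^sub>v a) = r \<cdot>\<^sub>v T a"
       "bij_betw T (carrier_vec n) (carrier_vec m)"
       "\<forall>a\<in>carrier_vec n. \<forall>b\<in>carrier_vec n. \<eta> (T a) (T b) = \<theta> a b"
    using assms unfolding xy isometric_iff by blast
  obtain S where S: "S \<in> carrier_vec m \<rightarrow> carrier_vec n"
       "\<forall>a\<in>carrier_vec m. \<forall>b\<in>carrier_vec m. S (a + b) = S a + S b"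
       "\<forall>r. \<forall>a\<in>carrier_vec m. S (r \<cdot>\<^sub>v a) = r \<cdot>\<^sub>v S a"
       "bij_betw S (carrier_vec m) (carrier_vec n)"
       "\<forall>a\<in>carrier_vec n. S (T a) = a" "\<forall>b\<in>carrier_vec m. T (S b) = b"
    by (rule linear_bij_inverse[OF T(1-4)])
  have "\<theta> (S a) (S b) = \<eta> a b" if "a \<in> carrier_vec m" "b \<in> carrier_vec m" for a b
    using T(5)[rule_format, OF funcset_mem[OF S(1) that(1)] funcset_mem[OF S(1) that(2)]] S(6) that by simp
  thus ?thesis unfolding xy isometric_iff using S(1-4) by blast
qed

lemma vec_first_append_vec: "a \<in> carrier_vec n \<Longrightarrow> vec_first (a @\<^sub>v b) n = a"
  by (intro eq_vecI) (auto simp: vec_first_def)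

lemma vec_last_append_vec: "b \<in> carrier_vec m \<Longrightarrow> vec_last (a @\<^sub>v b) m = b"
  by (intro eq_vecI) (auto simp: vec_last_def)

lemma isometric_form_sum:
  assumes "isometric x x'" "isometric y y'"
  shows "isometric (form_sum x y) (form_sum x' y')"
proof -
  obtain n \<theta> m \<eta> n' \<theta>' m' \<eta>' where xy: "x = (n, \<theta>)" "y = (m, \<eta>)" "x' = (n', \<theta>')" "y' = (m', \<eta>')"
    by (metis surj_pair)
  obtain T where T: "T \<in> carrier_vec n \<rightarrow> carrier_vec n'"
       "\<forall>a\<in>carrier_vec n. \<forall>b\<in>carrier_vec n. T (a + b) = T a + T b"
       "\<forall>r. \<forall>a\<in>carrier_vec n. T (r \<cdot>\<^sub>v a) = r \<cdot>\<^sub>v T a"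
       "bij_betw T (carrier_vec n) (carrier_vec n')"
       "\<forall>a\<in>carrier_vec n. \<forall>b\<in>carrier_vec n. \<theta>' (T a) (T b) = \<theta> a b"
    using assms(1) unfolding xy isometric_iff by blast
  obtain S where S: "S \<in> carrier_vec m \<rightarrow> carrier_vec m'"
       "\<forall>a\<in>carrier_vec m. \<forall>b\<in>carrier_vec m. S (a + b) = S a + S b"
       "\<forall>r. \<forall>a\<in>carrier_vec m. S (r \<cdot>\<^sub>v a) = r \<cdot>\<^sub>v S a"
       "bij_betw S (carrier_vec m) (carrier_vec m')"
       "\<forall>a\<in>carrier_vec m. \<forall>b\<in>carrier_vec m. \<eta>' (S a) (S b) = \<eta> a b"
    using assms(2) unfolding xy isometric_iff by blast
  define U where "U = (\<lambda>a. T (vec_first a n) @\<^sub>v S (vec_last a m))"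
  have Tc: "T a \<in> carrier_vec n'" if "a \<in> carrier_vec n" for a using T(1) that by blast
  have Sc: "S a \<in> carrier_vec m'" if "a \<in> carrier_vec m" for a using S(1) that by blast
  have Uc: "U a \<in> carrier_vec (n' + m')" for a
    unfolding U_def by (intro append_carrier_vec Tc Sc) auto
  have fU: "vec_first (U a) n' = T (vec_first a n)" for a
    unfolding U_def using Tc[of "vec_first a n"] by (simp add: vec_first_append_vec)
  have lU: "vec_last (U a) m' = S (vec_last a m)" for a
    unfolding U_def using Sc[of "vec_last a m"] by (simp add: vec_last_append_vec)
  have fadd: "vec_first (a + b) n = vec_first a n + vec_first b n"
    and ladd: "vec_last (a + b) m = vec_last a m + vec_last b m"
    if "a \<in> carrier_vec (n + m)" "b \<in> carrier_vec (n + m)" for a b :: "'a vec"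
    using that by (auto simp: vec_first_def vec_last_def)
  have fsm: "vec_first (r \<cdot>\<^sub>v a) n = r \<cdot>\<^sub>v vec_first a n"
    and lsm: "vec_last (r \<cdot>\<^sub>v a) m = r \<cdot>\<^sub>v vec_last a m"
    if "a \<in> carrier_vec (n + m)" for a :: "'a vec" and r
    using that by (auto simp: vec_first_def vec_last_def)
  have Uadd: "U (a + b) = U a + U b" if "a \<in> carrier_vec (n + m)" "b \<in> carrier_vec (n + m)" for a b
    unfolding U_def fadd[OF that] ladd[OF that]
    using T(2) S(2) append_vec_add[OF Tc Tc Sc Sc, of "vec_first a n" "vec_first b n"
       "vec_last a m" "vec_last b m"] by simp
  have Usm: "U (r \<cdot>\<^sub>v a) = r \<cdot>\<^sub>v U a" if a: "a \<in> carrier_vec (n + m)" for r a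
  proof -
    have "T (vec_first a n) \<in> carrier_vec n'" "S (vec_last a m) \<in> carrier_vec m'"
      using Tc Sc by auto
    thus ?thesis unfolding U_def fsm[OF a] lsm[OF a]
      using T(3) S(3) by (intro eq_vecI) (auto simp: less_diff_conv2)
  qed
  have "inj_on U (carrier_vec (n + m))"
  proof (rule inj_onI)
    fix a b assume ab: "a \<in> carrier_vec (n + m)" "b \<in> carrier_vec (n + m)" "U a = U b"
    have "T (vec_first a n) = T (vec_first b n)" using ab(3) fU by metis
    hence 1: "vec_first a n = vec_first b n"
      using T(4) by (auto simp: bij_betw_def dest: inj_onD)
    have "S (vec_last a m) = S (vec_last b m)" using ab(3) lU by metis
    hence 2: "vec_last a m = vec_last b m"
      using S(4) by (auto simp: bij_betw_def dest: inj_onD)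
    show "a = b" using 1 2 vec_first_last_append ab(1,2) by metis
  qed
  moreover have "U ` carrier_vec (n + m) = carrier_vec (n' + m')"
  proof
    show "carrier_vec (n' + m') \<subseteq> U ` carrier_vec (n + m)"
    proof
      fix b :: "'a vec" assume b: "b \<in> carrier_vec (n' + m')"
      obtain a1 where a1: "a1 \<in> carrier_vec n" "T a1 = vec_first b n'"
        using T(4) vec_first_carrier[of b n'] unfolding bij_betw_def by (metis image_iff)
      obtain a2 where a2: "a2 \<in> carrier_vec m" "S a2 = vec_last b m'"
        using S(4) vec_last_carrier[of b m'] unfolding bij_betw_def by (metis image_iff)
      have "U (a1 @\<^sub>v a2) = b" unfolding U_def using a1 a2 vec_first_last_append[OF b]
        by (simp add: vec_first_append_vec vec_last_append_vec)
      thus "b \<in> U ` carrier_vec (n + m)" using a1 a2 by (metis append_carrier_vec imageI)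
    qed
  qed (use Uc in auto)
  ultimately have bij: "bij_betw U (carrier_vec (n + m)) (carrier_vec (n' + m'))"
    by (simp add: bij_betw_def)
  show ?thesis unfolding xy form_sum.simps isometric_iff
    using Uc Uadd Usm bij T(5) S(5)
    by (intro exI[of _ U]) (auto simp: fU lU)
qed

text \<open>
  Multiplication with \<open>\<beta>\<close> exchanges the fixed elements of \<open>J\<close> with the \<open>\<epsilon>\<close>-symmetric ones. Its existence excludes
  the symplectic case of a trivial involution with \<open>\<epsilon> = -1\<close>, in which forms cannot be diagonalized.
\<close>
locale hermitian_field =
  fixes J :: "'k::field \<Rightarrow> 'k" and \<epsilon> :: int and \<beta> :: 'k
  assumes inv: "field_involution J"
    and eps: "\<epsilon> \<in> {1, -1}"
    and two: "(2 :: 'k) \<noteq> 0"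
    and beta: "\<beta> \<noteq> 0" "J \<beta> = of_int \<epsilon> * \<beta>"
begin

sublocale J: field_hom J using inv by (simp add: field_involution_def)

lemma JJ [simp]: "J (J x) = x" using inv by (simp add: field_involution_def)

abbreviation e :: 'k where "e \<equiv> of_int \<epsilon>"

lemma ee [simp]: "e * e = 1" "e * (e * x) = x" using eps by auto

lemma Je [simp]: "J e = e" using eps by (auto simp: J.hom_uminus)

definition diag_form :: "'k list \<Rightarrow> 'k form" where
  "diag_form ds = (length ds, \<lambda>a b. \<Sum>i<length ds. J (a $ i) * ds ! i * b $ i)"

definition admissible :: "'k list \<Rightarrow> bool" where
  "admissible ds \<longleftrightarrow> (\<forall>d\<in>set ds. d \<noteq> 0 \<and> J d = e * d)"

lemma admissible_simps [simp]:
  "admissible []" "admissible (x # xs) \<longleftrightarrow> x \<noteq> 0 \<and> J x = e * x \<and> admissible xs"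
  "admissible (xs @ ys) \<longleftrightarrow> admissible xs \<and> admissible ys"
  by (auto simp: admissible_def)

lemma hermitian_formD:
  assumes "hermitian_form J \<epsilon> (n, \<theta>)"
  shows "a \<in> carrier_vec n \<Longrightarrow> b \<in> carrier_vec n \<Longrightarrow> c \<in> carrier_vec n \<Longrightarrow> \<theta> (a + b) c = \<theta> a c + \<theta> b c"
    and "a \<in> carrier_vec n \<Longrightarrow> b \<in> carrier_vec n \<Longrightarrow> c \<in> carrier_vec n \<Longrightarrow> \<theta> a (b + c) = \<theta> a b + \<theta> a c"
    and "a \<in> carrier_vec n \<Longrightarrow> b \<in> carrier_vec n \<Longrightarrow> \<theta> (r \<cdot>\<^sub>v a) b = J r * \<theta> a b"
    and "a \<in> carrier_vec n \<Longrightarrow> b \<in> carrier_vec n \<Longrightarrow> \<theta> a (r \<cdot>\<^sub>v b) = \<theta> a b * r"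
    and "a \<in> carrier_vec n \<Longrightarrow> b \<in> carrier_vec n \<Longrightarrow> \<theta> a b = e * J (\<theta> b a)"
  using assms unfolding hermitian_form.simps by blast+

lemma hermitian_transport:
  assumes "isometric x y" "hermitian_form J \<epsilon> x"
  shows "hermitian_form J \<epsilon> y"
proof -
  obtain n \<theta> m \<eta> where xy: "x = (n, \<theta>)" "y = (m, \<eta>)" by (metis surj_pair)
  obtain T where T: "T \<in> carrier_vec n \<rightarrow> carrier_vec m"
       "\<forall>a\<in>carrier_vec n. \<forall>b\<in>carrier_vec n. T (a + b) = T a + T b"
       "\<forall>r. \<forall>a\<in>carrier_vec n. T (r \<cdot>\<^sub>v a) = r \<cdot>\<^sub>v T a"
       "bij_betw T (carrier_vec n) (carrier_vec m)"
       "\<forall>a\<in>carrier_vec n. \<forall>b\<in>carrier_vec n. \<eta> (T a) (T b) = \<theta> a b"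
    using assms unfolding xy isometric_iff by blast
  have im: "carrier_vec m = T ` carrier_vec n" using T(4) by (auto simp: bij_betw_def)
  have h: "\<And>a b c. a \<in> carrier_vec n \<Longrightarrow> b \<in> carrier_vec n \<Longrightarrow> c \<in> carrier_vec n \<Longrightarrow>
        \<theta> (a + b) c = \<theta> a c + \<theta> b c \<and> \<theta> a (b + c) = \<theta> a b + \<theta> a c"
     "\<And>r a b. a \<in> carrier_vec n \<Longrightarrow> b \<in> carrier_vec n \<Longrightarrow>
        \<theta> (r \<cdot>\<^sub>v a) b = J r * \<theta> a b \<and> \<theta> a (r \<cdot>\<^sub>v b) = \<theta> a b * r"
     "\<And>a b. a \<in> carrier_vec n \<Longrightarrow> b \<in> carrier_vec n \<Longrightarrow> \<theta> a b = e * J (\<theta> b a)"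
    using hermitian_formD[OF assms(2)[unfolded xy]] by blast+
  have h': "\<eta> (T a + T b) (T c) = \<eta> (T a) (T c) + \<eta> (T b) (T c)"
    "\<eta> (T a) (T b + T c) = \<eta> (T a) (T b) + \<eta> (T a) (T c)"
    if "a \<in> carrier_vec n" "b \<in> carrier_vec n" "c \<in> carrier_vec n" for a b c
  proof -
    have "T a + T b = T (a + b)" "T b + T c = T (b + c)" using T(2) that by auto
    thus "\<eta> (T a + T b) (T c) = \<eta> (T a) (T c) + \<eta> (T b) (T c)"
      "\<eta> (T a) (T b + T c) = \<eta> (T a) (T b) + \<eta> (T a) (T c)"
      using h(1) T(5) that by simp_all
  qed
  have h'': "\<eta> (r \<cdot>\<^sub>v T a) (T b) = J r * \<eta> (T a) (T b)" "\<eta> (T a) (r \<cdot>\<^sub>v T b) = \<eta> (T a) (T b) * r"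
    "\<eta> (T a) (T b) = e * J (\<eta> (T b) (T a))"
    if "a \<in> carrier_vec n" "b \<in> carrier_vec n" for r a b
  proof -
    have "r \<cdot>\<^sub>v T a = T (r \<cdot>\<^sub>v a)" "r \<cdot>\<^sub>v T b = T (r \<cdot>\<^sub>v b)" using T(3) that by auto
    thus "\<eta> (r \<cdot>\<^sub>v T a) (T b) = J r * \<eta> (T a) (T b)" "\<eta> (T a) (r \<cdot>\<^sub>v T b) = \<eta> (T a) (T b) * r"
      "\<eta> (T a) (T b) = e * J (\<eta> (T b) (T a))"
      using h(2)[OF that] h(3)[OF that] T(5) that by simp_all
  qed
  show ?thesis unfolding xy hermitian_form.simps im
    by (intro conjI ballI allI; elim imageE; hypsubst; rule h' h''; assumption)
qed

lemma nonsingular_iff: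
  assumes "hermitian_form J \<epsilon> (n, \<theta>)"
  shows "nonsingular J (n, \<theta>) \<longleftrightarrow>
    (\<forall>a\<in>carrier_vec n. (\<forall>b\<in>carrier_vec n. \<theta> b a = 0) \<longrightarrow> a = 0\<^sub>v n) \<and>
    (\<forall>f. (\<forall>a\<in>carrier_vec n. \<forall>b\<in>carrier_vec n. f (a + b) = f a + f b) \<and>
         (\<forall>r. \<forall>a\<in>carrier_vec n. f (r \<cdot>\<^sub>v a) = J r * f a) \<longrightarrow>
      (\<exists>a\<in>carrier_vec n. \<forall>b\<in>carrier_vec n. \<theta> b a = f b))"
    (is "_ \<longleftrightarrow> ?I \<and> ?S")
proof -
  let ?F = "\<lambda>a. restrict (\<lambda>b. \<theta> b a) (carrier_vec n)"
  have add: "\<theta> (a + b) c = \<theta> a c + \<theta> b c" "\<theta> a (b + c) = \<theta> a b + \<theta> a c"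
    if "a \<in> carrier_vec n" "b \<in> carrier_vec n" "c \<in> carrier_vec n" for a b c
    using hermitian_formD(1,2)[OF assms] that by blast+
  have sm: "\<theta> (r \<cdot>\<^sub>v a) b = J r * \<theta> a b" "\<theta> a (r \<cdot>\<^sub>v b) = \<theta> a b * r"
    if "a \<in> carrier_vec n" "b \<in> carrier_vec n" for r a b
    using hermitian_formD(3,4)[OF assms] that by blast+
  have F: "?F a \<in> conj_dual J n" if "a \<in> carrier_vec n" for a
    using that add sm by (auto simp: conj_dual_def)
  have "inj_on ?F (carrier_vec n) \<longleftrightarrow> ?I"
  proof
    assume inj: "inj_on ?F (carrier_vec n)"
    show ?I
    proof (intro ballI impI)
      fix a assume a: "a \<in> carrier_vec n" "\<forall>b\<in>carrier_vec n. \<theta> b a = 0"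
      have "\<theta> b (0\<^sub>v n) = 0" if "b \<in> carrier_vec n" for b
        using sm(2)[OF that, of "0\<^sub>v n" 0] by (simp add: zero_smult_vec[of _ n])
      hence "?F a = ?F (0\<^sub>v n)" using a by (auto simp: restrict_def)
      thus "a = 0\<^sub>v n" using inj a(1) by (auto dest: inj_onD)
    qed
  next
    assume I: ?I
    show "inj_on ?F (carrier_vec n)"
    proof (rule inj_onI)
      fix a b assume ab: "a \<in> carrier_vec n" "b \<in> carrier_vec n" "?F a = ?F b"
      have "\<theta> c (a + (-1) \<cdot>\<^sub>v b) = 0" if c: "c \<in> carrier_vec n" for c
      proof -
        have "\<theta> c a = \<theta> c b" using fun_cong[OF ab(3), of c] c by simp
        thus ?thesis using add(2)[OF c ab(1), of "(-1) \<cdot>\<^sub>v b"] sm(2)[OF c ab(2), of "-1"] ab(2) by simp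
      qed
      hence z: "a + (-1) \<cdot>\<^sub>v b = 0\<^sub>v n" using I ab by auto
      show "a = b"
      proof
        show "dim_vec a = dim_vec b" using ab by auto
        fix i assume i: "i < dim_vec b"
        have "(a + (-1) \<cdot>\<^sub>v b) $ i = 0" using z i ab by simp
        thus "a $ i = b $ i" using i ab by simp
      qed
    qed
  qed
  moreover have "conj_dual J n \<subseteq> ?F ` carrier_vec n \<longleftrightarrow> ?S"
  proof
    assume s: "conj_dual J n \<subseteq> ?F ` carrier_vec n"
    show ?S
    proof (intro allI impI)
      fix f assume f: "(\<forall>a\<in>carrier_vec n. \<forall>b\<in>carrier_vec n. f (a + b) = f a + f b) \<and>
         (\<forall>r. \<forall>a\<in>carrier_vec n. f (r \<cdot>\<^sub>v a) = J r * f a)"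
      hence "restrict f (carrier_vec n) \<in> conj_dual J n" by (auto simp: conj_dual_def)
      then obtain a where a: "a \<in> carrier_vec n" "restrict f (carrier_vec n) = ?F a"
        using s by blast
      have "\<theta> b a = f b" if "b \<in> carrier_vec n" for b
        using fun_cong[OF a(2), of b] that by simp
      thus "\<exists>a\<in>carrier_vec n. \<forall>b\<in>carrier_vec n. \<theta> b a = f b" using a(1) by blast
    qed
  next
    assume s: ?S
    show "conj_dual J n \<subseteq> ?F ` carrier_vec n"
    proof
      fix f assume f: "f \<in> conj_dual J n"
      then obtain a where a: "a \<in> carrier_vec n" "\<And>b. b \<in> carrier_vec n \<Longrightarrow> \<theta> b a = f b"
        using s unfolding conj_dual_def by blast
      have "f = ?F a"
      proof
        fix b show "f b = ?F a b"
          using a(2)[of b] f by (cases "b \<in> carrier_vec n") (auto simp: conj_dual_def extensional_def)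
      qed
      thus "f \<in> ?F ` carrier_vec n" using a(1) by blast
    qed
  qed
  moreover have "?F ` carrier_vec n \<subseteq> conj_dual J n" using F by blast
  ultimately show ?thesis unfolding nonsingular.simps bij_betw_def by blast
qed

lemma nonsingular_transport:
  assumes "isometric x y" "hermitian_form J \<epsilon> x" "nonsingular J x"
  shows "nonsingular J y"
proof -
  obtain n \<theta> m \<eta> where xy: "x = (n, \<theta>)" "y = (m, \<eta>)" by (metis surj_pair)
  obtain T where T: "T \<in> carrier_vec n \<rightarrow> carrier_vec m"
       "\<forall>a\<in>carrier_vec n. \<forall>b\<in>carrier_vec n. T (a + b) = T a + T b"
       "\<forall>r. \<forall>a\<in>carrier_vec n. T (r \<cdot>\<^sub>v a) = r \<cdot>\<^sub>v T a"
       "bij_betw T (carrier_vec n) (carrier_vec m)"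
       "\<forall>a\<in>carrier_vec n. \<forall>b\<in>carrier_vec n. \<eta> (T a) (T b) = \<theta> a b"
    using assms(1) unfolding xy isometric_iff by blast
  have im: "carrier_vec m = T ` carrier_vec n" using T(4) by (auto simp: bij_betw_def)
  have h: "hermitian_form J \<epsilon> (m, \<eta>)" using hermitian_transport[OF assms(1,2)] by (simp add: xy)
  note x = assms(3)[unfolded xy nonsingular_iff[OF assms(2)[unfolded xy]]]
  have "T (0 \<cdot>\<^sub>v 0\<^sub>v n) = 0 \<cdot>\<^sub>v T (0\<^sub>v n)" using T(3) zero_carrier_vec by blast
  moreover have "T (0\<^sub>v n) \<in> carrier_vec m" by (rule funcset_mem[OF T(1) zero_carrier_vec])
  ultimately have T0: "T (0\<^sub>v n) = 0\<^sub>v m" by (simp add: zero_smult_vec[of _ n] zero_smult_vec[of _ m])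
  show ?thesis unfolding xy nonsingular_iff[OF h]
  proof (intro conjI ballI allI impI)
    fix a assume a: "a \<in> carrier_vec m" "\<forall>b\<in>carrier_vec m. \<eta> b a = 0"
    then obtain a' where a': "a' \<in> carrier_vec n" "a = T a'" using im by blast
    have "\<theta> b a' = 0" if "b \<in> carrier_vec n" for b
      using a(2) a' T(1,5) that by (metis im imageI)
    hence "a' = 0\<^sub>v n" using x a'(1) by blast
    thus "a = 0\<^sub>v m" using a' T0 by simp
  next
    fix f assume f: "(\<forall>a\<in>carrier_vec m. \<forall>b\<in>carrier_vec m. f (a + b) = f a + f b) \<and>
         (\<forall>r. \<forall>a\<in>carrier_vec m. f (r \<cdot>\<^sub>v a) = J r * f a)"
    have "(\<forall>a\<in>carrier_vec n. \<forall>b\<in>carrier_vec n. f (T (a + b)) = f (T a) + f (T b)) \<and>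
         (\<forall>r. \<forall>a\<in>carrier_vec n. f (T (r \<cdot>\<^sub>v a)) = J r * f (T a))"
      using f T(1,2,3) im by auto
    hence "\<exists>a\<in>carrier_vec n. \<forall>b\<in>carrier_vec n. \<theta> b a = f (T b)"
      using x[THEN conjunct2, rule_format, of "\<lambda>a. f (T a)"] by blast
    then obtain a where a: "a \<in> carrier_vec n" "\<forall>b\<in>carrier_vec n. \<theta> b a = f (T b)" by blast
    show "\<exists>a\<in>carrier_vec m. \<forall>b\<in>carrier_vec m. \<eta> b a = f b"
      using a T(5) unfolding im by (intro bexI[of _ "T a"]) auto
  qed
qed

lemma herm_forms_transport: "isometric x y \<Longrightarrow> x \<in> herm_forms J \<epsilon> \<Longrightarrow> y \<in> herm_forms J \<epsilon>"
  using hermitian_transport nonsingular_transport by (auto simp: herm_forms_def)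

lemma diag_form_hermitian:
  assumes "admissible ds"
  shows "hermitian_form J \<epsilon> (diag_form ds)"
proof -
  have 1: "J (ds ! i) = e * ds ! i" if "i < length ds" for i
    using assms that by (auto simp: admissible_def)
  have 2: "e * J (J (b $ i) * ds ! i * a $ i) = J (a $ i) * ds ! i * b $ i" if "i < length ds" for a b i
    using 1[OF that] by (simp add: J.hom_mult ac_simps)
  show ?thesis
    unfolding diag_form_def hermitian_form.simps
  proof (intro conjI ballI allI)
    fix a b c :: "'k vec"
    assume *: "a \<in> carrier_vec (length ds)" "b \<in> carrier_vec (length ds)" "c \<in> carrier_vec (length ds)"
    show "(\<Sum>i<length ds. J ((a + b) $ i) * ds ! i * c $ i) =
        (\<Sum>i<length ds. J (a $ i) * ds ! i * c $ i) + (\<Sum>i<length ds. J (b $ i) * ds ! i * c $ i)"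
      unfolding sum.distrib[symmetric] using *
      by (intro sum.cong) (simp_all add: J.hom_add distrib_right)
    show "(\<Sum>i<length ds. J (a $ i) * ds ! i * (b + c) $ i) =
        (\<Sum>i<length ds. J (a $ i) * ds ! i * b $ i) + (\<Sum>i<length ds. J (a $ i) * ds ! i * c $ i)"
      unfolding sum.distrib[symmetric] using *
      by (intro sum.cong) (simp_all add: distrib_left)
  next
    fix r and a b :: "'k vec"
    assume *: "a \<in> carrier_vec (length ds)" "b \<in> carrier_vec (length ds)"
    show "(\<Sum>i<length ds. J ((r \<cdot>\<^sub>v a) $ i) * ds ! i * b $ i) =
        J r * (\<Sum>i<length ds. J (a $ i) * ds ! i * b $ i)"
      unfolding sum_distrib_left using * by (intro sum.cong) (simp_all add: J.hom_mult mult.assoc)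
    show "(\<Sum>i<length ds. J (a $ i) * ds ! i * (r \<cdot>\<^sub>v b) $ i) =
        (\<Sum>i<length ds. J (a $ i) * ds ! i * b $ i) * r"
      unfolding sum_distrib_right using * by (intro sum.cong) (simp_all add: ac_simps)
  next
    fix a b :: "'k vec"
    show "(\<Sum>i<length ds. J (a $ i) * ds ! i * b $ i) =
        e * J (\<Sum>i<length ds. J (b $ i) * ds ! i * a $ i)"
      unfolding J.hom_sum sum_distrib_left by (rule sum.cong) (simp_all only: lessThan_iff 2)
  qed
qed

lemma diag_form_herm_forms:
  assumes "admissible ds"
  shows "diag_form ds \<in> herm_forms J \<epsilon>"
proof -
  let ?n = "length ds"
  define \<theta> where "\<theta> = (\<lambda>a b :: 'k vec. \<Sum>i<?n. J (a $ i) * ds ! i * b $ i)"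
  have D: "diag_form ds = (?n, \<theta>)" by (simp add: diag_form_def \<theta>_def)
  have h: "hermitian_form J \<epsilon> (?n, \<theta>)" using diag_form_hermitian[OF assms] by (simp add: D)
  have ds: "ds ! i \<noteq> 0" if "i < ?n" for i using assms that by (auto simp: admissible_def)
  have u: "\<theta> (unit_vec ?n i) a = ds ! i * a $ i" if "i < ?n" for i a
  proof -
    have "\<theta> (unit_vec ?n i) a = (\<Sum>j<?n. if j = i then ds ! j * a $ j else 0)"
      unfolding \<theta>_def by (rule sum.cong) (use that in \<open>auto simp: unit_vec_def\<close>)
    thus ?thesis using that by simp
  qed
  have "nonsingular J (?n, \<theta>)"
    unfolding nonsingular_iff[OF h]
  proof (intro conjI ballI allI impI)
    fix a assume a: "a \<in> carrier_vec ?n" "\<forall>b\<in>carrier_vec ?n. \<theta> b a = 0"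
    have "a $ i = 0" if "i < ?n" for i
      using u[OF that, of a] a(2) ds[OF that] by (metis mult_eq_0_iff unit_vec_carrier)
    thus "a = 0\<^sub>v ?n" using a(1) by auto
  next
    fix f :: "'k vec \<Rightarrow> 'k" assume f: "(\<forall>a\<in>carrier_vec ?n. \<forall>b\<in>carrier_vec ?n. f (a + b) = f a + f b) \<and>
         (\<forall>r. \<forall>a\<in>carrier_vec ?n. f (r \<cdot>\<^sub>v a) = J r * f a)"
    define a where "a = vec ?n (\<lambda>i. f (unit_vec ?n i) / ds ! i)"
    have 1: "f (lincomb_vec ?n k (unit_vec ?n) c) = (\<Sum>i<k. J (c i) * f (unit_vec ?n i))"
      if "k \<le> ?n" for k c using that
    proof (induction k)
      case 0
      have "f (0 \<cdot>\<^sub>v 0\<^sub>v ?n) = J 0 * f (0\<^sub>v ?n)" using f zero_carrier_vec by blast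
      thus ?case by (simp add: zero_smult_vec[of _ ?n])
    next
      case (Suc k)
      thus ?case using f by (simp add: lincomb_vec_Suc)
    qed
    have "\<theta> b a = f b" if b: "b \<in> carrier_vec ?n" for b
    proof -
      have "b = lincomb_vec ?n ?n (unit_vec ?n) (($) b)"
      proof
        fix i assume "i < dim_vec (lincomb_vec ?n ?n (unit_vec ?n) (($) b))"
        hence i: "i < ?n" by (simp add: lincomb_vec_def)
        have "(\<Sum>j<?n. b $ j * unit_vec ?n j $ i) = (\<Sum>j<?n. if j = i then b $ j else 0)"
          by (rule sum.cong) (use i in \<open>auto simp: unit_vec_def\<close>)
        thus "b $ i = lincomb_vec ?n ?n (unit_vec ?n) (($) b) $ i"
          using i by (simp add: lincomb_vec_def)
      qed (use b in \<open>simp add: lincomb_vec_def\<close>)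
      hence "f b = (\<Sum>i<?n. J (b $ i) * f (unit_vec ?n i))" using 1[of ?n "($) b"] by simp
      also have "\<dots> = \<theta> b a" unfolding \<theta>_def by (rule sum.cong) (use ds in \<open>auto simp: a_def\<close>)
      finally show ?thesis by simp
    qed
    thus "\<exists>a\<in>carrier_vec ?n. \<forall>b\<in>carrier_vec ?n. \<theta> b a = f b"
      by (intro bexI[of _ a]) (auto simp: a_def)
  qed
  thus ?thesis using h by (simp add: herm_forms_def D)
qed

lemma hermitian_lincomb:
  assumes "hermitian_form J \<epsilon> (n, \<theta>)" "\<And>j. j < k \<Longrightarrow> v j \<in> carrier_vec n" "a \<in> carrier_vec n"
  shows "\<theta> a (lincomb_vec n k v c) = (\<Sum>j<k. \<theta> a (v j) * c j)"
    and "\<theta> (lincomb_vec n k v c) a = (\<Sum>j<k. J (c j) * \<theta> (v j) a)"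
proof -
  have add: "\<theta> (a + b) c = \<theta> a c + \<theta> b c" "\<theta> a (b + c) = \<theta> a b + \<theta> a c"
    if "a \<in> carrier_vec n" "b \<in> carrier_vec n" "c \<in> carrier_vec n" for a b c
    using hermitian_formD(1,2)[OF assms(1)] that by blast+
  have sm: "\<theta> (r \<cdot>\<^sub>v a) b = J r * \<theta> a b" "\<theta> a (r \<cdot>\<^sub>v b) = \<theta> a b * r"
    if "a \<in> carrier_vec n" "b \<in> carrier_vec n" for r a b
    using hermitian_formD(3,4)[OF assms(1)] that by blast+
  have z: "0 \<cdot>\<^sub>v 0\<^sub>v n = (0\<^sub>v n :: 'k vec)" by auto
  show "\<theta> a (lincomb_vec n k v c) = (\<Sum>j<k. \<theta> a (v j) * c j)" using assms(2)
  proof (induction k)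
    case 0
    show ?case using sm(2)[OF assms(3), of "0\<^sub>v n" 0] z by simp
  next
    case (Suc k)
    have "v k \<in> carrier_vec n" using Suc.prems by simp
    thus ?case using Suc add(2)[OF assms(3)] sm(2)[OF assms(3)] by (simp add: lincomb_vec_Suc)
  qed
  show "\<theta> (lincomb_vec n k v c) a = (\<Sum>j<k. J (c j) * \<theta> (v j) a)" using assms(2)
  proof (induction k)
    case 0
    show ?case using sm(1)[OF _ assms(3), of "0\<^sub>v n" 0] z by simp
  next
    case (Suc k)
    have "v k \<in> carrier_vec n" using Suc.prems by simp
    thus ?case using Suc add(1)[OF _ _ assms(3)] sm(1)[OF _ assms(3)] by (simp add: lincomb_vec_Suc)
  qed
qed

text \<open>
  A value \<open>\<theta> a b\<close> different from \<open>0\<close> becomes \<open>\<beta>\<close> when \<open>b\<close> is scaled, and then the sum of the two isotropic vectors has the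
  value \<open>2 * \<beta>\<close>.
\<close>
lemma polarization:
  assumes h: "hermitian_form J \<epsilon> (n, \<theta>)" and P: "vec_subspace n P"
    and iso: "\<And>z. z \<in> P \<Longrightarrow> \<theta> z z = 0" and ab: "a \<in> P" "b \<in> P"
  shows "\<theta> a b = 0"
proof (rule ccontr)
  assume c: "\<theta> a b \<noteq> 0"
  define r where "r = \<beta> / \<theta> a b"
  have abc: "a \<in> carrier_vec n" "b \<in> carrier_vec n" "r \<cdot>\<^sub>v b \<in> carrier_vec n"
    and rb: "r \<cdot>\<^sub>v b \<in> P" "a + r \<cdot>\<^sub>v b \<in> P"
    using P ab by (auto simp: vec_subspace_iff)
  have "0 = \<theta> (a + r \<cdot>\<^sub>v b) (a + r \<cdot>\<^sub>v b)" using iso rb by simp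
  also have "\<dots> = \<theta> a a + \<theta> a (r \<cdot>\<^sub>v b) + (\<theta> (r \<cdot>\<^sub>v b) a + \<theta> (r \<cdot>\<^sub>v b) (r \<cdot>\<^sub>v b))"
    using abc by (simp add: hermitian_formD(1,2)[OF h])
  also have "\<dots> = \<theta> a (r \<cdot>\<^sub>v b) + \<theta> (r \<cdot>\<^sub>v b) a"
    using iso ab(1) rb(1) by simp
  also have "\<theta> (r \<cdot>\<^sub>v b) a = e * J (\<theta> a (r \<cdot>\<^sub>v b))"
    using hermitian_formD(5)[OF h] abc by blast
  also have "\<theta> a (r \<cdot>\<^sub>v b) = \<beta>" using abc c by (simp add: hermitian_formD(4)[OF h] r_def)
  also have "e * J \<beta> = \<beta>" using beta by simp
  finally have "2 * \<beta> = 0" by (metis mult_2)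
  thus False using two beta by simp
qed

text \<open>
  An orthogonal family of vectors with non-zero values is chosen as long as possible. By polarization the form vanishes on the
  orthogonal complement, which is therefore zero because the form is non-singular.
\<close>
lemma diagonalization:
  assumes "x \<in> herm_forms J \<epsilon>"
  obtains ds where "admissible ds" "isometric (diag_form ds) x"
proof -
  obtain n \<theta> where x: "x = (n, \<theta>)" by (metis surj_pair)
  have h: "hermitian_form J \<epsilon> (n, \<theta>)" and ns: "nonsingular J (n, \<theta>)"
    using assms by (auto simp: herm_forms_def x)
  let ?O = "\<lambda>(k::nat) v. \<forall>i<k. v i \<in> carrier_vec n \<and> \<theta> (v i) (v i) \<noteq> 0 \<and> (\<forall>j<k. i \<noteq> j \<longrightarrow> \<theta> (v i) (v j) = 0)"
  have lc: "\<theta> (v i) (lincomb_vec n k v c) = \<theta> (v i) (v i) * c i" if "?O k v" "i < k" for k v i c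
  proof -
    have "\<theta> (v i) (lincomb_vec n k v c) = (\<Sum>j<k. \<theta> (v i) (v j) * c j)"
      using that by (intro hermitian_lincomb(1)[OF h]) auto
    also have "\<dots> = (\<Sum>j<k. if j = i then \<theta> (v i) (v i) * c i else 0)"
      by (rule sum.cong) (use that in auto)
    finally show ?thesis using that(2) by simp
  qed
  have z: "\<theta> a (0\<^sub>v n) = 0" if "a \<in> carrier_vec n" for a
    using hermitian_lincomb(1)[OF h, of 0 "\<lambda>_. 0\<^sub>v n" a] that by simp
  have ind: "indep_family n k v" if "?O k v" for k v
    unfolding indep_family_def
  proof (intro conjI allI impI)
    fix c j assume "lincomb_vec n k v c = 0\<^sub>v n" "j < k"
    thus "c j = 0" using lc[OF that, of j c] that z by (metis mult_eq_0_iff)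
  qed (use that in blast)
  have "\<exists>v. ?O 0 v" by simp
  moreover have "\<forall>k. (\<exists>v. ?O k v) \<longrightarrow> k \<le> n" using ind indep_family_le by blast
  ultimately have "\<exists>k. (\<exists>v. ?O k v) \<and> (\<forall>k'. (\<exists>v. ?O k' v) \<longrightarrow> k' \<le> k)"
    by (rule Nat.ex_has_greatest_nat)
  then obtain k v where v: "?O k v" and max: "\<And>k'. (\<exists>v. ?O k' v) \<Longrightarrow> k' \<le> k" by auto
  define P where "P = {z \<in> carrier_vec n. \<forall>i<k. \<theta> (v i) z = 0}"
  have vc: "v i \<in> carrier_vec n" if "i < k" for i using v that by blast
  have P: "vec_subspace n P"
    unfolding vec_subspace_iff P_def using vc z by (auto simp: hermitian_formD(2,4)[OF h])
  have sym0: "\<theta> a b = 0 \<Longrightarrow> \<theta> b a = 0" if "a \<in> carrier_vec n" "b \<in> carrier_vec n" for a b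
    using hermitian_formD(5)[OF h that(2,1)] by simp
  have "\<theta> z z = 0" if zP: "z \<in> P" for z
  proof (rule ccontr)
    assume nz: "\<theta> z z \<noteq> 0"
    have zc: "z \<in> carrier_vec n" and z0: "\<And>i. i < k \<Longrightarrow> \<theta> (v i) z = 0"
      using zP by (auto simp: P_def)
    have "?O (Suc k) (v(k := z))"
      using v nz zc z0 sym0[OF vc zc] by (auto simp: less_Suc_eq)
    thus False using max[of "Suc k"] by (metis Suc_n_not_le_n)
  qed
  hence PP: "\<theta> a b = 0" if "a \<in> P" "b \<in> P" for a b
    using polarization[OF h P _ that] by blast
  define pr where "pr = (\<lambda>a. lincomb_vec n k v (\<lambda>i. \<theta> (v i) a / \<theta> (v i) (v i)))"
  have pr: "a - pr a \<in> P" if a: "a \<in> carrier_vec n" for a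
  proof -
    have "\<theta> (v i) (a - pr a) = 0" if i: "i < k" for i
    proof -
      have pc: "pr a \<in> carrier_vec n" by (simp add: pr_def)
      have "a - pr a = a + (-1) \<cdot>\<^sub>v pr a" using a pc by auto
      hence "\<theta> (v i) (a - pr a) = \<theta> (v i) a + \<theta> (v i) (pr a) * (-1)"
        using a pc vc[OF i] by (simp add: hermitian_formD(2,4)[OF h])
      thus ?thesis using lc[OF v i] v i by (simp add: pr_def)
    qed
    thus ?thesis using a by (simp add: P_def pr_def)
  qed
  have P0: "b = 0\<^sub>v n" if b: "b \<in> P" for b
  proof -
    have bc: "b \<in> carrier_vec n" using b by (simp add: P_def)
    have "\<theta> a b = 0" if a: "a \<in> carrier_vec n" for a
    proof -
      have pc: "pr a \<in> carrier_vec n" by (simp add: pr_def)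
      have "a = pr a + (a - pr a)" using a pc by auto
      hence "\<theta> a b = \<theta> (pr a) b + \<theta> (a - pr a) b"
        using hermitian_formD(1)[OF h pc minus_carrier_vec[OF a pc] bc] by simp
      also have "\<theta> (pr a) b = 0"
        unfolding pr_def
        by (subst hermitian_lincomb(2)[OF h _ bc]) (use vc b in \<open>auto simp: P_def\<close>)
      also have "\<theta> (a - pr a) b = 0" using PP pr[OF a] b by blast
      finally show ?thesis by simp
    qed
    thus ?thesis using ns[unfolded nonsingular_iff[OF h]] bc by blast
  qed
  define T where "T = (\<lambda>a. lincomb_vec n k v (($) a))"
  define ds where "ds = map (\<lambda>i. \<theta> (v i) (v i)) [0..<k]"
  have ds: "length ds = k" "\<And>i. i < k \<Longrightarrow> ds ! i = \<theta> (v i) (v i)" by (auto simp: ds_def)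
  have lin: "linear_map class_ring (module_vec TYPE('k) k) (module_vec TYPE('k) n) T"
    unfolding T_def by (rule lincomb_vec_linear)
  have bij: "bij_betw T (carrier_vec k) (carrier_vec n)"
    unfolding bij_betw_def
  proof
    show "inj_on T (carrier_vec k)"
    proof (rule inj_onI)
      fix a b assume "a \<in> carrier_vec k" "b \<in> carrier_vec k" "T a = T b"
      thus "a = b" using indep_family_injD[OF ind[OF v], of "($) a" "($) b"] by (auto simp: T_def)
    qed
    show "T ` carrier_vec k = carrier_vec n"
    proof
      show "carrier_vec n \<subseteq> T ` carrier_vec k"
      proof
        fix a :: "'k vec" assume a: "a \<in> carrier_vec n"
        have pc: "pr a \<in> carrier_vec n" by (simp add: pr_def)
        have "a - pr a = 0\<^sub>v n" using P0 pr[OF a] by blast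
        moreover have "a = (a - pr a) + pr a" using a pc by auto
        ultimately have "a = pr a" using pc by (metis left_zero_vec)
        also have "\<dots> = T (vec k (\<lambda>i. \<theta> (v i) a / \<theta> (v i) (v i)))"
          unfolding pr_def T_def by (rule lincomb_vec_cong) auto
        finally show "a \<in> T ` carrier_vec k" by auto
      qed
    qed (auto simp: T_def)
  qed
  have pres: "\<theta> (T a) (T b) = (\<Sum>i<k. J (a $ i) * ds ! i * b $ i)" for a b
  proof -
    have "\<theta> (T a) (T b) = (\<Sum>i<k. J (a $ i) * \<theta> (v i) (T b))"
      unfolding T_def by (rule hermitian_lincomb(2)[OF h vc]) auto
    also have "\<dots> = (\<Sum>i<k. J (a $ i) * ds ! i * b $ i)"
      by (rule sum.cong) (auto simp: T_def lc[OF v] ds)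
    finally show ?thesis .
  qed
  have "admissible ds"
    unfolding admissible_def
  proof
    fix d assume "d \<in> set ds"
    then obtain i where i: "i < k" "d = \<theta> (v i) (v i)" by (auto simp: ds_def)
    have "\<theta> (v i) (v i) = e * J (\<theta> (v i) (v i))" using hermitian_formD(5)[OF h] vc[OF i(1)] by blast
    thus "d \<noteq> 0 \<and> J d = e * d" using i v by (metis ee(2))
  qed
  moreover have "isometric (diag_form ds) x"
    unfolding x diag_form_def isometric.simps ds(1) using lin bij pres by (intro exI[of _ T]) auto
  ultimately show ?thesis by (rule that)
qed

lemma diag_form_append: "isometric (form_sum (diag_form xs) (diag_form ys)) (diag_form (xs @ ys))"
  unfolding diag_form_def form_sum.simps length_append
proof (rule isometric_same_dim)
  let ?n = "length xs" and ?m = "length ys"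
  fix a b :: "'k vec" assume ab: "a \<in> carrier_vec (?n + ?m)" "b \<in> carrier_vec (?n + ?m)"
  have "(\<Sum>i<?n + ?m. J (a $ i) * (xs @ ys) ! i * b $ i) =
     (\<Sum>i<?n. J (a $ i) * (xs @ ys) ! i * b $ i) +
     (\<Sum>i<?m. J (a $ (?n + i)) * (xs @ ys) ! (?n + i) * b $ (?n + i))"
    using sum.atLeastLessThan_concat[of 0 ?n "?n + ?m" "\<lambda>i. J (a $ i) * (xs @ ys) ! i * b $ i"]
      sum.shift_bounds_nat_ivl[of "\<lambda>i. J (a $ i) * (xs @ ys) ! i * b $ i" 0 ?n ?m]
    by (simp add: lessThan_atLeast0 add.commute)
  also have "\<dots> = (\<Sum>i<?n. J (vec_first a ?n $ i) * xs ! i * vec_first b ?n $ i) +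
     (\<Sum>i<?m. J (vec_last a ?m $ i) * ys ! i * vec_last b ?m $ i)"
    using ab by (intro arg_cong2[of _ _ _ _ "(+)"] sum.cong)
      (auto simp: vec_first_def vec_last_def nth_append)
  finally show "(\<Sum>i<?n + ?m. J (a $ i) * (xs @ ys) ! i * b $ i) =
     (\<Sum>i<?n. J (vec_first a ?n $ i) * xs ! i * vec_first b ?n $ i) +
     (\<Sum>i<?m. J (vec_last a ?m $ i) * ys ! i * vec_last b ?m $ i)" .
qed

lemma form_sum_herm_forms:
  assumes "x \<in> herm_forms J \<epsilon>" "y \<in> herm_forms J \<epsilon>"
  shows "form_sum x y \<in> herm_forms J \<epsilon>"
proof -
  obtain xs where xs: "admissible xs" "isometric (diag_form xs) x" using assms diagonalization by blast
  obtain ys where ys: "admissible ys" "isometric (diag_form ys) y" using assms diagonalization by blast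
  have "isometric (diag_form (xs @ ys)) (form_sum x y)"
    using isometric_trans isometric_sym diag_form_append isometric_form_sum xs ys by meson
  thus ?thesis using herm_forms_transport diag_form_herm_forms xs ys by (metis admissible_simps(3))
qed

end

section \<open>The Witt group\<close>

context hermitian_field
begin

lemma zero_form_diag: "zero_form = diag_form []"
  by (simp add: zero_form_def diag_form_def)

lemma zero_form_herm_forms: "zero_form \<in> herm_forms J \<epsilon>"
  unfolding zero_form_diag by (rule diag_form_herm_forms) simp

lemma witt_rel_herm_forms:
  assumes "(x, y) \<in> witt_rel J \<epsilon>"
  shows "x \<in> herm_forms J \<epsilon> \<and> y \<in> herm_forms J \<epsilon>"
  using assms by induction (auto simp: zero_form_herm_forms form_sum_herm_forms)

lemma equiv_witt_rel: "equiv (herm_forms J \<epsilon>) (witt_rel J \<epsilon>)"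
proof (rule equivI)
  show "witt_rel J \<epsilon> \<subseteq> herm_forms J \<epsilon> \<times> herm_forms J \<epsilon>" using witt_rel_herm_forms by auto
  show "refl_on (herm_forms J \<epsilon>) (witt_rel J \<epsilon>)"
    using witt_rel_herm_forms by (auto simp: refl_on_def intro: witt_rel.isometric isometric_refl)
  show "sym (witt_rel J \<epsilon>)" by (auto intro!: symI witt_rel.sym)
  show "trans (witt_rel J \<epsilon>)" by (auto intro!: transI intro: witt_rel.trans)
qed

definition witt_class :: "'k form \<Rightarrow> 'k form set" where
  "witt_class x = witt_rel J \<epsilon> `` {x}"

definition diag_class :: "'k list \<Rightarrow> 'k form set" where
  "diag_class ds = witt_class (diag_form ds)"

lemma witt_class_eqI: "(x, y) \<in> witt_rel J \<epsilon> \<Longrightarrow> witt_class x = witt_class y"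
  unfolding witt_class_def by (rule equiv_class_eq[OF equiv_witt_rel])

lemma witt_class_isometricI:
  "isometric x y \<Longrightarrow> x \<in> herm_forms J \<epsilon> \<Longrightarrow> witt_class x = witt_class y"
  using herm_forms_transport[of x y] by (intro witt_class_eqI witt_rel.isometric)

lemma witt_class_self: "x \<in> herm_forms J \<epsilon> \<Longrightarrow> x \<in> witt_class x"
  unfolding witt_class_def by (rule equiv_class_self[OF equiv_witt_rel])

lemma witt_class_memD: "y \<in> witt_class x \<Longrightarrow> (x, y) \<in> witt_rel J \<epsilon>"
  by (simp add: witt_class_def)

lemma witt_class_carrier: "x \<in> herm_forms J \<epsilon> \<Longrightarrow> witt_class x \<in> carrier (witt_group J \<epsilon>)"
  by (auto simp: witt_group_def witt_class_def quotientI)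

lemma witt_group_cases:
  assumes "A \<in> carrier (witt_group J \<epsilon>)"
  obtains x where "x \<in> herm_forms J \<epsilon>" "A = witt_class x"
  using assms by (auto simp: witt_group_def witt_class_def elim!: quotientE)

lemma witt_mult:
  assumes "x \<in> herm_forms J \<epsilon>" "y \<in> herm_forms J \<epsilon>"
  shows "witt_class x \<otimes>\<^bsub>witt_group J \<epsilon>\<^esub> witt_class y = witt_class (form_sum x y)"
proof -
  have "witt_class (form_sum x' y') = witt_class (form_sum x y)"
    if "x' \<in> witt_class x" "y' \<in> witt_class y" for x' y'
    using witt_class_eqI[OF witt_rel.sum[OF that[THEN witt_class_memD]]] by simp
  hence "witt_rel J \<epsilon> `` {form_sum x' y' | x' y'. x' \<in> witt_class x \<and> y' \<in> witt_class y} =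
      witt_class (form_sum x y)"
    using witt_class_self[OF assms(1)] witt_class_self[OF assms(2)]
    unfolding witt_class_def by blast
  thus ?thesis by (simp add: witt_group_def)
qed

lemma diag_class_carrier: "admissible ds \<Longrightarrow> diag_class ds \<in> carrier (witt_group J \<epsilon>)"
  unfolding diag_class_def by (intro witt_class_carrier diag_form_herm_forms)

lemma witt_group_diag_cases:
  assumes "A \<in> carrier (witt_group J \<epsilon>)"
  obtains ds where "admissible ds" "A = diag_class ds"
proof -
  obtain x where x: "x \<in> herm_forms J \<epsilon>" "A = witt_class x" using assms witt_group_cases by blast
  obtain ds where "admissible ds" "isometric (diag_form ds) x" using x(1) diagonalization by blast
  thus ?thesis using that x witt_class_isometricI diag_form_herm_forms
    unfolding diag_class_def by metis
qed

lemma diag_class_append: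
  assumes "admissible xs" "admissible ys"
  shows "diag_class xs \<otimes>\<^bsub>witt_group J \<epsilon>\<^esub> diag_class ys = diag_class (xs @ ys)"
  unfolding diag_class_def witt_mult[OF assms[THEN diag_form_herm_forms]]
  by (rule witt_class_isometricI[OF diag_form_append form_sum_herm_forms[OF assms[THEN diag_form_herm_forms]]])

lemma witt_one: "\<one>\<^bsub>witt_group J \<epsilon>\<^esub> = diag_class []"
  by (simp add: witt_group_def diag_class_def witt_class_def zero_form_diag)

text \<open>
  The base change is given by the matrix with rows \<open>(p, q)\<close> and \<open>(r, s)\<close>.
\<close>
lemma isometric_binary:
  assumes "p * s - q * r \<noteq> 0"
    and "J p * p * a' + J r * r * b' = a" "J q * q * a' + J s * s * b' = b"
    and "J p * q * a' + J r * s * b' = 0" "J q * p * a' + J s * r * b' = 0"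
  shows "isometric (diag_form [a, b]) (diag_form [a', b'])"
proof -
  define T where "T = (\<lambda>v. vec 2 (\<lambda>i. if i = 0 then p * v $ 0 + q * v $ 1 else r * v $ 0 + s * v $ 1))"
  define S where "S = (\<lambda>v. vec 2 (\<lambda>i. if i = 0 then (s * v $ 0 - q * v $ 1) / (p * s - q * r)
     else (p * v $ 1 - r * v $ 0) / (p * s - q * r)))"
  have T: "T v \<in> carrier_vec 2" "T v $ 0 = p * v $ 0 + q * v $ 1" "T v $ Suc 0 = r * v $ 0 + s * v $ 1" for v
    by (simp_all add: T_def)
  have S: "S v \<in> carrier_vec 2" "S v $ 0 = (s * v $ 0 - q * v $ 1) / (p * s - q * r)"
    "S v $ Suc 0 = (p * v $ 1 - r * v $ 0) / (p * s - q * r)" for v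
    by (simp_all add: S_def)
  have Td: "dim_vec (T v) = 2" for v by (simp add: T_def)
  have eq2: "v = w" if "v \<in> carrier_vec 2" "w \<in> carrier_vec 2" "v $ 0 = w $ 0" "v $ Suc 0 = w $ Suc 0"
    for v w :: "'k vec"
    using that by (intro eq_vecI) (auto simp: less_2_cases_iff)
  have "S (T v) = v" if "v \<in> carrier_vec 2" for v
  proof (rule eq2)
    let ?D = "p * s - q * r"
    have "s * (p * v $ 0 + q * v $ 1) - q * (r * v $ 0 + s * v $ 1) = ?D * v $ 0"
      by (simp add: algebra_simps)
    thus "S (T v) $ 0 = v $ 0" using assms(1) by (simp add: T S)
    have "p * (r * v $ 0 + s * v $ 1) - r * (p * v $ 0 + q * v $ 1) = ?D * v $ 1"
      by (simp add: algebra_simps)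
    thus "S (T v) $ Suc 0 = v $ Suc 0" using assms(1) by (simp add: T S)
  qed (use that S in auto)
  moreover have "T (S v) = v" if "v \<in> carrier_vec 2" for v
  proof (rule eq2)
    let ?D = "p * s - q * r"
    have "p * ((s * v $ 0 - q * v $ 1) / ?D) + q * ((p * v $ 1 - r * v $ 0) / ?D) =
       (p * (s * v $ 0 - q * v $ 1) + q * (p * v $ 1 - r * v $ 0)) / ?D"
      by (simp add: add_divide_distrib)
    also have "\<dots> = (?D * v $ 0) / ?D" by (simp add: algebra_simps)
    finally show "T (S v) $ 0 = v $ 0" using assms(1) by (simp add: T S)
    have "r * ((s * v $ 0 - q * v $ 1) / ?D) + s * ((p * v $ 1 - r * v $ 0) / ?D) =
       (r * (s * v $ 0 - q * v $ 1) + s * (p * v $ 1 - r * v $ 0)) / ?D"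
      by (simp add: add_divide_distrib)
    also have "\<dots> = (?D * v $ 1) / ?D" by (simp add: algebra_simps)
    finally show "T (S v) $ Suc 0 = v $ Suc 0" using assms(1) by (simp add: T S)
  qed (use that T in auto)
  ultimately have bij: "bij_betw T (carrier_vec 2) (carrier_vec 2)"
    using T(1) S(1) by (intro bij_betwI[of _ _ _ S]) auto
  have s2: "sum f {..<Suc (Suc 0)} = f 0 + f 1" for f :: "nat \<Rightarrow> 'k"
    by (simp add: lessThan_Suc add.commute)
  have "(\<Sum>i<Suc (Suc 0). J (T v $ i) * [a', b'] ! i * T w $ i) =
      (\<Sum>i<Suc (Suc 0). J (v $ i) * [a, b] ! i * w $ i)" for v w
  proof -
    have "(\<Sum>i<Suc (Suc 0). J (T v $ i) * [a', b'] ! i * T w $ i) =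
       J (v $ 0) * (J p * p * a' + J r * r * b') * w $ 0 +
       J (v $ 1) * (J q * q * a' + J s * s * b') * w $ 1 +
       J (v $ 0) * (J p * q * a' + J r * s * b') * w $ 1 +
       J (v $ 1) * (J q * p * a' + J s * r * b') * w $ 0"
      by (simp add: s2 T J.hom_add J.hom_mult algebra_simps)
    also have "\<dots> = (\<Sum>i<Suc (Suc 0). J (v $ i) * [a, b] ! i * w $ i)"
      unfolding assms by (simp add: s2)
    finally show ?thesis .
  qed
  moreover have "T (v + w) = T v + T w" if "v \<in> carrier_vec 2" "w \<in> carrier_vec 2" for v w
    using that by (intro eq2) (auto simp: T Td algebra_simps intro: T(1) add_carrier_vec)
  moreover have "T (c \<cdot>\<^sub>v v) = c \<cdot>\<^sub>v T v" if "v \<in> carrier_vec 2" for c v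
    using that by (intro eq2) (auto simp: T Td algebra_simps intro: T(1) smult_carrier_vec)
  ultimately show ?thesis
    unfolding diag_form_def isometric_iff using T(1) bij
    by (intro exI[of _ T]) (auto simp: numeral_2_eq_2)
qed

lemma isometric_unary:
  assumes "p \<noteq> 0"
  shows "isometric (diag_form [J p * p * a]) (diag_form [a])"
proof -
  have "bij_betw (\<lambda>v. p \<cdot>\<^sub>v v) (carrier_vec 1) (carrier_vec 1)"
    using assms by (intro bij_betwI[of _ _ _ "\<lambda>v. inverse p \<cdot>\<^sub>v v"]) (auto simp: smult_smult_assoc)
  thus ?thesis
    unfolding diag_form_def isometric_iff
    by (intro exI[of _ "\<lambda>v. p \<cdot>\<^sub>v v"])
      (auto simp: J.hom_mult smult_add_distrib_vec[of _ 1] smult_smult_assoc mult.commute)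
qed

lemma metabolic_hyperbolic: "metabolic (diag_form [a, - a])"
proof -
  define v :: "nat \<Rightarrow> 'k vec" where "v = (\<lambda>_. vec 2 (\<lambda>_. 1))"
  have v: "v j $ i = 1" if "i < 2" for i j using that by (simp add: v_def)
  have "indep_family 2 1 v"
    unfolding indep_family_def
  proof (intro conjI allI impI)
    fix c :: "nat \<Rightarrow> 'k" and j assume c: "lincomb_vec 2 1 v c = 0\<^sub>v 2" and j: "j < (1 :: nat)"
    have "lincomb_vec 2 1 v c $ 0 = 0" unfolding c by simp
    thus "c j = 0" using j by (simp add: lincomb_vec_def v)
  qed (simp add: v_def)
  hence "vec_dim 2 (range (lincomb_vec 2 1 v)) = 1" by (rule vec_dim_eq)
  moreover have "vec_subspace 2 (range (lincomb_vec 2 1 v))" by (rule range_lincomb_subspace)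
  moreover have "(\<Sum>i<Suc (Suc 0). J (lincomb_vec 2 1 v c $ i) * [a, - a] ! i * lincomb_vec 2 1 v d $ i) = 0"
    for c d by (simp add: lessThan_Suc lincomb_vec_def v)
  ultimately show ?thesis
    unfolding diag_form_def
    by (auto simp: numeral_2_eq_2 intro!: exI[of _ "range (lincomb_vec 2 1 v)"])
qed

lemma diag_class_hyperbolic:
  assumes "admissible [a]"
  shows "diag_class [a, - a] = diag_class []"
  unfolding diag_class_def zero_form_diag[symmetric] using assms
  by (intro witt_class_eqI witt_rel.metabolic metabolic_hyperbolic diag_form_herm_forms)
    (simp add: J.hom_uminus)

lemma diag_class_swap2:
  assumes "admissible [a, b]"
  shows "diag_class [a, b] = diag_class [b, a]"
  unfolding diag_class_def using assms isometric_binary[of 0 0 1 1 b a a b]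
  by (intro witt_class_isometricI diag_form_herm_forms) auto

lemma diag_class_cong_append:
  assumes "diag_class xs = diag_class xs'" "diag_class ys = diag_class ys'"
    "admissible xs" "admissible ys" "admissible xs'" "admissible ys'"
  shows "diag_class (xs @ ys) = diag_class (xs' @ ys')"
  using assms by (simp flip: diag_class_append)

lemma diag_class_swap1:
  assumes "admissible (a # xs)"
  shows "diag_class (a # xs) = diag_class (xs @ [a])"
  using assms
proof (induction xs)
  case (Cons b xs)
  have "diag_class ([a, b] @ xs) = diag_class ([b, a] @ xs)"
    using Cons.prems by (intro diag_class_cong_append diag_class_swap2 refl) auto
  also have "[b, a] @ xs = [b] @ (a # xs)" by simp
  also have "diag_class ([b] @ (a # xs)) = diag_class ([b] @ (xs @ [a]))"
    using Cons by (intro diag_class_cong_append) auto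
  finally show ?case by simp
qed simp

lemma diag_class_swap:
  assumes "admissible xs" "admissible ys"
  shows "diag_class (xs @ ys) = diag_class (ys @ xs)"
  using assms
proof (induction xs arbitrary: ys)
  case (Cons a xs)
  have "diag_class ((a # xs) @ ys) = diag_class ((xs @ ys) @ [a])"
    using diag_class_swap1[of a "xs @ ys"] Cons.prems by simp
  also have "\<dots> = diag_class (xs @ (ys @ [a]))" by simp
  also have "\<dots> = diag_class ((ys @ [a]) @ xs)" using Cons by (intro Cons.IH) auto
  finally show ?case by simp
qed simp

lemma comm_monoid_witt: "comm_monoid (witt_group J \<epsilon>)"
proof (rule comm_monoidI)
  let ?W = "witt_group J \<epsilon>"
  fix A B C assume A: "A \<in> carrier ?W" and B: "B \<in> carrier ?W"
  obtain as where as: "admissible as" "A = diag_class as" using A by (rule witt_group_diag_cases)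
  obtain bs where bs: "admissible bs" "B = diag_class bs" using B by (rule witt_group_diag_cases)
  note * = as bs
  show "A \<otimes>\<^bsub>?W\<^esub> B \<in> carrier ?W" using * by (simp add: diag_class_append diag_class_carrier)
  show "A \<otimes>\<^bsub>?W\<^esub> B = B \<otimes>\<^bsub>?W\<^esub> A" using * diag_class_swap by (simp add: diag_class_append)
  show "\<one>\<^bsub>?W\<^esub> \<otimes>\<^bsub>?W\<^esub> A = A" using * by (simp add: diag_class_append witt_one)
  show "A \<otimes>\<^bsub>?W\<^esub> B \<otimes>\<^bsub>?W\<^esub> C = A \<otimes>\<^bsub>?W\<^esub> (B \<otimes>\<^bsub>?W\<^esub> C)" if C: "C \<in> carrier ?W"
  proof -
    obtain cs where "admissible cs" "C = diag_class cs" using C by (rule witt_group_diag_cases)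
    thus ?thesis using * by (simp add: diag_class_append)
  qed
qed (simp add: witt_one diag_class_carrier)

lemma diag_class_uminus:
  assumes "admissible xs"
  shows "diag_class (map uminus xs @ xs) = diag_class []"
  using assms
proof (induction xs)
  case (Cons a xs)
  have u: "admissible (map uminus xs)" using Cons.prems
    by (auto simp: admissible_def J.hom_uminus)
  have a: "admissible [a]" "admissible [- a]" using Cons.prems by (auto simp: J.hom_uminus)
  have "diag_class (map uminus (a # xs) @ (a # xs)) = diag_class ((- a # map uminus xs) @ ([a] @ xs))"
    by simp
  also have "\<dots> = diag_class (([a] @ xs) @ (- a # map uminus xs))"
    using Cons.prems u a by (intro diag_class_swap) auto
  also have "\<dots> = diag_class ([a] @ ((xs @ [- a]) @ map uminus xs))" by simp
  also have "\<dots> = diag_class ([a] @ (([- a] @ xs) @ map uminus xs))"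
    using Cons.prems u a by (intro diag_class_cong_append diag_class_swap refl) auto
  also have "\<dots> = diag_class ([a, - a] @ (xs @ map uminus xs))" by simp
  also have "\<dots> = diag_class ([a, - a] @ (map uminus xs @ xs))"
    using Cons.prems u a by (intro diag_class_cong_append diag_class_swap refl) auto
  also have "\<dots> = diag_class ([] @ [])"
    using Cons u a diag_class_hyperbolic by (intro diag_class_cong_append) auto
  finally show ?case by simp
qed simp

text \<open>
  Inverses exist because \<open>[a, - a]\<close> is metabolic.
\<close>
lemma comm_group_witt: "comm_group (witt_group J \<epsilon>)"
proof (rule comm_group.intro)
  show "comm_monoid (witt_group J \<epsilon>)" by (rule comm_monoid_witt)
  then interpret comm_monoid "witt_group J \<epsilon>" .
  show "group (witt_group J \<epsilon>)"
  proof (rule group_l_invI)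
    fix A assume "A \<in> carrier (witt_group J \<epsilon>)"
    then obtain as where as: "admissible as" "A = diag_class as" by (rule witt_group_diag_cases)
    have "admissible (map uminus as)" using as by (auto simp: admissible_def J.hom_uminus)
    thus "\<exists>B\<in>carrier (witt_group J \<epsilon>). B \<otimes>\<^bsub>witt_group J \<epsilon>\<^esub> A = \<one>\<^bsub>witt_group J \<epsilon>\<^esub>"
      using as by (intro bexI[of _ "diag_class (map uminus as)"])
        (simp_all add: diag_class_append diag_class_uminus witt_one diag_class_carrier)
  qed
qed

text \<open>
  The vector \<open>(1, 1)\<close> has the value \<open>(c + d) * b\<close>, and \<open>(- d, c)\<close> is orthogonal to it.
\<close>
lemma diag_class_sum2:
  assumes "admissible [b]" "J c = c" "J d = d" "c \<noteq> 0" "d \<noteq> 0" "c + d \<noteq> 0"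
  shows "diag_class [c * b, d * b] = diag_class [(c + d) * b, c * d * (c + d) * b]"
proof -
  have "isometric (diag_form [(c + d) * b, c * d * (c + d) * b]) (diag_form [c * b, d * b])"
    using assms by (intro isometric_binary[of 1 "- c" d 1])
      (auto simp: J.hom_uminus J.hom_mult algebra_simps eq_neg_iff_add_eq_0 neg_eq_iff_add_eq_0)
  moreover have "(c + d) * b \<noteq> 0 \<and> c * d * (c + d) * b \<noteq> 0" using assms by simp
  moreover have "J ((c + d) * b) = e * ((c + d) * b)"
    "J (c * d * (c + d) * b) = e * (c * d * (c + d) * b)"
    using assms by (simp_all only: admissible_simps J.hom_add J.hom_mult ac_simps)
  ultimately have "admissible [(c + d) * b, c * d * (c + d) * b]"
    "isometric (diag_form [(c + d) * b, c * d * (c + d) * b]) (diag_form [c * b, d * b])"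
    by simp_all
  thus ?thesis unfolding diag_class_def
    by (intro witt_class_isometricI[symmetric] diag_form_herm_forms)
qed

lemma diag_class_norm:
  assumes "admissible [b]" "p \<noteq> 0"
  shows "diag_class [p * J p * b] = diag_class [b]"
proof -
  have "admissible [p * J p * b]" using assms by (simp add: J.hom_mult ac_simps)
  thus ?thesis using isometric_unary[OF assms(2), of b] unfolding diag_class_def
    by (intro witt_class_isometricI diag_form_herm_forms) (simp_all add: mult.commute)
qed

end

text \<open>
  Extension of scalars and scaling are both defined by applying a map of forms to all representatives of a class. The
  relation is respected only up to isometry for sums, which is why the second assumption is about classes.
\<close>

lemma witt_induced_hom:
  assumes K: "hermitian_field J \<epsilon> \<beta>" and L: "hermitian_field J' \<epsilon>' \<beta>'"
    and rel: "\<And>x y. (x, y) \<in> witt_rel J \<epsilon> \<Longrightarrow> (f x, f y) \<in> witt_rel J' \<epsilon>'"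
    and sum: "\<And>x y. x \<in> herm_forms J \<epsilon> \<Longrightarrow> y \<in> herm_forms J \<epsilon> \<Longrightarrow>
      (f (form_sum x y), form_sum (f x) (f y)) \<in> witt_rel J' \<epsilon>'"
  shows "(\<lambda>A. witt_rel J' \<epsilon>' `` (f ` A)) \<in> hom (witt_group J \<epsilon>) (witt_group J' \<epsilon>')"
    and "x \<in> herm_forms J \<epsilon> \<Longrightarrow> witt_rel J' \<epsilon>' `` (f ` hermitian_field.witt_class J \<epsilon> x) =
       hermitian_field.witt_class J' \<epsilon>' (f x)"
proof -
  interpret K: hermitian_field J \<epsilon> \<beta> by fact
  interpret L: hermitian_field J' \<epsilon>' \<beta>' by fact
  let ?F = "\<lambda>A. witt_rel J' \<epsilon>' `` (f ` A)"
  have F: "?F (K.witt_class x) = L.witt_class (f x)" if x: "x \<in> herm_forms J \<epsilon>" for x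
  proof -
    have "L.witt_class (f y) = L.witt_class (f x)" if "y \<in> K.witt_class x" for y
      using L.witt_class_eqI[OF rel[OF K.witt_class_memD[OF that]]] by simp
    thus ?thesis using K.witt_class_self[OF x] unfolding L.witt_class_def by blast
  qed
  thus "x \<in> herm_forms J \<epsilon> \<Longrightarrow> ?F (K.witt_class x) = L.witt_class (f x)" .
  have fH: "f x \<in> herm_forms J' \<epsilon>'" if "x \<in> herm_forms J \<epsilon>" for x
    using rel[OF witt_rel.isometric[OF that that isometric_refl]] L.witt_rel_herm_forms by blast
  show "?F \<in> hom (witt_group J \<epsilon>) (witt_group J' \<epsilon>')"
  proof (rule homI)
    fix A assume "A \<in> carrier (witt_group J \<epsilon>)"
    then obtain x where "x \<in> herm_forms J \<epsilon>" "A = K.witt_class x" by (rule K.witt_group_cases)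
    thus "?F A \<in> carrier (witt_group J' \<epsilon>')" by (simp add: F L.witt_class_carrier fH)
    fix B assume "B \<in> carrier (witt_group J \<epsilon>)"
    then obtain y where "y \<in> herm_forms J \<epsilon>" "B = K.witt_class y" by (rule K.witt_group_cases)
    with \<open>x \<in> herm_forms J \<epsilon>\<close> \<open>A = K.witt_class x\<close>
    show "?F (A \<otimes>\<^bsub>witt_group J \<epsilon>\<^esub> B) = ?F A \<otimes>\<^bsub>witt_group J' \<epsilon>'\<^esub> ?F B"
      by (simp add: K.witt_mult L.witt_mult F fH K.form_sum_herm_forms L.witt_class_eqI[OF sum])
  qed
qed

section \<open>Extension of scalars\<close>

lemma sum_lessThan_add:
  "(\<Sum>i<n + m. f i) = (\<Sum>i<n. f i) + (\<Sum>i<m. f (n + i :: nat))"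
  using sum.atLeastLessThan_concat[of 0 n "n + m" f] sum.shift_bounds_nat_ivl[of f 0 n m]
  by (simp add: lessThan_atLeast0 add.commute)

lemma lincomb_unit_vec:
  assumes "a \<in> carrier_vec n"
  shows "lincomb_vec n n (unit_vec n) (($) a) = a"
proof
  fix i assume "i < dim_vec a"
  hence i: "i < n" using assms by simp
  have "(\<Sum>j<n. a $ j * unit_vec n j $ i) = (\<Sum>j<n. if j = i then a $ j else 0)"
    by (rule sum.cong) (use i in \<open>auto simp: unit_vec_def\<close>)
  thus "lincomb_vec n n (unit_vec n) (($) a) $ i = a $ i"
    using i by (simp add: lincomb_vec_def)
qed (use assms in \<open>simp add: lincomb_vec_def\<close>)

lemma linear_lincomb:
  fixes T :: "'k::field vec \<Rightarrow> 'k vec"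
  assumes T: "T \<in> carrier_vec n \<rightarrow> carrier_vec m"
       "\<forall>a\<in>carrier_vec n. \<forall>b\<in>carrier_vec n. T (a + b) = T a + T b"
       "\<forall>r. \<forall>a\<in>carrier_vec n. T (r \<cdot>\<^sub>v a) = r \<cdot>\<^sub>v T a"
    and v: "\<And>j. j < k \<Longrightarrow> v j \<in> carrier_vec n"
  shows "T (lincomb_vec n k v c) = lincomb_vec m k (\<lambda>j. T (v j)) c"
  using v
proof (induction k)
  case 0
  have c: "T (0\<^sub>v n) \<in> carrier_vec m" by (rule funcset_mem[OF T(1) zero_carrier_vec])
  have "T (0 \<cdot>\<^sub>v 0\<^sub>v n) = 0 \<cdot>\<^sub>v T (0\<^sub>v n)" using T(3) zero_carrier_vec by blast
  hence "T (0\<^sub>v n) = 0\<^sub>v m" using c by (simp add: zero_smult_vec[of _ n] zero_smult_vec[of _ m])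
  thus ?case by simp
next
  case (Suc k)
  have vk: "v k \<in> carrier_vec n" using Suc.prems by simp
  have Tk: "T (v k) \<in> carrier_vec m" by (rule funcset_mem[OF T(1) vk])
  show ?case using T(2,3) vk Tk Suc by (simp add: lincomb_vec_Suc)
qed

lemma vec_first_unit_vec:
  "i < n \<Longrightarrow> vec_first (unit_vec (n + m) i) n = unit_vec n i"
  "vec_first (unit_vec (n + m) (n + i)) n = 0\<^sub>v n"
  by (auto simp: vec_first_def unit_vec_def)

lemma vec_last_unit_vec:
  "i < n \<Longrightarrow> vec_last (unit_vec (n + m) i) m = 0\<^sub>v m"
  "i < m \<Longrightarrow> vec_last (unit_vec (n + m) (n + i)) m = unit_vec m i"
  by (auto simp: vec_last_def unit_vec_def)

locale hermitian_extension = K: hermitian_field J \<epsilon> \<beta>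
  for J :: "'k::field \<Rightarrow> 'k" and \<epsilon> :: int and \<beta> :: 'k +
  fixes h :: "'k \<Rightarrow> 'l::field" and J' :: "'l \<Rightarrow> 'l"
  assumes h: "field_hom h" and inv': "field_involution J'"
    and comm: "\<And>x. J' (h x) = h (J x)"
begin

sublocale h: field_hom h by (fact h)

sublocale L: hermitian_field J' \<epsilon> "h \<beta>"
proof
  show "field_involution J'" by (fact inv')
  show "\<epsilon> \<in> {1, -1}" by (rule K.eps)
  have "(2 :: 'l) = h 2" by (metis h.hom_add h.hom_one one_add_one)
  moreover have "h 2 \<noteq> 0" using K.two by (simp only: h.hom_0_iff not_False_eq_True)
  ultimately show "(2 :: 'l) \<noteq> 0" by (simp only: not_False_eq_True)
  show "h \<beta> \<noteq> 0" using K.beta by simp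
  show "J' (h \<beta>) = of_int \<epsilon> * h \<beta>" using K.eps by (auto simp: comm K.beta h.hom_uminus)
qed

abbreviation ext :: "'k form \<Rightarrow> 'l form" where "ext \<equiv> form_ext h J'"

abbreviation hv :: "'k vec \<Rightarrow> 'l vec" where "hv \<equiv> map_vec h"

definition ext_val :: "nat \<Rightarrow> ('k vec \<Rightarrow> 'k vec \<Rightarrow> 'k) \<Rightarrow> 'l vec \<Rightarrow> 'l vec \<Rightarrow> 'l" where
  "ext_val n \<theta> a b = (\<Sum>i<n. \<Sum>j<n. J' (a $ i) * h (\<theta> (unit_vec n i) (unit_vec n j)) * b $ j)"

lemma ext_eq: "ext (n, \<theta>) = (n, ext_val n \<theta>)"
  by (simp add: ext_val_def[abs_def])

lemma h_e: "h K.e = L.e" using K.eps by (auto simp: h.hom_uminus)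

lemma ext_hermitian:
  assumes "hermitian_form J \<epsilon> (n, \<theta>)"
  shows "hermitian_form J' \<epsilon> (n, ext_val n \<theta>)"
  unfolding hermitian_form.simps
proof (intro conjI ballI allI)
  fix a b c :: "'l vec" assume *: "a \<in> carrier_vec n" "b \<in> carrier_vec n" "c \<in> carrier_vec n"
  show "ext_val n \<theta> (a + b) c = ext_val n \<theta> a c + ext_val n \<theta> b c"
    unfolding ext_val_def sum.distrib[symmetric] using *
    by (intro sum.cong) (simp_all add: L.J.hom_add distrib_right)
  show "ext_val n \<theta> a (b + c) = ext_val n \<theta> a b + ext_val n \<theta> a c"
    unfolding ext_val_def sum.distrib[symmetric] using *
    by (intro sum.cong) (simp_all add: distrib_left)
next
  fix r and a b :: "'l vec" assume *: "a \<in> carrier_vec n" "b \<in> carrier_vec n"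
  show "ext_val n \<theta> (r \<cdot>\<^sub>v a) b = J' r * ext_val n \<theta> a b"
    unfolding ext_val_def sum_distrib_left using *
    by (intro sum.cong) (simp_all add: L.J.hom_mult mult.assoc)
  show "ext_val n \<theta> a (r \<cdot>\<^sub>v b) = ext_val n \<theta> a b * r"
    unfolding ext_val_def sum_distrib_right using * by (intro sum.cong) (simp_all add: ac_simps)
next
  fix a b :: "'l vec"
  have 1: "h (\<theta> (unit_vec n i) (unit_vec n j)) = L.e * J' (h (\<theta> (unit_vec n j) (unit_vec n i)))" for i j
  proof -
    have "\<theta> (unit_vec n i) (unit_vec n j) = K.e * J (\<theta> (unit_vec n j) (unit_vec n i))"
      by (rule K.hermitian_formD(5)[OF assms]) auto
    hence "h (\<theta> (unit_vec n i) (unit_vec n j)) = h (K.e * J (\<theta> (unit_vec n j) (unit_vec n i)))"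
      by simp
    thus ?thesis by (simp only: h.hom_mult h_e comm)
  qed
  have "ext_val n \<theta> a b = (\<Sum>j<n. \<Sum>i<n. J' (a $ i) * h (\<theta> (unit_vec n i) (unit_vec n j)) * b $ j)"
    unfolding ext_val_def by (rule sum.swap)
  also have "\<dots> = (\<Sum>j<n. \<Sum>i<n. L.e * J' (J' (b $ j) * h (\<theta> (unit_vec n j) (unit_vec n i)) * a $ i))"
  proof (intro sum.cong refl)
    fix i j
    show "J' (a $ i) * h (\<theta> (unit_vec n i) (unit_vec n j)) * b $ j =
       L.e * J' (J' (b $ j) * h (\<theta> (unit_vec n j) (unit_vec n i)) * a $ i)"
      unfolding 1[of i j] by (simp add: L.J.hom_mult ac_simps)
  qed
  also have "\<dots> = L.e * J' (ext_val n \<theta> b a)"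
    unfolding ext_val_def by (simp add: L.J.hom_sum sum_distrib_left)
  finally show "ext_val n \<theta> a b = L.e * J' (ext_val n \<theta> b a)" .
qed

lemma ext_val_hv:
  assumes H: "hermitian_form J \<epsilon> (n, \<theta>)" and ab: "a \<in> carrier_vec n" "b \<in> carrier_vec n"
  shows "ext_val n \<theta> (hv a) (hv b) = h (\<theta> a b)"
proof -
  have "\<theta> a b = \<theta> (lincomb_vec n n (unit_vec n) (($) a)) b"
    using ab by (simp add: lincomb_unit_vec)
  also have "\<dots> = (\<Sum>i<n. J (a $ i) * \<theta> (unit_vec n i) (lincomb_vec n n (unit_vec n) (($) b)))"
    using ab by (subst K.hermitian_lincomb(2)[OF H]) (auto simp: lincomb_unit_vec)
  also have "\<dots> = (\<Sum>i<n. J (a $ i) * (\<Sum>j<n. \<theta> (unit_vec n i) (unit_vec n j) * b $ j))"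
    by (subst K.hermitian_lincomb(1)[OF H]) auto
  finally have "h (\<theta> a b) = (\<Sum>i<n. \<Sum>j<n. J' (h (a $ i)) * h (\<theta> (unit_vec n i) (unit_vec n j)) * h (b $ j))"
    by (simp add: h.hom_sum h.hom_mult comm sum_distrib_left mult.assoc)
  thus ?thesis unfolding ext_val_def using ab by simp
qed

lemma hv_lincomb:
  assumes "\<And>j. j < k \<Longrightarrow> v j \<in> carrier_vec n"
  shows "hv (lincomb_vec n k v c) = lincomb_vec n k (\<lambda>j. hv (v j)) (\<lambda>j. h (c j))"
proof
  fix i assume "i < dim_vec (lincomb_vec n k (\<lambda>j. hv (v j)) (\<lambda>j. h (c j)))"
  hence i: "i < n" by (simp add: lincomb_vec_def)
  have "h (\<Sum>j<k. c j * v j $ i) = (\<Sum>j<k. h (c j) * hv (v j) $ i)"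
    unfolding h.hom_sum
  proof (intro sum.cong refl)
    fix j assume "j \<in> {..<k}"
    hence "dim_vec (v j) = n" using assms by auto
    thus "h (c j * v j $ i) = h (c j) * hv (v j) $ i" using i by (simp add: h.hom_mult)
  qed
  thus "hv (lincomb_vec n k v c) $ i = lincomb_vec n k (\<lambda>j. hv (v j)) (\<lambda>j. h (c j)) $ i"
    using i by (simp add: lincomb_vec_def)
qed (simp add: lincomb_vec_def)

lemma hv_unit_vec: "hv (unit_vec n i) = unit_vec n i"
  by (intro eq_vecI) (auto simp: unit_vec_def)

text \<open>
  An isometry is extended by its matrix in the standard bases; the extension of the inverse map is inverse to it.
\<close>
lemma ext_linear_bij:
  fixes T :: "'k vec \<Rightarrow> 'k vec"
  assumes T: "T \<in> carrier_vec n \<rightarrow> carrier_vec m"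
       "\<forall>a\<in>carrier_vec n. \<forall>b\<in>carrier_vec n. T (a + b) = T a + T b"
       "\<forall>r. \<forall>a\<in>carrier_vec n. T (r \<cdot>\<^sub>v a) = r \<cdot>\<^sub>v T a"
       "bij_betw T (carrier_vec n) (carrier_vec m)"
  shows "bij_betw (\<lambda>a. lincomb_vec m n (\<lambda>j. hv (T (unit_vec n j))) (($) a)) (carrier_vec n) (carrier_vec m)"
proof -
  obtain S where S: "S \<in> carrier_vec m \<rightarrow> carrier_vec n"
       "\<forall>a\<in>carrier_vec m. \<forall>b\<in>carrier_vec m. S (a + b) = S a + S b"
       "\<forall>r. \<forall>a\<in>carrier_vec m. S (r \<cdot>\<^sub>v a) = r \<cdot>\<^sub>v S a"
       "bij_betw S (carrier_vec m) (carrier_vec n)"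
       "\<forall>a\<in>carrier_vec n. S (T a) = a" "\<forall>b\<in>carrier_vec m. T (S b) = b"
    by (rule linear_bij_inverse[OF T])
  define E where "E = (\<lambda>n m (T :: 'k vec \<Rightarrow> 'k vec) a. lincomb_vec m n (\<lambda>j. hv (T (unit_vec n j))) (($) a))"
  have E: "E n m T a = lincomb_vec m n (\<lambda>j. hv (T (unit_vec n j))) (($) a)" for n m T a
    by (simp add: E_def)
  have main: "E m n S (E n m T a) = a"
    if T: "T \<in> carrier_vec n \<rightarrow> carrier_vec m"
      and S: "S \<in> carrier_vec m \<rightarrow> carrier_vec n"
       "\<forall>a\<in>carrier_vec m. \<forall>b\<in>carrier_vec m. S (a + b) = S a + S b"
       "\<forall>r. \<forall>a\<in>carrier_vec m. S (r \<cdot>\<^sub>v a) = r \<cdot>\<^sub>v S a"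
       "\<forall>a\<in>carrier_vec n. S (T a) = a" and a: "a \<in> carrier_vec n"
    for T S n m and a :: "'l vec"
  proof -
    have Tu: "T (unit_vec n j) \<in> carrier_vec m" for j by (rule funcset_mem[OF T unit_vec_carrier])
    have Su: "S (unit_vec m j) \<in> carrier_vec n" for j by (rule funcset_mem[OF S(1) unit_vec_carrier])
    have hvS: "E m n S (hv b) = hv (S b)" if b: "b \<in> carrier_vec m" for b
    proof -
      have "hv (S b) = hv (S (lincomb_vec m m (unit_vec m) (($) b)))"
        using b by (simp add: lincomb_unit_vec)
      also have "\<dots> = hv (lincomb_vec n m (\<lambda>j. S (unit_vec m j)) (($) b))"
        by (subst linear_lincomb[OF S(1-3)]) auto
      also have "\<dots> = lincomb_vec n m (\<lambda>j. hv (S (unit_vec m j))) (\<lambda>j. h (b $ j))"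
        by (rule hv_lincomb) (rule Su)
      also have "\<dots> = E m n S (hv b)"
        unfolding E_def using b by (intro lincomb_vec_cong) auto
      finally show ?thesis by simp
    qed
    have lin: "linear_map class_ring (module_vec TYPE('l) m) (module_vec TYPE('l) n) (E m n S)"
      unfolding E_def by (rule lincomb_vec_linear)
    have "E m n S (E n m T a) = lincomb_vec n n (\<lambda>j. E m n S (hv (T (unit_vec n j)))) (($) a)"
      using lin[unfolded linear_map_vec_iff] Tu unfolding E[of n m T]
      by (intro linear_lincomb) auto
    also have "\<dots> = lincomb_vec n n (unit_vec n) (($) a)"
      using S(4) by (intro lincomb_vec_cong) (simp_all add: hvS Tu hv_unit_vec)
    finally show ?thesis using a by (simp add: lincomb_unit_vec)
  qed
  have "bij_betw (E n m T) (carrier_vec n) (carrier_vec m)"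
  proof (rule bij_betwI[of _ _ _ "E m n S"])
    show "E m n S (E n m T a) = a" if "a \<in> carrier_vec n" for a
      by (rule main[OF T(1) S(1-3,5) that])
    show "E n m T (E m n S a) = a" if "a \<in> carrier_vec m" for a
      by (rule main[OF S(1) T(1-3) S(6) that])
  qed (auto simp: E_def)
  thus ?thesis by (simp add: E_def)
qed

lemma ext_isometric:
  assumes "isometric x y" "hermitian_form J \<epsilon> x"
  shows "isometric (ext x) (ext y)"
proof -
  obtain n \<theta> m \<eta> where xy: "x = (n, \<theta>)" "y = (m, \<eta>)" by (metis surj_pair)
  obtain T where T: "T \<in> carrier_vec n \<rightarrow> carrier_vec m"
       "\<forall>a\<in>carrier_vec n. \<forall>b\<in>carrier_vec n. T (a + b) = T a + T b"
       "\<forall>r. \<forall>a\<in>carrier_vec n. T (r \<cdot>\<^sub>v a) = r \<cdot>\<^sub>v T a"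
       "bij_betw T (carrier_vec n) (carrier_vec m)"
       "\<forall>a\<in>carrier_vec n. \<forall>b\<in>carrier_vec n. \<eta> (T a) (T b) = \<theta> a b"
    using assms(1) unfolding xy isometric_iff by blast
  let ?T = "\<lambda>a. lincomb_vec m n (\<lambda>j. hv (T (unit_vec n j))) (($) a)"
  have Tu: "T (unit_vec n j) \<in> carrier_vec m" for j by (rule funcset_mem[OF T(1) unit_vec_carrier])
  have Hx: "hermitian_form J \<epsilon> (n, \<theta>)" using assms(2) xy by simp
  have Hy: "hermitian_form J \<epsilon> (m, \<eta>)" using K.hermitian_transport[OF assms] xy by simp
  note Hy' = ext_hermitian[OF Hy]
  have "ext_val m \<eta> (?T a) (?T b) = ext_val n \<theta> a b" for a b
  proof -
    have "ext_val m \<eta> (?T a) (?T b) = (\<Sum>i<n. J' (a $ i) * ext_val m \<eta> (hv (T (unit_vec n i))) (?T b))"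
      using Tu by (intro L.hermitian_lincomb(2)[OF Hy']) auto
    also have "\<dots> = (\<Sum>i<n. J' (a $ i) * (\<Sum>j<n. ext_val m \<eta> (hv (T (unit_vec n i))) (hv (T (unit_vec n j))) * b $ j))"
      using Tu by (intro sum.cong refl arg_cong2[of _ _ _ _ "(*)"] L.hermitian_lincomb(1)[OF Hy']) auto
    also have "\<dots> = ext_val n \<theta> a b"
      unfolding ext_val_def[of n] using T(5)
      by (simp add: ext_val_hv[OF Hy Tu Tu] sum_distrib_left mult.assoc)
    finally show ?thesis .
  qed
  thus ?thesis unfolding xy ext_eq isometric.simps
    using lincomb_vec_linear ext_linear_bij[OF T(1-4)] by (intro exI[of _ ?T]) auto
qed

lemma ext_diag_form: "isometric (ext (K.diag_form ds)) (L.diag_form (map h ds))"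
  unfolding K.diag_form_def L.diag_form_def ext_eq length_map
proof (rule isometric_same_dim)
  let ?n = "length ds" and ?\<theta> = "\<lambda>a b. \<Sum>i<length ds. J (a $ i) * ds ! i * b $ i"
  fix a b :: "'l vec"
  have 1: "?\<theta> (unit_vec ?n i) (unit_vec ?n j) = (if i = j then ds ! i else 0)"
    if "i < ?n" "j < ?n" for i j
  proof -
    have "?\<theta> (unit_vec ?n i) (unit_vec ?n j) = (\<Sum>k<?n. if k = i then (if i = j then ds ! i else 0) else 0)"
      by (rule sum.cong) (use that in \<open>auto simp: unit_vec_def\<close>)
    thus ?thesis using that by simp
  qed
  have "ext_val ?n ?\<theta> a b = (\<Sum>i<?n. \<Sum>j<?n. if j = i then J' (a $ i) * h (ds ! i) * b $ i else 0)"
    unfolding ext_val_def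
  proof (intro sum.cong refl)
    fix i j assume "i \<in> {..<?n}" "j \<in> {..<?n}"
    hence ij: "i < ?n" "j < ?n" by simp_all
    show "J' (a $ i) * h (?\<theta> (unit_vec ?n i) (unit_vec ?n j)) * b $ j =
        (if j = i then J' (a $ i) * h (ds ! i) * b $ i else 0)"
      unfolding 1[OF ij] by simp
  qed
  also have "\<dots> = (\<Sum>i<?n. J' (a $ i) * h (ds ! i) * b $ i)"
    by (rule sum.cong) auto
  finally show "(\<Sum>i<?n. J' (a $ i) * map h ds ! i * b $ i) = ext_val ?n ?\<theta> a b"
    by simp
qed

lemma admissible_map: "K.admissible ds \<Longrightarrow> L.admissible (map h ds)"
  by (auto simp: K.admissible_def L.admissible_def comm h.hom_mult h_e)

lemma ext_herm_forms:
  assumes "x \<in> herm_forms J \<epsilon>"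
  shows "ext x \<in> herm_forms J' \<epsilon>"
proof -
  obtain ds where ds: "K.admissible ds" "isometric (K.diag_form ds) x"
    using assms by (rule K.diagonalization)
  have "isometric (ext (K.diag_form ds)) (ext x)"
    by (rule ext_isometric[OF ds(2) K.diag_form_hermitian[OF ds(1)]])
  hence "isometric (L.diag_form (map h ds)) (ext x)"
    using ext_diag_form isometric_sym isometric_trans by blast
  thus ?thesis using L.herm_forms_transport L.diag_form_herm_forms admissible_map ds(1) by blast
qed

text \<open>
  A basis of the isotropic subspace stays linearly independent after extension of scalars.
\<close>
lemma ext_metabolic:
  assumes "metabolic x" "hermitian_form J \<epsilon> x"
  shows "metabolic (ext x)"
proof -
  obtain n \<theta> where x: "x = (n, \<theta>)" by (metis surj_pair)
  have H: "hermitian_form J \<epsilon> (n, \<theta>)" using assms(2) x by simp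
  obtain W where W: "vec_subspace n W" "2 * vec_dim n W = n" "\<forall>a\<in>W. \<forall>b\<in>W. \<theta> a b = 0"
    using assms(1) x by auto
  let ?k = "vec_dim n W"
  obtain v where v: "indep_family n ?k v" "\<And>j. j < ?k \<Longrightarrow> v j \<in> W"
    "W = range (lincomb_vec n ?k v)"
    using vec_subspace_basis[OF W(1)] by metis
  have full: "vec_subspace n (carrier_vec n :: 'k vec set)" by (auto simp: vec_subspace_iff)
  have vc: "v j \<in> carrier_vec n" if "j < ?k" for j using v(1) that by (auto simp: indep_family_def)
  obtain l w where w: "?k \<le> l" "indep_family n l w" "\<forall>j<?k. w j = v j"
    "carrier_vec n = range (lincomb_vec n l w)"
    using indep_family_extend[OF v(1) full vc] by blast
  have wc: "w j \<in> carrier_vec n" if "j < l" for j using w(2) that by (auto simp: indep_family_def)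
  define T where "T = (\<lambda>a. lincomb_vec n l w (($) a))"
  have T: "T \<in> carrier_vec l \<rightarrow> carrier_vec n"
       "\<forall>a\<in>carrier_vec l. \<forall>b\<in>carrier_vec l. T (a + b) = T a + T b"
       "\<forall>r. \<forall>a\<in>carrier_vec l. T (r \<cdot>\<^sub>v a) = r \<cdot>\<^sub>v T a"
    using lincomb_vec_linear[of l n w] unfolding T_def linear_map_vec_iff by blast+
  have "bij_betw T (carrier_vec l) (carrier_vec n)"
    unfolding bij_betw_def
  proof
    show "inj_on T (carrier_vec l)"
    proof (rule inj_onI)
      fix a b assume *: "a \<in> carrier_vec l" "b \<in> carrier_vec l" "T a = T b"
      have "a $ j = b $ j" if "j < l" for j
        using indep_family_injD[OF w(2) _ that, of "($) a" "($) b"] *(3) by (simp add: T_def)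
      thus "a = b" using * by (intro eq_vecI) auto
    qed
    show "T ` carrier_vec l = carrier_vec n"
    proof
      show "carrier_vec n \<subseteq> T ` carrier_vec l"
      proof
        fix a :: "'k vec" assume "a \<in> carrier_vec n"
        then obtain c where "a = lincomb_vec n l w c" using w(4) by blast
        hence "a = T (vec l c)" using lincomb_vec_cong[of l c "($) (vec l c)" w w n]
          by (simp add: T_def)
        thus "a \<in> T ` carrier_vec l" by auto
      qed
    qed (use T(1) in auto)
  qed
  note bij = ext_linear_bij[OF T this]
  have Tu: "T (unit_vec l j) = w j" if "j < l" for j
  proof
    fix i assume "i < dim_vec (w j)"
    hence i: "i < n" using wc[OF that] by simp
    have "(\<Sum>k<l. unit_vec l j $ k * w k $ i) = (\<Sum>k<l. if k = j then w j $ i else 0)"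
      by (rule sum.cong) (use that in \<open>auto simp: unit_vec_def\<close>)
    thus "T (unit_vec l j) $ i = w j $ i" using i that by (simp add: T_def lincomb_vec_def)
  qed (use wc[OF that] in \<open>simp add: T_def lincomb_vec_def\<close>)
  define u where "u = (\<lambda>j. hv (w j))"
  have "indep_family n ?k u"
    unfolding indep_family_def
  proof (intro conjI allI impI)
    show "u j \<in> carrier_vec n" if "j < ?k" for j using wc[of j] that w(1) by (simp add: u_def)
    fix c j assume c: "lincomb_vec n ?k u c = 0\<^sub>v n" and j: "j < ?k"
    let ?c = "vec l (\<lambda>j. if j < ?k then c j else 0)"
    have z: "lincomb_vec n l (\<lambda>j. hv (T (unit_vec l j))) (($) (0\<^sub>v l)) = 0\<^sub>v n"
      by (intro eq_vecI) (auto simp: lincomb_vec_def)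
    have "lincomb_vec n l (\<lambda>j. hv (T (unit_vec l j))) (($) ?c) = lincomb_vec n ?k u c"
    proof
      fix i assume "i < dim_vec (lincomb_vec n ?k u c)"
      hence i: "i < n" by (simp add: lincomb_vec_def)
      have "(\<Sum>j<l. ?c $ j * hv (T (unit_vec l j)) $ i) = (\<Sum>j<?k. c j * u j $ i)"
        by (rule sum.mono_neutral_cong_right) (use w(1) in \<open>auto simp: Tu u_def\<close>)
      thus "lincomb_vec n l (\<lambda>j. hv (T (unit_vec l j))) (($) ?c) $ i = lincomb_vec n ?k u c $ i"
        using i by (simp add: lincomb_vec_def)
    qed (simp add: lincomb_vec_def)
    hence "?c = 0\<^sub>v l" using bij c z unfolding bij_betw_def
      by (metis (no_types, lifting) inj_onD vec_carrier zero_carrier_vec)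
    hence "?c $ j = 0" using j w(1) by simp
    thus "c j = 0" using j w(1) by simp
  qed
  note k = vec_dim_eq[OF this]
  have uc: "u j \<in> carrier_vec n" if "j < ?k" for j using wc[of j] that w(1) by (simp add: u_def)
  have iso: "ext_val n \<theta> (u i) (u j) = 0" if "i < ?k" "j < ?k" for i j
    using that w(3) v(2) W(3) by (simp add: u_def ext_val_hv[OF H] vc)
  have "ext_val n \<theta> (lincomb_vec n ?k u c) (lincomb_vec n ?k u d) = 0" for c d
  proof -
    have "ext_val n \<theta> (u i) (lincomb_vec n ?k u d) = (\<Sum>j<?k. ext_val n \<theta> (u i) (u j) * d j)"
      if "i < ?k" for i
      by (rule L.hermitian_lincomb(1)[OF ext_hermitian[OF H] uc uc[OF that]])
    hence "ext_val n \<theta> (u i) (lincomb_vec n ?k u d) = 0" if "i < ?k" for i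
      using that iso by simp
    moreover have "ext_val n \<theta> (lincomb_vec n ?k u c) (lincomb_vec n ?k u d) =
        (\<Sum>i<?k. J' (c i) * ext_val n \<theta> (u i) (lincomb_vec n ?k u d))"
      by (rule L.hermitian_lincomb(2)[OF ext_hermitian[OF H] uc lincomb_vec_carrier])
    ultimately show ?thesis by simp
  qed
  thus ?thesis unfolding x ext_eq metabolic.simps using W(2) k
    by (intro exI[of _ "range (lincomb_vec n ?k u)"]) (auto intro: range_lincomb_subspace)
qed

lemma ext_form_sum:
  assumes "hermitian_form J \<epsilon> x" "hermitian_form J \<epsilon> y"
  shows "isometric (ext (form_sum x y)) (form_sum (ext x) (ext y))"
proof -
  obtain n \<theta> m \<eta> where xy: "x = (n, \<theta>)" "y = (m, \<eta>)" by (metis surj_pair)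
  have Hx: "hermitian_form J \<epsilon> (n, \<theta>)" and Hy: "hermitian_form J \<epsilon> (m, \<eta>)" using assms xy by auto
  have zx: "\<theta> a (0\<^sub>v n) = 0" "\<theta> (0\<^sub>v n) a = 0" if "a \<in> carrier_vec n" for a
    using K.hermitian_lincomb[OF Hx, of 0 "\<lambda>_. 0\<^sub>v n" a] that by simp_all
  have zy: "\<eta> a (0\<^sub>v m) = 0" "\<eta> (0\<^sub>v m) a = 0" if "a \<in> carrier_vec m" for a
    using K.hermitian_lincomb[OF Hy, of 0 "\<lambda>_. 0\<^sub>v m" a] that by simp_all
  show ?thesis unfolding xy ext_eq form_sum.simps
  proof (rule isometric_same_dim)
    fix a b :: "'l vec" assume ab: "a \<in> carrier_vec (n + m)" "b \<in> carrier_vec (n + m)"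
    have ab': "vec_first a n $ i = a $ i" "vec_first b n $ i = b $ i" if "i < n" for i
      using that by (auto simp: vec_first_def)
    have ab'': "vec_last a m $ i = a $ (n + i)" "vec_last b m $ i = b $ (n + i)" if "i < m" for i
      using that ab by (auto simp: vec_last_def)
    show "ext_val n \<theta> (vec_first a n) (vec_first b n) + ext_val m \<eta> (vec_last a m) (vec_last b m) =
      ext_val (n + m) (\<lambda>a b. \<theta> (vec_first a n) (vec_first b n) + \<eta> (vec_last a m) (vec_last b m)) a b"
      unfolding ext_val_def sum_lessThan_add
      by (simp add: vec_first_unit_vec vec_last_unit_vec zx zy ab' ab'' sum.distrib)
  qed
qed

lemma ext_witt_rel:
  assumes "(x, y) \<in> witt_rel J \<epsilon>"
  shows "(ext x, ext y) \<in> witt_rel J' \<epsilon>"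
  using assms
proof induction
  case (isometric x y)
  thus ?case by (intro witt_rel.isometric ext_herm_forms ext_isometric) (auto simp: herm_forms_def)
next
  case (metabolic x)
  hence "(ext x, zero_form) \<in> witt_rel J' \<epsilon>"
    by (intro witt_rel.metabolic ext_herm_forms ext_metabolic) (auto simp: herm_forms_def)
  moreover have "ext zero_form = zero_form" by (simp add: zero_form_def fun_eq_iff)
  ultimately show ?case by simp
next
  case (sum x y x' y')
  have *: "x \<in> herm_forms J \<epsilon>" "x' \<in> herm_forms J \<epsilon>" "y \<in> herm_forms J \<epsilon>" "y' \<in> herm_forms J \<epsilon>"
    using sum.hyps K.witt_rel_herm_forms by auto
  have "(ext (form_sum u u'), form_sum (ext u) (ext u')) \<in> witt_rel J' \<epsilon>"
    if "u \<in> herm_forms J \<epsilon>" "u' \<in> herm_forms J \<epsilon>" for u u'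
    using that by (intro witt_rel.isometric ext_form_sum ext_herm_forms L.form_sum_herm_forms K.form_sum_herm_forms)
      (auto simp: herm_forms_def)
  thus ?case using * sum.IH by (meson witt_rel.sum witt_rel.sym witt_rel.trans)
qed (auto intro: witt_rel.sym witt_rel.trans)

lemma ext_form_sum_witt_rel:
  assumes "x \<in> herm_forms J \<epsilon>" "y \<in> herm_forms J \<epsilon>"
  shows "(ext (form_sum x y), form_sum (ext x) (ext y)) \<in> witt_rel J' \<epsilon>"
  using assms by (intro witt_rel.isometric ext_form_sum ext_herm_forms L.form_sum_herm_forms K.form_sum_herm_forms)
      (auto simp: herm_forms_def)

lemma witt_ext_hom: "witt_ext h J' \<epsilon> \<in> hom (witt_group J \<epsilon>) (witt_group J' \<epsilon>)"
proof -
  have "witt_ext h J' \<epsilon> = (\<lambda>A. witt_rel J' \<epsilon> `` (ext ` A))" by (simp add: fun_eq_iff witt_ext_def)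
  thus ?thesis
    using witt_induced_hom(1)[OF K.hermitian_field_axioms L.hermitian_field_axioms
        ext_witt_rel ext_form_sum_witt_rel] by simp
qed

lemma witt_ext_diag_class:
  assumes "K.admissible ds"
  shows "witt_ext h J' \<epsilon> (K.diag_class ds) = L.diag_class (map h ds)"
proof -
  have "witt_ext h J' \<epsilon> (K.diag_class ds) = L.witt_class (ext (K.diag_form ds))"
    unfolding witt_ext_def K.diag_class_def
    using witt_induced_hom(2)[OF K.hermitian_field_axioms L.hermitian_field_axioms
        ext_witt_rel ext_form_sum_witt_rel K.diag_form_herm_forms[OF assms]] by simp
  also have "\<dots> = L.diag_class (map h ds)"
    unfolding L.diag_class_def
    by (intro L.witt_class_isometricI ext_diag_form ext_herm_forms K.diag_form_herm_forms assms)
  finally show ?thesis .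
qed

end

section \<open>Signatures over the complex numbers\<close>

definition sign_scale :: "int \<Rightarrow> complex" where
  "sign_scale \<epsilon> = csqrt (of_int \<epsilon>)"

lemma Re_of_real_mult: "Re (complex_of_real x * z) = x * Re z"
  by simp

lemma field_involution_cnj: "field_involution cnj"
proof -
  have "field_hom cnj" by unfold_locales simp_all
  thus ?thesis by (simp add: field_involution_def)
qed

lemma hermitian_field_cnj:
  assumes "\<epsilon> \<in> {1, -1}"
  shows "hermitian_field cnj \<epsilon> (sign_scale \<epsilon>)"
proof
  show "field_involution cnj" by (rule field_involution_cnj)
  show "sign_scale \<epsilon> \<noteq> 0" "cnj (sign_scale \<epsilon>) = of_int \<epsilon> * sign_scale \<epsilon>"
    using assms by (auto simp: sign_scale_def complex_eq_iff)
qed (use assms in auto)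

text \<open>
  A complex form together with an isometry \<open>T\<close> from a diagonal form. The signature is defined by maximal definite
  subspaces, and it is compared here with the signs of the diagonal entries.
\<close>
locale complex_diagonalization =
  fixes \<epsilon> :: int and n :: nat and \<theta> :: "complex vec \<Rightarrow> complex vec \<Rightarrow> complex"
    and ds :: "complex list" and T :: "complex vec \<Rightarrow> complex vec"
  assumes eps: "\<epsilon> \<in> {1, -1}"
    and herm: "hermitian_form cnj \<epsilon> (n, \<theta>)"
    and adm: "hermitian_field.admissible cnj \<epsilon> ds"
    and T_carrier: "T \<in> carrier_vec (length ds) \<rightarrow> carrier_vec n"
    and T_add: "\<forall>a\<in>carrier_vec (length ds). \<forall>b\<in>carrier_vec (length ds). T (a + b) = T a + T b"
    and T_smult: "\<forall>r. \<forall>a\<in>carrier_vec (length ds). T (r \<cdot>\<^sub>v a) = r \<cdot>\<^sub>v T a"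
    and T_bij: "bij_betw T (carrier_vec (length ds)) (carrier_vec n)"
    and T_form: "\<forall>a\<in>carrier_vec (length ds). \<forall>b\<in>carrier_vec (length ds).
       \<theta> (T a) (T b) = (\<Sum>i<length ds. cnj (a $ i) * ds ! i * b $ i)"
begin

sublocale C: hermitian_field cnj \<epsilon> "sign_scale \<epsilon>" by (rule hermitian_field_cnj[OF eps])

definition S :: "complex vec \<Rightarrow> complex vec" where
  "S = (SOME S. S \<in> carrier_vec n \<rightarrow> carrier_vec (length ds) \<and>
       (\<forall>a\<in>carrier_vec n. \<forall>b\<in>carrier_vec n. S (a + b) = S a + S b) \<and>
       (\<forall>r. \<forall>a\<in>carrier_vec n. S (r \<cdot>\<^sub>v a) = r \<cdot>\<^sub>v S a) \<and>
       (\<forall>a\<in>carrier_vec (length ds). S (T a) = a) \<and> (\<forall>b\<in>carrier_vec n. T (S b) = b))"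

lemma S_all: "S \<in> carrier_vec n \<rightarrow> carrier_vec (length ds) \<and>
       (\<forall>a\<in>carrier_vec n. \<forall>b\<in>carrier_vec n. S (a + b) = S a + S b) \<and>
       (\<forall>r. \<forall>a\<in>carrier_vec n. S (r \<cdot>\<^sub>v a) = r \<cdot>\<^sub>v S a) \<and>
       (\<forall>a\<in>carrier_vec (length ds). S (T a) = a) \<and> (\<forall>b\<in>carrier_vec n. T (S b) = b)"
proof -
  obtain S where S: "S \<in> carrier_vec n \<rightarrow> carrier_vec (length ds)"
       "\<forall>a\<in>carrier_vec n. \<forall>b\<in>carrier_vec n. S (a + b) = S a + S b"
       "\<forall>r. \<forall>a\<in>carrier_vec n. S (r \<cdot>\<^sub>v a) = r \<cdot>\<^sub>v S a"
       "bij_betw S (carrier_vec n) (carrier_vec (length ds))"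
       "\<forall>a\<in>carrier_vec (length ds). S (T a) = a" "\<forall>b\<in>carrier_vec n. T (S b) = b"
    by (rule linear_bij_inverse[OF T_carrier T_add T_smult T_bij])
  show ?thesis unfolding S_def by (rule someI[of _ S]) (use S in blast)
qed

lemma S_carrier: "a \<in> carrier_vec n \<Longrightarrow> S a \<in> carrier_vec (length ds)"
  and S_add: "a \<in> carrier_vec n \<Longrightarrow> b \<in> carrier_vec n \<Longrightarrow> S (a + b) = S a + S b"
  and S_smult: "a \<in> carrier_vec n \<Longrightarrow> S (r \<cdot>\<^sub>v a) = r \<cdot>\<^sub>v S a"
  and ST: "a \<in> carrier_vec (length ds) \<Longrightarrow> S (T a) = a"
  and TS: "b \<in> carrier_vec n \<Longrightarrow> T (S b) = b"
  using S_all by blast+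

lemma Tc: "a \<in> carrier_vec (length ds) \<Longrightarrow> T a \<in> carrier_vec n" using T_carrier by blast

definition entry :: "nat \<Rightarrow> real" where "entry i = Re (sign_scale \<epsilon> * ds ! i)"

definition scaled :: "complex vec \<Rightarrow> real" where "scaled a = Re (sign_scale \<epsilon> * \<theta> a a)"

lemma entry_nonzero: "i < length ds \<Longrightarrow> entry i \<noteq> 0"
proof -
  assume i: "i < length ds"
  have d: "ds ! i \<noteq> 0" "cnj (ds ! i) = of_int \<epsilon> * ds ! i"
    using adm i by (auto simp: C.admissible_def)
  have "cnj (sign_scale \<epsilon> * ds ! i) = sign_scale \<epsilon> * ds ! i"
    using C.beta d eps by auto
  hence "Im (sign_scale \<epsilon> * ds ! i) = 0" by (metis Reals_cnj_iff complex_is_Real_iff)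
  moreover have "sign_scale \<epsilon> * ds ! i \<noteq> 0" using C.beta d by simp
  ultimately show ?thesis unfolding entry_def by (metis complex_eq_iff zero_complex.simps)
qed

lemma scaled_eq:
  assumes "a \<in> carrier_vec n"
  shows "scaled a = (\<Sum>i<length ds. (cmod (S a $ i))\<^sup>2 * entry i)"
proof -
  have "\<theta> a a = (\<Sum>i<length ds. cnj (S a $ i) * ds ! i * S a $ i)"
    using T_form S_carrier[OF assms] TS[OF assms] by metis
  hence "sign_scale \<epsilon> * \<theta> a a = (\<Sum>i<length ds. sign_scale \<epsilon> * (cnj (S a $ i) * ds ! i * S a $ i))"
    by (simp add: sum_distrib_left)
  also have "\<dots> = (\<Sum>i<length ds. complex_of_real ((cmod (S a $ i))\<^sup>2) * (sign_scale \<epsilon> * ds ! i))"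
    by (intro sum.cong refl) (simp only: complex_norm_square ac_simps)
  finally have "scaled a = (\<Sum>i<length ds. Re (complex_of_real ((cmod (S a $ i))\<^sup>2) * (sign_scale \<epsilon> * ds ! i)))"
    by (simp add: scaled_def)
  thus ?thesis by (simp only: Re_of_real_mult entry_def)
qed

text \<open>The sign \<open>s\<close> treats positive and negative subspaces together.\<close>
definition definite_subspace :: "real \<Rightarrow> complex vec set \<Rightarrow> bool" where
  "definite_subspace s W \<longleftrightarrow> vec_subspace n W \<and> (\<forall>a\<in>W. a \<noteq> 0\<^sub>v n \<longrightarrow> s * scaled a > 0)"

definition idx :: "real \<Rightarrow> nat set" where "idx s = {i. i < length ds \<and> s * entry i > 0}"

lemma idx_finite: "finite (idx s)" by (auto simp: idx_def)

lemma scaled_off: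
  assumes s: "s \<noteq> 0" and a: "a \<in> carrier_vec n" "\<And>i. i \<in> idx s \<Longrightarrow> S a $ i = 0" and nz: "a \<noteq> 0\<^sub>v n"
  shows "s * scaled a < 0"
proof -
  have "s * scaled a = (\<Sum>i<length ds. (cmod (S a $ i))\<^sup>2 * (s * entry i))"
    unfolding scaled_eq[OF a(1)] by (simp add: sum_distrib_left ac_simps)
  also have "\<dots> < 0"
  proof -
    have "\<exists>i<length ds. S a $ i \<noteq> 0"
    proof (rule ccontr)
      assume "\<not> (\<exists>i<length ds. S a $ i \<noteq> 0)"
      hence "S a = 0 \<cdot>\<^sub>v S a" using S_carrier[OF a(1)] by (intro eq_vecI) auto
      hence "S a = S (0 \<cdot>\<^sub>v a)" using S_smult[OF a(1)] by simp
      hence "a = 0 \<cdot>\<^sub>v a" using TS a(1) by (metis smult_carrier_vec)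
      thus False using nz a(1) by (simp add: zero_smult_vec)
    qed
    then obtain j where j: "j < length ds" "S a $ j \<noteq> 0" by blast
    have le: "(cmod (S a $ i))\<^sup>2 * (s * entry i) \<le> 0" if "i < length ds" for i
      using a(2)[of i] that by (cases "i \<in> idx s") (auto simp: idx_def mult_nonneg_nonpos)
    have "s * entry j \<noteq> 0" using s entry_nonzero[OF j(1)] by simp
    moreover have "j \<notin> idx s" using a(2) j by blast
    hence "\<not> 0 < s * entry j" using j by (simp add: idx_def)
    ultimately have "s * entry j < 0" by linarith
    hence "(cmod (S a $ j))\<^sup>2 * (s * entry j) < 0" using j by (simp add: mult_pos_neg)
    thus ?thesis
      using sum_strict_mono_ex1[of "{..<length ds}" "\<lambda>i. (cmod (S a $ i))\<^sup>2 * (s * entry i)" "\<lambda>_. 0"] le j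
      by auto
  qed
  finally show ?thesis .
qed

text \<open>
  Otherwise some non-zero vector of \<open>W\<close> has vanishing coordinates at all entries of the sign of \<open>s\<close>.
\<close>
lemma vec_dim_isotropic_le:
  assumes s: "s \<noteq> 0" and W: "vec_subspace n W" "\<And>a. a \<in> W \<Longrightarrow> s * scaled a \<ge> 0"
  shows "vec_dim n W \<le> card (idx s)"
proof (rule ccontr)
  assume "\<not> vec_dim n W \<le> card (idx s)"
  hence lt: "card (idx s) < vec_dim n W" by simp
  have "\<exists>a\<in>W. a \<noteq> 0\<^sub>v n \<and> (\<forall>i\<in>idx s. S a $ i = 0)"
  proof (rule vec_dim_lt_exists[OF W(1) idx_finite lt])
    fix i and a b :: "complex vec" assume *: "i \<in> idx s" "a \<in> carrier_vec n" "b \<in> carrier_vec n"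
    hence "i < dim_vec (S b)" using S_carrier[OF *(3)] by (simp add: idx_def)
    thus "S (a + b) $ i = S a $ i + S b $ i" using * by (simp add: S_add)
  next
    fix i r and a :: "complex vec" assume *: "i \<in> idx s" "a \<in> carrier_vec n"
    hence "i < dim_vec (S a)" using S_carrier[OF *(2)] by (simp add: idx_def)
    thus "S (r \<cdot>\<^sub>v a) $ i = r * S a $ i" using * by (simp add: S_smult)
  qed
  then obtain a where a: "a \<in> W" "a \<noteq> 0\<^sub>v n" "\<forall>i\<in>idx s. S a $ i = 0" by blast
  have "a \<in> carrier_vec n" using a(1) W(1) by (auto simp: vec_subspace_iff)
  thus False using scaled_off[OF s _ _ a(2)] a(3) W(2)[OF a(1)] by force
qed

text \<open>
  The span of the basis vectors with entries of the sign of \<open>s\<close> contains a non-zero vector that is orthogonal to \<open>W\<close>.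
  Hence maximal definite subspaces all have the same dimension.
\<close>
lemma definite_subspace_extend:
  assumes s: "s \<noteq> 0" and W: "definite_subspace s W" and lt: "vec_dim n W < card (idx s)"
  shows "\<exists>U. definite_subspace s U \<and> W \<subseteq> U \<and> U \<noteq> W"
proof -
  have sub: "vec_subspace n W" using W by (simp add: definite_subspace_def)
  obtain w where w: "\<And>j. j < vec_dim n W \<Longrightarrow> w j \<in> W" "W = range (lincomb_vec n (vec_dim n W) w)"
    using vec_subspace_basis[OF sub] by metis
  have wc: "w j \<in> carrier_vec n" if "j < vec_dim n W" for j
    using w(1)[OF that] sub by (auto simp: vec_subspace_iff)
  let ?k = "length ds"
  define u where "u = (\<lambda>i. T (unit_vec ?k i))"
  have uc: "u i \<in> carrier_vec n" for i unfolding u_def by (rule Tc) simp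
  have "card {..<vec_dim n W} < card (idx s)" using lt by simp
  from homogeneous_solution[OF finite_lessThan idx_finite this, of "\<lambda>j i. \<theta> (w j) (u i)"]
  obtain c where c: "\<exists>i\<in>idx s. c i \<noteq> 0" "\<forall>j<vec_dim n W. (\<Sum>i\<in>idx s. \<theta> (w j) (u i) * c i) = 0"
    by auto
  define b where "b = vec ?k (\<lambda>i. if i \<in> idx s then c i else 0)"
  define v where "v = T b"
  have bc: "b \<in> carrier_vec ?k" by (simp add: b_def)
  have vc: "v \<in> carrier_vec n" unfolding v_def by (rule Tc[OF bc])
  have "v = T (lincomb_vec ?k ?k (unit_vec ?k) (($) b))" using bc by (simp add: lincomb_unit_vec v_def)
  also have "\<dots> = lincomb_vec n ?k u (($) b)"
    unfolding u_def by (rule linear_lincomb[OF T_carrier T_add T_smult]) simp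
  finally have v: "v = lincomb_vec n ?k u (($) b)" .
  have wv: "\<theta> (w j) v = 0" if j: "j < vec_dim n W" for j
  proof -
    have "\<theta> (w j) v = (\<Sum>i<?k. \<theta> (w j) (u i) * b $ i)"
      unfolding v by (rule C.hermitian_lincomb(1)[OF herm uc wc[OF j]])
    also have "\<dots> = (\<Sum>i\<in>idx s. \<theta> (w j) (u i) * c i)"
      by (rule sum.mono_neutral_cong_right) (auto simp: b_def idx_def)
    finally show ?thesis using c j by simp
  qed
  have Wv: "\<theta> a v = 0" if a: "a \<in> W" for a
  proof -
    obtain d where d: "a = lincomb_vec n (vec_dim n W) w d" using w(2) a by blast
    have "\<theta> a v = (\<Sum>j<vec_dim n W. cnj (d j) * \<theta> (w j) v)"
      unfolding d by (rule C.hermitian_lincomb(2)[OF herm wc vc])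
    thus ?thesis using wv by simp
  qed
  have vW: "\<theta> v a = 0" if a: "a \<in> W" for a
  proof -
    have "a \<in> carrier_vec n" using a sub by (auto simp: vec_subspace_iff)
    from C.hermitian_formD(5)[OF herm vc this] show ?thesis using Wv[OF a] by simp
  qed
  have v0: "v \<noteq> 0\<^sub>v n"
  proof
    assume "v = 0\<^sub>v n"
    hence "S v = S (0 \<cdot>\<^sub>v v)" using zero_smult_vec[OF vc] by metis
    hence "b = 0 \<cdot>\<^sub>v b" using S_smult[OF vc] ST[OF bc] by (simp add: v_def)
    hence b0: "b = 0\<^sub>v ?k" using bc by (simp add: zero_smult_vec)
    obtain i where i: "i \<in> idx s" "c i \<noteq> 0" using c by blast
    hence "b $ i = c i" by (simp add: b_def idx_def)
    thus False using i b0 by (simp add: idx_def)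
  qed
  have posv: "s * scaled v > 0"
  proof -
    have "S v = b" using ST[OF bc] by (simp add: v_def)
    hence "s * scaled v = (\<Sum>i<?k. (cmod (b $ i))\<^sup>2 * (s * entry i))"
      using scaled_eq[OF vc] by (simp add: sum_distrib_left ac_simps)
    moreover have "\<dots> > 0"
    proof -
      obtain i where i: "i \<in> idx s" "c i \<noteq> 0" using c by blast
      have "(cmod (b $ i))\<^sup>2 * (s * entry i) > 0" using i by (auto simp: b_def idx_def)
      moreover have "(cmod (b $ j))\<^sup>2 * (s * entry j) \<ge> 0" if "j < ?k" for j
        using that by (auto simp: b_def idx_def)
      ultimately show ?thesis using i
        by (intro sum_pos2[of _ i]) (auto simp: idx_def)
    qed
    ultimately show ?thesis by simp
  qed
  define U where "U = {a + z \<cdot>\<^sub>v v | a z. a \<in> W}"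
  have Wc: "W \<subseteq> carrier_vec n" using sub by (simp add: vec_subspace_iff)
  have "vec_subspace n U"
    unfolding vec_subspace_iff
  proof (intro conjI ballI allI)
    show "U \<subseteq> carrier_vec n" using Wc vc by (auto simp: U_def)
    have "0\<^sub>v n = 0\<^sub>v n + 0 \<cdot>\<^sub>v v" using vc by (simp add: zero_smult_vec)
    thus "0\<^sub>v n \<in> U" using sub unfolding U_def vec_subspace_iff by blast
  next
    fix a b assume "a \<in> U" "b \<in> U"
    then obtain a' z b' y where *: "a = a' + z \<cdot>\<^sub>v v" "b = b' + y \<cdot>\<^sub>v v" "a' \<in> W" "b' \<in> W"
      unfolding U_def by blast
    have "a + b = (a' + b') + (z + y) \<cdot>\<^sub>v v" unfolding *(1,2) using *(3,4) Wc vc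
      by (intro eq_vecI) (auto simp: algebra_simps)
    thus "a + b \<in> U" using * sub unfolding U_def vec_subspace_iff by blast
  next
    fix r a assume "a \<in> U"
    then obtain a' z where *: "a = a' + z \<cdot>\<^sub>v v" "a' \<in> W" unfolding U_def by blast
    have "r \<cdot>\<^sub>v a = r \<cdot>\<^sub>v a' + (r * z) \<cdot>\<^sub>v v" unfolding *(1) using *(2) Wc vc
      by (intro eq_vecI) (auto simp: algebra_simps)
    thus "r \<cdot>\<^sub>v a \<in> U" using * sub unfolding U_def vec_subspace_iff by blast
  qed
  moreover have "s * scaled a > 0" if aU: "a \<in> U" and a0: "a \<noteq> 0\<^sub>v n" for a
  proof -
    obtain a' z where a: "a = a' + z \<cdot>\<^sub>v v" "a' \<in> W" using aU unfolding U_def by blast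
    have a'c: "a' \<in> carrier_vec n" using a Wc by blast
    have zc: "z \<cdot>\<^sub>v v \<in> carrier_vec n" using vc by simp
    have "\<theta> a a = \<theta> a' a' + \<theta> a' (z \<cdot>\<^sub>v v) + (\<theta> (z \<cdot>\<^sub>v v) a' + \<theta> (z \<cdot>\<^sub>v v) (z \<cdot>\<^sub>v v))"
      unfolding a(1) using a'c zc by (simp add: C.hermitian_formD(1,2)[OF herm])
    also have "\<dots> = \<theta> a' a' + cnj z * \<theta> v v * z"
      using a'c vc Wv[OF a(2)] vW[OF a(2)] by (simp add: C.hermitian_formD(3,4)[OF herm])
    also have "\<dots> = \<theta> a' a' + of_real ((cmod z)\<^sup>2) * \<theta> v v"
      by (simp only: complex_norm_square ac_simps)
    finally have "sign_scale \<epsilon> * \<theta> a a = sign_scale \<epsilon> * \<theta> a' a' + of_real ((cmod z)\<^sup>2) * (sign_scale \<epsilon> * \<theta> v v)"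
      by (simp add: algebra_simps)
    hence eq: "scaled a = scaled a' + (cmod z)\<^sup>2 * scaled v"
      unfolding scaled_def by (simp only: plus_complex.sel Re_of_real_mult)
    show ?thesis
    proof (cases "z = 0")
      case True
      hence "a = a'" using a(1) a'c vc by (simp add: zero_smult_vec)
      thus ?thesis using W a(2) a0 by (simp add: definite_subspace_def)
    next
      case False
      have "s * scaled a' \<ge> 0"
      proof (cases "a' = 0\<^sub>v n")
        case True
        have "\<theta> (0\<^sub>v n) (0\<^sub>v n) = 0" using C.hermitian_lincomb(1)[OF herm, of 0 "\<lambda>_. 0\<^sub>v n" "0\<^sub>v n"] by simp
        thus ?thesis using True by (simp add: scaled_def)
      qed (use W a(2) in \<open>force simp: definite_subspace_def\<close>)
      moreover have "(cmod z)\<^sup>2 * (s * scaled v) > 0" using False posv by simp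
      ultimately show ?thesis by (simp add: eq algebra_simps)
    qed
  qed
  ultimately have "definite_subspace s U" by (simp add: definite_subspace_def)
  moreover have "W \<subseteq> U"
  proof
    fix a assume a: "a \<in> W"
    hence "a = a + 0 \<cdot>\<^sub>v v" using Wc vc by (auto simp: zero_smult_vec)
    thus "a \<in> U" using a unfolding U_def by blast
  qed
  moreover have "U \<noteq> W"
  proof
    assume "U = W"
    moreover have "v = 0\<^sub>v n + 1 \<cdot>\<^sub>v v" using vc by simp
    ultimately have "v \<in> W" using sub unfolding U_def vec_subspace_iff by blast
    hence "\<theta> v v = 0" by (rule Wv)
    thus False using posv by (simp add: scaled_def)
  qed
  ultimately show ?thesis by blast
qed

lemma maximal_definite_dim:
  assumes s: "s \<noteq> 0" and W: "definite_subspace s W"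
    and max: "\<And>U. definite_subspace s U \<and> W \<subseteq> U \<Longrightarrow> U = W"
  shows "vec_dim n W = card (idx s)"
proof (rule antisym)
  have "\<theta> (0\<^sub>v n) (0\<^sub>v n) = 0" using C.hermitian_lincomb(1)[OF herm, of 0 "\<lambda>_. 0\<^sub>v n" "0\<^sub>v n"] by simp
  hence "s * scaled a \<ge> 0" if "a \<in> W" for a
    using W that by (cases "a = 0\<^sub>v n") (force simp: scaled_def definite_subspace_def)+
  thus "vec_dim n W \<le> card (idx s)"
    using W by (intro vec_dim_isotropic_le[OF s]) (auto simp: definite_subspace_def)
  show "card (idx s) \<le> vec_dim n W"
    using definite_subspace_extend[OF s W] max by (meson not_le)
qed

lemma maximal_definite_exists:
  assumes s: "s \<noteq> 0"
  shows "\<exists>W. definite_subspace s W \<and> (\<forall>U. definite_subspace s U \<and> W \<subseteq> U \<longrightarrow> U = W)"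
proof -
  let ?k = "length ds"
  define W where "W = {a \<in> carrier_vec n. \<forall>i<?k. i \<notin> idx s \<longrightarrow> S a $ i = 0}"
  have S_idx: "S (a + b) $ i = S a $ i + S b $ i" "S (r \<cdot>\<^sub>v a) $ i = r * S a $ i"
    if "a \<in> carrier_vec n" "b \<in> carrier_vec n" "i < ?k" for a b r i
    using that S_carrier[OF that(1)] S_carrier[OF that(2)] by (auto simp: S_add S_smult)
  have "S (0\<^sub>v n) $ i = 0" if "i < ?k" for i
    using S_idx(2)[OF _ _ that, of "0\<^sub>v n" "0\<^sub>v n" 0] by (simp add: zero_smult_vec[of _ n])
  hence sub: "vec_subspace n W"
    unfolding vec_subspace_iff W_def by (auto simp: S_idx)
  have "s * scaled a > 0" if a: "a \<in> W" "a \<noteq> 0\<^sub>v n" for a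
  proof -
    have ac: "a \<in> carrier_vec n" using a by (simp add: W_def)
    have "(- s) * scaled a < 0"
    proof (rule scaled_off[OF _ ac _ a(2)])
      fix i assume "i \<in> idx (- s)"
      hence "i < ?k" "i \<notin> idx s" by (auto simp: idx_def)
      thus "S a $ i = 0" using a by (simp add: W_def)
    qed (use s in simp)
    thus ?thesis by simp
  qed
  hence "definite_subspace s W" using sub by (simp add: definite_subspace_def)
  moreover have "U = W" if U: "definite_subspace s U" "W \<subseteq> U" for U
  proof
    show "U \<subseteq> W"
    proof
      fix a assume a: "a \<in> U"
      have Usub: "vec_subspace n U" using U by (simp add: definite_subspace_def)
      have ac: "a \<in> carrier_vec n" using a Usub by (auto simp: vec_subspace_iff)
      define b where "b = vec ?k (\<lambda>i. if i \<in> idx s then S a $ i else 0)"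
      have bc: "b \<in> carrier_vec ?k" by (simp add: b_def)
      have Tbc: "T b \<in> carrier_vec n" by (rule Tc[OF bc])
      have TbW: "T b \<in> W" using Tbc by (simp add: W_def ST[OF bc]) (simp add: b_def)
      define c where "c = a + (-1) \<cdot>\<^sub>v T b"
      have cU: "c \<in> U" using a TbW U(2) Usub unfolding c_def vec_subspace_iff by blast
      have cc: "c \<in> carrier_vec n" using ac Tbc by (simp add: c_def)
      have "S c $ i = 0" if i: "i \<in> idx s" for i
      proof -
        have "i < ?k" using i by (simp add: idx_def)
        moreover have "(-1) \<cdot>\<^sub>v T b \<in> carrier_vec n" using Tbc by simp
        ultimately have "S c $ i = S a $ i + (-1) * S (T b) $ i"
          unfolding c_def using ac Tbc by (simp only: S_idx)
        thus ?thesis using i \<open>i < ?k\<close> by (simp add: ST[OF bc]) (simp add: b_def)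
      qed
      hence "c = 0\<^sub>v n" using scaled_off[OF s cc] U(1) cU by (force simp: definite_subspace_def)
      moreover have "a = c + T b" unfolding c_def using ac Tbc by (intro eq_vecI) auto
      ultimately have "a = T b" using Tbc by simp
      thus "a \<in> W" using TbW by simp
    qed
  qed (use U in simp)
  ultimately show ?thesis by blast
qed

lemma signature_card: "signature \<epsilon> (n, \<theta>) = int (card (idx 1)) - int (card (idx (- 1)))"
proof -
  have pos: "positive_subspace \<epsilon> (n, \<theta>) = definite_subspace 1"
    by (auto simp: fun_eq_iff definite_subspace_def scaled_def sign_scale_def)
  have neg: "negative_subspace \<epsilon> (n, \<theta>) = definite_subspace (- 1)"
    by (auto simp: fun_eq_iff definite_subspace_def scaled_def sign_scale_def)
  obtain W where W: "definite_subspace 1 W" "\<forall>U. definite_subspace 1 U \<and> W \<subseteq> U \<longrightarrow> U = W"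
    using maximal_definite_exists[of 1] by auto
  obtain W' where W': "definite_subspace (- 1) W'" "\<forall>U. definite_subspace (- 1) U \<and> W' \<subseteq> U \<longrightarrow> U = W'"
    using maximal_definite_exists[of "- 1"] by auto
  show ?thesis
    unfolding signature_def pos neg fst_conv
  proof (rule the_equality)
    show "\<exists>W W'. definite_subspace 1 W \<and> (\<forall>U. definite_subspace 1 U \<and> W \<subseteq> U \<longrightarrow> U = W) \<and>
       definite_subspace (- 1) W' \<and> (\<forall>U. definite_subspace (- 1) U \<and> W' \<subseteq> U \<longrightarrow> U = W') \<and>
       int (card (idx 1)) - int (card (idx (- 1))) = int (vec_dim n W) - int (vec_dim n W')"
      using W W' maximal_definite_dim[of 1 W] maximal_definite_dim[of "- 1" W'] by force
  next
    fix t assume "\<exists>W W'. definite_subspace 1 W \<and> (\<forall>U. definite_subspace 1 U \<and> W \<subseteq> U \<longrightarrow> U = W) \<and>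
       definite_subspace (- 1) W' \<and> (\<forall>U. definite_subspace (- 1) U \<and> W' \<subseteq> U \<longrightarrow> U = W') \<and>
       t = int (vec_dim n W) - int (vec_dim n W')"
    then obtain V V' where V: "definite_subspace 1 V" "\<forall>U. definite_subspace 1 U \<and> V \<subseteq> U \<longrightarrow> U = V"
       "definite_subspace (- 1) V'" "\<forall>U. definite_subspace (- 1) U \<and> V' \<subseteq> U \<longrightarrow> U = V'"
       "t = int (vec_dim n V) - int (vec_dim n V')" by blast
    have "vec_dim n V = card (idx 1)" using maximal_definite_dim[of 1 V] V(1,2) by simp
    moreover have "vec_dim n V' = card (idx (- 1))" using maximal_definite_dim[of "- 1" V'] V(3,4) by simp
    ultimately show "t = int (card (idx 1)) - int (card (idx (- 1)))" using V(5) by simp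
  qed
qed

lemma length_eq_dim: "length ds = n"
proof -
  let ?k = "length ds"
  define u where "u = (\<lambda>i. T (unit_vec ?k i))"
  have Tl: "T a = lincomb_vec n ?k u (($) a)" if a: "a \<in> carrier_vec ?k" for a
  proof -
    have "T a = T (lincomb_vec ?k ?k (unit_vec ?k) (($) a))" using a by (simp add: lincomb_unit_vec)
    also have "\<dots> = lincomb_vec n ?k u (($) a)"
      unfolding u_def by (rule linear_lincomb[OF T_carrier T_add T_smult]) simp
    finally show ?thesis .
  qed
  have Tv: "lincomb_vec n ?k u c = T (vec ?k c)" for c
    using Tl[of "vec ?k c"] lincomb_vec_cong[of ?k c "($) (vec ?k c)" u u n] by simp
  have "indep_family n ?k u"
    unfolding indep_family_def
  proof (intro conjI allI impI)
    show "u j \<in> carrier_vec n" for j unfolding u_def by (rule Tc) simp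
    fix c j assume c: "lincomb_vec n ?k u c = 0\<^sub>v n" and j: "j < ?k"
    have "T (0\<^sub>v ?k) = 0\<^sub>v n" using Tl[of "0\<^sub>v ?k"] by (simp add: lincomb_vec_def) (auto simp: lincomb_vec_def)
    hence "T (vec ?k c) = T (0\<^sub>v ?k)" using c Tv by simp
    hence "vec ?k c = 0\<^sub>v ?k" using T_bij by (auto simp: bij_betw_def dest: inj_onD)
    hence "vec ?k c $ j = 0" using j by simp
    thus "c j = 0" using j by simp
  qed
  hence "vec_dim n (range (lincomb_vec n ?k u)) = ?k" by (rule vec_dim_eq)
  moreover have "range (lincomb_vec n ?k u) = carrier_vec n"
  proof
    show "carrier_vec n \<subseteq> range (lincomb_vec n ?k u)"
      using TS S_carrier Tl by (metis rangeI subsetI)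
  qed auto
  moreover have "vec_dim n (carrier_vec n :: complex vec set) = n"
  proof -
    interpret V: vec_space "TYPE(complex)" n .
    have eq: "(module_vec TYPE(complex) n)\<lparr>carrier := carrier_vec n\<rparr> = module_vec TYPE(complex) n"
      by (simp add: module_vec_def)
    show ?thesis using V.dim_is_n by (simp only: eq)
  qed
  ultimately show ?thesis by simp
qed

text \<open>
  The isotropic subspace of half the dimension bounds both the number of positive and the number of negative entries from below.
\<close>
lemma signature_metabolic:
  assumes "metabolic (n, \<theta>)"
  shows "signature \<epsilon> (n, \<theta>) = 0"
proof -
  obtain W where W: "vec_subspace n W" "2 * vec_dim n W = n" "\<forall>a\<in>W. \<forall>b\<in>W. \<theta> a b = 0"
    using assms by auto
  have "scaled a = 0" if "a \<in> W" for a using W that by (simp add: scaled_def)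
  hence "vec_dim n W \<le> card (idx 1)" "vec_dim n W \<le> card (idx (- 1))"
    using vec_dim_isotropic_le[OF _ W(1)] by simp_all
  moreover have "card (idx 1) + card (idx (- 1)) \<le> n"
  proof -
    have "card (idx 1) + card (idx (- 1)) = card (idx 1 \<union> idx (- 1))"
      by (rule card_Un_disjoint[symmetric]) (auto simp: idx_def)
    also have "\<dots> \<le> card {..<length ds}" by (rule card_mono) (auto simp: idx_def)
    finally show ?thesis by (simp add: length_eq_dim)
  qed
  ultimately show ?thesis using W(2) by (simp add: signature_card)
qed

end

definition diag_signature :: "int \<Rightarrow> complex list \<Rightarrow> int" where
  "diag_signature \<epsilon> ds = int (length (filter (\<lambda>d. Re (sign_scale \<epsilon> * d) > 0) ds)) -
     int (length (filter (\<lambda>d. Re (sign_scale \<epsilon> * d) < 0) ds))"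

lemma diag_signature_append:
  "diag_signature \<epsilon> (xs @ ys) = diag_signature \<epsilon> xs + diag_signature \<epsilon> ys"
  by (simp add: diag_signature_def)

lemma complex_diagonalizationI:
  assumes eps: "\<epsilon> \<in> {1, -1}" and "hermitian_field.admissible cnj \<epsilon> ds"
    "isometric (hermitian_field.diag_form cnj ds) (n, \<theta>)"
  shows "\<exists>T. complex_diagonalization \<epsilon> n \<theta> ds T"
proof -
  interpret C: hermitian_field cnj \<epsilon> "sign_scale \<epsilon>" by (rule hermitian_field_cnj[OF eps])
  have H: "hermitian_form cnj \<epsilon> (n, \<theta>)"
    using C.hermitian_transport[OF assms(3) C.diag_form_hermitian[OF assms(2)]] .
  obtain T where T: "T \<in> carrier_vec (length ds) \<rightarrow> carrier_vec n"
    "\<forall>a\<in>carrier_vec (length ds). \<forall>b\<in>carrier_vec (length ds). T (a + b) = T a + T b"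
    "\<forall>r. \<forall>a\<in>carrier_vec (length ds). T (r \<cdot>\<^sub>v a) = r \<cdot>\<^sub>v T a"
    "bij_betw T (carrier_vec (length ds)) (carrier_vec n)"
    "\<forall>a\<in>carrier_vec (length ds). \<forall>b\<in>carrier_vec (length ds).
       \<theta> (T a) (T b) = (\<Sum>i<length ds. cnj (a $ i) * ds ! i * b $ i)"
    using assms(3) unfolding C.diag_form_def isometric_iff by blast
  show ?thesis by (rule exI, rule complex_diagonalization.intro[OF eps H assms(2) T])
qed

lemma signature_diag:
  assumes eps: "\<epsilon> \<in> {1, -1}" and "hermitian_field.admissible cnj \<epsilon> ds"
    "isometric (hermitian_field.diag_form cnj ds) x"
  shows "signature \<epsilon> x = diag_signature \<epsilon> ds"
proof -
  obtain n \<theta> where x: "x = (n, \<theta>)" by (metis surj_pair)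
  obtain T where "complex_diagonalization \<epsilon> n \<theta> ds T"
    using complex_diagonalizationI[OF eps assms(2)] assms(3) x by blast
  then interpret D: complex_diagonalization \<epsilon> n \<theta> ds T .
  have "card (D.idx 1) = length (filter (\<lambda>d. Re (sign_scale \<epsilon> * d) > 0) ds)"
    unfolding length_filter_conv_card D.idx_def D.entry_def by simp
  moreover have "card (D.idx (- 1)) = length (filter (\<lambda>d. Re (sign_scale \<epsilon> * d) < 0) ds)"
    unfolding length_filter_conv_card D.idx_def D.entry_def by simp
  ultimately show ?thesis unfolding x D.signature_card diag_signature_def by simp
qed

lemma signature_witt_rel:
  assumes eps: "\<epsilon> \<in> {1, -1}" and "(x, y) \<in> witt_rel cnj \<epsilon>"
  shows "signature \<epsilon> x = signature \<epsilon> y"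
proof -
  interpret C: hermitian_field cnj \<epsilon> "sign_scale \<epsilon>" by (rule hermitian_field_cnj[OF eps])
  from assms(2) show ?thesis
  proof induction
    case (isometric x y)
    obtain ds where ds: "C.admissible ds" "isometric (C.diag_form ds) x"
      by (rule C.diagonalization[OF isometric(1)])
    have "isometric (C.diag_form ds) y" by (rule isometric_trans[OF ds(2) isometric(3)])
    thus ?case using signature_diag[OF eps ds(1)] ds(2) by simp
  next
    case (metabolic x)
    obtain n \<theta> where x: "x = (n, \<theta>)" by (metis surj_pair)
    obtain ds where ds: "C.admissible ds" "isometric (C.diag_form ds) x"
      by (rule C.diagonalization[OF metabolic(1)])
    obtain T where "complex_diagonalization \<epsilon> n \<theta> ds T"
      using complex_diagonalizationI[OF eps ds(1)] ds(2) x by blast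
    then interpret D: complex_diagonalization \<epsilon> n \<theta> ds T .
    have "signature \<epsilon> x = 0" using D.signature_metabolic metabolic(2) x by simp
    moreover have "signature \<epsilon> zero_form = 0"
      unfolding C.zero_form_diag
      by (subst signature_diag[OF eps _ isometric_refl]) (simp_all add: diag_signature_def)
    ultimately show ?case by simp
  next
    case (sum x y x' y')
    have *: "signature \<epsilon> (form_sum u u') = signature \<epsilon> u + signature \<epsilon> u'"
      if u: "u \<in> herm_forms cnj \<epsilon>" "u' \<in> herm_forms cnj \<epsilon>" for u u'
    proof -
      obtain ds where ds: "C.admissible ds" "isometric (C.diag_form ds) u"
        by (rule C.diagonalization[OF u(1)])
      obtain ds' where ds': "C.admissible ds'" "isometric (C.diag_form ds') u'"
        by (rule C.diagonalization[OF u(2)])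
      have "isometric (C.diag_form (ds @ ds')) (form_sum u u')"
        using isometric_trans isometric_sym C.diag_form_append isometric_form_sum ds ds' by meson
      hence "signature \<epsilon> (form_sum u u') = diag_signature \<epsilon> (ds @ ds')"
        using ds(1) ds'(1) by (intro signature_diag[OF eps]) simp_all
      thus ?thesis using signature_diag[OF eps ds] signature_diag[OF eps ds']
        by (simp add: diag_signature_append)
    qed
    show ?case using sum C.witt_rel_herm_forms by (simp add: *)
  qed auto
qed

lemma witt_signature_class:
  assumes eps: "\<epsilon> \<in> {1, -1}" and ds: "hermitian_field.admissible cnj \<epsilon> ds"
  shows "witt_signature \<epsilon> (hermitian_field.diag_class cnj \<epsilon> ds) = diag_signature \<epsilon> ds"
proof -
  interpret C: hermitian_field cnj \<epsilon> "sign_scale \<epsilon>" by (rule hermitian_field_cnj[OF eps])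
  have sd: "signature \<epsilon> (C.diag_form ds) = diag_signature \<epsilon> ds"
    by (rule signature_diag[OF eps ds isometric_refl])
  have "C.diag_form ds \<in> C.diag_class ds"
    unfolding C.diag_class_def by (rule C.witt_class_self[OF C.diag_form_herm_forms[OF ds]])
  moreover have "signature \<epsilon> x = diag_signature \<epsilon> ds" if "x \<in> C.diag_class ds" for x
    using signature_witt_rel[OF eps C.witt_class_memD] that sd unfolding C.diag_class_def by metis
  ultimately show ?thesis unfolding witt_signature_def by (intro the_equality) auto
qed

section \<open>Tensor products with the rationals\<close>

lemma comm_group_rat_group: "comm_group rat_group"
  by (rule comm_groupI) (auto simp: rat_group_def intro: exI[of _ "- _"])

lemma rat_group_simps [simp]:
  "carrier rat_group = UNIV" "x \<otimes>\<^bsub>rat_group\<^esub> y = x + y" "\<one>\<^bsub>rat_group\<^esub> = 0"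
  by (simp_all add: rat_group_def)

lemma rat_group_inv [simp]: "inv\<^bsub>rat_group\<^esub> x = - x"
proof -
  interpret comm_group rat_group by (rule comm_group_rat_group)
  show ?thesis by (rule inv_equality) auto
qed

lemma rat_group_pow: "x [^]\<^bsub>rat_group\<^esub> (n :: nat) = of_nat n * x"
proof -
  interpret comm_group rat_group by (rule comm_group_rat_group)
  show ?thesis by (induction n) (simp_all add: algebra_simps)
qed

lemma rat_group_int_pow: "x [^]\<^bsub>rat_group\<^esub> (i :: int) = of_int i * x"
proof -
  interpret comm_group rat_group by (rule comm_group_rat_group)
  show ?thesis by (simp add: int_pow_def2 rat_group_pow)
qed

lemma comm_group_tensor_product:
  assumes "group G" "group H"
  shows "comm_group (tensor_product G H)"
  unfolding tensor_product_def
  by (intro comm_group.abelian_FactGroup abelian_free_Abelian_group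
      normal_imp_subgroup tensor_kernel_normal assms)

lemma tensor_lift_hom:
  assumes "group G" "group H" "comm_group K"
    and "\<And>a b. a \<in> carrier G \<Longrightarrow> b \<in> carrier H \<Longrightarrow> B a b \<in> carrier K"
    and "\<And>a a' b. a \<in> carrier G \<Longrightarrow> a' \<in> carrier G \<Longrightarrow> b \<in> carrier H \<Longrightarrow>
      B (a \<otimes>\<^bsub>G\<^esub> a') b = B a b \<otimes>\<^bsub>K\<^esub> B a' b"
    and "\<And>a b b'. a \<in> carrier G \<Longrightarrow> b \<in> carrier H \<Longrightarrow> b' \<in> carrier H \<Longrightarrow>
      B a (b \<otimes>\<^bsub>H\<^esub> b') = B a b \<otimes>\<^bsub>K\<^esub> B a b'"
  shows "tensor_lift G H K B \<in> hom (tensor_product G H) K"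
    and "a \<in> carrier G \<Longrightarrow> b \<in> carrier H \<Longrightarrow> tensor_lift G H K B (pure_tensor G H a b) = B a b"
  using theI'[OF tensor_lift_ex1[of G H K B, OF assms]] unfolding tensor_lift_def by blast+

lemma pure_tensor_carrier:
  assumes "a \<in> carrier G" "b \<in> carrier H"
  shows "pure_tensor G H a b \<in> carrier (tensor_product G H)"
proof -
  have "frag_of (a, b) \<in> carrier (free_Abelian_group (carrier G \<times> carrier H))" using assms by simp
  thus ?thesis unfolding tensor_product_def pure_tensor_def carrier_FactGroup by blast
qed

lemma tensor_relation_zero:
  assumes "group G" "group H" and xyz: "frag_of x - frag_of y - frag_of z \<in> tensor_relations G H"
    "x \<in> carrier G \<times> carrier H" "y \<in> carrier G \<times> carrier H" "z \<in> carrier G \<times> carrier H"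
  shows "pure_tensor G H (fst x) (snd x) =
    pure_tensor G H (fst y) (snd y) \<otimes>\<^bsub>tensor_product G H\<^esub> pure_tensor G H (fst z) (snd z)"
proof -
  let ?A = "free_Abelian_group (carrier G \<times> carrier H)" and ?N = "tensor_kernel G H"
  interpret N: normal ?N ?A by (rule tensor_kernel_normal[OF assms(1,2)])
  interpret T: comm_group "tensor_product G H" by (rule comm_group_tensor_product[OF assms(1,2)])
  let ?c = "\<lambda>x. ?N #>\<^bsub>?A\<^esub> x"
  have hom: "?c \<in> hom ?A (tensor_product G H)"
    unfolding tensor_product_def by (rule N.r_coset_hom_Mod)
  interpret c: group_hom ?A "tensor_product G H" ?c
    using hom by (simp add: group_hom_def group_hom_axioms_def T.group_axioms)
  let ?r = "frag_of x - frag_of y - frag_of z"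
  have fr: "frag_of x \<in> carrier ?A" "frag_of y \<in> carrier ?A" "frag_of z \<in> carrier ?A" using xyz by simp_all
  have rN: "?r \<in> ?N" unfolding tensor_kernel_def by (rule generate.incl[OF xyz(1)])
  have rA: "?r \<in> carrier ?A" using rN N.subset by blast
  have "?c ?r = \<one>\<^bsub>tensor_product G H\<^esub>"
    using N.coset_join2[OF rA N.subgroup_axioms rN] by (simp add: tensor_product_def)
  moreover have "frag_of x = ?r \<otimes>\<^bsub>?A\<^esub> (frag_of y \<otimes>\<^bsub>?A\<^esub> frag_of z)" by simp
  hence "?c (frag_of x) = ?c ?r \<otimes>\<^bsub>tensor_product G H\<^esub> (?c (frag_of y) \<otimes>\<^bsub>tensor_product G H\<^esub> ?c (frag_of z))"
    using fr rA by (metis c.hom_mult N.m_closed)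
  ultimately have "?c (frag_of x) = ?c (frag_of y) \<otimes>\<^bsub>tensor_product G H\<^esub> ?c (frag_of z)"
    using c.hom_closed[OF fr(2)] c.hom_closed[OF fr(3)] by simp
  thus ?thesis by (simp add: pure_tensor_def)
qed

lemma pure_tensor_mult_left:
  assumes "group G" "group H" "a \<in> carrier G" "a' \<in> carrier G" "b \<in> carrier H"
  shows "pure_tensor G H (a \<otimes>\<^bsub>G\<^esub> a') b =
    pure_tensor G H a b \<otimes>\<^bsub>tensor_product G H\<^esub> pure_tensor G H a' b"
proof -
  interpret G: group G by fact
  have "frag_of (a \<otimes>\<^bsub>G\<^esub> a', b) - frag_of (a, b) - frag_of (a', b) \<in> tensor_relations G H"
    using assms unfolding tensor_relations_def by blast
  from tensor_relation_zero[OF assms(1,2) this] show ?thesis using assms by simp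
qed

lemma pure_tensor_mult_right:
  assumes "group G" "group H" "a \<in> carrier G" "b \<in> carrier H" "b' \<in> carrier H"
  shows "pure_tensor G H a (b \<otimes>\<^bsub>H\<^esub> b') =
    pure_tensor G H a b \<otimes>\<^bsub>tensor_product G H\<^esub> pure_tensor G H a b'"
proof -
  interpret H: group H by fact
  have "frag_of (a, b \<otimes>\<^bsub>H\<^esub> b') - frag_of (a, b) - frag_of (a, b') \<in> tensor_relations G H"
    using assms unfolding tensor_relations_def by blast
  from tensor_relation_zero[OF assms(1,2) this] show ?thesis using assms by simp
qed

lemma pure_tensor_hom_left:
  assumes "group G" "group H" "b \<in> carrier H"
  shows "(\<lambda>a. pure_tensor G H a b) \<in> hom G (tensor_product G H)"
  by (rule homI) (use assms in \<open>simp_all add: pure_tensor_carrier pure_tensor_mult_left\<close>)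

lemma pure_tensor_hom_right:
  assumes "group G" "group H" "a \<in> carrier G"
  shows "(\<lambda>b. pure_tensor G H a b) \<in> hom H (tensor_product G H)"
  by (rule homI) (use assms in \<open>simp_all add: pure_tensor_carrier pure_tensor_mult_right\<close>)

lemma tensor_map_hom:
  assumes "group G" "group G'" "group H" and \<phi>: "\<phi> \<in> hom G G'"
  defines "\<Phi> \<equiv> tensor_lift G H (tensor_product G' H) (\<lambda>a b. pure_tensor G' H (\<phi> a) b)"
  shows "\<Phi> \<in> hom (tensor_product G H) (tensor_product G' H)"
    and "a \<in> carrier G \<Longrightarrow> b \<in> carrier H \<Longrightarrow> \<Phi> (pure_tensor G H a b) = pure_tensor G' H (\<phi> a) b"
proof -
  have c: "\<phi> a \<in> carrier G'" if "a \<in> carrier G" for a using \<phi> that by (rule hom_in_carrier)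
  show "\<Phi> \<in> hom (tensor_product G H) (tensor_product G' H)"
    unfolding \<Phi>_def
    by (rule tensor_lift_hom(1)) (use assms c in \<open>auto simp: hom_mult comm_group_tensor_product
       pure_tensor_carrier pure_tensor_mult_left pure_tensor_mult_right\<close>)
  show "a \<in> carrier G \<Longrightarrow> b \<in> carrier H \<Longrightarrow> \<Phi> (pure_tensor G H a b) = pure_tensor G' H (\<phi> a) b"
    unfolding \<Phi>_def
    by (rule tensor_lift_hom(2)) (use assms c in \<open>auto simp: hom_mult comm_group_tensor_product
       pure_tensor_carrier pure_tensor_mult_left pure_tensor_mult_right\<close>)
qed

lemma pure_tensor_int_pow:
  assumes "group G" "a \<in> carrier G"
  shows "pure_tensor G rat_group (a [^]\<^bsub>G\<^esub> (i :: int)) q = pure_tensor G rat_group a (of_int i * q)"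
proof -
  interpret G: group G by fact
  interpret R: comm_group rat_group by (rule comm_group_rat_group)
  interpret T: comm_group "tensor_product G rat_group"
    by (rule comm_group_tensor_product[OF G.group_axioms R.group_axioms])
  interpret l: group_hom G "tensor_product G rat_group" "\<lambda>a. pure_tensor G rat_group a q"
    using pure_tensor_hom_left[OF G.group_axioms R.group_axioms, of "q"]
    by (simp add: group_hom_def group_hom_axioms_def G.group_axioms T.group_axioms)
  interpret r: group_hom rat_group "tensor_product G rat_group" "\<lambda>q. pure_tensor G rat_group a q"
    using pure_tensor_hom_right[OF G.group_axioms R.group_axioms assms(2)]
    by (simp add: group_hom_def group_hom_axioms_def R.group_axioms T.group_axioms)
  have "pure_tensor G rat_group (a [^]\<^bsub>G\<^esub> i) q = pure_tensor G rat_group a q [^]\<^bsub>tensor_product G rat_group\<^esub> i"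
    using l.hom_int_pow[OF assms(2)] by simp
  also have "\<dots> = pure_tensor G rat_group a (of_int i * q)"
    using r.hom_int_pow[of q i] by (simp add: rat_group_int_pow)
  finally show ?thesis .
qed

text \<open>
  Two pure tensors are added after their rational factors have been brought to a common denominator.
\<close>
lemma tensor_rat_pure:
  assumes "comm_group G" "U \<in> carrier (tensor_product G rat_group)"
  obtains a q where "a \<in> carrier G" "U = pure_tensor G rat_group a q"
proof -
  interpret G: comm_group G by fact
  interpret R: comm_group rat_group by (rule comm_group_rat_group)
  let ?A = "free_Abelian_group (carrier G \<times> carrier rat_group)" and ?N = "tensor_kernel G rat_group"
  let ?T = "tensor_product G rat_group"
  interpret N: normal ?N ?A by (rule tensor_kernel_normal[OF G.group_axioms R.group_axioms])
  interpret T: comm_group ?T by (rule comm_group_tensor_product[OF G.group_axioms R.group_axioms])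
  let ?c = "\<lambda>x. ?N #>\<^bsub>?A\<^esub> x"
  have hom: "?c \<in> hom ?A ?T"
    unfolding tensor_product_def by (rule N.r_coset_hom_Mod)
  interpret c: group_hom ?A ?T ?c
    using hom by (simp add: group_hom_def group_hom_axioms_def T.group_axioms)
  have add: "\<exists>c\<in>carrier G. \<exists>s. pure_tensor G rat_group a q \<otimes>\<^bsub>?T\<^esub> pure_tensor G rat_group b r =
      pure_tensor G rat_group c s" if ab: "a \<in> carrier G" "b \<in> carrier G" for a b q r
  proof -
    obtain i m where q: "q = of_int i / of_int m" "m > 0"
      by (metis quotient_of_denom_pos quotient_of_div surj_pair)
    obtain j l where r: "r = of_int j / of_int l" "l > 0"
      by (metis quotient_of_denom_pos quotient_of_div surj_pair)
    let ?t = "1 / of_int (m * l)"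
    have "q = of_int (i * l) * ?t" "r = of_int (j * m) * ?t" using q r by (simp_all add: field_simps)
    hence "pure_tensor G rat_group a q \<otimes>\<^bsub>?T\<^esub> pure_tensor G rat_group b r =
        pure_tensor G rat_group (a [^]\<^bsub>G\<^esub> (i * l)) ?t \<otimes>\<^bsub>?T\<^esub> pure_tensor G rat_group (b [^]\<^bsub>G\<^esub> (j * m)) ?t"
      using ab by (simp only: pure_tensor_int_pow[OF G.group_axioms])
    also have "\<dots> = pure_tensor G rat_group (a [^]\<^bsub>G\<^esub> (i * l) \<otimes>\<^bsub>G\<^esub> b [^]\<^bsub>G\<^esub> (j * m)) ?t"
      using ab by (intro pure_tensor_mult_left[symmetric] G.group_axioms R.group_axioms) auto
    finally show ?thesis
      by (intro bexI[of _ "a [^]\<^bsub>G\<^esub> (i * l) \<otimes>\<^bsub>G\<^esub> b [^]\<^bsub>G\<^esub> (j * m)"] exI[of _ ?t]) (simp_all only: ab G.m_closed G.int_pow_closed)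
  qed
  have inv: "inv\<^bsub>?T\<^esub> pure_tensor G rat_group b r = pure_tensor G rat_group b (- r)"
    if b: "b \<in> carrier G" for b r
  proof -
    interpret r: group_hom rat_group ?T "\<lambda>q. pure_tensor G rat_group b q"
      using pure_tensor_hom_right[OF G.group_axioms R.group_axioms b]
      by (simp add: group_hom_def group_hom_axioms_def R.group_axioms T.group_axioms)
    show ?thesis using r.hom_inv[of r] by simp
  qed
  obtain x where x: "x \<in> carrier ?A" "U = ?c x"
    using assms(2) unfolding tensor_product_def carrier_FactGroup by blast
  have "\<exists>a\<in>carrier G. \<exists>q. ?c x = pure_tensor G rat_group a q"
  proof (rule free_Abelian_group_induct[of x "carrier G \<times> carrier rat_group"])
    show "Poly_Mapping.keys x \<subseteq> carrier G \<times> carrier rat_group" using x(1) by simp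
    have c1: "pure_tensor G rat_group \<one>\<^bsub>G\<^esub> 0 \<in> carrier ?T" by (rule pure_tensor_carrier) simp_all
    have "?c 0 = \<one>\<^bsub>?T\<^esub>" using c.hom_one by (simp only: one_free_Abelian_group)
    also have "\<dots> = pure_tensor G rat_group \<one>\<^bsub>G\<^esub> 0 \<otimes>\<^bsub>?T\<^esub> inv\<^bsub>?T\<^esub> pure_tensor G rat_group \<one>\<^bsub>G\<^esub> 0"
      by (rule T.r_inv[OF c1, symmetric])
    finally show "\<exists>a\<in>carrier G. \<exists>q. ?c 0 = pure_tensor G rat_group a q"
      unfolding inv[OF G.one_closed] using add[OF G.one_closed G.one_closed, of 0 "- 0"] by (simp only:)
  next
    fix x y assume xy: "Poly_Mapping.keys x \<subseteq> carrier G \<times> carrier rat_group"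
        "Poly_Mapping.keys y \<subseteq> carrier G \<times> carrier rat_group"
      and IH: "\<exists>a\<in>carrier G. \<exists>q. ?c x = pure_tensor G rat_group a q"
        "\<exists>a\<in>carrier G. \<exists>q. ?c y = pure_tensor G rat_group a q"
    have xy': "x \<in> carrier ?A" "y \<in> carrier ?A" using xy by auto
    obtain a q b r where ab: "a \<in> carrier G" "?c x = pure_tensor G rat_group a q"
      "b \<in> carrier G" "?c y = pure_tensor G rat_group b r" using IH by blast
    have "x - y = x \<otimes>\<^bsub>?A\<^esub> inv\<^bsub>?A\<^esub> y" using xy by simp
    hence "?c (x - y) = ?c (x \<otimes>\<^bsub>?A\<^esub> inv\<^bsub>?A\<^esub> y)" by (rule arg_cong)
    also have "\<dots> = ?c x \<otimes>\<^bsub>?T\<^esub> ?c (inv\<^bsub>?A\<^esub> y)"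
      by (rule c.hom_mult[OF xy'(1) N.inv_closed[OF xy'(2)]])
    also have "?c (inv\<^bsub>?A\<^esub> y) = inv\<^bsub>?T\<^esub> ?c y" by (rule c.hom_inv[OF xy'(2)])
    finally show "\<exists>a\<in>carrier G. \<exists>q. ?c (x - y) = pure_tensor G rat_group a q"
      unfolding ab(2) ab(4) inv[OF ab(3)] using add[OF ab(1,3), of q "- r"] by (simp only:)
  next
    fix p assume "p \<in> carrier G \<times> carrier rat_group"
    thus "\<exists>a\<in>carrier G. \<exists>q. ?c (frag_of p) = pure_tensor G rat_group a q"
      by (cases p) (auto simp: pure_tensor_def)
  qed
  thus ?thesis using that x(2) by blast
qed

text \<open>
  The rational factor is divisible by \<open>n\<close>.
\<close>
lemma pure_tensor_torsion:
  assumes "group G" "a \<in> carrier G" "n > 0" "a [^]\<^bsub>G\<^esub> (n :: nat) = \<one>\<^bsub>G\<^esub>"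
  shows "pure_tensor G rat_group a q = \<one>\<^bsub>tensor_product G rat_group\<^esub>"
proof -
  interpret G: group G by fact
  interpret R: comm_group rat_group by (rule comm_group_rat_group)
  interpret T: comm_group "tensor_product G rat_group"
    by (rule comm_group_tensor_product[OF G.group_axioms R.group_axioms])
  interpret l: group_hom G "tensor_product G rat_group" "\<lambda>a. pure_tensor G rat_group a (q / of_nat n)"
    using pure_tensor_hom_left[OF G.group_axioms R.group_axioms, of "q / of_nat n"]
    by (simp add: group_hom_def group_hom_axioms_def G.group_axioms T.group_axioms)
  have "a [^]\<^bsub>G\<^esub> int n = \<one>\<^bsub>G\<^esub>" using assms(4) by (simp add: int_pow_int)
  hence "pure_tensor G rat_group \<one>\<^bsub>G\<^esub> (q / of_nat n) = pure_tensor G rat_group a (of_int (int n) * (q / of_nat n))"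
    using pure_tensor_int_pow[OF assms(1,2), of "int n" "q / of_nat n"] by simp
  also have "of_int (int n) * (q / of_nat n) = q" using assms(3) by simp
  finally show ?thesis using l.hom_one by simp
qed

section \<open>The signature on rational Witt groups\<close>

lemma hom_witt_signature:
  assumes eps: "\<epsilon> \<in> {1, -1}" "A \<in> carrier (witt_group cnj \<epsilon>)" "B \<in> carrier (witt_group cnj \<epsilon>)"
  shows "witt_signature \<epsilon> (A \<otimes>\<^bsub>witt_group cnj \<epsilon>\<^esub> B) = witt_signature \<epsilon> A + witt_signature \<epsilon> B"
proof -
  interpret C: hermitian_field cnj \<epsilon> "sign_scale \<epsilon>" by (rule hermitian_field_cnj[OF eps(1)])
  obtain as where as: "C.admissible as" "A = C.diag_class as" using eps(2) by (rule C.witt_group_diag_cases)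
  obtain bs where bs: "C.admissible bs" "B = C.diag_class bs" using eps(3) by (rule C.witt_group_diag_cases)
  show ?thesis using as bs
    by (simp add: C.diag_class_append witt_signature_class[OF eps(1)] diag_signature_append)
qed

lemma rat_signature_hom:
  assumes eps: "\<epsilon> \<in> {1, -1}"
  shows "rat_signature \<epsilon> \<in> hom (rat_witt_group cnj \<epsilon>) rat_group"
    and "A \<in> carrier (witt_group cnj \<epsilon>) \<Longrightarrow>
      rat_signature \<epsilon> (pure_tensor (witt_group cnj \<epsilon>) rat_group A q) = of_int (witt_signature \<epsilon> A) * q"
proof -
  interpret C: hermitian_field cnj \<epsilon> "sign_scale \<epsilon>" by (rule hermitian_field_cnj[OF eps])
  interpret W: comm_group "witt_group cnj \<epsilon>" by (rule C.comm_group_witt)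
  interpret R: comm_group rat_group by (rule comm_group_rat_group)
  show "rat_signature \<epsilon> \<in> hom (rat_witt_group cnj \<epsilon>) rat_group"
    unfolding rat_signature_def rat_witt_group_def
    by (rule tensor_lift_hom(1)[OF W.group_axioms R.group_axioms comm_group_rat_group])
      (simp_all add: hom_witt_signature[OF eps] algebra_simps)
  show "A \<in> carrier (witt_group cnj \<epsilon>) \<Longrightarrow>
      rat_signature \<epsilon> (pure_tensor (witt_group cnj \<epsilon>) rat_group A q) = of_int (witt_signature \<epsilon> A) * q"
    unfolding rat_signature_def
    by (rule tensor_lift_hom(2)[OF W.group_axioms R.group_axioms comm_group_rat_group])
      (simp_all add: hom_witt_signature[OF eps] algebra_simps)
qed

lemma (in hermitian_extension) rat_witt_ext_hom:
  "rat_witt_ext J J' h \<epsilon> \<in> hom (rat_witt_group J \<epsilon>) (rat_witt_group J' \<epsilon>)"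
  "A \<in> carrier (witt_group J \<epsilon>) \<Longrightarrow> rat_witt_ext J J' h \<epsilon> (pure_tensor (witt_group J \<epsilon>) rat_group A q) =
     pure_tensor (witt_group J' \<epsilon>) rat_group (witt_ext h J' \<epsilon> A) q"
proof -
  interpret W: comm_group "witt_group J \<epsilon>" by (rule K.comm_group_witt)
  interpret W': comm_group "witt_group J' \<epsilon>" by (rule L.comm_group_witt)
  interpret R: comm_group rat_group by (rule comm_group_rat_group)
  note m = tensor_map_hom[OF W.group_axioms W'.group_axioms R.group_axioms witt_ext_hom]
  show "rat_witt_ext J J' h \<epsilon> \<in> hom (rat_witt_group J \<epsilon>) (rat_witt_group J' \<epsilon>)"
    using m(1) by (simp add: rat_witt_ext_def rat_witt_group_def)
  show "A \<in> carrier (witt_group J \<epsilon>) \<Longrightarrow> rat_witt_ext J J' h \<epsilon> (pure_tensor (witt_group J \<epsilon>) rat_group A q) =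
     pure_tensor (witt_group J' \<epsilon>) rat_group (witt_ext h J' \<epsilon> A) q"
    using m(2)[of A q] by (simp add: rat_witt_ext_def rat_witt_group_def)
qed

section \<open>Orderings\<close>

locale preordered_subfield =
  fixes K0 T :: "'k::field set"
  assumes K0_1: "1 \<in> K0"
    and K0_add: "\<And>x y. x \<in> K0 \<Longrightarrow> y \<in> K0 \<Longrightarrow> x + y \<in> K0"
    and K0_mult: "\<And>x y. x \<in> K0 \<Longrightarrow> y \<in> K0 \<Longrightarrow> x * y \<in> K0"
    and K0_uminus: "\<And>x. x \<in> K0 \<Longrightarrow> - x \<in> K0"
    and K0_inverse: "\<And>x. x \<in> K0 \<Longrightarrow> inverse x \<in> K0"
    and T_sub: "T \<subseteq> K0"
    and T_add: "\<And>x y. x \<in> T \<Longrightarrow> y \<in> T \<Longrightarrow> x + y \<in> T"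
    and T_mult: "\<And>x y. x \<in> T \<Longrightarrow> y \<in> T \<Longrightarrow> x * y \<in> T"
    and T_square: "\<And>x. x \<in> K0 \<Longrightarrow> x * x \<in> T"
    and T_neg1: "-1 \<notin> T"

locale ordered_subfield = preordered_subfield K0 T for K0 T :: "'k::field set" +
  assumes T_total: "\<And>x. x \<in> K0 \<Longrightarrow> x \<in> T \<or> - x \<in> T"

context preordered_subfield
begin

lemma K0_0: "0 \<in> K0" using K0_add[OF K0_1 K0_uminus[OF K0_1]] by simp

lemma T_0: "0 \<in> T" using T_square[OF K0_0] by simp

lemma T_1: "1 \<in> T" using T_square[OF K0_1] by simp

lemma T_inverse: assumes "x \<in> T" shows "inverse x \<in> T"
proof (cases "x = 0")
  case False
  have "x * (inverse x * inverse x) \<in> T"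
    using assms T_sub by (intro T_mult T_square K0_inverse) auto
  thus ?thesis using False by (simp flip: mult.assoc)
qed (use assms in simp)

lemma T_antisym: assumes "x \<in> T" "- x \<in> T" shows "x = 0"
proof (rule ccontr)
  assume "x \<noteq> 0"
  moreover have "- x * inverse x \<in> T" using assms by (intro T_mult T_inverse)
  ultimately show False using T_neg1 by simp
qed

text \<open>
  If \<open>x\<close> is not in \<open>T\<close>, then \<open>T - x T\<close> is a preordering that contains \<open>- x\<close>.
\<close>
lemma adjoin_uminus:
  assumes x: "x \<in> K0" "x \<notin> T"
  shows "preordered_subfield K0 {a - x * b | a b. a \<in> T \<and> b \<in> T}" (is "preordered_subfield K0 ?T")
proof
  fix y z assume "y \<in> ?T" "z \<in> ?T"
  then obtain a b c d where *: "y = a - x * b" "z = c - x * d" "a \<in> T" "b \<in> T" "c \<in> T" "d \<in> T"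
    by blast
  have "y + z = (a + c) - x * (b + d)" unfolding *(1,2) by (simp add: algebra_simps)
  thus "y + z \<in> ?T" using * T_add by blast
  have "y * z = (a * c + (x * x) * (b * d)) - x * (a * d + b * c)" unfolding *(1,2) by (simp add: algebra_simps)
  moreover have "a * c + (x * x) * (b * d) \<in> T" "a * d + b * c \<in> T"
    using * T_add T_mult T_square x(1) by auto
  ultimately show "y * z \<in> ?T" by blast
next
  show "-1 \<notin> ?T"
  proof
    assume "-1 \<in> ?T"
    then obtain a b where *: "-1 = a - x * b" "a \<in> T" "b \<in> T" by blast
    have "b \<noteq> 0" using * T_neg1 by auto
    hence "x = (1 + a) * inverse b" using *(1) by (simp add: field_simps)
    thus False using x(2) * T_add T_mult T_inverse T_1 by auto
  qed
next
  fix y assume "y \<in> K0"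
  hence "y * y = y * y - x * 0" "y * y \<in> T" using T_square by auto
  thus "y * y \<in> ?T" using T_0 by blast
next
  show "?T \<subseteq> K0"
  proof
    fix y assume "y \<in> ?T"
    then obtain a b where *: "y = a - x * b" "a \<in> T" "b \<in> T" by blast
    have "y = a + - (x * b)" using * by simp
    moreover have "a \<in> K0" "b \<in> K0" using * T_sub by auto
    ultimately show "y \<in> K0" by (simp only: x(1) K0_add K0_uminus K0_mult)
  qed
qed (auto intro: K0_1 K0_add K0_mult K0_uminus K0_inverse)

lemma extends_to_ordering: "\<exists>T'. T \<subseteq> T' \<and> ordered_subfield K0 T'"
proof -
  let ?A = "{T'. T \<subseteq> T' \<and> preordered_subfield K0 T'}"
  have "T \<in> ?A" using preordered_subfield_axioms by simp
  have "\<exists>M\<in>?A. \<forall>U\<in>?A. M \<subseteq> U \<longrightarrow> U = M"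
  proof (rule subset_Zorn_nonempty)
    show "?A \<noteq> {}" using \<open>T \<in> ?A\<close> by blast
    fix C assume C: "C \<noteq> {}" "subset.chain ?A C"
    have CA: "\<And>U. U \<in> C \<Longrightarrow> U \<in> ?A" and chain: "\<And>U Y. U \<in> C \<Longrightarrow> Y \<in> C \<Longrightarrow> U \<subseteq> Y \<or> Y \<subseteq> U"
      using C(2) unfolding subset_chain_def by blast+
    have two: "\<exists>Z\<in>C. x \<in> Z \<and> y \<in> Z" if "x \<in> \<Union>C" "y \<in> \<Union>C" for x y
      using that chain by blast
    have P: "preordered_subfield K0 U" if "U \<in> C" for U using CA[OF that] by simp
    have "preordered_subfield K0 (\<Union>C)"
    proof
      fix x y assume "x \<in> \<Union>C" "y \<in> \<Union>C"
      then obtain Z where Z: "Z \<in> C" "x \<in> Z" "y \<in> Z" using two by blast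
      show "x + y \<in> \<Union>C" "x * y \<in> \<Union>C"
        using Z preordered_subfield.T_add[OF P[OF Z(1)]] preordered_subfield.T_mult[OF P[OF Z(1)]] by blast+
    next
      show "-1 \<notin> \<Union>C" using P preordered_subfield.T_neg1 by blast
      show "\<Union>C \<subseteq> K0" using P preordered_subfield.T_sub by blast
      show "x * x \<in> \<Union>C" if "x \<in> K0" for x
        using P preordered_subfield.T_square that C(1) by blast
    qed (auto intro: K0_1 K0_add K0_mult K0_uminus K0_inverse)
    moreover have "T \<subseteq> \<Union>C" using C(1) CA by blast
    ultimately show "\<Union>C \<in> ?A" by simp
  qed
  then obtain M where MA: "M \<in> ?A" and max': "\<forall>U\<in>?A. M \<subseteq> U \<longrightarrow> U = M" by (rule bexE)
  have M: "T \<subseteq> M" "preordered_subfield K0 M" using MA by auto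
  have max: "U = M" if "T \<subseteq> U" "preordered_subfield K0 U" "M \<subseteq> U" for U
    using max' that by auto
  interpret M: preordered_subfield K0 M by fact
  have "x \<in> M \<or> - x \<in> M" if x: "x \<in> K0" for x
  proof (cases "x \<in> M")
    case False
    let ?U = "{a - x * b | a b. a \<in> M \<and> b \<in> M}"
    have "M \<subseteq> ?U"
    proof
      fix a assume "a \<in> M"
      moreover have "a = a - x * 0" by simp
      ultimately show "a \<in> ?U" using M.T_0 by blast
    qed
    hence "?U = M" using max[of ?U] M.adjoin_uminus[OF x False] M(1) by blast
    moreover have "- x = 0 - x * 1" by simp
    hence "- x \<in> ?U" using M.T_0 M.T_1 by blast
    ultimately show ?thesis by simp
  qed simp
  hence "ordered_subfield K0 M"
    using M(2) by (simp add: ordered_subfield_def ordered_subfield_axioms_def)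
  thus ?thesis using M(1) by blast
qed

end

section \<open>Scaling of forms, and an ordering for every non-torsion class\<close>

fun scale_form :: "'k::field \<Rightarrow> 'k form \<Rightarrow> 'k form" where
  "scale_form c (n, \<theta>) = (n, \<lambda>a b. c * \<theta> a b)"

context hermitian_field
begin

definition scalars :: "'k set" where "scalars = {c. c \<noteq> 0 \<and> J c = c}"

lemma scale_isometric: "isometric x y \<Longrightarrow> isometric (scale_form c x) (scale_form c y)"
  by (cases x; cases y) (auto simp: isometric_iff simp del: isometric.simps)

lemma scale_diag_form: "isometric (scale_form c (diag_form ds)) (diag_form (map ((*) c) ds))"
  unfolding diag_form_def scale_form.simps length_map
  by (rule isometric_same_dim) (auto simp: sum_distrib_left ac_simps intro!: sum.cong)

lemma admissible_scale: "c \<in> scalars \<Longrightarrow> admissible ds \<Longrightarrow> admissible (map ((*) c) ds)"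
  by (auto simp: admissible_def scalars_def J.hom_mult ac_simps)

lemma scale_herm_forms:
  assumes "c \<in> scalars" "x \<in> herm_forms J \<epsilon>"
  shows "scale_form c x \<in> herm_forms J \<epsilon>"
proof -
  obtain ds where ds: "admissible ds" "isometric (diag_form ds) x" using assms(2) by (rule diagonalization)
  have "isometric (diag_form (map ((*) c) ds)) (scale_form c x)"
    using isometric_trans[OF isometric_sym[OF scale_diag_form] scale_isometric[OF ds(2)]] .
  thus ?thesis using herm_forms_transport diag_form_herm_forms admissible_scale assms(1) ds(1) by blast
qed

lemma scale_form_sum: "scale_form c (form_sum x y) = form_sum (scale_form c x) (scale_form c y)"
  by (cases x; cases y) (simp add: distrib_left)

lemma scale_witt_rel:
  assumes "c \<in> scalars" "(x, y) \<in> witt_rel J \<epsilon>"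
  shows "(scale_form c x, scale_form c y) \<in> witt_rel J \<epsilon>"
  using assms(2)
proof induction
  case (isometric x y)
  show ?case using isometric assms(1)
    by (intro witt_rel.isometric scale_herm_forms scale_isometric)
next
  case (metabolic x)
  have "metabolic (scale_form c x)" using metabolic(2) by (cases x) auto
  moreover have "scale_form c zero_form = zero_form" by (simp add: zero_form_def)
  ultimately show ?case using witt_rel.metabolic[OF scale_herm_forms[OF assms(1) metabolic(1)]] by simp
next
  case (sum x y x' y')
  thus ?case by (simp add: scale_form_sum witt_rel.sum)
qed (auto intro: witt_rel.sym witt_rel.trans)

definition scale_class :: "'k \<Rightarrow> 'k form set \<Rightarrow> 'k form set" where
  "scale_class c A = witt_rel J \<epsilon> `` (scale_form c ` A)"

lemma scale_sum_rel:
  assumes "c \<in> scalars" "x \<in> herm_forms J \<epsilon>" "y \<in> herm_forms J \<epsilon>"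
  shows "(scale_form c (form_sum x y), form_sum (scale_form c x) (scale_form c y)) \<in> witt_rel J \<epsilon>"
  unfolding scale_form_sum
  by (intro witt_rel.isometric isometric_refl form_sum_herm_forms scale_herm_forms assms)

lemma scale_class_hom:
  assumes "c \<in> scalars"
  shows "scale_class c \<in> hom (witt_group J \<epsilon>) (witt_group J \<epsilon>)"
proof -
  have "scale_class c = (\<lambda>A. witt_rel J \<epsilon> `` (scale_form c ` A))" by (simp add: fun_eq_iff scale_class_def)
  thus ?thesis
    using witt_induced_hom(1)[OF hermitian_field_axioms hermitian_field_axioms
        scale_witt_rel[OF assms] scale_sum_rel[OF assms]] by simp
qed

lemma scale_diag_class:
  assumes "c \<in> scalars" "admissible ds"
  shows "scale_class c (diag_class ds) = diag_class (map ((*) c) ds)"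
proof -
  have "scale_class c (diag_class ds) = witt_class (scale_form c (diag_form ds))"
    unfolding scale_class_def diag_class_def
    by (rule witt_induced_hom(2)[OF hermitian_field_axioms hermitian_field_axioms
        scale_witt_rel[OF assms(1)] scale_sum_rel[OF assms(1)] diag_form_herm_forms[OF assms(2)]])
  also have "\<dots> = diag_class (map ((*) c) ds)"
    unfolding diag_class_def
    by (intro witt_class_isometricI scale_diag_form scale_herm_forms diag_form_herm_forms assms)
  finally show ?thesis .
qed

sublocale W: comm_group "witt_group J \<epsilon>" by (rule comm_group_witt)

abbreviation W where "W \<equiv> witt_group J \<epsilon>"

lemma scale_closed [simp]: "c \<in> scalars \<Longrightarrow> A \<in> carrier W \<Longrightarrow> scale_class c A \<in> carrier W"
  by (rule hom_in_carrier[OF scale_class_hom])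

lemma scale_mult:
  "c \<in> scalars \<Longrightarrow> A \<in> carrier W \<Longrightarrow> B \<in> carrier W \<Longrightarrow>
     scale_class c (A \<otimes>\<^bsub>W\<^esub> B) = scale_class c A \<otimes>\<^bsub>W\<^esub> scale_class c B"
  by (rule hom_mult[OF scale_class_hom])

lemma scalars_mult: "c \<in> scalars \<Longrightarrow> d \<in> scalars \<Longrightarrow> c * d \<in> scalars"
  by (auto simp: scalars_def J.hom_mult)

lemma scale_scale:
  assumes "c \<in> scalars" "d \<in> scalars" "A \<in> carrier W"
  shows "scale_class c (scale_class d A) = scale_class (c * d) A"
proof -
  obtain ds where "admissible ds" "A = diag_class ds" using assms(3) by (rule witt_group_diag_cases)
  moreover have "map ((*) c) (map ((*) d) ds) = map ((*) (c * d)) ds" by (simp add: mult.assoc)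
  ultimately show ?thesis using assms
    by (simp only: scale_diag_class admissible_scale scalars_mult)
qed

lemma scale_norm:
  assumes "p \<noteq> 0" "A \<in> carrier W"
  shows "scale_class (p * J p) A = A"
proof -
  have p: "p * J p \<in> scalars" using assms(1) by (auto simp: scalars_def J.hom_mult mult.commute)
  obtain ds where ds: "admissible ds" "A = diag_class ds" using assms(2) by (rule witt_group_diag_cases)
  have "diag_class (map ((*) (p * J p)) ds) = diag_class ds" using ds(1)
  proof (induction ds)
    case (Cons d ds)
    have "diag_class ([p * J p * d] @ map ((*) (p * J p)) ds) = diag_class ([d] @ ds)"
    proof (rule diag_class_cong_append)
      show "diag_class [p * J p * d] = diag_class [d]"
        using Cons.prems by (intro diag_class_norm assms(1)) simp
    qed (use Cons admissible_scale[OF p] admissible_scale[OF p, of "[d]"] in auto)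
    thus ?case by simp
  qed simp
  thus ?thesis using scale_diag_class[OF p ds(1)] ds(2) by simp
qed

lemma scale_square:
  assumes "c \<in> scalars" "A \<in> carrier W"
  shows "scale_class (c * c) A = A"
  using scale_norm[of c A] assms by (auto simp: scalars_def)

lemma neg1_scalars: "-1 \<in> scalars" by (simp add: scalars_def J.hom_uminus)

lemma scale_neg1:
  assumes "A \<in> carrier W"
  shows "scale_class (- 1) A = inv\<^bsub>W\<^esub> A"
proof -
  obtain ds where ds: "admissible ds" "A = diag_class ds" using assms by (rule witt_group_diag_cases)
  have eq: "map ((*) (- 1)) ds = map uminus ds" by simp
  have "scale_class (- 1) A \<otimes>\<^bsub>W\<^esub> A = diag_class (map uminus ds @ ds)"
    using ds admissible_scale[OF neg1_scalars ds(1)]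
    by (simp only: scale_diag_class[OF neg1_scalars] diag_class_append eq)
  also have "\<dots> = \<one>\<^bsub>W\<^esub>" using ds by (simp add: diag_class_uminus witt_one)
  finally show ?thesis using assms neg1_scalars by (intro W.inv_equality[symmetric]) auto
qed

lemma scale_uminus:
  assumes "c \<in> scalars" "A \<in> carrier W"
  shows "scale_class (- c) A = inv\<^bsub>W\<^esub> (scale_class c A)"
  using scale_scale[OF neg1_scalars assms] scale_neg1[of "scale_class c A"] assms by simp

text \<open>
  This is the isometry of \<open>[c, d]\<close> with \<open>[c + d, c * d * (c + d)]\<close>, written for the action of scalars on classes.
\<close>
lemma scale_add:
  assumes "c \<in> scalars" "d \<in> scalars" "c + d \<noteq> 0" "A \<in> carrier W"
  shows "scale_class c A \<otimes>\<^bsub>W\<^esub> scale_class d A =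
    scale_class (c + d) (A \<otimes>\<^bsub>W\<^esub> scale_class (c * d) A)"
proof -
  let ?s = "c + d" and ?p = "c * d * (c + d)"
  have s1: "?s \<in> scalars" using assms by (simp add: scalars_def J.hom_add)
  have s2: "c * d \<in> scalars" by (rule scalars_mult[OF assms(1,2)])
  have s3: "?p \<in> scalars" by (rule scalars_mult[OF s2 s1])
  note s = s1 s2 s3
  have main: "diag_class (map ((*) c) ds) \<otimes>\<^bsub>W\<^esub> diag_class (map ((*) d) ds) =
      diag_class (map ((*) ?s) ds) \<otimes>\<^bsub>W\<^esub> diag_class (map ((*) ?p) ds)" if "admissible ds" for ds
    using that
  proof (induction ds)
    case (Cons b ds)
    have b: "admissible [b]" and ds: "admissible ds" using Cons.prems by auto
    have split: "diag_class (map ((*) r) (b # ds)) = diag_class [r * b] \<otimes>\<^bsub>W\<^esub> diag_class (map ((*) r) ds)"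
      and cl: "diag_class [r * b] \<in> carrier W" "diag_class (map ((*) r) ds) \<in> carrier W"
      if "r \<in> scalars" for r
      using admissible_scale[OF that b] admissible_scale[OF that ds]
      by (simp_all add: diag_class_append diag_class_carrier)
    have "diag_class [c * b] \<otimes>\<^bsub>W\<^esub> diag_class [d * b] = diag_class [c * b, d * b]"
      using admissible_scale[OF assms(1) b] admissible_scale[OF assms(2) b] by (simp add: diag_class_append)
    also have "\<dots> = diag_class [?s * b, ?p * b]"
      using assms b by (intro diag_class_sum2) (auto simp: scalars_def)
    also have "\<dots> = diag_class [?s * b] \<otimes>\<^bsub>W\<^esub> diag_class [?p * b]"
      using admissible_scale[OF s(1) b] admissible_scale[OF s(3) b] by (simp add: diag_class_append)
    finally have 1: "diag_class [c * b] \<otimes>\<^bsub>W\<^esub> diag_class [d * b] =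
        diag_class [?s * b] \<otimes>\<^bsub>W\<^esub> diag_class [?p * b]" .
    have ac: "(x \<otimes>\<^bsub>W\<^esub> y) \<otimes>\<^bsub>W\<^esub> (z \<otimes>\<^bsub>W\<^esub> w) = (x \<otimes>\<^bsub>W\<^esub> z) \<otimes>\<^bsub>W\<^esub> (y \<otimes>\<^bsub>W\<^esub> w)"
      if "x \<in> carrier W" "y \<in> carrier W" "z \<in> carrier W" "w \<in> carrier W" for x y z w
      using that by (simp add: W.m_ac)
    note c = cl[OF assms(1)] and d = cl[OF assms(2)] and s' = cl[OF s(1)] and p = cl[OF s(3)]
    show ?case
      unfolding split[OF assms(1)] split[OF assms(2)] split[OF s(1)] split[OF s(3)]
        ac[OF c d] ac[OF s' p] 1 Cons.IH[OF ds] ..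
  qed simp
  obtain ds where ds: "admissible ds" "A = diag_class ds" using assms(4) by (rule witt_group_diag_cases)
  have "scale_class ?s (A \<otimes>\<^bsub>W\<^esub> scale_class (c * d) A) = scale_class ?s A \<otimes>\<^bsub>W\<^esub> scale_class ?p A"
    using assms s by (simp add: scale_mult scale_scale mult.commute)
  thus ?thesis using main[OF ds(1)] assms s ds by (simp add: scale_diag_class)
qed

definition torsion :: "'k form set \<Rightarrow> bool" where
  "torsion A \<longleftrightarrow> A \<in> carrier W \<and> (\<exists>n::nat. n > 0 \<and> A [^]\<^bsub>W\<^esub> n = \<one>\<^bsub>W\<^esub>)"

lemma torsion_one: "torsion \<one>\<^bsub>W\<^esub>" by (auto simp: torsion_def intro: exI[of _ 1])

lemma torsion_mult: "torsion A \<Longrightarrow> torsion B \<Longrightarrow> torsion (A \<otimes>\<^bsub>W\<^esub> B)"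
proof -
  assume AB: "torsion A" "torsion B"
  obtain n :: nat where n: "A \<in> carrier W" "n > 0" "A [^]\<^bsub>W\<^esub> n = \<one>\<^bsub>W\<^esub>"
    using AB(1) by (auto simp: torsion_def)
  obtain m :: nat where m: "B \<in> carrier W" "m > 0" "B [^]\<^bsub>W\<^esub> m = \<one>\<^bsub>W\<^esub>"
    using AB(2) by (auto simp: torsion_def)
  note * = n m
  have "A [^]\<^bsub>W\<^esub> (n * m) = \<one>\<^bsub>W\<^esub>" using * by (simp flip: W.nat_pow_pow)
  moreover have "B [^]\<^bsub>W\<^esub> (m * n) = \<one>\<^bsub>W\<^esub>" using * by (simp flip: W.nat_pow_pow)
  ultimately have "(A \<otimes>\<^bsub>W\<^esub> B) [^]\<^bsub>W\<^esub> (n * m) = \<one>\<^bsub>W\<^esub>"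
    using * by (simp add: W.nat_pow_distrib mult.commute)
  thus "torsion (A \<otimes>\<^bsub>W\<^esub> B)" using * by (auto simp: torsion_def intro!: exI[of _ "n * m"])
qed

lemma torsion_inv: "torsion A \<Longrightarrow> torsion (inv\<^bsub>W\<^esub> A)"
  unfolding torsion_def by (elim conjE exE, intro conjI exI W.inv_closed, assumption+)
    (simp only: W.nat_pow_inv W.inv_one)

lemma torsion_square: "A \<in> carrier W \<Longrightarrow> torsion (A \<otimes>\<^bsub>W\<^esub> A) \<Longrightarrow> torsion A"
proof -
  assume A: "A \<in> carrier W" "torsion (A \<otimes>\<^bsub>W\<^esub> A)"
  then obtain n :: nat where n: "n > 0" "(A \<otimes>\<^bsub>W\<^esub> A) [^]\<^bsub>W\<^esub> n = \<one>\<^bsub>W\<^esub>" by (auto simp: torsion_def)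
  have "A [^]\<^bsub>W\<^esub> (n + n) = \<one>\<^bsub>W\<^esub>" using n A by (simp add: W.nat_pow_distrib W.nat_pow_mult)
  thus "torsion A" unfolding torsion_def using A(1) n(1) by (intro conjI exI[of _ "n + n"]) simp_all
qed

lemma torsion_scale:
  assumes "c \<in> scalars" "torsion A"
  shows "torsion (scale_class c A)"
proof -
  interpret s: group_hom W W "scale_class c"
    using scale_class_hom[OF assms(1)] by (simp add: group_hom_def group_hom_axioms_def W.group_axioms)
  obtain n :: nat where n: "A \<in> carrier W" "n > 0" "A [^]\<^bsub>W\<^esub> n = \<one>\<^bsub>W\<^esub>"
    using assms(2) by (auto simp: torsion_def)
  have "scale_class c A [^]\<^bsub>W\<^esub> n = scale_class c (A [^]\<^bsub>W\<^esub> n)" by (rule s.hom_nat_pow[OF n(1), symmetric])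
  also have "\<dots> = \<one>\<^bsub>W\<^esub>" unfolding n(3) by (rule s.hom_one)
  finally show ?thesis unfolding torsion_def using n s.hom_closed[OF n(1)] by (intro conjI exI[of _ n])
qed

definition tor_eq :: "'k form set \<Rightarrow> 'k form set \<Rightarrow> bool" where
  "tor_eq A B \<longleftrightarrow> A \<in> carrier W \<and> B \<in> carrier W \<and> torsion (A \<otimes>\<^bsub>W\<^esub> inv\<^bsub>W\<^esub> B)"

lemma tor_eq_refl: "A \<in> carrier W \<Longrightarrow> tor_eq A A"
  by (simp add: tor_eq_def torsion_one)

lemma tor_eq_sym: "tor_eq A B \<Longrightarrow> tor_eq B A"
proof -
  assume AB: "tor_eq A B"
  have "inv\<^bsub>W\<^esub> (A \<otimes>\<^bsub>W\<^esub> inv\<^bsub>W\<^esub> B) = B \<otimes>\<^bsub>W\<^esub> inv\<^bsub>W\<^esub> A"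
    using AB by (simp add: tor_eq_def W.inv_mult W.m_comm)
  moreover have "torsion (inv\<^bsub>W\<^esub> (A \<otimes>\<^bsub>W\<^esub> inv\<^bsub>W\<^esub> B))"
    using AB by (intro torsion_inv) (simp add: tor_eq_def)
  ultimately show "tor_eq B A" using AB by (simp add: tor_eq_def)
qed

lemma tor_eq_mult:
  assumes "tor_eq A B" "tor_eq C D"
  shows "tor_eq (A \<otimes>\<^bsub>W\<^esub> C) (B \<otimes>\<^bsub>W\<^esub> D)"
proof -
  have "(A \<otimes>\<^bsub>W\<^esub> C) \<otimes>\<^bsub>W\<^esub> inv\<^bsub>W\<^esub> (B \<otimes>\<^bsub>W\<^esub> D) = (A \<otimes>\<^bsub>W\<^esub> inv\<^bsub>W\<^esub> B) \<otimes>\<^bsub>W\<^esub> (C \<otimes>\<^bsub>W\<^esub> inv\<^bsub>W\<^esub> D)"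
    using assms by (simp add: tor_eq_def W.inv_mult W.m_ac)
  thus ?thesis using assms torsion_mult[of "A \<otimes>\<^bsub>W\<^esub> inv\<^bsub>W\<^esub> B" "C \<otimes>\<^bsub>W\<^esub> inv\<^bsub>W\<^esub> D"]
    by (simp add: tor_eq_def)
qed

lemma tor_eq_trans:
  assumes "tor_eq A B" "tor_eq B C"
  shows "tor_eq A C"
proof -
  have c: "A \<in> carrier W" "B \<in> carrier W" "C \<in> carrier W" using assms by (auto simp: tor_eq_def)
  have "(A \<otimes>\<^bsub>W\<^esub> inv\<^bsub>W\<^esub> B) \<otimes>\<^bsub>W\<^esub> (B \<otimes>\<^bsub>W\<^esub> inv\<^bsub>W\<^esub> C) = A \<otimes>\<^bsub>W\<^esub> ((inv\<^bsub>W\<^esub> B \<otimes>\<^bsub>W\<^esub> B) \<otimes>\<^bsub>W\<^esub> inv\<^bsub>W\<^esub> C)"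
    using c by (simp only: W.m_assoc W.m_closed W.inv_closed)
  hence "(A \<otimes>\<^bsub>W\<^esub> inv\<^bsub>W\<^esub> B) \<otimes>\<^bsub>W\<^esub> (B \<otimes>\<^bsub>W\<^esub> inv\<^bsub>W\<^esub> C) = A \<otimes>\<^bsub>W\<^esub> inv\<^bsub>W\<^esub> C"
    using c by simp
  thus ?thesis using assms torsion_mult[of "A \<otimes>\<^bsub>W\<^esub> inv\<^bsub>W\<^esub> B" "B \<otimes>\<^bsub>W\<^esub> inv\<^bsub>W\<^esub> C"]
    by (simp add: tor_eq_def)
qed

lemma tor_eq_scale:
  assumes "c \<in> scalars" "tor_eq A B"
  shows "tor_eq (scale_class c A) (scale_class c B)"
proof -
  interpret s: group_hom W W "scale_class c"
    using scale_class_hom[OF assms(1)] by (simp add: group_hom_def group_hom_axioms_def W.group_axioms)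
  show ?thesis using assms(2) torsion_scale[OF assms(1), of "A \<otimes>\<^bsub>W\<^esub> inv\<^bsub>W\<^esub> B"]
    by (simp add: tor_eq_def)
qed

lemma tor_eq_square:
  assumes "A \<in> carrier W" "B \<in> carrier W" "tor_eq (A \<otimes>\<^bsub>W\<^esub> A) (B \<otimes>\<^bsub>W\<^esub> B)"
  shows "tor_eq A B"
proof -
  have "(A \<otimes>\<^bsub>W\<^esub> A) \<otimes>\<^bsub>W\<^esub> inv\<^bsub>W\<^esub> (B \<otimes>\<^bsub>W\<^esub> B) = (A \<otimes>\<^bsub>W\<^esub> inv\<^bsub>W\<^esub> B) \<otimes>\<^bsub>W\<^esub> (A \<otimes>\<^bsub>W\<^esub> inv\<^bsub>W\<^esub> B)"
    using assms by (simp add: W.inv_mult W.m_ac)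
  thus ?thesis using assms torsion_square[of "A \<otimes>\<^bsub>W\<^esub> inv\<^bsub>W\<^esub> B"] by (simp add: tor_eq_def)
qed

lemma not_tor_eq_inv:
  assumes "A \<in> carrier W" "\<not> torsion A"
  shows "\<not> tor_eq (inv\<^bsub>W\<^esub> A) A"
proof
  assume "tor_eq (inv\<^bsub>W\<^esub> A) A"
  hence "torsion (inv\<^bsub>W\<^esub> (A \<otimes>\<^bsub>W\<^esub> A))" using assms by (simp add: tor_eq_def W.inv_mult)
  hence "torsion (A \<otimes>\<^bsub>W\<^esub> A)" using torsion_inv[of "inv\<^bsub>W\<^esub> (A \<otimes>\<^bsub>W\<^esub> A)"] assms by simp
  thus False using torsion_square assms by blast
qed

text \<open>
  The proof of closure under addition uses the formula for \<open>c + d\<close>: if \<open>c\<close> and \<open>d\<close> fix \<open>w\<close> up to torsion,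
  then twice \<open>w\<close> equals twice \<open>(c + d) w\<close>, and torsion absorbs the factor two. The element \<open>-1\<close> inverts \<open>w\<close>, so
  that it does not fix \<open>w\<close>.
\<close>
lemma stabilizer_preordering:
  assumes w: "w \<in> carrier W" "\<not> torsion w"
  defines "P \<equiv> {c \<in> scalars. tor_eq (scale_class c w) w}"
  shows "preordered_subfield {c. J c = c} (insert 0 P)"
proof
  have neg: "c \<notin> P" if "d \<in> P" "c = - d" for c d
  proof
    assume "c \<in> P"
    hence "tor_eq (scale_class (- d) w) w" using that by (simp add: P_def)
    hence "tor_eq (inv\<^bsub>W\<^esub> (scale_class d w)) w" using that w by (simp add: P_def scale_uminus)
    moreover have "tor_eq (inv\<^bsub>W\<^esub> (scale_class d w)) (inv\<^bsub>W\<^esub> w)"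
    proof -
      have "tor_eq (scale_class (- 1) (scale_class d w)) (scale_class (- 1) w)"
        using that by (intro tor_eq_scale neg1_scalars) (simp add: P_def)
      thus ?thesis using that w by (simp add: P_def scale_neg1)
    qed
    ultimately have "tor_eq (inv\<^bsub>W\<^esub> w) w" using tor_eq_trans tor_eq_sym by blast
    thus False using not_tor_eq_inv w by blast
  qed
  have mult: "c * d \<in> P" if cd: "c \<in> P" "d \<in> P" for c d
  proof -
    have "tor_eq (scale_class c (scale_class d w)) (scale_class c w)"
      using cd by (intro tor_eq_scale) (auto simp: P_def)
    thus ?thesis using cd w tor_eq_trans scalars_mult by (auto simp: P_def scale_scale)
  qed
  have norm: "p * J p \<in> P" if "p \<noteq> 0" for p
    using that w by (auto simp: P_def scale_norm tor_eq_refl scalars_def J.hom_mult mult.commute)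
  have add: "c + d \<in> P" if cd: "c \<in> P" "d \<in> P" for c d
  proof -
    have nz: "c + d \<noteq> 0" using neg[OF cd(2), of c] cd(1) by (auto simp: eq_neg_iff_add_eq_0)
    have s: "c \<in> scalars" "d \<in> scalars" "c + d \<in> scalars" "c * d \<in> scalars"
      using cd nz mult[OF cd] by (auto simp: P_def scalars_def J.hom_add)
    let ?u = "scale_class (c + d) w"
    have "tor_eq (w \<otimes>\<^bsub>W\<^esub> scale_class (c * d) w) (w \<otimes>\<^bsub>W\<^esub> w)"
      using mult[OF cd] w by (intro tor_eq_mult tor_eq_refl) (auto simp: P_def)
    hence "tor_eq (scale_class (c + d) (w \<otimes>\<^bsub>W\<^esub> scale_class (c * d) w)) (scale_class (c + d) (w \<otimes>\<^bsub>W\<^esub> w))"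
      by (rule tor_eq_scale[OF s(3)])
    hence "tor_eq (scale_class c w \<otimes>\<^bsub>W\<^esub> scale_class d w) (?u \<otimes>\<^bsub>W\<^esub> ?u)"
      using s w nz by (simp add: scale_add scale_mult)
    moreover have "tor_eq (scale_class c w \<otimes>\<^bsub>W\<^esub> scale_class d w) (w \<otimes>\<^bsub>W\<^esub> w)"
      using cd by (intro tor_eq_mult) (auto simp: P_def)
    ultimately have "tor_eq (?u \<otimes>\<^bsub>W\<^esub> ?u) (w \<otimes>\<^bsub>W\<^esub> w)" using tor_eq_trans tor_eq_sym by blast
    hence "tor_eq ?u w" by (rule tor_eq_square[OF scale_closed[OF s(3) w(1)] w(1)])
    thus ?thesis using s by (simp add: P_def)
  qed
  show "x + y \<in> insert 0 P" "x * y \<in> insert 0 P" if "x \<in> insert 0 P" "y \<in> insert 0 P" for x y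
    using that add mult by auto
  show "x * x \<in> insert 0 P" if "x \<in> {c. J c = c}" for x
    using that norm[of x] by (cases "x = 0") auto
  have "1 \<in> P" using norm[of 1] by simp
  hence "-1 \<notin> P" using neg[of 1 "-1"] by simp
  thus "-1 \<notin> insert 0 P" by simp
  show "insert 0 P \<subseteq> {c. J c = c}" by (auto simp: P_def scalars_def)
  show "1 \<in> {c. J c = c}" by simp
  fix x y assume "x \<in> {c. J c = c}"
  hence x: "J x = x" by (rule CollectD)
  show "- x \<in> {c. J c = c}" "inverse x \<in> {c. J c = c}"
    by (simp_all only: mem_Collect_eq J.hom_uminus J.hom_inverse x)
  assume "y \<in> {c. J c = c}"
  hence y: "J y = y" by (rule CollectD)
  show "x + y \<in> {c. J c = c}" "x * y \<in> {c. J c = c}"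
    by (simp_all only: mem_Collect_eq J.hom_add J.hom_mult x y)
qed

text \<open>
  Since \<open>c * c\<close> acts trivially, \<open>c\<close> fixes all values of \<open>U + c U\<close> (written additively). For \<open>c = a\<close> and
  \<open>c = - a\<close> the two values at \<open>U\<close> add up to twice \<open>U\<close>, so that one of the two operators keeps a class of infinite order.
  The required operator is a composition of such operators, one for every element of \<open>as\<close>.
\<close>
lemma sign_operator:
  assumes "set as \<subseteq> scalars" "v \<in> carrier W" "\<not> torsion v"
  shows "\<exists>E. E \<in> hom W W \<and> \<not> torsion (E v) \<and>
    (\<forall>c\<in>scalars. \<forall>U\<in>carrier W. E (scale_class c U) = scale_class c (E U)) \<and>
    (\<forall>a\<in>set as. (\<forall>U\<in>carrier W. scale_class a (E U) = E U) \<or> (\<forall>U\<in>carrier W. scale_class (- a) (E U) = E U))"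
  using assms(1)
proof (induction as)
  case Nil
  have "(\<lambda>U. U) \<in> hom W W" by (auto simp: hom_def)
  thus ?case using assms(3) by (intro exI[of _ "\<lambda>U. U"]) auto
next
  case (Cons a as)
  have "set as \<subseteq> scalars" using Cons.prems by simp
  from Cons.IH[OF this] obtain E where E4: "E \<in> hom W W \<and> \<not> torsion (E v) \<and>
    (\<forall>c\<in>scalars. \<forall>U\<in>carrier W. E (scale_class c U) = scale_class c (E U)) \<and>
    (\<forall>a\<in>set as. (\<forall>U\<in>carrier W. scale_class a (E U) = E U) \<or> (\<forall>U\<in>carrier W. scale_class (- a) (E U) = E U))" ..
  note E = E4[THEN conjunct1] E4[THEN conjunct2, THEN conjunct1]
    E4[THEN conjunct2, THEN conjunct2, THEN conjunct1, rule_format]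
    E4[THEN conjunct2, THEN conjunct2, THEN conjunct2, THEN bspec]
  have a: "a \<in> scalars" "- a \<in> scalars" using Cons.prems by (auto simp: scalars_def J.hom_uminus)
  have Ec: "E U \<in> carrier W" if "U \<in> carrier W" for U using E(1) that by (rule hom_in_carrier)
  let ?w = "E v"
  have w: "?w \<in> carrier W" using Ec assms(2) .
  have "\<exists>c\<in>{a, - a}. \<not> torsion (?w \<otimes>\<^bsub>W\<^esub> scale_class c ?w)"
  proof (rule ccontr)
    assume neg: "\<not> ?thesis"
    have t: "torsion (?w \<otimes>\<^bsub>W\<^esub> scale_class c ?w)" if c: "c \<in> {a, - a}" for c
    proof (rule ccontr)
      assume "\<not> torsion (?w \<otimes>\<^bsub>W\<^esub> scale_class c ?w)"
      hence "\<exists>c\<in>{a, - a}. \<not> torsion (?w \<otimes>\<^bsub>W\<^esub> scale_class c ?w)" using c by (rule bexI)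
      with neg show False by (rule notE)
    qed
    have "torsion (?w \<otimes>\<^bsub>W\<^esub> scale_class a ?w)" "torsion (?w \<otimes>\<^bsub>W\<^esub> scale_class (- a) ?w)"
      by (rule t, simp)+
    hence "torsion ((?w \<otimes>\<^bsub>W\<^esub> scale_class a ?w) \<otimes>\<^bsub>W\<^esub> (?w \<otimes>\<^bsub>W\<^esub> scale_class (- a) ?w))"
      by (rule torsion_mult)
    also have "(?w \<otimes>\<^bsub>W\<^esub> scale_class a ?w) \<otimes>\<^bsub>W\<^esub> (?w \<otimes>\<^bsub>W\<^esub> scale_class (- a) ?w) =
        (?w \<otimes>\<^bsub>W\<^esub> ?w) \<otimes>\<^bsub>W\<^esub> (scale_class a ?w \<otimes>\<^bsub>W\<^esub> inv\<^bsub>W\<^esub> scale_class a ?w)"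
      unfolding scale_uminus[OF a(1) w]
      by (simp only: w scale_closed[OF a(1) w] W.inv_closed W.m_ac W.m_closed)
    also have "\<dots> = ?w \<otimes>\<^bsub>W\<^esub> ?w"
      by (simp only: W.r_inv[OF scale_closed[OF a(1) w]] W.r_one[OF W.m_closed[OF w w]])
    finally have "torsion ?w" by (rule torsion_square[OF w])
    with E(2) show False by (rule notE)
  qed
  then obtain c where c: "c \<in> {a, - a}" "\<not> torsion (?w \<otimes>\<^bsub>W\<^esub> scale_class c ?w)" by blast
  have cs: "c \<in> scalars" using c(1) a by blast
  define E' where "E' = (\<lambda>U. E U \<otimes>\<^bsub>W\<^esub> scale_class c (E U))"
  have hom': "E' \<in> hom W W"
  proof (rule homI)
    fix U Y assume XY: "U \<in> carrier W" "Y \<in> carrier W"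
    show "E' U \<in> carrier W" using XY Ec cs by (simp add: E'_def)
    show "E' (U \<otimes>\<^bsub>W\<^esub> Y) = E' U \<otimes>\<^bsub>W\<^esub> E' Y"
      using XY Ec cs by (simp add: E'_def hom_mult[OF E(1)] scale_mult W.m_ac)
  qed
  have comm': "E' (scale_class d U) = scale_class d (E' U)" if "d \<in> scalars" "U \<in> carrier W" for d U
    using that Ec cs by (simp add: E'_def E(3) scale_mult scale_scale mult.commute)
  have fix_c: "scale_class c (E' U) = E' U" if "U \<in> carrier W" for U
    using that Ec cs by (simp add: E'_def scale_mult scale_scale scale_square W.m_comm)
  have old: "scale_class d (E' U) = E' U"
    if d: "d \<in> scalars" "\<forall>U\<in>carrier W. scale_class d (E U) = E U" and U: "U \<in> carrier W" for d U
  proof -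
    have "scale_class d (scale_class c (E U)) = scale_class c (scale_class d (E U))"
      using d(1) cs Ec[OF U] by (simp add: scale_scale mult.commute)
    thus ?thesis using d U Ec[OF U] cs by (simp add: E'_def scale_mult)
  qed
  have sgn': "\<forall>b\<in>set (a # as). (\<forall>U\<in>carrier W. scale_class b (E' U) = E' U) \<or>
      (\<forall>U\<in>carrier W. scale_class (- b) (E' U) = E' U)"
  proof
    fix b assume b: "b \<in> set (a # as)"
    hence bs: "b \<in> scalars" "- b \<in> scalars" using Cons.prems by (auto simp: scalars_def J.hom_uminus)
    show "(\<forall>U\<in>carrier W. scale_class b (E' U) = E' U) \<or> (\<forall>U\<in>carrier W. scale_class (- b) (E' U) = E' U)"
    proof (cases "b = a")
      case True
      have all_c: "\<forall>U\<in>carrier W. scale_class c (E' U) = E' U" by (intro ballI fix_c)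
      from c(1) consider "c = b" | "c = - b" using True by blast
      thus ?thesis
      proof cases
        case 1
        show ?thesis using all_c unfolding 1 by (rule disjI1)
      next
        case 2
        show ?thesis using all_c unfolding 2 by (rule disjI2)
      qed
    next
      case False
      hence "b \<in> set as" using b by simp
      from E(4)[OF this] show ?thesis
      proof
        assume "\<forall>U\<in>carrier W. scale_class b (E U) = E U"
        from old[OF bs(1) this] show ?thesis by (intro disjI1 ballI)
      next
        assume "\<forall>U\<in>carrier W. scale_class (- b) (E U) = E U"
        from old[OF bs(2) this] show ?thesis by (intro disjI2 ballI)
      qed
    qed
  qed
  have nt': "\<not> torsion (E' v)" unfolding E'_def by (rule c(2))
  show ?case
  proof (rule exI[of _ E'], intro conjI hom' nt' sgn' ballI)
    fix d U assume "d \<in> scalars" "U \<in> carrier W"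
    thus "E' (scale_class d U) = scale_class d (E' U)" by (rule comm')
  qed
qed

text \<open>
  Applied to the class of the diagonal form, the operator gives the sum of the signs as the exponent of the image of
  \<open>[\<beta>]\<close>. A sum equal to zero would make the result trivial.
\<close>
theorem nontorsion_ordering:
  assumes as: "set as \<subseteq> scalars" and nt: "\<not> torsion (diag_class (map (\<lambda>a. a * \<beta>) as))"
  shows "\<exists>T. ordered_subfield {c. J c = c} T \<and> (\<forall>x. x * J x \<in> T) \<and>
    (\<Sum>a\<leftarrow>as. if a \<in> T then 1 else - 1 :: int) \<noteq> 0"
proof -
  have b: "admissible [\<beta>]" using beta by simp
  let ?u = "diag_class [\<beta>]" and ?v = "diag_class (map (\<lambda>a. a * \<beta>) as)"
  have adm: "admissible (map (\<lambda>a. a * \<beta>) cs)" if cs: "set cs \<subseteq> scalars" for cs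
    unfolding admissible_def
  proof
    fix d assume "d \<in> set (map (\<lambda>a. a * \<beta>) cs)"
    then obtain a where "a \<in> set cs" and d: "d = a * \<beta>" by auto
    hence a: "a \<in> scalars" "d = a * \<beta>" using cs by blast+
    hence "J d = of_int \<epsilon> * d" by (simp add: scalars_def J.hom_mult beta(2))
    moreover have "d \<noteq> 0" using a beta(1) by (simp add: scalars_def)
    ultimately show "d \<noteq> 0 \<and> J d = of_int \<epsilon> * d" by blast
  qed
  have v: "?v \<in> carrier W" and u: "?u \<in> carrier W" using adm[OF as] b by (auto intro: diag_class_carrier)
  from sign_operator[OF as v nt] obtain E where E4: "E \<in> hom W W \<and> \<not> torsion (E ?v) \<and>
    (\<forall>c\<in>scalars. \<forall>U\<in>carrier W. E (scale_class c U) = scale_class c (E U)) \<and>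
    (\<forall>a\<in>set as. (\<forall>U\<in>carrier W. scale_class a (E U) = E U) \<or> (\<forall>U\<in>carrier W. scale_class (- a) (E U) = E U))" ..
  note E = E4[THEN conjunct1] E4[THEN conjunct2, THEN conjunct1]
    E4[THEN conjunct2, THEN conjunct2, THEN conjunct1, rule_format]
    E4[THEN conjunct2, THEN conjunct2, THEN conjunct2, THEN bspec]
  have Ec: "E U \<in> carrier W" if "U \<in> carrier W" for U using E(1) that by (rule hom_in_carrier)
  define P where "P = {c \<in> scalars. tor_eq (scale_class c (E ?v)) (E ?v)}"
  interpret P: preordered_subfield "{c. J c = c}" "insert 0 P"
    unfolding P_def by (rule stabilizer_preordering[OF Ec[OF v] E(2)])
  from P.extends_to_ordering obtain T where TT: "insert 0 P \<subseteq> T \<and> ordered_subfield {c. J c = c} T" ..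
  note T = TT[THEN conjunct1] TT[THEN conjunct2]
  interpret T: ordered_subfield "{c. J c = c}" T by fact
  have fixP: "c \<in> P" if "c \<in> scalars" "\<forall>U\<in>carrier W. scale_class c (E U) = E U" for c
    unfolding P_def using that(1) bspec[OF that(2) v] tor_eq_refl[OF Ec[OF v]] by simp
  have "x * J x \<in> T" for x
  proof (cases "x = 0")
    case False
    have "x * J x \<in> scalars" using False by (simp add: scalars_def J.hom_mult mult.commute)
    moreover have "tor_eq (scale_class (x * J x) (E ?v)) (E ?v)"
      unfolding scale_norm[OF False Ec[OF v]] by (rule tor_eq_refl[OF Ec[OF v]])
    ultimately show ?thesis using T(1) by (auto simp: P_def)
  qed (use T.T_0 in simp)
  moreover have "(\<Sum>a\<leftarrow>as. if a \<in> T then 1 else - 1 :: int) \<noteq> 0"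
  proof
    assume z: "(\<Sum>a\<leftarrow>as. if a \<in> T then 1 else - 1 :: int) = 0"
    have "E (diag_class (map (\<lambda>a. a * \<beta>) cs)) = E ?u [^]\<^bsub>W\<^esub> (\<Sum>a\<leftarrow>cs. if a \<in> T then 1 else - 1 :: int)"
      if "set cs \<subseteq> set as" for cs using that
    proof (induction cs)
      case Nil
      have "E \<one>\<^bsub>W\<^esub> = \<one>\<^bsub>W\<^esub>" using hom_one[OF E(1) W.group_axioms W.group_axioms] .
      thus ?case by (simp add: witt_one[symmetric])
    next
      case (Cons a cs)
      have a: "a \<in> scalars" "a \<in> set as" "set cs \<subseteq> scalars" using Cons.prems as by auto
      let ?ds = "map (\<lambda>a. a * \<beta>) cs"
      have adm_a: "admissible [a * \<beta>]" using adm[of "[a]"] a(1) by simp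
      have adm_cs: "admissible ?ds" by (rule adm[OF a(3)])
      have sc: "scale_class a ?u = diag_class [a * \<beta>]" using scale_diag_class[OF a(1) b] by simp
      have "diag_class (map (\<lambda>a. a * \<beta>) (a # cs)) = diag_class [a * \<beta>] \<otimes>\<^bsub>W\<^esub> diag_class ?ds"
        using diag_class_append[OF adm_a adm_cs] by simp
      hence "E (diag_class (map (\<lambda>a. a * \<beta>) (a # cs))) = E (diag_class [a * \<beta>] \<otimes>\<^bsub>W\<^esub> diag_class ?ds)"
        by (rule arg_cong)
      also have "\<dots> = E (diag_class [a * \<beta>]) \<otimes>\<^bsub>W\<^esub> E (diag_class ?ds)"
        by (rule hom_mult[OF E(1) diag_class_carrier[OF adm_a] diag_class_carrier[OF adm_cs]])
      also have "E (diag_class [a * \<beta>]) = scale_class a (E ?u)"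
        unfolding sc[symmetric] by (rule E(3)[OF a(1) u])
      also have "scale_class a (E ?u) = E ?u [^]\<^bsub>W\<^esub> (if a \<in> T then 1 else - 1 :: int)"
      proof -
        from E(4)[OF a(2)] consider "\<forall>U\<in>carrier W. scale_class a (E U) = E U"
          | "\<forall>U\<in>carrier W. scale_class (- a) (E U) = E U" by (rule disjE)
        thus ?thesis
        proof cases
          case 1
          have "a \<in> P" by (rule fixP[OF a(1) 1])
          hence "a \<in> T" using T(1) by blast
          thus ?thesis using bspec[OF 1 u] Ec[OF u] by (simp add: W.int_pow_1)
        next
          case 2
          have ma: "- a \<in> scalars" using a(1) by (simp add: scalars_def J.hom_uminus)
          have "- a \<in> P" by (rule fixP[OF ma 2])
          hence "- a \<in> T" using T(1) by blast
          hence "a \<notin> T" using T.T_antisym[of a] a(1) by (auto simp: scalars_def)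
          moreover have "scale_class a (E ?u) = inv\<^bsub>W\<^esub> (E ?u)"
            using scale_uminus[OF ma Ec[OF u]] bspec[OF 2 u] by simp
          ultimately show ?thesis using Ec[OF u] by (simp add: W.int_pow_neg W.int_pow_1)
        qed
      qed
      also have "E (diag_class ?ds) = E ?u [^]\<^bsub>W\<^esub> (\<Sum>a\<leftarrow>cs. if a \<in> T then 1 else - 1 :: int)"
        by (rule Cons.IH) (use Cons.prems in simp)
      finally show ?case using Ec[OF u] by (simp add: W.int_pow_mult)
    qed
    from this[OF subset_refl] have "E ?v = E ?u [^]\<^bsub>W\<^esub> (0 :: int)" unfolding z .
    hence "E ?v = \<one>\<^bsub>W\<^esub>" by simp
    with E(2) torsion_one show False by simp
  qed
  ultimately show ?thesis using T(2) by (intro exI[of _ T] conjI allI)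
qed

end

section \<open>The standard part of a finite element\<close>

context ordered_subfield
begin

lemma T_of_nat: "of_nat n \<in> T"
  by (induction n) (auto intro: T_0 T_1 T_add)

lemma T_of_int_iff: "of_int m \<in> T \<longleftrightarrow> 0 \<le> m"
proof
  assume m: "of_int m \<in> T"
  show "0 \<le> m"
  proof (rule ccontr)
    assume "\<not> 0 \<le> m"
    hence "- 1 = m + int (nat (- m - 1))" by simp
    hence "(of_int (- 1) :: 'k) = of_int m + of_nat (nat (- m - 1))" by (metis of_int_add of_int_of_nat_eq)
    thus False using T_neg1 T_add[OF m T_of_nat] by simp
  qed
next
  assume "0 \<le> m"
  hence "of_int m = (of_nat (nat m) :: 'k)" by simp
  thus "of_int m \<in> T" using T_of_nat by metis
qed

lemma T_K0: "x \<in> T \<Longrightarrow> x \<in> K0" using T_sub by blast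

lemma K0_of_nat: "of_nat n \<in> K0" by (rule T_K0[OF T_of_nat])

lemma K0_of_int: "of_int m \<in> K0"
  by (cases m rule: int_cases2) (auto intro: K0_of_nat K0_uminus)

lemma K0_diff: "x \<in> K0 \<Longrightarrow> y \<in> K0 \<Longrightarrow> x - y \<in> K0"
  using K0_add[OF _ K0_uminus, of x y] by simp

lemma of_nat_nonzero: "n > 0 \<Longrightarrow> (of_nat n :: 'k) \<noteq> 0"
proof
  assume "n > 0" "(of_nat n :: 'k) = 0"
  hence "(of_nat (n - 1) :: 'k) = - 1" by (simp add: of_nat_diff)
  thus False using T_of_nat[of "n - 1"] T_neg1 by simp
qed

lemma T_halve: assumes "x + x \<in> T" shows "x \<in> T"
proof -
  have "(x + x) * inverse (of_nat 2) \<in> T" using assms T_of_nat by (intro T_mult T_inverse)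
  moreover have "(2 :: 'k) \<noteq> 0" using of_nat_nonzero[of 2] by simp
  hence "(x + x) * inverse (of_nat 2) = x" by (simp add: field_simps flip: mult_2)
  ultimately show ?thesis by simp
qed

definition finite_elt :: "'k \<Rightarrow> bool" where
  "finite_elt x \<longleftrightarrow> x \<in> K0 \<and> (\<exists>n::nat. of_nat n - x \<in> T \<and> of_nat n + x \<in> T)"

definition cut :: "'k \<Rightarrow> real set" where
  "cut x = {real_of_int m / real n | m n. 0 < n \<and> of_nat n * x - of_int m \<in> T}"

text \<open>
  The standard part is the supremum of the rational numbers below \<open>x\<close>.
\<close>
definition st :: "'k \<Rightarrow> real" where "st x = Sup (cut x)"

lemma finite_K0: "finite_elt x \<Longrightarrow> x \<in> K0" by (simp add: finite_elt_def)

lemma finite_of_int: "finite_elt (of_int m)"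
proof -
  have "of_nat (nat \<bar>m\<bar>) = (of_int \<bar>m\<bar> :: 'k)" by simp
  hence "of_nat (nat \<bar>m\<bar>) - of_int m \<in> T" "of_nat (nat \<bar>m\<bar>) + of_int m \<in> T"
    by (simp_all only: of_int_diff[symmetric] of_int_add[symmetric] T_of_int_iff)
  thus ?thesis using K0_of_int unfolding finite_elt_def by blast
qed

lemma finite_of_nat: "finite_elt (of_nat n)" using finite_of_int[of "int n"] by simp

lemma finite_1: "finite_elt 1" using finite_of_nat[of 1] by simp

lemma finite_0: "finite_elt 0" using finite_of_nat[of 0] by simp

lemma finite_uminus: "finite_elt x \<Longrightarrow> finite_elt (- x)"
  unfolding finite_elt_def using K0_uminus by auto

lemma finite_add: assumes "finite_elt x" "finite_elt y" shows "finite_elt (x + y)"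
proof -
  obtain n m :: nat where "of_nat n - x \<in> T" "of_nat n + x \<in> T" "of_nat m - y \<in> T" "of_nat m + y \<in> T"
    using assms by (auto simp: finite_elt_def)
  hence "(of_nat n - x) + (of_nat m - y) \<in> T" "(of_nat n + x) + (of_nat m + y) \<in> T"
    using T_add by blast+
  hence "of_nat (n + m) - (x + y) \<in> T" "of_nat (n + m) + (x + y) \<in> T"
    by (simp_all add: algebra_simps)
  thus ?thesis using assms K0_add unfolding finite_elt_def by blast
qed

lemma finite_diff: "finite_elt x \<Longrightarrow> finite_elt y \<Longrightarrow> finite_elt (x - y)"
  using finite_add[OF _ finite_uminus, of x y] by simp

lemma finite_mult: assumes "finite_elt x" "finite_elt y" shows "finite_elt (x * y)"
proof -
  obtain n m :: nat where *: "of_nat n - x \<in> T" "of_nat n + x \<in> T" "of_nat m - y \<in> T" "of_nat m + y \<in> T"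
    using assms by (auto simp: finite_elt_def)
  have "(of_nat n - x) * (of_nat m + y) + (of_nat n + x) * (of_nat m - y) \<in> T"
    "(of_nat n - x) * (of_nat m - y) + (of_nat n + x) * (of_nat m + y) \<in> T"
    by (intro T_add T_mult *)+
  hence "(of_nat (n * m) - x * y) + (of_nat (n * m) - x * y) \<in> T"
    "(of_nat (n * m) + x * y) + (of_nat (n * m) + x * y) \<in> T"
    by (simp_all add: algebra_simps)
  hence "of_nat (n * m) - x * y \<in> T" "of_nat (n * m) + x * y \<in> T" by (auto intro: T_halve)
  thus ?thesis using assms K0_mult unfolding finite_elt_def by blast
qed

lemma cut_le:
  assumes "0 < n" "of_nat n * x - of_int m \<in> T" "0 < k" "of_int l - of_nat k * x \<in> T"
  shows "real_of_int m / real n \<le> real_of_int l / real k"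
proof -
  have "of_nat k * (of_nat n * x - of_int m) + of_nat n * (of_int l - of_nat k * x) \<in> T"
    using assms by (intro T_add T_mult T_of_nat)
  also have "of_nat k * (of_nat n * x - of_int m) + of_nat n * (of_int l - of_nat k * x) =
      of_int (int n * l - int k * m)" by (simp add: algebra_simps)
  finally have "int k * m \<le> int n * l" by (simp only: T_of_int_iff)
  hence "real_of_int (int k * m) \<le> real_of_int (int n * l)" by (simp only: of_int_le_iff)
  thus ?thesis using assms(1,3) by (simp add: field_simps)
qed

lemma st_upper:
  assumes "finite_elt x" "0 < k" "of_int l - of_nat k * x \<in> T"
  shows "st x \<le> real_of_int l / real k"
  unfolding st_def
proof (rule cSup_least)
  obtain n :: nat where "of_nat n + x \<in> T" using assms(1) by (auto simp: finite_elt_def)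
  hence "of_nat 1 * x - of_int (- int n) \<in> T" by (simp add: add.commute)
  thus "cut x \<noteq> {}" unfolding cut_def by blast
  show "y \<le> real_of_int l / real k" if "y \<in> cut x" for y
    using that cut_le assms(2,3) unfolding cut_def by blast
qed

lemma st_lower:
  assumes "finite_elt x" "0 < n" "of_nat n * x - of_int m \<in> T"
  shows "real_of_int m / real n \<le> st x"
  unfolding st_def
proof (rule cSup_upper)
  show "real_of_int m / real n \<in> cut x" using assms unfolding cut_def by blast
  obtain k :: nat where "of_nat k - x \<in> T" using assms(1) by (auto simp: finite_elt_def)
  hence "of_int (int k) - of_nat 1 * x \<in> T" by simp
  hence "y \<le> real_of_int (int k) / real 1" if "y \<in> cut x" for y
    using that cut_le[of _ x _ 1 "int k"] unfolding cut_def by auto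
  thus "bdd_above (cut x)" by (rule bdd_aboveI)
qed

lemma st_unique:
  assumes x: "finite_elt x"
    and lo: "\<And>n m. 0 < n \<Longrightarrow> of_nat n * x - of_int m \<in> T \<Longrightarrow> real_of_int m / real n \<le> r"
    and up: "\<And>n m. 0 < n \<Longrightarrow> of_int m - of_nat n * x \<in> T \<Longrightarrow> r \<le> real_of_int m / real n"
  shows "st x = r"
proof -
  have frac: "\<exists>m n. 0 < n \<and> a < real_of_int m / real n \<and> real_of_int m / real n < b" if ab: "a < b" for a b
  proof -
    obtain q where q: "a < of_rat q" "of_rat q < b" using of_rat_dense[OF ab] by blast
    obtain m n where mn: "q = of_int m / of_int n" "n > 0"
      by (metis quotient_of_denom_pos quotient_of_div surj_pair)
    have "of_rat q = real_of_int m / real (nat n)" using mn by (simp add: of_rat_divide)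
    thus ?thesis using q mn(2) by (intro exI[of _ m] exI[of _ "nat n"]) auto
  qed
  have tot: "of_nat n * x - of_int m \<in> T \<or> of_int m - of_nat n * x \<in> T" for n m
    using T_total[of "of_nat n * x - of_int m"] x
    by (auto simp: K0_diff K0_mult K0_of_nat K0_of_int finite_K0)
  have "\<not> st x < r"
  proof
    assume "st x < r"
    then obtain m n where mn: "0 < n" "st x < real_of_int m / real n" "real_of_int m / real n < r"
      using frac by blast
    show False using tot[of n m] st_lower[OF x mn(1), of m] up[OF mn(1), of m] mn by auto
  qed
  moreover have "\<not> r < st x"
  proof
    assume "r < st x"
    then obtain m n where mn: "0 < n" "r < real_of_int m / real n" "real_of_int m / real n < st x"
      using frac by blast
    show False using tot[of n m] st_upper[OF x mn(1), of m] lo[OF mn(1), of m] mn by auto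
  qed
  ultimately show ?thesis by simp
qed

lemma st_of_int: "st (of_int i) = real_of_int i"
proof (rule st_unique[OF finite_of_int])
  fix n m assume n: "0 < (n :: nat)"
  {
    assume "of_nat n * of_int i - of_int m \<in> T"
    hence "of_int (int n * i - m) \<in> T" by simp
    hence "m \<le> int n * i" by (simp only: T_of_int_iff)
    hence "real_of_int m \<le> real_of_int (int n * i)" by (simp only: of_int_le_iff)
    thus "real_of_int m / real n \<le> real_of_int i" using n by (simp add: field_simps)
  }
  {
    assume "of_int m - of_nat n * of_int i \<in> T"
    hence "of_int (m - int n * i) \<in> T" by simp
    hence "int n * i \<le> m" by (simp only: T_of_int_iff)
    hence "real_of_int (int n * i) \<le> real_of_int m" by (simp only: of_int_le_iff)
    thus "real_of_int i \<le> real_of_int m / real n" using n by (simp add: field_simps)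
  }
qed

lemma st_approx:
  assumes x: "finite_elt x" and k: "0 < k"
  obtains i where "of_nat k * x - of_int i \<in> T" "of_int (i + 3) - of_nat k * x \<in> T"
    "of_int i \<le> real k * st x" "real k * st x \<le> of_int (i + 3)"
proof -
  define i where "i = \<lfloor>real k * st x\<rfloor> - 1"
  have tot: "of_nat k * x - of_int m \<in> T \<or> of_int m - of_nat k * x \<in> T" for m
    using T_total[of "of_nat k * x - of_int m"] x
    by (auto simp: K0_diff K0_mult K0_of_nat K0_of_int finite_K0)
  have i: "real_of_int i < real k * st x" "real k * st x < real_of_int (i + 3)"
    unfolding i_def by linarith+
  have "of_nat k * x - of_int i \<in> T"
  proof (rule ccontr)
    assume "\<not> ?thesis"
    hence "st x \<le> real_of_int i / real k" using tot st_upper[OF x k] by blast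
    thus False using i(1) k by (simp add: field_simps)
  qed
  moreover have "of_int (i + 3) - of_nat k * x \<in> T"
  proof (rule ccontr)
    assume "\<not> ?thesis"
    hence "real_of_int (i + 3) / real k \<le> st x" using tot st_lower[OF x k] by blast
    thus False using i(2) k by (simp add: field_simps)
  qed
  ultimately show ?thesis using that i by simp
qed

lemma st_add:
  assumes x: "finite_elt x" and y: "finite_elt y"
  shows "st (x + y) = st x + st y"
proof (rule ccontr)
  assume "st (x + y) \<noteq> st x + st y"
  hence "0 < \<bar>st (x + y) - (st x + st y)\<bar>" by simp
  then obtain k :: nat where k: "6 < real k * \<bar>st (x + y) - (st x + st y)\<bar>"
    using ex_less_of_nat_mult by blast
  hence k0: "0 < k" by (cases k) auto
  obtain i where i: "of_nat k * x - of_int i \<in> T" "of_int (i + 3) - of_nat k * x \<in> T"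
    "of_int i \<le> real k * st x" "real k * st x \<le> of_int (i + 3)" using st_approx[OF x k0] by blast
  obtain j where j: "of_nat k * y - of_int j \<in> T" "of_int (j + 3) - of_nat k * y \<in> T"
    "of_int j \<le> real k * st y" "real k * st y \<le> of_int (j + 3)" using st_approx[OF y k0] by blast
  have "of_nat k * (x + y) - of_int (i + j) \<in> T"
    using T_add[OF i(1) j(1)] by (simp add: algebra_simps)
  from st_lower[OF finite_add[OF x y] k0 this]
  have 1: "real_of_int (i + j) \<le> real k * st (x + y)" using k0 by (simp add: field_simps)
  have "of_int (i + j + 6) - of_nat k * (x + y) \<in> T"
    using T_add[OF i(2) j(2)] by (simp add: algebra_simps)
  from st_upper[OF finite_add[OF x y] k0 this]
  have 2: "real k * st (x + y) \<le> real_of_int (i + j + 6)" using k0 by (simp add: field_simps)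
  have "\<bar>real k * st (x + y) - (real k * st x + real k * st y)\<bar> \<le> 6"
    using 1 2 i(3,4) j(3,4) by (simp add: abs_le_iff)
  also have "real k * st (x + y) - (real k * st x + real k * st y) = real k * (st (x + y) - (st x + st y))"
    by (simp add: algebra_simps)
  finally show False using k by (simp add: abs_mult)
qed

lemma st_nonneg: "finite_elt x \<Longrightarrow> x \<in> T \<Longrightarrow> 0 \<le> st x"
  using st_lower[of x 1 0] by simp

lemma st_0: "st 0 = 0" using st_of_int[of 0] by simp
lemma st_1: "st 1 = 1" using st_of_int[of 1] by simp

lemma st_uminus: "finite_elt x \<Longrightarrow> st (- x) = - st x"
  using st_add[OF _ finite_uminus, of x x] st_0 by simp

text \<open>
  Such a functional agrees with a multiple of \<open>st\<close> on rational numbers, and every finite element is squeezed between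
  rational numbers. Applied to multiplication with a fixed positive element, followed by \<open>st\<close>, this shows that \<open>st\<close> is multiplicative.
\<close>
lemma additive_functional:
  assumes add: "\<And>x y. finite_elt x \<Longrightarrow> finite_elt y \<Longrightarrow> \<phi> (x + y) = \<phi> x + \<phi> y"
    and nonneg: "\<And>x. finite_elt x \<Longrightarrow> x \<in> T \<Longrightarrow> 0 \<le> \<phi> x"
    and x: "finite_elt x"
  shows "\<phi> x = \<phi> 1 * st x"
proof -
  have z: "\<phi> 0 = (0 :: real)" using add[OF finite_0 finite_0] by simp
  have neg: "\<phi> (- x) = - \<phi> x" if "finite_elt x" for x
    using add[OF that finite_uminus[OF that]] z by simp
  have diff: "\<phi> (x - y) = \<phi> x - \<phi> y" if "finite_elt x" "finite_elt y" for x y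
    using add[OF that(1) finite_uminus[OF that(2)]] neg[OF that(2)] by simp
  have nat: "\<phi> (of_nat n * x) = real n * \<phi> x" if "finite_elt x" for n x
    by (induction n) (simp_all add: z distrib_right add that finite_mult finite_of_nat)
  have int: "\<phi> (of_int m) = real_of_int m * \<phi> 1" for m
    using nat[OF finite_1] neg[OF finite_of_nat] by (cases m rule: int_cases2) auto
  have lin: "\<phi> (of_nat n * x - of_int m) = real n * \<phi> x - real_of_int m * \<phi> 1"
    "\<phi> (of_int m - of_nat n * x) = real_of_int m * \<phi> 1 - real n * \<phi> x" for n m
    using diff[OF finite_mult[OF finite_of_nat x] finite_of_int] diff[OF finite_of_int finite_mult[OF finite_of_nat x]]
    by (simp_all add: nat[OF x] int)
  have fin: "finite_elt (of_nat n * x - of_int m)" "finite_elt (of_int m - of_nat n * x)" for n m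
    using x by (auto intro: finite_diff finite_mult finite_of_nat finite_of_int)
  have 1: "0 \<le> \<phi> 1" by (rule nonneg[OF finite_1 T_1])
  have lo: "real_of_int m * \<phi> 1 \<le> real n * \<phi> x" if "of_nat n * x - of_int m \<in> T" for n m
    using nonneg[OF fin(1) that] lin by simp
  have up: "real n * \<phi> x \<le> real_of_int m * \<phi> 1" if "of_int m - of_nat n * x \<in> T" for n m
    using nonneg[OF fin(2) that] lin by simp
  show ?thesis
  proof (cases "\<phi> 1 = 0")
    case True
    obtain n :: nat where n: "of_nat n - x \<in> T" "of_nat n + x \<in> T" using x by (auto simp: finite_elt_def)
    have "of_int (int n) - of_nat 1 * x \<in> T" "of_nat 1 * x - of_int (- int n) \<in> T"
      using n by (simp_all add: add.commute)
    thus ?thesis using up[of "int n" 1] lo[of 1 "- int n"] True by simp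
  next
    case False
    hence pos: "0 < \<phi> 1" using 1 by simp
    have "st x = \<phi> x / \<phi> 1"
    proof (rule st_unique[OF x])
      fix n m assume n: "0 < (n :: nat)"
      show "real_of_int m / real n \<le> \<phi> x / \<phi> 1" if "of_nat n * x - of_int m \<in> T"
        using lo[OF that] n pos by (simp add: field_simps)
      show "\<phi> x / \<phi> 1 \<le> real_of_int m / real n" if "of_int m - of_nat n * x \<in> T"
        using up[OF that] n pos by (simp add: field_simps)
    qed
    thus ?thesis using pos by simp
  qed
qed

lemma st_mult:
  assumes x: "finite_elt x" and y: "finite_elt y"
  shows "st (x * y) = st x * st y"
proof -
  have pos: "st (x * y) = st x * st y" if y: "finite_elt y" "y \<in> T" for y
  proof -
    have "st (x * y) = st (1 * y) * st x"
      by (rule additive_functional[of "\<lambda>x. st (x * y)"])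
        (use x y in \<open>auto simp: distrib_right st_add finite_mult intro!: st_nonneg T_mult\<close>)
    thus ?thesis by simp
  qed
  consider "y \<in> T" | "- y \<in> T" using T_total[OF finite_K0[OF y]] by blast
  thus ?thesis
  proof cases
    case 2
    have "st (x * - y) = st x * st (- y)" using pos[OF finite_uminus[OF y] 2] .
    thus ?thesis using st_uminus[OF finite_mult[OF x y]] st_uminus[OF y] by simp
  qed (use pos y in blast)
qed

lemma infinite_inverse:
  assumes "x \<in> K0" "\<not> finite_elt x"
  shows "finite_elt (inverse x)" "st (inverse x) = 0"
proof -
  have *: "finite_elt (inverse x) \<and> st (inverse x) = 0"
    if x: "x \<in> K0" "\<not> finite_elt x" "x \<in> T" for x
  proof -
    have x0: "x \<noteq> 0" using x finite_0 by auto
    have i: "inverse x \<in> T" by (rule T_inverse[OF x(3)])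
    have big: "of_int 1 - of_nat n * inverse x \<in> T" for n :: nat
    proof -
      have "of_nat n + x \<in> T" by (intro T_add T_of_nat x(3))
      hence "of_nat n - x \<notin> T" using x by (auto simp: finite_elt_def)
      hence "x - of_nat n \<in> T"
        using T_total[of "of_nat n - x"] x(1) by (auto simp: K0_diff K0_of_nat)
      hence "(x - of_nat n) * inverse x \<in> T" using i by (intro T_mult)
      thus ?thesis using x0 by (simp add: algebra_simps)
    qed
    have fin: "finite_elt (inverse x)"
      using big[of 1] T_add[OF T_1 i] K0_inverse[OF x(1)] unfolding finite_elt_def
      by (intro conjI exI[of _ 1]) simp_all
    have "st (inverse x) \<le> 0"
    proof (rule ccontr)
      assume "\<not> ?thesis"
      hence p: "0 < st (inverse x)" by simp
      then obtain n :: nat where n: "1 < real n * st (inverse x)" using ex_less_of_nat_mult by blast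
      hence "0 < n" by (cases n) auto
      from st_upper[OF fin this big] show False using n \<open>0 < n\<close> by (simp add: field_simps)
    qed
    thus ?thesis using st_nonneg[OF fin i] fin by simp
  qed
  have "finite_elt (inverse x) \<and> st (inverse x) = 0"
  proof (cases "x \<in> T")
    case False
    have "\<not> finite_elt (- x)" using finite_uminus[of "- x"] assms(2) by auto
    moreover have "- x \<in> T" using T_total[OF assms(1)] False by blast
    ultimately have "finite_elt (- inverse x) \<and> st (- inverse x) = 0"
      using *[of "- x"] K0_uminus[OF assms(1)] by simp
    thus ?thesis using finite_uminus[of "- inverse x"] st_uminus[of "- inverse x"] by simp
  qed (use * assms in blast)
  thus "finite_elt (inverse x)" "st (inverse x) = 0" by auto
qed

end

section \<open>From an ordering to a real point\<close>

text \<open>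
  The constants \<open>\<iota>\<close> of an algebraic field with involution, inside an ordered field extension in which norms are positive.
\<close>
locale real_place = ordered_subfield K0 T for K0 T :: "'k::field set" +
  fixes \<sigma> :: "'f::field_char_0 \<Rightarrow> 'f" and \<iota> :: "'f \<Rightarrow> 'k" and J :: "'k \<Rightarrow> 'k"
  assumes sigma: "field_involution \<sigma>" and J: "field_involution J" and iota: "field_hom \<iota>"
    and J_iota: "\<And>x. J (\<iota> x) = \<iota> (\<sigma> x)"
    and K0_eq: "K0 = {c. J c = c}"
    and norm_T: "\<And>x. x * J x \<in> T"
    and alg: "\<And>x :: 'f. algebraic x"
begin

sublocale s: field_hom \<sigma> using sigma by (simp add: field_involution_def)
sublocale J: field_hom J using J by (simp add: field_involution_def)
sublocale i: field_hom \<iota> by (rule iota)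

lemma ss [simp]: "\<sigma> (\<sigma> x) = x" using sigma by (simp add: field_involution_def)

lemma iota_K0: "\<sigma> x = x \<Longrightarrow> \<iota> x \<in> K0" by (simp add: K0_eq J_iota)

lemma iota_of_nat: "\<iota> (of_nat n) = of_nat n"
  by (induction n) (simp_all add: i.hom_add)

lemma iota_of_int: "\<iota> (of_int m) = of_int m"
  by (cases m rule: int_cases2) (simp_all add: iota_of_nat i.hom_uminus)

lemma int_poly_finite:
  assumes "\<And>i. coeff p i \<in> \<int>" "finite_elt (\<iota> y)"
  shows "finite_elt (\<iota> (poly p y))"
  using assms(1)
proof (induction p)
  case 0
  show ?case by (simp add: finite_0)
next
  case (pCons a p)
  have "coeff (pCons a p) 0 \<in> \<int>" by (rule pCons.prems)
  then obtain m where m: "a = of_int m" by (auto elim: Ints_cases)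
  have "coeff p i \<in> \<int>" for i using pCons.prems[of "Suc i"] by simp
  hence "finite_elt (\<iota> (poly p y))" by (rule pCons.IH)
  thus ?case using assms(2)
    by (simp add: m i.hom_add i.hom_mult iota_of_int finite_add finite_mult finite_of_int)
qed

text \<open>
  An element of an algebraic extension of the rationals cannot be infinite: otherwise its inverse is
  infinitesimal, and the reversed integer polynomial would have constant term \<open>0\<close>.
\<close>
lemma const_finite:
  assumes x: "\<sigma> x = x"
  shows "finite_elt (\<iota> x)"
proof (rule ccontr)
  assume nf: "\<not> finite_elt (\<iota> x)"
  note inf = infinite_inverse[OF iota_K0[OF x] nf]
  have x0: "x \<noteq> 0" using nf finite_0 by auto
  obtain p where p: "\<And>i. coeff p i \<in> \<int>" "p \<noteq> 0" "poly p x = 0"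
    using alg[of x] by (auto simp: algebraic_def)
  let ?q = "reflect_poly p" and ?y = "inverse x"
  have y: "finite_elt (\<iota> ?y)" "st (\<iota> ?y) = 0" using inf by (simp_all add: i.hom_inverse)
  have "poly ?q ?y = 0" using p(3) x0 by (simp add: poly_reflect_poly_nz)
  moreover obtain a q' where q: "?q = pCons a q'" by (metis pCons_cases)
  ultimately have a: "a + ?y * poly q' ?y = 0" by simp
  have qi: "coeff ?q i \<in> \<int>" for i using p(1) by (auto simp: coeff_reflect_poly)
  have "coeff q' i \<in> \<int>" for i using qi[of "Suc i"] by (simp add: q)
  hence f: "finite_elt (\<iota> (poly q' ?y))" using y(1) by (rule int_poly_finite)
  have "coeff ?q 0 \<in> \<int>" by (rule qi)
  then obtain m where m: "a = of_int m" by (auto simp: q elim: Ints_cases)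
  have "of_int m = - (\<iota> ?y * \<iota> (poly q' ?y))"
  proof -
    have "a = - (?y * poly q' ?y)" using a by (simp add: eq_neg_iff_add_eq_0)
    hence "\<iota> a = \<iota> (- (?y * poly q' ?y))" by simp
    thus ?thesis by (simp only: m iota_of_int i.hom_uminus i.hom_mult)
  qed
  hence "st (of_int m) = - (st (\<iota> ?y) * st (\<iota> (poly q' ?y)))"
    using y(1) f by (simp add: st_uminus finite_mult st_mult)
  hence "m = 0" using y(2) by (simp add: st_of_int)
  hence "coeff ?q 0 = 0" using m q by simp
  thus False using p(2) by simp
qed

definition real_emb :: "'f \<Rightarrow> real" where "real_emb x = st (\<iota> x)"

lemma real_emb_add: "\<sigma> x = x \<Longrightarrow> \<sigma> y = y \<Longrightarrow> real_emb (x + y) = real_emb x + real_emb y"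
  by (simp add: real_emb_def i.hom_add st_add const_finite)

lemma real_emb_mult: "\<sigma> x = x \<Longrightarrow> \<sigma> y = y \<Longrightarrow> real_emb (x * y) = real_emb x * real_emb y"
  by (simp add: real_emb_def i.hom_mult st_mult const_finite)

lemma real_emb_uminus: "\<sigma> x = x \<Longrightarrow> real_emb (- x) = - real_emb x"
  by (simp add: real_emb_def i.hom_uminus st_uminus const_finite)

lemma real_emb_diff: "\<sigma> x = x \<Longrightarrow> \<sigma> y = y \<Longrightarrow> real_emb (x - y) = real_emb x - real_emb y"
  using real_emb_add[of x "- y"] real_emb_uminus[of y] by (simp add: s.hom_uminus)

lemma real_emb_0: "real_emb 0 = 0" and real_emb_1: "real_emb 1 = 1"
  by (simp_all add: real_emb_def st_0 st_1)

text \<open>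
  The standard part embeds the fixed field of \<open>\<sigma>\<close> into the reals. If \<open>\<sigma>\<close> is not trivial, the whole field is generated
  by an element \<open>\<alpha>\<close> with \<open>\<sigma> \<alpha> = - \<alpha>\<close>. Here \<open>- (\<alpha> * \<alpha>)\<close> is a norm, hence
  positive, so that \<open>\<alpha>\<close> can be sent to a purely imaginary number.
\<close>
lemma complex_embedding:
  obtains C :: "'f \<Rightarrow> complex" where "field_hom C" "\<And>x. C (\<sigma> x) = cnj (C x)"
    "\<And>x. \<sigma> x = x \<Longrightarrow> C x = of_real (real_emb x)"
proof (cases "\<forall>x. \<sigma> x = x")
  case True
  show ?thesis
  proof (rule that[of "\<lambda>x. of_real (real_emb x)"])
    show "field_hom (\<lambda>x. complex_of_real (real_emb x))"
      by unfold_locales (use True in \<open>simp_all add: real_emb_add real_emb_mult real_emb_0 real_emb_1\<close>)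
  qed (use True in simp_all)
next
  case False
  then obtain b where b: "\<sigma> b \<noteq> b" by blast
  define \<alpha> where "\<alpha> = b - \<sigma> b"
  have al: "\<alpha> \<noteq> 0" "\<sigma> \<alpha> = - \<alpha>" using b by (auto simp: \<alpha>_def s.hom_minus)
  define re where "re = (\<lambda>x. (x + \<sigma> x) / 2)"
  define im where "im = (\<lambda>x. (x - \<sigma> x) / (2 * \<alpha>))"
  have two: "\<sigma> 2 = 2" by (metis one_add_one s.hom_add s.hom_one)
  have sdiv: "\<sigma> (x / y) = \<sigma> x / \<sigma> y" for x y by (simp add: divide_inverse s.hom_mult s.hom_inverse)
  have fx: "\<sigma> (re x) = re x" "\<sigma> (im x) = im x" for x
  proof -
    show "\<sigma> (re x) = re x" by (simp add: re_def sdiv two s.hom_add add.commute)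
    have "\<sigma> (im x) = (\<sigma> x - x) / (- (2 * \<alpha>))"
      by (simp add: im_def sdiv two s.hom_minus s.hom_mult al)
    thus "\<sigma> (im x) = im x" by (simp add: im_def divide_simps)
  qed
  define d where "d = - (\<alpha> * \<alpha>)"
  have fd: "\<sigma> d = d" by (simp add: d_def s.hom_uminus s.hom_mult al)
  have "\<iota> d = \<iota> \<alpha> * J (\<iota> \<alpha>)" by (simp add: d_def J_iota al i.hom_uminus i.hom_mult)
  hence "\<iota> d \<in> T" using norm_T by metis
  hence d0: "0 \<le> real_emb d" unfolding real_emb_def by (intro st_nonneg const_finite fd)
  define C where "C = (\<lambda>x. Complex (real_emb (re x)) (real_emb (im x) * sqrt (real_emb d)))"
  have mult: "re (x * y) = re x * re y - im x * im y * d" "im (x * y) = re x * im y + im x * re y" for x y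
    using al(1) by (simp_all add: re_def im_def d_def s.hom_mult field_simps)
  have sq: "sqrt (real_emb d) * sqrt (real_emb d) = real_emb d" using d0 by simp
  have fm: "\<sigma> (x * y) = x * y" if "\<sigma> x = x" "\<sigma> y = y" for x y using that by (simp add: s.hom_mult)
  have Cm: "C (x * y) = C x * C y" for x y
  proof -
    have 1: "real_emb (re (x * y)) = real_emb (re x) * real_emb (re y) - real_emb (im x) * real_emb (im y) * real_emb d"
      unfolding mult by (simp add: real_emb_diff real_emb_mult fm fx fd)
    have 2: "real_emb (im (x * y)) = real_emb (re x) * real_emb (im y) + real_emb (im x) * real_emb (re y)"
      unfolding mult by (simp add: real_emb_add real_emb_mult fm fx)
    have 3: "real_emb (im x) * sqrt (real_emb d) * (real_emb (im y) * sqrt (real_emb d)) =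
        real_emb (im x) * real_emb (im y) * real_emb d"
      using sq by (metis mult.assoc mult.left_commute)
    show ?thesis
    proof (rule complex_eqI)
      show "Re (C (x * y)) = Re (C x * C y)" by (simp only: C_def complex.sel times_complex.simps 1 3)
      show "Im (C (x * y)) = Im (C x * C y)" by (simp add: C_def 2 algebra_simps)
    qed
  qed
  have Ca: "C (x + y) = C x + C y" for x y
  proof -
    have "re (x + y) = re x + re y" "im (x + y) = im x + im y"
      by (simp_all add: re_def im_def s.hom_add add_divide_distrib diff_divide_distrib)
    thus ?thesis by (simp add: C_def complex_eq_iff real_emb_add fx distrib_right)
  qed
  have C0: "C 0 = 0" "C 1 = 1"
    by (simp_all add: C_def complex_eq_iff re_def im_def real_emb_0 real_emb_1)
  show ?thesis
  proof (rule that[of C])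
    show "field_hom C" by unfold_locales (simp_all add: Cm Ca C0)
    show "C (\<sigma> x) = cnj (C x)" for x
    proof -
      have "re (\<sigma> x) = re x" "im (\<sigma> x) = - im x"
        by (simp_all add: re_def im_def add.commute minus_divide_left)
      thus ?thesis by (simp add: C_def complex_eq_iff real_emb_uminus fx)
    qed
    show "C x = of_real (real_emb x)" if "\<sigma> x = x" for x
      using that by (simp add: C_def complex_eq_iff re_def im_def real_emb_0)
  qed
qed

end

lemma algebraic_field_hom:
  fixes C :: "'f::field_char_0 \<Rightarrow> 'g::field_char_0"
  assumes "field_hom C" "algebraic x"
  shows "algebraic (C x)"
proof -
  interpret C: field_hom C by fact
  have Cn: "C (of_nat n) = of_nat n" for n by (induction n) (simp_all add: C.hom_add)
  have Ci: "C (of_int m) = of_int m" for m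
    by (cases m rule: int_cases2) (simp_all add: Cn C.hom_uminus)
  obtain p where p: "\<And>i. coeff p i \<in> \<int>" "p \<noteq> 0" "poly p x = 0"
    using assms(2) by (auto simp: algebraic_def)
  have "coeff (map_poly C p) i \<in> \<int>" for i
  proof -
    obtain m where "coeff p i = of_int m" using p(1)[of i] by (auto elim: Ints_cases)
    thus ?thesis by (simp add: Ci)
  qed
  moreover have "map_poly C p \<noteq> 0" using p(2) by simp
  moreover have "poly (map_poly C p) (C x) = 0" using p(3) by simp
  ultimately show ?thesis unfolding algebraic_def by blast
qed

text \<open>
  The element \<open>u\<close> is a coordinate on the real line. Its standard part is an endpoint of the interval found below.
\<close>
locale embedded_real_place = real_place K0 T \<sigma> \<iota> J
  for K0 T :: "'k::field set" and \<sigma> :: "'f::field_char_0 \<Rightarrow> 'f" and \<iota> :: "'f \<Rightarrow> 'k" and J :: "'k \<Rightarrow> 'k" +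
  fixes C :: "'f \<Rightarrow> complex" and u :: 'k
  assumes C: "field_hom C" and C_sigma: "\<And>x. C (\<sigma> x) = cnj (C x)"
    and C_real: "\<And>x. \<sigma> x = x \<Longrightarrow> C x = of_real (real_emb x)"
    and u_K0: "J u = u" and u_finite: "finite_elt u"
    and u_transcendental: "\<And>p. p \<noteq> 0 \<Longrightarrow> poly (map_poly \<iota> p) u \<noteq> 0"
begin

sublocale C: field_hom C by (rule C)
sublocale mC: map_poly_idom_hom C ..
sublocale mi: map_poly_idom_hom \<iota> ..
sublocale ms: map_poly_inj_idom_hom \<sigma> ..

definition real_poly :: "'f poly \<Rightarrow> real poly" where
  "real_poly p = map_poly (\<lambda>a. Re (C a)) p"

lemma coeff_real_poly [simp]: "coeff (real_poly p) i = Re (C (coeff p i))"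
  by (simp add: real_poly_def coeff_map_poly)

abbreviation fixed_poly :: "'f poly \<Rightarrow> bool" where "fixed_poly p \<equiv> map_poly \<sigma> p = p"

lemma fixed_poly_coeff: "fixed_poly p \<Longrightarrow> \<sigma> (coeff p i) = coeff p i"
  by (metis s.coeff_map_poly_hom)

lemma map_C_real:
  assumes "fixed_poly p"
  shows "map_poly C p = map_poly of_real (real_poly p)"
proof (rule poly_eqI)
  fix i
  have "C (coeff p i) = of_real (real_emb (coeff p i))" by (rule C_real[OF fixed_poly_coeff[OF assms]])
  thus "coeff (map_poly C p) i = coeff (map_poly of_real (real_poly p)) i"
    by (simp add: coeff_map_poly)
qed

lemma poly_of_real: "poly (map_poly of_real q) (of_real x) = (of_real (poly q x) :: complex)"
  by (induction q) (simp_all add: map_poly_pCons)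

lemma poly_C_real: "fixed_poly p \<Longrightarrow> poly (map_poly C p) (of_real x) = of_real (poly (real_poly p) x)"
  by (simp add: map_C_real poly_of_real)

lemma poly_real_mult:
  assumes "fixed_poly p" "fixed_poly q"
  shows "poly (real_poly (p * q)) x = poly (real_poly p) x * poly (real_poly q) x"
proof -
  have "fixed_poly (p * q)" using assms by (simp add: ms.hom_mult)
  hence "of_real (poly (real_poly (p * q)) x) = poly (map_poly C (p * q)) (of_real x)"
    by (simp add: poly_C_real)
  also have "\<dots> = of_real (poly (real_poly p) x * poly (real_poly q) x)"
    using assms by (simp add: mC.hom_mult poly_C_real)
  finally show ?thesis by (simp only: of_real_eq_iff)
qed

lemma fixed_poly_power: "fixed_poly p \<Longrightarrow> fixed_poly (p ^ k)"
  by (induction k) (simp_all add: ms.hom_mult)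

lemma poly_real_power:
  assumes "fixed_poly p"
  shows "poly (real_poly (p ^ k)) x = poly (real_poly p) x ^ k"
proof (induction k)
  case 0
  have "real_poly 1 = 1" by (rule poly_eqI) (simp add: coeff_1)
  thus ?case by simp
next
  case (Suc k)
  thus ?case using assms fixed_poly_power by (simp add: poly_real_mult)
qed

abbreviation ev :: "'f poly \<Rightarrow> 'k" where "ev p \<equiv> poly (map_poly \<iota> p) u"

lemma ev_K0: "fixed_poly p \<Longrightarrow> ev p \<in> K0"
proof (induction p)
  case (pCons a p)
  have f: "\<sigma> a = a" "fixed_poly p" using pCons.prems by (simp_all add: s.map_poly_pCons_hom)
  have "u \<in> K0" using u_K0 by (simp add: K0_eq)
  thus ?case using pCons.IH[OF f(2)] iota_K0[OF f(1)]
    by (simp add: i.map_poly_pCons_hom K0_add K0_mult)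
qed (simp add: K0_0)

lemma ev_finite: "fixed_poly p \<Longrightarrow> finite_elt (ev p) \<and> st (ev p) = poly (real_poly p) (st u)"
proof (induction p)
  case 0
  have "real_poly 0 = 0" by (rule poly_eqI) simp
  thus ?case by (simp add: finite_0 st_0)
next
  case (pCons a p)
  have f: "\<sigma> a = a" "fixed_poly p" using pCons.prems by (simp_all add: s.map_poly_pCons_hom)
  have r: "real_poly (pCons a p) = pCons (Re (C a)) (real_poly p)"
    by (rule poly_eqI) (simp add: coeff_pCons split: nat.split)
  have "st (\<iota> a) = Re (C a)" using C_real[OF f(1)] by (simp add: real_emb_def)
  thus ?case using pCons.IH[OF f(2)] const_finite[OF f(1)] u_finite
    by (simp add: r i.map_poly_pCons_hom finite_add finite_mult st_add st_mult)
qed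

lemma ev_mult: "ev (p * q) = ev p * ev q" by (simp add: mi.hom_mult)

lemma ev_power: "ev (p ^ k) = ev p ^ k" by (induction k) (simp_all add: ev_mult)

lemma T_power: "x \<in> T \<Longrightarrow> x ^ k \<in> T" by (induction k) (auto intro: T_1 T_mult)

text \<open>
  The standard part \<open>c\<close> of \<open>u\<close> may be a common zero of some of the polynomials. All of them are then
  powers of one polynomial \<open>m\<close> with a simple zero at \<open>c\<close>, times a polynomial with no zero there, and
  the sign of \<open>m\<close> at \<open>u\<close> tells on which side of \<open>c\<close> the interval lies.
\<close>
lemma local_uniformizer:
  assumes root: "\<exists>q. q \<noteq> 0 \<and> poly (map_poly C q) (of_real (st u)) = 0"
  shows "\<exists>m. fixed_poly m \<and> ev m \<in> T \<and> ev m \<noteq> 0 \<and> poly (real_poly m) (st u) = 0 \<and>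
    poly (pderiv (real_poly m)) (st u) \<noteq> 0 \<and>
    (\<forall>p. fixed_poly p \<longrightarrow> p \<noteq> 0 \<longrightarrow>
       (\<exists>k h. p = m ^ k * h \<and> fixed_poly h \<and> poly (real_poly h) (st u) \<noteq> 0))"
proof -
  let ?c = "complex_of_real (st u)"
  let ?Z = "\<lambda>q. q \<noteq> 0 \<and> poly (map_poly C q) ?c = 0"
  obtain q0 where q0: "?Z q0" and min: "\<And>q. ?Z q \<Longrightarrow> degree q0 \<le> degree q"
    using ex_has_least_nat[of ?Z _ degree] root by metis
  define m0 where "m0 = smult (inverse (lead_coeff q0)) q0"
  have m0: "m0 \<noteq> 0" "degree m0 = degree q0" "lead_coeff m0 = 1" "poly (map_poly C m0) ?c = 0"
    using q0 by (simp_all add: m0_def C.map_poly_hom_smult)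
  have min0: "q = 0" if "poly (map_poly C q) ?c = 0" "degree q < degree m0" for q
    using min[of q] that m0(2) by auto
  have fm0: "fixed_poly m0"
  proof (rule ccontr)
    assume ne: "\<not> fixed_poly m0"
    let ?r = "map_poly \<sigma> m0 - m0"
    have "poly (map_poly C (map_poly \<sigma> m0)) ?c = cnj (poly (map_poly C m0) ?c)"
    proof (induction m0)
      case (pCons a p)
      thus ?case by (simp add: s.map_poly_pCons_hom C.map_poly_pCons_hom C_sigma)
    qed simp
    hence "poly (map_poly C ?r) ?c = 0" using m0(4) by (simp add: mC.hom_minus)
    moreover have "degree ?r < degree m0"
    proof -
      have le: "degree ?r \<le> degree m0" by (rule degree_diff_le) simp_all
      have "coeff ?r (degree m0) = 0" using m0(3) by simp
      hence "degree ?r \<noteq> degree m0" using ne by (metis eq_iff_diff_eq_0 leading_coeff_0_iff)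
      thus ?thesis using le by simp
    qed
    ultimately show False using min0 ne by (metis eq_iff_diff_eq_0)
  qed
  have deg: "0 < degree m0"
  proof (rule ccontr)
    assume "\<not> 0 < degree m0"
    then obtain a where "m0 = [:a:]" by (metis degree_eq_zeroE gr0I)
    thus False using m0 by simp
  qed
  have fact0: "\<exists>k h. p = m0 ^ k * h \<and> poly (map_poly C h) ?c \<noteq> 0" if "p \<noteq> 0" for p
    using that
  proof (induction "degree p" arbitrary: p rule: less_induct)
    case less
    show ?case
    proof (cases "poly (map_poly C p) ?c = 0")
      case True
      have "map_poly C (m0 * (p div m0) + p mod m0) = map_poly C p" by simp
      hence "map_poly C p = map_poly C m0 * map_poly C (p div m0) + map_poly C (p mod m0)"
        by (simp only: mC.hom_add mC.hom_mult)
      hence "poly (map_poly C p) ?c = poly (map_poly C m0 * map_poly C (p div m0) + map_poly C (p mod m0)) ?c"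
        by (rule arg_cong)
      hence "poly (map_poly C (p mod m0)) ?c = 0" unfolding True poly_add poly_mult m0(4) by simp
      moreover have "p mod m0 = 0 \<or> degree (p mod m0) < degree m0" using m0(1) by (rule degree_mod_less)
      ultimately have "p mod m0 = 0" using min0 by blast
      hence p: "p = m0 * (p div m0)" by (metis add.right_neutral mult_div_mod_eq)
      hence nz: "p div m0 \<noteq> 0" using less.prems by auto
      hence "degree p = degree m0 + degree (p div m0)" using p m0(1) degree_mult_eq by metis
      hence "degree (p div m0) < degree p" using deg by simp
      from less.hyps[OF this nz] obtain k h where kh: "p div m0 = m0 ^ k * h" "poly (map_poly C h) ?c \<noteq> 0"
        by blast
      have "p = m0 ^ Suc k * h" using p kh(1) by (simp add: mult.assoc)
      thus ?thesis using kh(2) by blast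
    next
      case False
      thus ?thesis by (intro exI[of _ 0] exI[of _ p]) simp
    qed
  qed
  have der0: "poly (map_poly C (pderiv m0)) ?c \<noteq> 0"
  proof
    assume "poly (map_poly C (pderiv m0)) ?c = 0"
    hence "pderiv m0 = 0" using min0[of "pderiv m0"] deg by (simp add: degree_pderiv)
    thus False using deg by (simp add: pderiv_eq_0_iff)
  qed
  \<comment> \<open>The sign of \<open>m0\<close> is changed so that its value at \<open>u\<close> is positive.\<close>
  define e :: 'f where "e = (if ev m0 \<in> T then 1 else - 1)"
  have e: "e * e = 1" "\<sigma> e = e" by (auto simp: e_def s.hom_uminus)
  have e0: "e \<noteq> 0" using e(1) by auto
  define m where "m = smult e m0"
  have fm: "fixed_poly m" using fm0 e(2) by (simp add: m_def s.map_poly_hom_smult)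
  have evm: "ev m = \<iota> e * ev m0" by (simp add: m_def i.map_poly_hom_smult)
  have "ev m \<in> T" using T_total[OF ev_K0[OF fm0]] by (auto simp: evm e_def i.hom_uminus)
  moreover have "ev m \<noteq> 0"
    using u_transcendental[OF m0(1)] e(1) by (auto simp: evm)
  moreover have "poly (map_poly C m) ?c = 0" using m0(4) by (simp add: m_def C.map_poly_hom_smult)
  hence "poly (real_poly m) (st u) = 0" using poly_C_real[OF fm] by simp
  moreover have "poly (pderiv (real_poly m)) (st u) \<noteq> 0"
  proof -
    have fpd: "fixed_poly (pderiv m)" using fm by (metis s.map_poly_pderiv)
    have Cn: "C (of_nat n) = of_nat n" for n by (induction n) (simp_all add: C.hom_add)
    have rp: "pderiv (real_poly m) = real_poly (pderiv m)"
    proof (rule poly_eqI)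
      fix i
      have "C (coeff (pderiv m) i) = of_nat (Suc i) * C (coeff m (Suc i))"
        by (simp only: coeff_pderiv C.hom_mult Cn)
      thus "coeff (pderiv (real_poly m)) i = coeff (real_poly (pderiv m)) i"
        by (simp add: coeff_pderiv)
    qed
    have "poly (map_poly C (pderiv m)) ?c = C e * poly (map_poly C (pderiv m0)) ?c"
      by (simp add: m_def pderiv_smult C.map_poly_hom_smult)
    also have "\<dots> \<noteq> 0" using der0 e(1) by auto
    finally show ?thesis using poly_C_real[OF fpd] rp by auto
  qed
  moreover have "\<exists>k h. p = m ^ k * h \<and> fixed_poly h \<and> poly (real_poly h) (st u) \<noteq> 0"
    if p: "fixed_poly p" "p \<noteq> 0" for p
  proof -
    obtain k h where kh: "p = m0 ^ k * h" "poly (map_poly C h) ?c \<noteq> 0" using fact0[OF p(2)] by blast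
    have "m0 ^ k * map_poly \<sigma> h = m0 ^ k * h"
      using p(1) fixed_poly_power[OF fm0, of k] unfolding kh(1) by (simp add: ms.hom_mult)
    hence fh: "fixed_poly h" using m0(1) by simp
    have ek: "e ^ k * e ^ k = 1" using e(1) by (simp flip: power_mult_distrib)
    have "p = m ^ k * smult (e ^ k) h"
      using ek by (simp add: m_def kh(1) smult_power mult.commute)
    moreover have feh: "fixed_poly (smult (e ^ k) h)"
    proof -
      have "\<sigma> (e ^ k) = e ^ k" using e(2) by (induction k) (simp_all add: s.hom_mult)
      thus ?thesis using fh by (simp add: s.map_poly_hom_smult)
    qed
    moreover have "poly (map_poly C (smult (e ^ k) h)) ?c \<noteq> 0"
      using kh(2) e0 by (simp add: C.map_poly_hom_smult)
    hence "complex_of_real (poly (real_poly (smult (e ^ k) h)) (st u)) \<noteq> 0"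
      by (simp only: poly_C_real[OF feh] not_False_eq_True)
    hence "poly (real_poly (smult (e ^ k) h)) (st u) \<noteq> 0" by simp
    ultimately show ?thesis by (intro exI[of _ k] exI[of _ "smult (e ^ k) h"] conjI)
  qed
  ultimately show ?thesis using fm by (intro exI[of _ m] conjI allI impI)
qed

lemma unit_eventually_positive:
  assumes "fixed_poly h" "ev h \<in> T" "poly (real_poly h) (st u) \<noteq> 0"
  shows "eventually (\<lambda>x. 0 < poly (real_poly h) x) (at (st u) within S)"
proof -
  have "0 \<le> poly (real_poly h) (st u)" using ev_finite[OF assms(1)] st_nonneg assms(2) by metis
  hence "0 < poly (real_poly h) (st u)" using assms(3) by simp
  moreover have "isCont (poly (real_poly h)) (st u)" by (rule poly_isCont)
  hence "(poly (real_poly h) \<longlongrightarrow> poly (real_poly h) (st u)) (at (st u) within S)"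
    by (metis isCont_def tendsto_within_subset subset_UNIV)
  ultimately show ?thesis by (rule order_tendstoD(1)[rotated])
qed

text \<open>
  All polynomials in \<open>ps\<close> are positive on that side of the standard part of \<open>u\<close> on which the uniformizer is positive.
\<close>
theorem positive_interval:
  assumes ps: "finite ps" "\<And>p. p \<in> ps \<Longrightarrow> fixed_poly p \<and> p \<noteq> 0 \<and> ev p \<in> T"
  shows "\<exists>l r. l < r \<and> (\<forall>x p. l < x \<longrightarrow> x < r \<longrightarrow> p \<in> ps \<longrightarrow> 0 < poly (real_poly p) x)"
proof -
  let ?c = "st u"
  have "\<exists>F\<in>{at_right ?c, at_left ?c}. \<forall>p\<in>ps. eventually (\<lambda>x. 0 < poly (real_poly p) x) F"
  proof (cases "\<exists>q. q \<noteq> 0 \<and> poly (map_poly C q) (of_real ?c) = 0")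
    case False
    have "eventually (\<lambda>x. 0 < poly (real_poly p) x) (at_right ?c)" if p: "p \<in> ps" for p
    proof (rule unit_eventually_positive)
      have "poly (map_poly C p) (of_real ?c) \<noteq> 0" using False ps(2)[OF p] by blast
      hence "complex_of_real (poly (real_poly p) ?c) \<noteq> 0" using poly_C_real[of p ?c] ps(2)[OF p] by simp
      thus "poly (real_poly p) ?c \<noteq> 0" by simp
    qed (use ps(2)[OF p] in auto)
    thus ?thesis by blast
  next
    case True
    from local_uniformizer[OF True] obtain m where m_all: "fixed_poly m \<and> ev m \<in> T \<and> ev m \<noteq> 0 \<and>
      poly (real_poly m) ?c = 0 \<and> poly (pderiv (real_poly m)) ?c \<noteq> 0 \<and>
      (\<forall>p. fixed_poly p \<longrightarrow> p \<noteq> 0 \<longrightarrow>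
         (\<exists>k h. p = m ^ k * h \<and> fixed_poly h \<and> poly (real_poly h) ?c \<noteq> 0))" ..
    note r1 = m_all[THEN conjunct2] and r2 = m_all[THEN conjunct2, THEN conjunct2]
    note m = m_all[THEN conjunct1] r1[THEN conjunct1] r2[THEN conjunct1] r2[THEN conjunct2, THEN conjunct1]
      r2[THEN conjunct2, THEN conjunct2, THEN conjunct1]
    note fac = r2[THEN conjunct2, THEN conjunct2, THEN conjunct2, rule_format]
    have der: "DERIV (poly (real_poly m)) ?c :> poly (pderiv (real_poly m)) ?c" by (rule poly_DERIV)
    obtain S where S: "S \<in> {{?c<..}, {..<?c}}"
      "eventually (\<lambda>x. 0 < poly (real_poly m) x) (at ?c within S)"
    proof (cases "0 < poly (pderiv (real_poly m)) ?c")
      case True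
      then obtain \<delta> where d: "0 < \<delta>" "\<And>h. 0 < h \<Longrightarrow> h < \<delta> \<Longrightarrow> poly (real_poly m) ?c < poly (real_poly m) (?c + h)"
        using DERIV_pos_inc_right[OF der] by blast
      have "eventually (\<lambda>x. 0 < poly (real_poly m) x) (at_right ?c)"
        unfolding eventually_at_right_field
      proof (intro exI[of _ "?c + \<delta>"] conjI allI impI)
        fix y assume "?c < y" "y < ?c + \<delta>"
        thus "0 < poly (real_poly m) y" using d(2)[of "y - ?c"] m(4) by simp
      qed (use d(1) in simp)
      thus ?thesis using that[of "{?c<..}"] by simp
    next
      case False
      hence "poly (pderiv (real_poly m)) ?c < 0" using m(5) by simp
      then obtain \<delta> where d: "0 < \<delta>" "\<And>h. 0 < h \<Longrightarrow> h < \<delta> \<Longrightarrow> poly (real_poly m) ?c < poly (real_poly m) (?c - h)"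
        using DERIV_neg_dec_left[OF der] by blast
      have "eventually (\<lambda>x. 0 < poly (real_poly m) x) (at_left ?c)"
        unfolding eventually_at_left_field
      proof (intro exI[of _ "?c - \<delta>"] conjI allI impI)
        fix y assume "?c - \<delta> < y" "y < ?c"
        thus "0 < poly (real_poly m) y" using d(2)[of "?c - y"] m(4) by simp
      qed (use d(1) in simp)
      thus ?thesis using that[of "{..<?c}"] by simp
    qed
    have "eventually (\<lambda>x. 0 < poly (real_poly p) x) (at ?c within S)" if p: "p \<in> ps" for p
    proof -
      have p': "fixed_poly p" "p \<noteq> 0" "ev p \<in> T" using ps(2)[OF p] by auto
      obtain k h where kh: "p = m ^ k * h" "fixed_poly h" "poly (real_poly h) ?c \<noteq> 0"
        using fac[OF p'(1,2)] by blast
      have "inverse (ev m ^ k) * ev p \<in> T" using m(2) p'(3) by (intro T_mult T_inverse T_power)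
      moreover have "inverse (ev m ^ k) * ev p = ev h" using m(3) by (simp add: kh(1) ev_mult ev_power flip: mult.assoc)
      ultimately have "ev h \<in> T" by simp
      hence "eventually (\<lambda>x. 0 < poly (real_poly h) x) (at ?c within S)"
        by (rule unit_eventually_positive[OF kh(2) _ kh(3)])
      with S(2) show ?thesis
      proof eventually_elim
        case (elim x)
        thus ?case unfolding kh(1)
          by (simp add: poly_real_mult[OF fixed_poly_power[OF m(1)] kh(2)] poly_real_power[OF m(1)])
      qed
    qed
    thus ?thesis using S(1) by auto
  qed
  then obtain F where F: "F \<in> {at_right ?c, at_left ?c}"
    "\<forall>p\<in>ps. eventually (\<lambda>x. 0 < poly (real_poly p) x) F" by blast
  have ev: "eventually (\<lambda>x. \<forall>p\<in>ps. 0 < poly (real_poly p) x) F"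
    by (rule eventually_ball_finite[OF ps(1) F(2)])
  from F(1) consider "F = at_right ?c" | "F = at_left ?c" by blast
  thus ?thesis
  proof cases
    case 1
    from ev[unfolded 1 eventually_at_right_field]
    obtain b where "?c < b \<and> (\<forall>y>?c. y < b \<longrightarrow> (\<forall>p\<in>ps. 0 < poly (real_poly p) y))" ..
    thus ?thesis by (intro exI[of _ ?c] exI[of _ b]) simp
  next
    case 2
    from ev[unfolded 2 eventually_at_left_field]
    obtain b where "b < ?c \<and> (\<forall>y>b. y < ?c \<longrightarrow> (\<forall>p\<in>ps. 0 < poly (real_poly p) y))" ..
    thus ?thesis by (intro exI[of _ b] exI[of _ ?c]) simp
  qed
qed

end

section \<open>Rational functions\<close>

lemma field_homI:
  fixes f :: "'a::field \<Rightarrow> 'b::field"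
  assumes "\<And>x y. f (x + y) = f x + f y" "\<And>x y. f (x * y) = f x * f y" "f 1 = 1"
  shows "field_hom f"
proof -
  have "f (0 + 0) = f 0 + f 0" by (rule assms(1))
  hence "f 0 + 0 = f 0 + f 0" by (simp only: add_0_right)
  hence "0 = f 0" by (rule add_left_imp_eq)
  hence "f 0 = 0" by simp
  thus ?thesis by unfold_locales (simp_all add: assms)
qed

lemma field_hom_comp: "field_hom f \<Longrightarrow> field_hom g \<Longrightarrow> field_hom (\<lambda>x. g (f x))"
proof -
  assume "field_hom f" "field_hom g"
  interpret f: field_hom f by fact
  interpret g: field_hom g by fact
  show ?thesis by (rule field_homI) (simp_all add: f.hom_add g.hom_add f.hom_mult g.hom_mult)
qed

lemma fract_lift_hom:
  fixes h :: "'a::idom \<Rightarrow> 'b::field"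
  assumes h: "comm_ring_hom h" and inj: "\<And>a. h a = 0 \<Longrightarrow> a = 0"
  shows "field_hom (fract_lift h)" "fract_lift h (to_fract a) = h a"
proof -
  interpret h: comm_ring_hom h by fact
  have F: "fract_lift h (Fraction_Field.Fract a b) = h a / h b" if "b \<noteq> 0" for a b
    using fract_lift_Fract[OF h inj that] .
  show "fract_lift h (to_fract a) = h a" using F[of 1 a] by (simp add: to_fract_def)
  show "field_hom (fract_lift h)"
  proof (rule field_homI)
    show "fract_lift h 1 = 1" using F[of 1 1] by (simp add: One_fract_def)
    fix x y :: "'a fract"
    obtain a b where x: "x = Fraction_Field.Fract a b" "b \<noteq> 0" by (cases x) auto
    obtain c d where y: "y = Fraction_Field.Fract c d" "d \<noteq> 0" by (cases y) auto
    have nz: "h b \<noteq> 0" "h d \<noteq> 0" using inj x(2) y(2) by blast+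
    have bd: "b * d \<noteq> 0" using x y by simp
    show "fract_lift h (x * y) = fract_lift h x * fract_lift h y"
      by (simp add: x(1) y(1) F[OF bd] F[OF x(2)] F[OF y(2)] h.hom_mult)
    show "fract_lift h (x + y) = fract_lift h x + fract_lift h y"
      using nz by (simp add: x y F[OF bd] F[OF x(2)] F[OF y(2)] h.hom_mult h.hom_add field_simps)
  qed
qed

definition ratconst :: "'k::field \<Rightarrow> 'k poly fract" where "ratconst c = to_fract [:c:]"

definition ratvar :: "'k::field poly fract" where "ratvar = to_fract [:0, 1:]"

lemma ratconst_hom: "field_hom (ratconst :: 'k::field \<Rightarrow> _)"
proof (rule field_homI)
  fix x y :: 'k
  have "[:x + y:] = [:x:] + [:y:]" "[:x * y:] = [:x:] * [:y:]" by simp_all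
  thus "ratconst (x + y) = ratconst x + ratconst y" "ratconst (x * y) = ratconst x * ratconst y"
    unfolding ratconst_def by (metis to_fract_add, metis to_fract_mult)
  show "ratconst (1 :: 'k) = 1" by (simp add: ratconst_def flip: one_pCons)
qed

lemma to_fract_pCons: "to_fract (pCons a p) = ratconst a + ratvar * to_fract p"
proof -
  have "pCons a p = [:a:] + [:0, 1:] * p" by simp
  thus ?thesis unfolding ratconst_def ratvar_def by (metis to_fract_add to_fract_mult)
qed

lemma to_fract_poly: "to_fract p = poly (map_poly ratconst p) ratvar"
proof -
  interpret c: field_hom ratconst by (rule ratconst_hom)
  show ?thesis
    by (induction p) (simp_all add: to_fract_pCons c.map_poly_pCons_hom)
qed

lemma ratfun_closed_induct:
  assumes const: "\<And>c. P (ratconst c)" and var: "P ratvar"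
    and add: "\<And>x y. P x \<Longrightarrow> P y \<Longrightarrow> P (x + y)" and mult: "\<And>x y. P x \<Longrightarrow> P y \<Longrightarrow> P (x * y)"
    and inv: "\<And>x. P x \<Longrightarrow> P (inverse x)"
  shows "P x"
proof -
  have poly: "P (to_fract p)" for p
  proof (induction p)
    case 0
    show ?case using const[of 0] by (simp add: ratconst_def)
  qed (simp add: to_fract_pCons const var add mult)
  obtain a b where x: "x = Fraction_Field.Fract a b" "b \<noteq> 0" by (cases x) auto
  have "x = to_fract a * inverse (to_fract b)" by (simp add: x(1) Fract_conv_to_fract divide_inverse)
  thus ?thesis using poly mult inv by simp
qed

text \<open>
  Two homomorphisms out of the field of rational functions are compared on its generators.
\<close>
lemma ratfun_hom_eqI:
  assumes "field_hom f" "field_hom g" "\<And>c. f (ratconst c) = g (ratconst c)" "f ratvar = g ratvar"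
  shows "f x = g x"
proof -
  interpret f: field_hom f by fact
  interpret g: field_hom g by fact
  show ?thesis
    by (rule ratfun_closed_induct)
      (simp_all add: assms(3,4) f.hom_add g.hom_add f.hom_mult g.hom_mult f.hom_inverse g.hom_inverse)
qed

lemma ratvar_nonzero: "ratvar \<noteq> 0"
  by (simp add: ratvar_def)

lemma comm_ring_hom_poly_eval:
  fixes f :: "'a::field \<Rightarrow> 'b::field"
  assumes "field_hom f"
  shows "comm_ring_hom (\<lambda>p. poly (map_poly f p) y)"
proof -
  interpret f: field_hom f by fact
  interpret m: map_poly_idom_hom f ..
  show ?thesis by unfold_locales (simp_all add: m.hom_add m.hom_mult)
qed

lemma poly_inverse_ratvar_eq_0:
  assumes "poly (map_poly ratconst p) (inverse ratvar) = 0"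
  shows "p = 0"
proof -
  interpret c: field_hom ratconst by (rule ratconst_hom)
  have r: "reflect_poly (map_poly ratconst p) = map_poly ratconst (reflect_poly p)"
    by (rule poly_eqI) (simp add: coeff_reflect_poly)
  have "poly (reflect_poly (map_poly ratconst p)) ratvar = 0"
    using poly_reflect_poly_nz[OF ratvar_nonzero, of "map_poly ratconst p"] assms by simp
  hence "to_fract (reflect_poly p) = 0" by (simp only: r to_fract_poly)
  thus ?thesis by simp
qed

lemma ratfun_inv_hom:
  fixes \<sigma> :: "'k::field \<Rightarrow> 'k"
  assumes "field_hom \<sigma>"
  shows "field_hom (ratfun_inv \<sigma>)" "ratfun_inv \<sigma> (ratconst c) = ratconst (\<sigma> c)"
    "ratfun_inv \<sigma> ratvar = inverse ratvar"
proof -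
  interpret s: field_hom \<sigma> by fact
  interpret c: field_hom "ratconst :: 'k \<Rightarrow> _" by (rule ratconst_hom)
  let ?f = "\<lambda>c. ratconst (\<sigma> c)"
  let ?h = "\<lambda>p. poly (map_poly ?f p) (inverse ratvar)"
  have f: "field_hom ?f" by (rule field_hom_comp[OF assms ratconst_hom])
  interpret f: field_hom ?f by (rule f)
  have h: "comm_ring_hom ?h" by (rule comm_ring_hom_poly_eval[OF f])
  have mp: "map_poly ?f p = map_poly ratconst (map_poly \<sigma> p)" for p
    by (rule poly_eqI) simp
  have inj: "p = 0" if "?h p = 0" for p
    using poly_inverse_ratvar_eq_0[of "map_poly \<sigma> p"] that by (simp add: mp)
  have eq: "ratfun_inv \<sigma> = fract_lift ?h"
    by (simp add: ratfun_inv_def ratconst_def ratvar_def)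
  show "field_hom (ratfun_inv \<sigma>)" unfolding eq by (rule fract_lift_hom(1)[OF h inj])
  show "ratfun_inv \<sigma> (ratconst c) = ratconst (\<sigma> c)"
    using fract_lift_hom(2)[OF h inj, of "[:c:]"] by (simp add: eq ratconst_def[of c] f.map_poly_pCons_hom)
  show "ratfun_inv \<sigma> ratvar = inverse ratvar"
    using fract_lift_hom(2)[OF h inj, of "[:0, 1:]"]
    unfolding eq by (simp only: ratvar_def[symmetric]) (simp add: f.map_poly_pCons_hom)
qed

lemma ratfun_inv_involution:
  fixes \<sigma> :: "'k::field \<Rightarrow> 'k"
  assumes "field_involution \<sigma>"
  shows "field_involution (ratfun_inv \<sigma>)"
proof -
  have s: "field_hom \<sigma>" "\<And>x. \<sigma> (\<sigma> x) = x" using assms by (auto simp: field_involution_def)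
  note J = ratfun_inv_hom[OF s(1)]
  interpret J: field_hom "ratfun_inv \<sigma>" by (rule J(1))
  have id: "field_hom (\<lambda>x :: 'k poly fract. x)" by (rule field_homI) simp_all
  have "ratfun_inv \<sigma> (ratfun_inv \<sigma> x) = x" for x
    by (rule ratfun_hom_eqI[OF field_hom_comp[OF J(1) J(1)] id]) (simp_all add: J s J.hom_inverse)
  thus ?thesis using J(1) by (simp add: field_involution_def)
qed

lemma ratfun_map_hom:
  fixes \<rho> :: "'k::field \<Rightarrow> 'l::field"
  assumes "field_hom \<rho>"
  shows "field_hom (ratfun_map \<rho>)" "ratfun_map \<rho> (ratconst c) = ratconst (\<rho> c)"
    "ratfun_map \<rho> ratvar = ratvar"
proof -
  interpret r: field_hom \<rho> by fact
  interpret m: map_poly_idom_hom \<rho> ..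
  let ?h = "\<lambda>p. to_fract (map_poly \<rho> p)"
  have h: "comm_ring_hom ?h" by unfold_locales (simp_all add: m.hom_add m.hom_mult)
  have inj: "p = 0" if "?h p = 0" for p using that by simp
  show "field_hom (ratfun_map \<rho>)" unfolding ratfun_map_def by (rule fract_lift_hom(1)[OF h inj])
  show "ratfun_map \<rho> (ratconst c) = ratconst (\<rho> c)"
    unfolding ratfun_map_def ratconst_def using fract_lift_hom(2)[OF h inj, of "[:c:]"]
    by (simp add: r.map_poly_pCons_hom)
  show "ratfun_map \<rho> ratvar = ratvar"
    unfolding ratfun_map_def ratvar_def using fract_lift_hom(2)[OF h inj, of "[:0, 1:]"]
    by (simp add: r.map_poly_pCons_hom)
qed

lemma of_qbar_hom: "field_hom of_qbar"
  by (rule field_homI) (simp_all add: plus_qbar.rep_eq times_qbar.rep_eq one_qbar.rep_eq)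

text \<open>The adjunction of the coefficients and of the root is a finite extension of the ground field.\<close>
lemma (in field) algebraic_over_finite_extension:
  assumes K: "subfield K R" and xs: "set xs \<subseteq> carrier R" "\<And>x. x \<in> set xs \<Longrightarrow> (algebraic over K) x"
    and p: "p \<in> carrier (univ_poly R (finite_extension K xs))" "p \<noteq> []" "eval p z = \<zero>" and z: "z \<in> carrier R"
  shows "(algebraic over K) z"
proof -
  let ?K = "finite_extension K xs"
  have K': "subfield ?K R" by (rule finite_extension_is_subfield[OF K xs])
  have fK: "finite_dimension K ?K" by (rule finite_extension_finite_dimension(1)[OF K xs])
  have "(algebraic over ?K) z" by (rule algebraicI[OF p])
  hence fz: "finite_dimension ?K (simple_extension ?K z)"
    using finite_dimension_simple_extension[OF K' z] by simp
  have "finite_dimension K (simple_extension ?K z)"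
    by (rule telescopic_base_dim(1)[OF K K' fK fz])
  thus ?thesis
    by (rule finite_dimension_imp_algebraic[OF K simple_extension_is_subring[OF subfieldE(1)[OF K'] z]])
      (rule simple_extension_mem[OF subfieldE(1)[OF K'] z])
qed

lemma algebraic_root_qbar:
  assumes p: "p \<noteq> 0" "poly (map_poly of_qbar p) z = 0"
  shows "algebraic z"
proof -
  let ?R = "class_ring :: complex ring"
  interpret q: field_hom of_qbar by (rule of_qbar_hom)
  let ?p = "map_poly of_qbar p"
  let ?xs = "coeffs ?p"
  have xs: "set ?xs \<subseteq> carrier ?R" by simp
  have alg: "(ring.algebraic ?R over \<rat>) x" if xm: "x \<in> set ?xs" for x
  proof -
    obtain y where "x = of_qbar y" using xm by auto
    thus ?thesis using of_qbar[of y] by (simp add: algebraic_iff_over_Rats[symmetric])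
  qed
  have mem: "set ?xs \<subseteq> ring.finite_extension ?R \<rat> ?xs"
    by (rule domain.finite_extension_mem[OF field.axioms(1)[OF class_field] subfieldE(1)[OF subfield_Rats] xs])
  let ?l = "rev ?xs"
  have p0: "?p \<noteq> 0" using p(1) by simp
  hence "hd ?l \<noteq> 0" by (simp add: hd_rev last_coeffs_eq_coeff_degree del: q.coeffs_map_poly_hom q.hom_lead_coeff)
  hence l1: "?l \<in> carrier (univ_poly ?R (ring.finite_extension ?R \<rat> ?xs))"
    using mem by (simp add: univ_poly_def polynomial_def)
  have l2: "?l \<noteq> []" using p0 by simp
  have l3: "ring.eval ?R ?l z = \<zero>\<^bsub>?R\<^esub>" using p(2) by (simp add: eval_class_ring del: q.coeffs_map_poly_hom)
  have "(ring.algebraic ?R over \<rat>) z"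
    by (rule field.algebraic_over_finite_extension[OF class_field subfield_Rats xs _ l1 l2 l3])
      (rule alg, assumption, simp)
  thus ?thesis by (simp add: algebraic_iff_over_Rats)
qed

lemma ratfun_eval_hom:
  assumes "\<not> algebraic z"
  shows "field_hom (ratfun_eval z)" "ratfun_eval z (ratconst c) = of_qbar c" "ratfun_eval z ratvar = z"
proof -
  interpret q: field_hom of_qbar by (rule of_qbar_hom)
  let ?h = "\<lambda>p. poly (map_poly of_qbar p) z"
  have h: "comm_ring_hom ?h" by (rule comm_ring_hom_poly_eval[OF of_qbar_hom])
  have inj: "p = 0" if "?h p = 0" for p using algebraic_root_qbar that assms by blast
  show "field_hom (ratfun_eval z)" unfolding ratfun_eval_def by (rule fract_lift_hom(1)[OF h inj])
  show "ratfun_eval z (ratconst c) = of_qbar c"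
    unfolding ratfun_eval_def ratconst_def using fract_lift_hom(2)[OF h inj, of "[:c:]"]
    by (simp add: q.map_poly_pCons_hom)
  show "ratfun_eval z ratvar = z"
    unfolding ratfun_eval_def ratvar_def using fract_lift_hom(2)[OF h inj, of "[:0, 1:]"]
    by (simp add: q.map_poly_pCons_hom)
qed

lemma cnj_qbar_involution: "field_involution cnj_qbar"
proof -
  have "field_hom cnj_qbar"
    by (rule field_homI; transfer) simp_all
  moreover have "cnj_qbar (cnj_qbar x) = x" for x by transfer simp
  ultimately show ?thesis by (simp add: field_involution_def)
qed

lemma countable_algebraic: "countable {x :: complex. algebraic x}"
proof -
  let ?P = "\<lambda>cs :: int list. Poly (map of_int cs) :: complex poly"
  have "{x :: complex. algebraic x} \<subseteq> (\<Union>cs\<in>{cs. ?P cs \<noteq> 0}. {x. poly (?P cs) x = 0})"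
  proof
    fix x :: complex assume "x \<in> {x. algebraic x}"
    then obtain p where p: "\<And>i. coeff p i \<in> \<int>" "p \<noteq> 0" "poly p x = 0" by (auto simp: algebraic_def)
    have ints: "\<exists>cs. as = map of_int cs" if "set as \<subseteq> (\<int> :: complex set)" for as
      using that
    proof (induction as)
      case (Cons a as)
      obtain cs where "as = map of_int cs" using Cons by auto
      moreover obtain m where "a = of_int m" using Cons.prems by (auto elim: Ints_cases)
      ultimately have "a # as = map of_int (m # cs)" by simp
      thus ?case by (rule exI)
    qed simp
    have "set (coeffs p) \<subseteq> \<int>"
    proof
      fix a assume "a \<in> set (coeffs p)"
      hence "a \<in> range (coeff p)" unfolding range_coeff by simp
      thus "a \<in> \<int>" using p(1) by auto
    qed
    hence "\<exists>cs. coeffs p = map of_int cs" by (rule ints)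
    then obtain cs where "coeffs p = map of_int cs" by blast
    hence "?P cs = p" by (metis Poly_coeffs)
    thus "x \<in> (\<Union>cs\<in>{cs. ?P cs \<noteq> 0}. {x. poly (?P cs) x = 0})" using p by blast
  qed
  moreover have "countable (\<Union>cs\<in>{cs. ?P cs \<noteq> 0}. {x. poly (?P cs) x = 0})"
    by (rule countable_UN, rule countableI_type, rule countable_finite) (simp add: poly_roots_finite)
  ultimately show ?thesis by (rule countable_subset)
qed

section \<open>A real coordinate on the field of rational functions\<close>

text \<open>
  The element \<open>\<gamma>\<close> generates a quadratic extension of the field of functions in \<open>u\<close> whose non-trivial automorphism is given by \<open>J\<close>.
\<close>
locale real_coordinate = embedded_real_place K0 T \<sigma> \<iota> J C u
  for K0 T :: "'k::field set" and \<sigma> :: "'f::field_char_0 \<Rightarrow> 'f" and \<iota> :: "'f \<Rightarrow> 'k" and J :: "'k \<Rightarrow> 'k"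
    and C :: "'f \<Rightarrow> complex" and u :: 'k +
  fixes \<gamma> :: 'k and G :: "'f poly"
  assumes gamma: "J \<gamma> = - \<gamma>" "\<gamma> \<noteq> 0" "\<gamma> * \<gamma> = ev G" and fixed_G: "fixed_poly G"
begin

text \<open>Membership in the quadratic extension, by \<open>\<gamma>\<close>, of the field generated by \<open>u\<close> and the fixed constants.\<close>
definition repr :: "'k \<Rightarrow> bool" where
  "repr x \<longleftrightarrow> (\<exists>Q Y Z. fixed_poly Q \<and> fixed_poly Y \<and> fixed_poly Z \<and> ev Q \<noteq> 0 \<and> ev Q * x = ev Y + ev Z * \<gamma>)"

lemma reprI: "fixed_poly Q \<Longrightarrow> fixed_poly Y \<Longrightarrow> fixed_poly Z \<Longrightarrow> ev Q \<noteq> 0 \<Longrightarrow>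
    ev Q * x = ev Y + ev Z * \<gamma> \<Longrightarrow> repr x"
  unfolding repr_def by blast

lemma ev_add: "ev (p + q) = ev p + ev q" by (simp add: mi.hom_add)
lemma ev_minus: "ev (p - q) = ev p - ev q" by (simp add: mi.hom_minus)
lemma ev_const: "ev [:c:] = \<iota> c" by (simp add: i.map_poly_pCons_hom)
lemma ev_var: "ev [:0, 1:] = u" by (simp add: i.map_poly_pCons_hom)

lemma fixed_const: "\<sigma> c = c \<Longrightarrow> fixed_poly [:c:]" by (simp add: s.map_poly_pCons_hom)
lemma fixed_var: "fixed_poly [:0, 1:]" by (simp add: s.map_poly_pCons_hom)

lemmas fixed_intros = ms.hom_add ms.hom_minus ms.hom_mult

lemma repr_add: assumes "repr x" "repr y" shows "repr (x + y)"
proof -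
  obtain Q Y Z where 1: "fixed_poly Q" "fixed_poly Y" "fixed_poly Z" "ev Q \<noteq> 0" "ev Q * x = ev Y + ev Z * \<gamma>"
    using assms(1) unfolding repr_def by blast
  obtain Q' Y' Z' where 2: "fixed_poly Q'" "fixed_poly Y'" "fixed_poly Z'" "ev Q' \<noteq> 0" "ev Q' * y = ev Y' + ev Z' * \<gamma>"
    using assms(2) unfolding repr_def by blast
  show ?thesis
  proof (rule reprI[of "Q * Q'" "Q' * Y + Q * Y'" "Q' * Z + Q * Z'"])
    have "ev Q * ev Q' * (x + y) = ev Q' * (ev Q * x) + ev Q * (ev Q' * y)" by (simp add: algebra_simps)
    thus "ev (Q * Q') * (x + y) = ev (Q' * Y + Q * Y') + ev (Q' * Z + Q * Z') * \<gamma>"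
      unfolding 1(5) 2(5) by (simp only: ev_add ev_mult) (simp only: algebra_simps)
  qed (use 1(1-4) 2(1-4) in \<open>simp_all only: fixed_intros ev_mult mult_eq_0_iff simp_thms\<close>)
qed

lemma repr_mult: assumes "repr x" "repr y" shows "repr (x * y)"
proof -
  obtain Q Y Z where 1: "fixed_poly Q" "fixed_poly Y" "fixed_poly Z" "ev Q \<noteq> 0" "ev Q * x = ev Y + ev Z * \<gamma>"
    using assms(1) unfolding repr_def by blast
  obtain Q' Y' Z' where 2: "fixed_poly Q'" "fixed_poly Y'" "fixed_poly Z'" "ev Q' \<noteq> 0" "ev Q' * y = ev Y' + ev Z' * \<gamma>"
    using assms(2) unfolding repr_def by blast
  show ?thesis
  proof (rule reprI[of "Q * Q'" "Y * Y' + Z * Z' * G" "Y * Z' + Z * Y'"])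
    have "ev Q * ev Q' * (x * y) = (ev Q * x) * (ev Q' * y)" by (simp only: ac_simps)
    also have "\<dots> = ev Y * ev Y' + ev Z * ev Z' * (\<gamma> * \<gamma>) + (ev Y * ev Z' + ev Z * ev Y') * \<gamma>"
      unfolding 1(5) 2(5) by (simp only: algebra_simps)
    finally show "ev (Q * Q') * (x * y) = ev (Y * Y' + Z * Z' * G) + ev (Y * Z' + Z * Y') * \<gamma>"
      by (simp only: ev_add ev_mult gamma(3))
  qed (use 1(1-4) 2(1-4) fixed_G in \<open>simp_all only: fixed_intros ev_mult mult_eq_0_iff simp_thms\<close>)
qed

lemma J_ev: "fixed_poly p \<Longrightarrow> J (ev p) = ev p" using ev_K0 by (simp add: K0_eq)

text \<open>The denominator is made real by multiplication with the conjugate.\<close>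
lemma repr_inverse: assumes "repr x" shows "repr (inverse x)"
proof (cases "x = 0")
  case False
  obtain Q Y Z where 1: "fixed_poly Q" "fixed_poly Y" "fixed_poly Z" "ev Q \<noteq> 0" "ev Q * x = ev Y + ev Z * \<gamma>"
    using assms(1) unfolding repr_def by blast
  have c: "ev Y - ev Z * \<gamma> = J (ev Q * x)"
    unfolding 1(5) using 1(2,3) by (simp add: J.hom_add J.hom_mult J_ev gamma(1))
  have "ev Q * x \<noteq> 0" using 1(4) False by simp
  moreover have "J (ev Q * x) \<noteq> 0" using 1(4) False by simp
  moreover have n: "ev (Y * Y - Z * Z * G) = (ev Q * x) * (ev Y - ev Z * \<gamma>)"
    unfolding 1(5) by (simp only: ev_minus ev_mult gamma(3)[symmetric]) (simp add: algebra_simps)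
  ultimately have nz: "ev (Y * Y - Z * Z * G) \<noteq> 0" by (simp add: c)
  show ?thesis
  proof (rule reprI[OF _ _ _ nz, of "Q * Y" "- (Q * Z)"])
    show "ev (Y * Y - Z * Z * G) * inverse x = ev (Q * Y) + ev (- (Q * Z)) * \<gamma>"
    proof -
      have "ev Q * x * (ev Y - ev Z * \<gamma>) * inverse x = ev Q * (ev Y - ev Z * \<gamma>) * (x * inverse x)"
        by (simp only: ac_simps)
      also have "x * inverse x = 1" using False by simp
      finally show ?thesis unfolding n by (simp add: ev_mult mi.hom_uminus algebra_simps)
    qed
  qed (use 1(1-3) fixed_G in \<open>simp_all add: fixed_intros ms.hom_uminus\<close>)
qed (use assms in simp)

lemma repr_base: "repr u" "repr \<gamma>" "\<sigma> c = c \<Longrightarrow> repr (\<iota> c)"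
proof -
  have f1: "fixed_poly 1" "fixed_poly 0" by simp_all
  have e1: "ev 1 = 1" "ev 0 = 0" by simp_all
  show "repr u" by (rule reprI[OF f1(1) fixed_var f1(2)]) (simp_all add: e1 ev_var del: map_poly_1)
  show "repr \<gamma>" by (rule reprI[OF f1(1) f1(2) f1(1)]) (simp_all add: e1)
  show "\<sigma> c = c \<Longrightarrow> repr (\<iota> c)"
    by (rule reprI[OF f1(1) fixed_const f1(2)]) (simp_all add: ev_const)
qed

lemma repr_fixed:
  assumes "repr x" "J x = x"
  obtains Q P where "fixed_poly Q" "fixed_poly P" "ev Q \<noteq> 0" "x * (ev Q * ev Q) = ev P"
proof -
  obtain Q Y Z where 1: "fixed_poly Q" "fixed_poly Y" "fixed_poly Z" "ev Q \<noteq> 0" "ev Q * x = ev Y + ev Z * \<gamma>"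
    using assms(1) unfolding repr_def by blast
  have "J (ev Q * x) = ev Q * x" using 1(1) assms(2) by (simp add: J.hom_mult J_ev)
  hence "ev Y - ev Z * \<gamma> = ev Y + ev Z * \<gamma>"
    unfolding 1(5) using 1(2,3) by (simp add: J.hom_add J.hom_mult J_ev gamma(1))
  hence "of_nat 2 * (ev Z * \<gamma>) = 0" by (simp add: algebra_simps eq_neg_iff_add_eq_0)
  hence "ev Z * \<gamma> = 0" using of_nat_nonzero[of 2] by (simp only: mult_eq_0_iff) simp
  hence Qx: "ev Q * x = ev Y" using 1(5) by simp
  have "x * (ev Q * ev Q) = (ev Q * x) * ev Q" by (simp only: ac_simps)
  also have "\<dots> = ev (Y * Q)" unfolding Qx ev_mult ..
  finally have "x * (ev Q * ev Q) = ev (Y * Q)" .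
  moreover have "fixed_poly (Y * Q)" using 1 by (simp only: fixed_intros)
  ultimately show ?thesis using that 1 by blast
qed

lemma hom_ev:
  assumes "field_hom e" "\<And>c. e (\<iota> c) = C c" "e u = of_real x" "fixed_poly p"
  shows "e (ev p) = of_real (poly (real_poly p) x)"
proof -
  interpret e: field_hom e by fact
  have "e (ev p) = poly (map_poly C p) (e u)"
    by (induction p) (simp_all add: i.map_poly_pCons_hom C.map_poly_pCons_hom e.hom_add e.hom_mult assms(2))
  thus ?thesis using assms(3,4) by (simp add: poly_C_real)
qed

text \<open>
  Up to a square, an element fixed by the involution is a polynomial in \<open>u\<close>, and the polynomials that are
  positive in the ordering are positive on an interval.
\<close>
lemma positive_point_interval:
  assumes A: "finite A" "\<And>a. a \<in> A \<Longrightarrow> a \<in> T \<and> a \<noteq> 0 \<and> repr a"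
    and H: "fixed_poly H" "ev H \<in> T" "H \<noteq> 0"
  shows "\<exists>l r. l < r \<and> (\<forall>x. l < x \<longrightarrow> x < r \<longrightarrow> 0 < poly (real_poly H) x \<and>
    (\<forall>e a. field_hom e \<longrightarrow> (\<forall>c. e (\<iota> c) = C c) \<longrightarrow> e u = of_real x \<longrightarrow> a \<in> A \<longrightarrow> (\<exists>s>0. e a = of_real s)))"
proof -
  let ?rep = "\<lambda>a R. fixed_poly (fst R) \<and> fixed_poly (snd R) \<and> ev (snd R) \<noteq> 0 \<and> a * (ev (snd R) * ev (snd R)) = ev (fst R)"
  have "\<forall>a\<in>A. \<exists>R. ?rep a R"
  proof
    fix a assume a: "a \<in> A"
    have "J a = a" using A(2)[OF a] T_K0 by (auto simp: K0_eq)
    then obtain Q P where "fixed_poly Q" "fixed_poly P" "ev Q \<noteq> 0" "a * (ev Q * ev Q) = ev P"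
      using A(2)[OF a] by (elim conjE repr_fixed)
    hence "?rep a (P, Q)" by (simp only: fst_conv snd_conv simp_thms)
    thus "\<exists>R. ?rep a R" by (rule exI)
  qed
  from bchoice[OF this] obtain R where R: "\<forall>a\<in>A. ?rep a (R a)" ..
  define P where "P = (\<lambda>a. fst (R a))"
  define Q where "Q = (\<lambda>a. snd (R a))"
  have PQ: "fixed_poly (Q a)" "fixed_poly (P a)" "ev (Q a) \<noteq> 0" "a * (ev (Q a) * ev (Q a)) = ev (P a)" if "a \<in> A" for a
    unfolding P_def Q_def using bspec[OF R that] by simp_all
  have pos: "fixed_poly p \<and> p \<noteq> 0 \<and> ev p \<in> T" if p: "p \<in> insert H (P ` A)" for p
  proof (cases "p = H")
    case False
    then obtain a where a: "a \<in> A" "p = P a" using p by blast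
    have "ev (P a) \<in> T" unfolding PQ(4)[OF a(1), symmetric]
      using A(2)[OF a(1)] ev_K0[OF PQ(1)[OF a(1)]] by (intro T_mult T_square) auto
    moreover have "ev (P a) \<noteq> 0" unfolding PQ(4)[OF a(1), symmetric]
      using A(2)[OF a(1)] PQ(3)[OF a(1)] by simp
    hence "P a \<noteq> 0" by auto
    ultimately show ?thesis unfolding a(2) using PQ(2)[OF a(1)] by (intro conjI)
  qed (use H in blast)
  have fin: "finite (insert H (P ` A))" using A(1) by simp
  from positive_interval[OF fin pos] obtain l r where "l < r"
    "\<forall>x p. l < x \<longrightarrow> x < r \<longrightarrow> p \<in> insert H (P ` A) \<longrightarrow> 0 < poly (real_poly p) x" by blast
  note lr = this(1) this(2)[rule_format]
  show ?thesis
  proof (rule exI[of _ l], rule exI[of _ r], intro conjI allI impI)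
    show "l < r" by (rule lr(1))
    show "0 < poly (real_poly H) x" if "l < x" "x < r" for x using lr(2)[OF that] by simp
    fix x e a assume x: "l < x" "x < r" and e: "field_hom e" "\<forall>c. e (\<iota> c) = C c" "e u = of_real x" and a: "a \<in> A"
    interpret e: field_hom e by (rule e(1))
    note he = hom_ev[OF e(1) e(2)[rule_format] e(3)]
    let ?p = "poly (real_poly (P a)) x" and ?q = "poly (real_poly (Q a)) x"
    have p: "0 < ?p" using lr(2)[OF x] a by simp
    have eq: "e a * (of_real ?q * of_real ?q) = of_real ?p"
      using arg_cong[OF PQ(4)[OF a], of e] by (simp only: e.hom_mult he[OF PQ(1)[OF a]] he[OF PQ(2)[OF a]])
    have q: "?q \<noteq> 0"
    proof
      assume "?q = 0"
      thus False using eq p by simp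
    qed
    have "e a = of_real (?p / (?q * ?q))" using eq q by (simp add: nonzero_eq_divide_eq)
    moreover have "0 < ?q\<^sup>2" using q by simp
    hence "0 < ?p / (?q * ?q)" using p by (simp only: power2_eq_square divide_pos_pos)
    ultimately show "\<exists>s>0. e a = of_real s" by blast
  qed
qed

end

text \<open>
  A rational function with a pole at some point is transcendental over the constants: in a polynomial in it, the
  leading term has the pole of highest order.
\<close>
lemma pole_transcendental:
  fixes N D :: "'f::field poly"
  assumes D: "D \<noteq> 0" "poly D c = 0" and N: "poly N c \<noteq> 0" and p: "p \<noteq> 0"
  shows "poly (map_poly ratconst p) (to_fract N / to_fract D) \<noteq> 0"
proof
  interpret k: field_hom "ratconst :: 'f \<Rightarrow> _" by (rule ratconst_hom)
  let ?u = "to_fract N / to_fract D"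
  assume z: "poly (map_poly ratconst p) ?u = 0"
  have pow: "to_fract (D ^ k) = to_fract D ^ k" for k by (induction k) simp_all
  have "\<exists>R. to_fract D ^ degree p * poly (map_poly ratconst p) ?u = to_fract R \<and>
      poly R c = lead_coeff p * poly N c ^ degree p"
    using p
  proof (induction p)
    case (pCons a q)
    show ?case
    proof (cases "q = 0")
      case True
      thus ?thesis by (intro exI[of _ "[:a:]"]) (simp add: k.map_poly_pCons_hom, simp add: ratconst_def)
    next
      case False
      then obtain R where R: "to_fract D ^ degree q * poly (map_poly ratconst q) ?u = to_fract R"
        "poly R c = lead_coeff q * poly N c ^ degree q" using pCons.IH by blast
      have "to_fract D ^ Suc (degree q) * poly (map_poly ratconst (pCons a q)) ?u =
          to_fract D ^ Suc (degree q) * ratconst a + to_fract N * (to_fract D ^ degree q * poly (map_poly ratconst q) ?u)"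
        using D(1) by (simp add: k.map_poly_pCons_hom distrib_left)
      also have "\<dots> = to_fract (D ^ Suc (degree q) * [:a:] + N * R)"
        unfolding R(1) ratconst_def by (simp only: to_fract_add to_fract_mult pow)
      finally show ?thesis using False D(2) R(2)
        by (intro exI[of _ "D ^ Suc (degree q) * [:a:] + N * R"]) simp
    qed
  qed simp
  then obtain R where "to_fract R = 0" "poly R c = lead_coeff p * poly N c ^ degree p" using z by auto
  thus False using N p by simp
qed

text \<open>
  The points of the circle are parametrised by \<open>Z\<close>, with inverse map \<open>g\<close>. It is used where the
  polynomial \<open>H\<close> is positive.
\<close>
locale rational_coordinate =
  real_coordinate K0 T \<sigma> ratconst "ratfun_inv \<sigma>" C u \<gamma> G
  for K0 T :: "'f::field_char_0 poly fract set" and \<sigma> C u \<gamma> G +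
  fixes H :: "'f poly" and Z :: "real \<Rightarrow> complex" and g :: "complex \<Rightarrow> complex"
  assumes H: "fixed_poly H" "ev H \<in> T" "H \<noteq> 0"
    and repr_gen: "repr ratvar" "\<And>c. repr (ratconst c)"
    and Z: "\<And>x. 0 < poly (real_poly H) x \<Longrightarrow> norm (Z x) = 1"
      "\<And>x. 0 < poly (real_poly H) x \<Longrightarrow> g (Z x) = of_real x"
    and g: "\<And>e. field_hom e \<Longrightarrow> (\<And>c. e (ratconst c) = C c) \<Longrightarrow> e u = g (e ratvar)"
begin

lemma repr_all: "repr x"
  by (rule ratfun_closed_induct[of repr]) (simp_all add: repr_gen repr_add repr_mult repr_inverse)

text \<open>
  Only countably many points of the interval are mapped to algebraic numbers.
\<close>
lemma positive_point:
  assumes A: "finite A" "A \<subseteq> T - {0}"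
  shows "\<exists>z. norm z = 1 \<and> \<not> algebraic z \<and> (\<forall>e. field_hom e \<longrightarrow> (\<forall>c. e (ratconst c) = C c) \<longrightarrow> e ratvar = z \<longrightarrow>
     (\<forall>a\<in>A. \<exists>s>0. e a = complex_of_real s))"
proof -
  have A': "a \<in> T \<and> a \<noteq> 0 \<and> repr a" if "a \<in> A" for a using that A(2) repr_all by blast
  from positive_point_interval[OF A(1) A' H] obtain l r where "l < r"
    "\<forall>x. l < x \<longrightarrow> x < r \<longrightarrow> 0 < poly (real_poly H) x \<and>
      (\<forall>e a. field_hom e \<longrightarrow> (\<forall>c. e (ratconst c) = C c) \<longrightarrow> e u = of_real x \<longrightarrow> a \<in> A \<longrightarrow> (\<exists>s>0. e a = of_real s))"
    by blast
  note lr = this(1) this(2)[rule_format, THEN conjunct1] this(2)[rule_format, THEN conjunct2, rule_format]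
  have "inj_on Z {l<..<r}"
  proof (rule inj_onI)
    fix x y assume "x \<in> {l<..<r}" "y \<in> {l<..<r}" "Z x = Z y"
    hence "complex_of_real x = of_real y" using Z(2)[OF lr(2)] by (metis greaterThanLessThan_iff)
    thus "x = y" by simp
  qed
  moreover have "\<not> countable {l<..<r}" using lr(1) by (simp add: uncountable_open_interval)
  ultimately have "\<not> countable (Z ` {l<..<r})" using countable_image_inj_on by blast
  hence "\<not> Z ` {l<..<r} \<subseteq> {z. algebraic z}" using countable_algebraic countable_subset by blast
  then obtain w where "w \<in> Z ` {l<..<r}" "\<not> algebraic w" by blast
  then obtain x where x: "l < x" "x < r" "\<not> algebraic (Z x)" by auto
  have "\<exists>s>0. e a = complex_of_real s"
    if "field_hom e" "\<forall>c. e (ratconst c) = C c" "e ratvar = Z x" "a \<in> A" for e a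
    using that lr(3)[OF x(1,2), of e a] g[of e] Z(2)[OF lr(2)[OF x(1,2)]] by simp
  thus ?thesis using x(3) Z(1)[OF lr(2)[OF x(1,2)]] by blast
qed

end

section \<open>Every ordering is realised at points of the unit circle\<close>

locale rational_place = real_place K0 T \<sigma> ratconst "ratfun_inv \<sigma>"
  for K0 T :: "'f::field_char_0 poly fract set" and \<sigma>
begin

lemma J_const: "ratfun_inv \<sigma> (ratconst c) = ratconst (\<sigma> c)"
  and J_var: "ratfun_inv \<sigma> ratvar = inverse ratvar"
  using ratfun_inv_hom[OF s.field_hom_axioms] by blast+

lemma norm_in_T: "y = ratfun_inv \<sigma> x \<Longrightarrow> x * y \<in> T" using norm_T by simp

lemma embedding_coeff: assumes "field_hom C" shows "C (of_nat n) = (of_nat n :: complex)"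
proof -
  interpret C: field_hom C by fact
  show ?thesis by (induction n) (simp_all add: C.hom_add)
qed

text \<open>
  The coordinate is \<open>u = t + inverse t\<close>. It is finite because \<open>2 - u\<close> and \<open>2 + u\<close> are the norms of \<open>1 - t\<close> and
  \<open>1 + t\<close>, and \<open>4 - u * u\<close> is the norm of \<open>t - inverse t\<close>. For \<open>x * x < 4\<close> the solutions of
  \<open>z + inverse z = x\<close> lie on the circle.
\<close>
lemma positive_point_trivial:
  assumes triv: "\<And>x. \<sigma> x = x"
    and C: "field_hom C" "\<And>x. C (\<sigma> x) = cnj (C x)" "\<And>x. \<sigma> x = x \<Longrightarrow> C x = of_real (real_emb x)"
    and A: "finite A" "A \<subseteq> T - {0}"
  shows "\<exists>z. norm z = 1 \<and> \<not> algebraic z \<and> (\<forall>e. field_hom e \<longrightarrow> (\<forall>c. e (ratconst c) = C c) \<longrightarrow> e ratvar = z \<longrightarrow>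
     (\<forall>a\<in>A. \<exists>s>0. e a = complex_of_real s))"
proof -
  interpret C: field_hom C by fact
  define t :: "'f poly fract" where "t = ratvar"
  define v where "v = inverse t"
  define u where "u = t + v"
  define \<gamma> where "\<gamma> = t - v"
  have t0: "t \<noteq> 0" unfolding t_def by (rule ratvar_nonzero)
  have tv: "t * v = 1" "v * t = 1" using t0 by (simp_all add: v_def)
  have J: "ratfun_inv \<sigma> t = v" "ratfun_inv \<sigma> v = t"
    by (simp_all add: t_def v_def J_var J.hom_inverse)
  have Ju: "ratfun_inv \<sigma> u = u" "ratfun_inv \<sigma> \<gamma> = - \<gamma>"
    by (simp_all add: u_def \<gamma>_def J.hom_add J.hom_minus J)
  have u_frac: "u = to_fract [:1, 0, 1:] / to_fract [:0, 1:]"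
  proof -
    have "[:1, 0, 1:] = [:0, 1:] * [:0, 1:] + (1 :: 'f poly)" by (simp add: one_pCons)
    hence "to_fract [:1, 0, 1:] = t * t + 1" unfolding t_def ratvar_def by (metis to_fract_add to_fract_mult to_fract_1)
    thus ?thesis using t0 unfolding u_def v_def ratvar_def[symmetric] t_def[symmetric] by (simp add: field_simps)
  qed
  have u_tr: "poly (map_poly ratconst p) u \<noteq> 0" if "p \<noteq> 0" for p
    unfolding u_frac by (rule pole_transcendental[of _ 0]) (use that in simp_all)
  have "\<gamma> \<noteq> 0"
  proof
    assume "\<gamma> = 0"
    hence "t * t = 1" using tv by (simp add: \<gamma>_def)
    hence "to_fract ([:0, 1:] * [:0, 1:]) = to_fract (1 :: 'f poly)" unfolding t_def ratvar_def by (simp only: to_fract_mult to_fract_1)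
    hence "[:0, 1:] * [:0, 1:] = (1 :: 'f poly)" by (simp only: to_fract_eq_iff)
    thus False by (simp add: one_pCons)
  qed
  have "(1 - t) * (1 - v) \<in> T" "(1 + t) * (1 + v) \<in> T"
    by (rule norm_in_T; simp add: J.hom_minus J.hom_add J)+
  hence "of_nat 2 - u \<in> T" "of_nat 2 + u \<in> T" using tv by (simp_all add: u_def algebra_simps)
  moreover have "u \<in> K0" using Ju by (simp add: K0_eq)
  ultimately have uf: "finite_elt u" unfolding finite_elt_def by (intro conjI exI[of _ "2 :: nat"])
  interpret embedded_real_place K0 T \<sigma> ratconst "ratfun_inv \<sigma>" C u
    by unfold_locales (use C Ju uf u_tr in auto)
  have fixed: "fixed_poly p" for p by (rule poly_eqI) (simp add: triv)
  have sq: "\<gamma> * \<gamma> = u * u - 4"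
  proof -
    have "\<gamma> * \<gamma> = t * t + v * v - 2 * (t * v)" "u * u = t * t + v * v + 2 * (t * v)"
      by (simp_all add: \<gamma>_def u_def algebra_simps)
    thus ?thesis by (simp add: tv)
  qed
  have c4: "ratconst 4 = (4 :: 'f poly fract)" using iota_of_nat[of 4] by simp
  have evG: "ev [:- 4, 0, 1:] = u * u - 4"
    by (simp add: i.map_poly_pCons_hom i.hom_uminus c4)
  interpret real_coordinate K0 T \<sigma> ratconst "ratfun_inv \<sigma>" C u \<gamma> "[:- 4, 0, 1:]"
    by unfold_locales (use Ju \<open>\<gamma> \<noteq> 0\<close> sq evG fixed in auto)
  define Z where "Z = (\<lambda>x. Complex (x / 2) (sqrt (4 - x\<^sup>2) / 2))"
  have C4: "C 4 = 4" using embedding_coeff[OF C(1), of 4] by simp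
  have H: "poly (real_poly [:4, 0, - 1:]) x = 4 - x\<^sup>2" for x
  proof -
    have "real_poly [:4, 0, - 1:] = [:4, 0, - 1:]"
      by (rule poly_eqI) (simp add: coeff_pCons C4 C.hom_uminus split: nat.split)
    thus ?thesis by (simp add: power2_eq_square)
  qed
  interpret rational_coordinate K0 T \<sigma> C u \<gamma> "[:- 4, 0, 1:]" "[:4, 0, - 1:]" Z "\<lambda>z. z + inverse z"
  proof
    show "fixed_poly [:4, 0, - 1:]" by (rule fixed)
    show "[:4, 0, - 1:] \<noteq> (0 :: 'f poly)" by simp
    have "ev [:4, 0, - 1:] = \<gamma> * (- \<gamma>)"
      by (simp add: i.map_poly_pCons_hom i.hom_uminus c4 sq)
    also have "\<dots> \<in> T" by (rule norm_in_T) (simp add: Ju)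
    finally show "ev [:4, 0, - 1:] \<in> T" .
    show rc: "repr (ratconst c)" for c by (rule repr_base(3)[OF triv])
    have var_eq: "ratvar = ratconst (inverse 2) * (u + \<gamma>)"
    proof -
      have "ratconst 2 = (2 :: 'f poly fract)" using iota_of_nat[of 2] by simp
      hence half: "ratconst (inverse 2) * 2 = (1 :: 'f poly fract)" using i.hom_mult[of "inverse 2" 2] by simp
      have "u + \<gamma> = 2 * t" by (simp add: u_def \<gamma>_def)
      thus ?thesis by (simp only: mult.assoc[symmetric] half mult_1_left t_def)
    qed
    show "repr ratvar" unfolding var_eq by (intro repr_mult repr_add rc repr_base(1,2))
    fix x assume "0 < poly (real_poly [:4, 0, - 1:]) x"
    hence x: "0 < 4 - x\<^sup>2" by (simp only: H)
    have sqrt_sq: "(sqrt (4 - x\<^sup>2))\<^sup>2 = 4 - x\<^sup>2" using x by simp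
    have "(cmod (Z x))\<^sup>2 = 1\<^sup>2"
      unfolding Z_def cmod_power2 complex.sel power_divide sqrt_sq by (simp add: field_simps)
    thus n: "cmod (Z x) = 1" by (rule power2_eq_imp_eq) simp_all
    have "Z x * cnj (Z x) = 1" using n complex_norm_square[of "Z x"] by simp
    hence inv: "inverse (Z x) = cnj (Z x)" by (rule inverse_unique)
    show "Z x + inverse (Z x) = of_real x" unfolding inv complex_add_cnj by (simp add: Z_def)
  next
    fix e :: "'f poly fract \<Rightarrow> complex" assume "field_hom e"
    then interpret e: field_hom e .
    show "e u = e ratvar + inverse (e ratvar)" by (simp add: u_def v_def t_def e.hom_add e.hom_inverse)
  qed
  show ?thesis by (rule positive_point[OF A])
qed

text \<open>
  With \<open>\<sigma> \<alpha> = - \<alpha>\<close>, the Moebius transformation \<open>\<alpha> * (1 + \<kappa> * t) / (1 - \<kappa> * t)\<close> is invariant under the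
  involution for \<open>\<kappa> = 1\<close> and \<open>\<kappa> = - 1\<close>. As \<open>\<alpha>\<close> is sent to an imaginary number, its inverse maps the real line into the circle.
\<close>
lemma positive_point_nontrivial:
  assumes nontriv: "\<sigma> b \<noteq> b"
    and C: "field_hom C" "\<And>x. C (\<sigma> x) = cnj (C x)" "\<And>x. \<sigma> x = x \<Longrightarrow> C x = of_real (real_emb x)"
    and A: "finite A" "A \<subseteq> T - {0}"
  shows "\<exists>z. norm z = 1 \<and> \<not> algebraic z \<and> (\<forall>e. field_hom e \<longrightarrow> (\<forall>c. e (ratconst c) = C c) \<longrightarrow> e ratvar = z \<longrightarrow>
     (\<forall>a\<in>A. \<exists>s>0. e a = complex_of_real s))"
proof -
  interpret C: field_hom C by fact
  define \<alpha> where "\<alpha> = b - \<sigma> b"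
  have al: "\<alpha> \<noteq> 0" "\<sigma> \<alpha> = - \<alpha>" using nontriv by (auto simp: \<alpha>_def s.hom_minus)
  define t :: "'f poly fract" where "t = ratvar"
  have t0: "t \<noteq> 0" unfolding t_def by (rule ratvar_nonzero)
  have Jt: "ratfun_inv \<sigma> t = inverse t" by (simp add: t_def J_var)
  define \<gamma> where "\<gamma> = ratconst \<alpha>"
  have ga: "ratfun_inv \<sigma> \<gamma> = - \<gamma>" "\<gamma> \<noteq> 0" using al by (simp_all add: \<gamma>_def J_const i.hom_uminus)
  define U where "U = (\<lambda>\<kappa>. \<gamma> * (1 + ratconst \<kappa> * t) / (1 - ratconst \<kappa> * t))"
  have lin: "1 + ratconst c * t = to_fract [:1, c:]" for c
  proof -
    have "[:1, c:] = [:1:] + [:c:] * [:0, 1:]" by simp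
    thus ?thesis unfolding t_def ratvar_def ratconst_def by (metis one_pCons to_fract_1 to_fract_add to_fract_mult)
  qed
  have lin': "1 - ratconst c * t = to_fract [:1, - c:]" for c
    using lin[of "- c"] by (simp add: i.hom_uminus)
  have nz: "1 + ratconst c * t \<noteq> 0" "1 - ratconst c * t \<noteq> 0" for c
    unfolding lin lin' by simp_all
  have JU: "ratfun_inv \<sigma> (U \<kappa>) = U \<kappa>" if k: "\<kappa> = 1 \<or> \<kappa> = - 1" for \<kappa>
  proof -
    have "\<sigma> \<kappa> = \<kappa>" using k by (auto simp: s.hom_uminus)
    hence "ratfun_inv \<sigma> (U \<kappa>) = - \<gamma> * (1 + ratconst \<kappa> * inverse t) / (1 - ratconst \<kappa> * inverse t)"
      by (simp add: U_def divide_inverse J.hom_mult J.hom_inverse J.hom_add J.hom_minus J_const Jt ga)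
    also have "\<dots> = U \<kappa>"
    proof -
      have k2: "ratconst \<kappa> = 1 \<or> ratconst \<kappa> = - 1" using k by (auto simp: i.hom_uminus)
      hence "ratconst \<kappa> * ratconst \<kappa> = 1" by auto
      have nz': "1 - ratconst \<kappa> * inverse t \<noteq> 0"
      proof
        assume "1 - ratconst \<kappa> * inverse t = 0"
        hence "t = ratconst \<kappa>" using t0 by (simp add: field_simps)
        hence "1 - ratconst \<kappa> * t = 0" using k2 by auto
        thus False using nz by blast
      qed
      have "(1 + ratconst \<kappa> * inverse t) * (1 - ratconst \<kappa> * t) = - ((1 + ratconst \<kappa> * t) * (1 - ratconst \<kappa> * inverse t))"
        using t0 k2 by (auto simp: algebra_simps)
      hence "- \<gamma> * ((1 + ratconst \<kappa> * inverse t) * (1 - ratconst \<kappa> * t)) = \<gamma> * (1 + ratconst \<kappa> * t) * (1 - ratconst \<kappa> * inverse t)"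
        by simp
      thus ?thesis unfolding U_def using nz' nz(2)[of \<kappa>] by (simp only: frac_eq_eq mult.assoc simp_thms) 
    qed
    finally show ?thesis .
  qed
  have fin2: "finite_elt (\<gamma> * \<gamma>)"
    unfolding \<gamma>_def i.hom_mult[symmetric] by (rule const_finite) (simp add: s.hom_mult al)
  have UU: "U 1 * U (- 1) = \<gamma> * \<gamma>"
    using nz(1)[of 1] nz(2)[of 1] by (simp add: U_def i.hom_uminus)
  \<comment> \<open>One of the two Moebius coordinates is finite because their product is a constant.\<close>
  obtain \<kappa> where k: "\<kappa> = 1 \<or> \<kappa> = - 1" and uf: "finite_elt (U \<kappa>)"
  proof (cases "finite_elt (U 1)")
    case True
    thus ?thesis using that[of 1] by simp
  next
    case False
    have "U 1 \<in> K0" using JU[of 1] by (simp add: K0_eq)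
    note inf = infinite_inverse(1)[OF this False]
    have "U 1 \<noteq> 0" using ga(2) nz(1)[of 1] nz(2)[of 1] by (simp add: U_def)
    hence "U (- 1) = inverse (U 1) * (\<gamma> * \<gamma>)" unfolding UU[symmetric] by simp
    hence "finite_elt (U (- 1))" using finite_mult[OF inf fin2] by simp
    thus ?thesis using that[of "- 1"] by simp
  qed
  define u where "u = U \<kappa>"
  have Ju: "ratfun_inv \<sigma> u = u" using JU[OF k] by (simp add: u_def)
  have kk: "\<kappa> * \<kappa> = 1" "\<kappa> \<noteq> 0" using k by auto
  have u_frac: "u = to_fract (smult \<alpha> [:1, \<kappa>:]) / to_fract [:1, - \<kappa>:]"
  proof -
    have "smult \<alpha> [:1, \<kappa>:] = [:\<alpha>:] * [:1, \<kappa>:]" by simp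
    hence "to_fract (smult \<alpha> [:1, \<kappa>:]) = \<gamma> * to_fract [:1, \<kappa>:]" unfolding \<gamma>_def ratconst_def by (metis to_fract_mult)
    thus ?thesis by (simp add: u_def U_def lin lin')
  qed
  have N_eq: "poly (smult \<alpha> [:1, \<kappa>:]) \<kappa> = \<alpha> * (1 + \<kappa> * \<kappa>)" by (simp add: algebra_simps)
  have N0: "poly (smult \<alpha> [:1, \<kappa>:]) \<kappa> \<noteq> 0" unfolding N_eq kk(1) using al(1) by simp
  have u_tr: "poly (map_poly ratconst p) u \<noteq> 0" if "p \<noteq> 0" for p
    unfolding u_frac by (rule pole_transcendental[OF _ _ N0]) (use that kk in simp_all)
  interpret embedded_real_place K0 T \<sigma> ratconst "ratfun_inv \<sigma>" C u
    by unfold_locales (use C Ju uf[folded u_def] u_tr in auto)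
  have fG: "fixed_poly [:\<alpha> * \<alpha>:]" by (simp add: s.map_poly_pCons_hom s.hom_mult al)
  have evG: "\<gamma> * \<gamma> = ev [:\<alpha> * \<alpha>:]" by (simp add: \<gamma>_def i.map_poly_pCons_hom i.hom_mult)
  interpret real_coordinate K0 T \<sigma> ratconst "ratfun_inv \<sigma>" C u \<gamma> "[:\<alpha> * \<alpha>:]"
    by unfold_locales (use ga evG fG in auto)
  define a where "a = Im (C \<alpha>)"
  have Ca: "C \<alpha> = \<i> * of_real a"
  proof -
    have "C (\<sigma> \<alpha>) = - C \<alpha>" by (simp add: al C.hom_uminus)
    hence "Re (C \<alpha>) = 0" unfolding C_sigma by (simp add: complex_eq_iff)
    thus ?thesis by (simp add: a_def complex_eq_iff)
  qed
  have a0: "a \<noteq> 0" using al(1) Ca by auto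
  have Ck: "C \<kappa> * C \<kappa> = 1" "cmod (C \<kappa>) = 1" "C \<kappa> \<noteq> 0" using k by (auto simp: C.hom_uminus)
  define Z where "Z = (\<lambda>x. C \<kappa> * (of_real x - C \<alpha>) / (of_real x + C \<alpha>))"
  have d0: "of_real x + C \<alpha> \<noteq> 0" "of_real x - C \<alpha> \<noteq> 0" for x using a0 by (auto simp: Ca complex_eq_iff)
  have H1: "real_poly 1 = 1" by (rule poly_eqI) (simp add: coeff_1)
  interpret rational_coordinate K0 T \<sigma> C u \<gamma> "[:\<alpha> * \<alpha>:]" 1 Z "\<lambda>z. C \<alpha> * (1 + C \<kappa> * z) / (1 - C \<kappa> * z)"
  proof
    show "fixed_poly 1" "ev 1 \<in> T" "1 \<noteq> (0 :: 'f poly)" using T_1 by simp_all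
    show rc: "repr (ratconst c)" for c
    proof -
      define y where "y = (c + \<sigma> c) / 2"
      define w where "w = (c - \<sigma> c) / (2 * \<alpha>)"
      have two: "\<sigma> 2 = 2" by (metis one_add_one s.hom_add s.hom_one)
      have sdiv: "\<sigma> (x / y) = \<sigma> x / \<sigma> y" for x y by (simp add: divide_inverse s.hom_mult s.hom_inverse)
      have y: "\<sigma> y = y" by (simp add: y_def sdiv two s.hom_add add.commute)
      have "\<sigma> w = (\<sigma> c - c) / (- (2 * \<alpha>))" by (simp add: w_def sdiv two s.hom_minus s.hom_mult al)
      hence w: "\<sigma> w = w" by (simp add: w_def divide_simps)
      have "c = y + w * \<alpha>" using al(1) by (simp add: y_def w_def field_simps)
      hence "ratconst c = ratconst y + ratconst w * \<gamma>" by (simp add: \<gamma>_def i.hom_add i.hom_mult)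
      thus ?thesis using y w by (simp add: repr_add repr_mult repr_base)
    qed
    have var_eq: "ratvar = ratconst \<kappa> * (u + ratconst (- 1) * \<gamma>) * inverse (u + \<gamma>)"
    proof -
      have kt: "ratconst \<kappa> * ratconst \<kappa> = (1 :: 'f poly fract)" unfolding i.hom_mult[symmetric] kk by simp
      let ?n = "1 - ratconst \<kappa> * t"
      have n: "?n \<noteq> 0" by (rule nz)
      have "u = \<gamma> * (1 + ratconst \<kappa> * t) / ?n" unfolding u_def U_def ..
      hence un: "u * ?n = \<gamma> * (1 + ratconst \<kappa> * t)" by (simp only: nonzero_eq_divide_eq[OF n])
      have "(u + \<gamma>) * ?n = \<gamma> * (1 + ratconst \<kappa> * t) + \<gamma> * ?n" "(u - \<gamma>) * ?n = \<gamma> * (1 + ratconst \<kappa> * t) - \<gamma> * ?n"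
        by (simp_all only: distrib_right left_diff_distrib un)
      hence 1: "(u + \<gamma>) * ?n = 2 * \<gamma>" "(u - \<gamma>) * ?n = 2 * \<gamma> * (ratconst \<kappa> * t)" by (simp_all add: algebra_simps)
      have two: "(2 :: 'f poly fract) \<noteq> 0" using of_nat_nonzero[of 2] by simp
      have up: "u + \<gamma> \<noteq> 0" using 1(1) two ga(2) by auto
      have "(u - \<gamma>) * ?n = ((u + \<gamma>) * ?n) * (ratconst \<kappa> * t)" unfolding 1 ..
      hence "(u - \<gamma>) * ?n = ((u + \<gamma>) * (ratconst \<kappa> * t)) * ?n" by (simp only: ac_simps)
      hence "u - \<gamma> = (u + \<gamma>) * (ratconst \<kappa> * t)" using n by simp
      hence "ratconst \<kappa> * (u - \<gamma>) = (ratconst \<kappa> * ratconst \<kappa>) * (t * (u + \<gamma>))" by (simp only: ac_simps)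
      hence "ratconst \<kappa> * (u - \<gamma>) * inverse (u + \<gamma>) = t" using up by (simp add: kt mult.assoc)
      thus ?thesis by (simp add: t_def i.hom_uminus)
    qed
    show "repr ratvar" unfolding var_eq by (intro repr_mult repr_add repr_inverse rc repr_base(1,2))
    fix x assume "0 < poly (real_poly 1) x"
    have "cmod (of_real x - C \<alpha>) = cmod (cnj (of_real x + C \<alpha>))" by (simp add: Ca)
    hence "cmod (of_real x - C \<alpha>) = cmod (of_real x + C \<alpha>)" by (simp only: complex_mod_cnj)
    thus "cmod (Z x) = 1" using d0(1)[of x] by (simp add: Z_def norm_mult norm_divide Ck)
    have "C \<kappa> * Z x = (of_real x - C \<alpha>) / (of_real x + C \<alpha>)" by (simp add: Z_def Ck flip: mult.assoc)
    moreover have "1 + (of_real x - C \<alpha>) / (of_real x + C \<alpha>) = 2 * of_real x / (of_real x + C \<alpha>)"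
      "1 - (of_real x - C \<alpha>) / (of_real x + C \<alpha>) = 2 * C \<alpha> / (of_real x + C \<alpha>)"
      using d0(1)[of x] by (simp_all add: divide_simps)
    ultimately show "C \<alpha> * (1 + C \<kappa> * Z x) / (1 - C \<kappa> * Z x) = of_real x"
      using d0(1)[of x] al(1) by simp
  next
    fix e :: "'f poly fract \<Rightarrow> complex" assume e: "field_hom e" "\<And>c. e (ratconst c) = C c"
    interpret e: field_hom e by (rule e(1))
    show "e u = C \<alpha> * (1 + C \<kappa> * e ratvar) / (1 - C \<kappa> * e ratvar)"
      by (simp add: u_def U_def \<gamma>_def t_def divide_inverse e.hom_add e.hom_minus e.hom_mult e.hom_inverse e(2))
  qed
  show ?thesis by (rule positive_point[OF A])
qed

theorem positive_point_on_circle: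
  assumes A: "finite A" "A \<subseteq> T - {0}"
  obtains \<rho> z where "\<rho> \<in> embeddings \<sigma>" "norm z = 1" "\<not> algebraic z"
    "\<forall>a\<in>A. \<exists>s>0. ratfun_eval z (ratfun_map \<rho> a) = complex_of_real s"
proof -
  obtain C where C: "field_hom C" "\<And>x. C (\<sigma> x) = cnj (C x)" "\<And>x. \<sigma> x = x \<Longrightarrow> C x = of_real (real_emb x)"
    by (rule complex_embedding) blast
  interpret C: field_hom C by (rule C(1))
  have "\<exists>z. norm z = 1 \<and> \<not> algebraic z \<and> (\<forall>e. field_hom e \<longrightarrow> (\<forall>c. e (ratconst c) = C c) \<longrightarrow> e ratvar = z \<longrightarrow>
     (\<forall>a\<in>A. \<exists>s>0. e a = complex_of_real s))"
  proof (cases "\<forall>x. \<sigma> x = x")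
    case True
    show ?thesis by (rule positive_point_trivial[OF _ C A]) (use True in blast)
  next
    case False
    then obtain b where "\<sigma> b \<noteq> b" by blast
    thus ?thesis by (rule positive_point_nontrivial[OF _ C A])
  qed
  then obtain z where z: "norm z = 1" "\<not> algebraic z"
    "\<And>e. field_hom e \<Longrightarrow> (\<And>c. e (ratconst c) = C c) \<Longrightarrow> e ratvar = z \<Longrightarrow> \<forall>a\<in>A. \<exists>s>0. e a = complex_of_real s"
    by blast
  define \<rho> where "\<rho> = (\<lambda>x. to_qbar (C x))"
  have r: "of_qbar (\<rho> x) = C x" for x
    unfolding \<rho>_def by (rule to_qbar_inverse) (simp add: algebraic_field_hom[OF C(1) alg])
  have inj: "x = y" if "of_qbar x = of_qbar y" for x y using that by (simp add: of_qbar_inject)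
  have rh: "field_hom \<rho>"
    by (rule field_homI; rule inj)
      (simp_all add: plus_qbar.rep_eq times_qbar.rep_eq one_qbar.rep_eq r C.hom_add C.hom_mult)
  have "\<rho> (\<sigma> x) = cnj_qbar (\<rho> x)" for x by (rule inj) (simp add: cnj_qbar.rep_eq r C(2))
  hence "\<rho> \<in> embeddings \<sigma>" using rh by (simp add: embeddings_def)
  moreover have "\<forall>a\<in>A. \<exists>s>0. ratfun_eval z (ratfun_map \<rho> a) = complex_of_real s"
    by (rule z(3)[of "\<lambda>x. ratfun_eval z (ratfun_map \<rho> x)", OF field_hom_comp[OF ratfun_map_hom(1)[OF rh] ratfun_eval_hom(1)[OF z(2)]]])
      (simp_all add: ratfun_map_hom[OF rh] ratfun_eval_hom[OF z(2)] r)
  ultimately show ?thesis using that z(1,2) by blast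
qed

end

text \<open>
  The reason why one of two conjugate embeddings suffices.
\<close>
lemma evaluation_cnj:
  assumes \<rho>: "field_hom \<rho>" and z: "\<not> algebraic z"
  shows "ratfun_eval (cnj z) (ratfun_map (cnj_qbar \<circ> \<rho>) x) = cnj (ratfun_eval z (ratfun_map \<rho> x))"
proof -
  have c: "field_hom cnj_qbar" using cnj_qbar_involution by (simp add: field_involution_def)
  have c': "field_hom cnj" using field_involution_cnj by (simp add: field_involution_def)
  have r': "field_hom (cnj_qbar \<circ> \<rho>)" using field_hom_comp[OF \<rho> c] by (simp add: o_def)
  have z': "\<not> algebraic (cnj z)" using z by simp
  show ?thesis
    by (rule ratfun_hom_eqI[OF field_hom_comp[OF ratfun_map_hom(1)[OF r'] ratfun_eval_hom(1)[OF z']]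
          field_hom_comp[OF field_hom_comp[OF ratfun_map_hom(1)[OF \<rho>] ratfun_eval_hom(1)[OF z]] c']])
      (simp_all add: ratfun_map_hom[OF r'] ratfun_map_hom[OF \<rho>] ratfun_eval_hom[OF z] ratfun_eval_hom[OF z'] cnj_qbar.rep_eq)
qed

lemma (in rational_place) positive_point_up_to_cnj:
  assumes A: "finite A" "A \<subseteq> T - {0}" and G0: "embeddings_up_to_cnj \<sigma> G0"
  obtains \<rho> z where "\<rho> \<in> G0" "norm z = 1" "\<not> algebraic z"
    "\<forall>a\<in>A. \<exists>s>0. ratfun_eval z (ratfun_map \<rho> a) = complex_of_real s"
proof -
  obtain \<rho> z where *: "\<rho> \<in> embeddings \<sigma>" "norm z = 1" "\<not> algebraic z"
    "\<forall>a\<in>A. \<exists>s>0. ratfun_eval z (ratfun_map \<rho> a) = complex_of_real s"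
    by (rule positive_point_on_circle[OF A])
  obtain \<rho>' where r': "\<rho>' \<in> G0" "\<rho>' = \<rho> \<or> \<rho>' = cnj_qbar \<circ> \<rho>"
    using G0 *(1) unfolding embeddings_up_to_cnj_def by blast
  show ?thesis
  proof (cases "\<rho>' = \<rho>")
    case True
    thus ?thesis using that[OF r'(1) *(2,3)] *(4) by simp
  next
    case False
    hence eq: "\<rho>' = cnj_qbar \<circ> \<rho>" using r'(2) by blast
    have rh: "field_hom \<rho>" using *(1) by (simp add: embeddings_def)
    have "\<exists>s>0. ratfun_eval (cnj z) (ratfun_map \<rho>' a) = complex_of_real s" if "a \<in> A" for a
    proof -
      from bspec[OF *(4) that] obtain s where s: "s > 0 \<and> ratfun_eval z (ratfun_map \<rho> a) = complex_of_real s" ..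
      hence "ratfun_eval (cnj z) (ratfun_map \<rho>' a) = complex_of_real s"
        unfolding eq evaluation_cnj[OF rh *(3)] by simp
      thus ?thesis using s by (intro exI[of _ s] conjI) simp_all
    qed
    thus ?thesis using that[OF r'(1), of "cnj z"] *(2,3) by simp
  qed
qed

section \<open>Signatures of evaluated forms\<close>

lemma diag_signature_single:
  assumes "Re (sign_scale \<epsilon> * d) = x" "x \<noteq> 0"
  shows "diag_signature \<epsilon> [d] = (if 0 < x then 1 else - 1)"
  unfolding diag_signature_def filter.simps assms(1) using assms(2) by auto

lemma sign_of_product:
  fixes x y :: real
  assumes "x \<noteq> 0" "y \<noteq> 0"
  shows "(if 0 < x * y then 1 else - 1 :: int) = (if 0 < y then 1 else - 1) * (if 0 < x then 1 else - 1)"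
  using assms by (cases "0 < x"; cases "0 < y") (auto simp: zero_less_mult_iff)

lemma diag_signature_scaled:
  fixes s :: "'a \<Rightarrow> real" and w :: complex
  assumes w: "Re (sign_scale \<epsilon> * w) \<noteq> 0" and s: "\<And>a. a \<in> set as \<Longrightarrow> s a \<noteq> 0"
  shows "diag_signature \<epsilon> (map (\<lambda>a. of_real (s a) * w) as) =
    (if 0 < Re (sign_scale \<epsilon> * w) then 1 else - 1) * (\<Sum>a\<leftarrow>as. if 0 < s a then 1 else - 1)"
  using s
proof (induction as)
  case Nil
  show ?case by (simp add: diag_signature_def)
next
  case (Cons a as)
  let ?f = "\<lambda>a. of_real (s a) * w" and ?c = "Re (sign_scale \<epsilon> * w)"
  have sa: "s a \<noteq> 0" by (rule Cons.prems) simp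
  have "sign_scale \<epsilon> * ?f a = of_real (s a) * (sign_scale \<epsilon> * w)" by (simp only: ac_simps)
  hence re: "Re (sign_scale \<epsilon> * ?f a) = s a * ?c" by (simp only: Re_of_real_mult)
  have "s a * ?c \<noteq> 0" using sa w by (simp only: mult_eq_0_iff simp_thms)
  from diag_signature_single[OF re this]
  have one: "diag_signature \<epsilon> [?f a] = (if 0 < ?c then 1 else - 1) * (if 0 < s a then 1 else - 1)"
    unfolding sign_of_product[OF sa w] .
  have "diag_signature \<epsilon> (map ?f (a # as)) = diag_signature \<epsilon> [?f a] + diag_signature \<epsilon> (map ?f as)"
    using diag_signature_append[of \<epsilon> "[?f a]" "map ?f as"] by (simp only: append.simps list.map)
  also have "diag_signature \<epsilon> (map ?f as) = (if 0 < ?c then 1 else - 1) * (\<Sum>a\<leftarrow>as. if 0 < s a then 1 else - 1)"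
    by (rule Cons.IH) (rule Cons.prems, simp)
  finally show ?case unfolding one by (simp only: distrib_left list.map sum_list.Cons)
qed

text \<open>
  An \<open>\<epsilon>\<close>-symmetric complex number is real or purely imaginary, and the factor \<open>sign_scale \<epsilon>\<close> makes it real.
\<close>
lemma sign_scale_nonzero:
  assumes "\<epsilon> \<in> {1, -1}" "cnj w = of_int \<epsilon> * w" "w \<noteq> 0"
  shows "Re (sign_scale \<epsilon> * w) \<noteq> 0"
proof -
  from assms(1) consider "\<epsilon> = 1" | "\<epsilon> = - 1" by blast
  thus ?thesis
  proof cases
    case 1
    have "Im (cnj w) = Im w" using arg_cong[OF assms(2), of Im] 1 by simp
    hence "Re w \<noteq> 0" using assms(3) by (simp add: complex_eq_iff)
    thus ?thesis by (simp add: 1 sign_scale_def)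
  next
    case 2
    have "Re (cnj w) = - Re w" using arg_cong[OF assms(2), of Re] 2 by simp
    hence "Im w \<noteq> 0" using assms(3) by (simp add: complex_eq_iff)
    thus ?thesis by (simp add: 2 sign_scale_def)
  qed
qed

locale rational_hermitian =
  fixes \<sigma> :: "'f::field_char_0 \<Rightarrow> 'f" and \<epsilon> :: int
  assumes sigma: "field_involution \<sigma>" and eps: "\<epsilon> \<in> {1, -1}"
begin

definition unit_elt :: "'f poly fract" where
  "unit_elt = (if \<epsilon> = 1 then 1 else ratvar - inverse ratvar)"

text \<open>In the skew case, multiplication with \<open>t - inverse t\<close> turns hermitian forms into skew-hermitian forms.\<close>
sublocale H: hermitian_field "ratfun_inv \<sigma>" \<epsilon> unit_elt
proof
  show "field_involution (ratfun_inv \<sigma>)" by (rule ratfun_inv_involution[OF sigma])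
  show "\<epsilon> \<in> {1, -1}" by (rule eps)
  have sh: "field_hom \<sigma>" using sigma by (simp add: field_involution_def)
  interpret J: field_hom "ratfun_inv \<sigma>" by (rule ratfun_inv_hom(1)[OF sh])
  have t0: "(ratvar :: 'f poly fract) \<noteq> 0" by (rule ratvar_nonzero)
  have two: "to_fract (1 + 1 :: 'f poly) \<noteq> 0" unfolding to_fract_eq_0_iff by simp
  show "(2 :: 'f poly fract) \<noteq> 0" by (rule two[unfolded to_fract_add to_fract_1, unfolded one_add_one])
  show "unit_elt \<noteq> 0"
  proof (cases "\<epsilon> = 1")
    case False
    have "ratvar - inverse ratvar \<noteq> (0 :: 'f poly fract)"
    proof
      assume "ratvar - inverse ratvar = (0 :: 'f poly fract)"
      hence "ratvar * ratvar = (1 :: 'f poly fract)" using t0 by (simp add: field_simps)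
      hence "to_fract ([:0, 1:] * [:0, 1:]) = to_fract (1 :: 'f poly)" unfolding ratvar_def by (simp only: to_fract_mult to_fract_1)
      hence "[:0, 1:] * [:0, 1:] = (1 :: 'f poly)" by (simp only: to_fract_eq_iff)
      thus False by (simp add: one_pCons)
    qed
    thus ?thesis using False unfolding unit_elt_def by simp
  next
    case True
    show ?thesis unfolding unit_elt_def if_P[OF True] by simp
  qed
  show "ratfun_inv \<sigma> unit_elt = of_int \<epsilon> * unit_elt"
  proof (cases "\<epsilon> = 1")
    case True
    show ?thesis unfolding unit_elt_def if_P[OF True] unfolding True by simp
  next
    case False
    hence e: "\<epsilon> = - 1" using eps by blast
    show ?thesis unfolding unit_elt_def if_not_P[OF False] unfolding e
      by (simp add: J.hom_minus J.hom_inverse ratfun_inv_hom(3)[OF sh])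
  qed
qed

end

lemma (in hermitian_extension) rat_witt_ext_diag:
  assumes "K.admissible ds"
  shows "rat_witt_ext J J' h \<epsilon> (pure_tensor (witt_group J \<epsilon>) rat_group (K.diag_class ds) q) =
    pure_tensor (witt_group J' \<epsilon>) rat_group (L.diag_class (map h ds)) q"
  using rat_witt_ext_hom(2)[OF K.diag_class_carrier[OF assms], of q] by (simp only: witt_ext_diag_class[OF assms])

locale evaluation = rational_hermitian \<sigma> \<epsilon>
  for \<sigma> :: "'f::field_char_0 \<Rightarrow> 'f" and \<epsilon> :: int +
  fixes \<rho> :: "'f \<Rightarrow> qbar" and z :: complex
  assumes rho: "\<rho> \<in> embeddings \<sigma>" and z: "norm z = 1" "\<not> algebraic z"
begin

lemma rho_hom: "field_hom \<rho>" and rho_sigma: "\<rho> (\<sigma> a) = cnj_qbar (\<rho> a)"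
  using rho by (auto simp: embeddings_def)

lemma sigma_hom: "field_hom \<sigma>" using sigma by (simp add: field_involution_def)

lemma cnj_qbar_hom: "field_hom cnj_qbar" using cnj_qbar_involution by (simp add: field_involution_def)

lemma cnj_hom: "field_hom cnj" using field_involution_cnj by (simp add: field_involution_def)

sublocale M: hermitian_extension "ratfun_inv \<sigma>" \<epsilon> unit_elt "ratfun_map \<rho>" "ratfun_inv cnj_qbar"
proof (intro hermitian_extension.intro hermitian_extension_axioms.intro)
  show "hermitian_field (ratfun_inv \<sigma>) \<epsilon> unit_elt" by (rule H.hermitian_field_axioms)
  note m = ratfun_map_hom[OF rho_hom] and J = ratfun_inv_hom[OF sigma_hom]
    and J' = ratfun_inv_hom[OF cnj_qbar_hom]
  show "field_hom (ratfun_map \<rho>)" by (rule m(1))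
  show "field_involution (ratfun_inv cnj_qbar)" by (rule ratfun_inv_involution[OF cnj_qbar_involution])
  interpret m: field_hom "ratfun_map \<rho>" by (rule m(1))
  show "ratfun_inv cnj_qbar (ratfun_map \<rho> x) = ratfun_map \<rho> (ratfun_inv \<sigma> x)" for x
    by (rule ratfun_hom_eqI[OF field_hom_comp[OF m(1) J'(1)] field_hom_comp[OF J(1) m(1)]])
      (simp_all add: m J J' rho_sigma m.hom_inverse)
qed

lemma cnj_z: "cnj z = inverse z"
proof -
  have "z * cnj z = 1" using z(1) complex_norm_square[of z] by simp
  thus ?thesis by (rule inverse_unique[symmetric])
qed

sublocale E: hermitian_extension "ratfun_inv cnj_qbar" \<epsilon> "ratfun_map \<rho> unit_elt" "ratfun_eval z" cnj
proof (intro hermitian_extension.intro hermitian_extension_axioms.intro)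
  show "hermitian_field (ratfun_inv cnj_qbar) \<epsilon> (ratfun_map \<rho> unit_elt)" by (rule M.L.hermitian_field_axioms)
  note e = ratfun_eval_hom[OF z(2)] and J = ratfun_inv_hom[OF cnj_qbar_hom]
  show "field_hom (ratfun_eval z)" by (rule e(1))
  show "field_involution cnj" by (rule field_involution_cnj)
  interpret e: field_hom "ratfun_eval z" by (rule e(1))
  show "cnj (ratfun_eval z x) = ratfun_eval z (ratfun_inv cnj_qbar x)" for x
    by (rule ratfun_hom_eqI[OF field_hom_comp[OF e(1) cnj_hom] field_hom_comp[OF J(1) e(1)]])
      (simp_all add: e J cnj_z cnj_qbar.rep_eq e.hom_inverse)
qed

lemma signature_pure:
  assumes ds: "H.admissible ds"
  shows "rat_signature \<epsilon> (eval_at z \<epsilon> (embed_coeffs \<sigma> \<rho> \<epsilon>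
      (pure_tensor (witt_group (ratfun_inv \<sigma>) \<epsilon>) rat_group (H.diag_class ds) q))) =
    of_int (diag_signature \<epsilon> (map (\<lambda>d. ratfun_eval z (ratfun_map \<rho> d)) ds)) * q"
proof -
  have a1: "hermitian_field.admissible (ratfun_inv cnj_qbar) \<epsilon> (map (ratfun_map \<rho>) ds)"
    by (rule M.admissible_map[OF ds])
  have a2: "hermitian_field.admissible cnj \<epsilon> (map (ratfun_eval z) (map (ratfun_map \<rho>) ds))"
    by (rule E.admissible_map[OF a1])
  have c: "hermitian_field.diag_class cnj \<epsilon> (map (ratfun_eval z) (map (ratfun_map \<rho>) ds)) \<in> carrier (witt_group cnj \<epsilon>)"
    by (rule E.L.diag_class_carrier[OF a2])
  show ?thesis
    unfolding embed_coeffs_def M.rat_witt_ext_diag[OF ds] eval_at_def E.rat_witt_ext_diag[OF a1]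
      rat_signature_hom(2)[OF eps c] witt_signature_class[OF eps a2]
    by (simp add: comp_def)
qed

lemma signature_one:
  "rat_signature \<epsilon> (eval_at z \<epsilon> (embed_coeffs \<sigma> \<rho> \<epsilon> \<one>\<^bsub>rat_witt_group (ratfun_inv \<sigma>) \<epsilon>\<^esub>)) = 0"
proof -
  interpret C: hermitian_field cnj \<epsilon> "sign_scale \<epsilon>" by (rule hermitian_field_cnj[OF eps])
  have g: "group (rat_witt_group J \<epsilon>)" if "comm_group (witt_group J \<epsilon>)" for J :: "'k::field \<Rightarrow> 'k"
    using comm_group_tensor_product[OF comm_group.axioms(2)[OF that] comm_group.axioms(2)[OF comm_group_rat_group]]
    unfolding rat_witt_group_def by (rule comm_group.axioms(2))
  have 1: "embed_coeffs \<sigma> \<rho> \<epsilon> \<one>\<^bsub>rat_witt_group (ratfun_inv \<sigma>) \<epsilon>\<^esub> = \<one>\<^bsub>rat_witt_group (ratfun_inv cnj_qbar) \<epsilon>\<^esub>"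
    unfolding embed_coeffs_def
    by (rule hom_one[OF M.rat_witt_ext_hom(1) g[OF H.comm_group_witt] g[OF M.L.comm_group_witt]])
  have 2: "eval_at z \<epsilon> \<one>\<^bsub>rat_witt_group (ratfun_inv cnj_qbar) \<epsilon>\<^esub> = \<one>\<^bsub>rat_witt_group cnj \<epsilon>\<^esub>"
    unfolding eval_at_def
    by (rule hom_one[OF E.rat_witt_ext_hom(1) g[OF M.L.comm_group_witt] g[OF C.comm_group_witt]])
  have "rat_signature \<epsilon> \<one>\<^bsub>rat_witt_group cnj \<epsilon>\<^esub> = \<one>\<^bsub>rat_group\<^esub>"
    by (rule hom_one[OF rat_signature_hom(1)[OF eps] g[OF C.comm_group_witt] comm_group.axioms(2)[OF comm_group_rat_group]])
  thus ?thesis by (simp add: 1 2)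
qed

text \<open>
  The value of \<open>unit_elt\<close> at \<open>z\<close> only contributes a common sign.
\<close>
lemma signature_of_real_entries:
  assumes as: "\<And>a. a \<in> set as \<Longrightarrow> s a \<noteq> 0 \<and> ratfun_eval z (ratfun_map \<rho> a) = of_real (s a)"
  shows "\<bar>diag_signature \<epsilon> (map (\<lambda>d. ratfun_eval z (ratfun_map \<rho> d)) (map (\<lambda>a. a * unit_elt) as))\<bar> =
    \<bar>\<Sum>a\<leftarrow>as. if 0 < s a then 1 else - 1\<bar>"
proof -
  let ?w = "ratfun_eval z (ratfun_map \<rho> unit_elt)"
  have eq: "map (\<lambda>d. ratfun_eval z (ratfun_map \<rho> d)) (map (\<lambda>a. a * unit_elt) as) = map (\<lambda>a. of_real (s a) * ?w) as"
    using as by (simp add: M.h.hom_mult E.h.hom_mult)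
  note nz = sign_scale_nonzero[OF eps E.L.beta(2,1)]
  have "diag_signature \<epsilon> (map (\<lambda>a. of_real (s a) * ?w) as) =
    (if 0 < Re (sign_scale \<epsilon> * ?w) then 1 else - 1) * (\<Sum>a\<leftarrow>as. if 0 < s a then 1 else - 1)"
    by (rule diag_signature_scaled[OF nz]) (drule as, erule conjunct1)
  thus ?thesis unfolding eq by (simp add: abs_mult)
qed

end

section \<open>Vanishing of all signatures\<close>

theorem theorem1p1:
  fixes \<sigma> :: "'f::field_char_0 \<Rightarrow> 'f"
    and \<epsilon> :: int
    and G0 :: "('f \<Rightarrow> qbar) set"
    and \<tau> :: "'f poly fract rat_witt"
  assumes "galois_over_Rats TYPE('f)"
    and "field_involution \<sigma>"
    and "\<epsilon> \<in> {1, -1}"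
    and "embeddings_up_to_cnj \<sigma> G0"
    and "\<tau> \<in> carrier (rat_witt_group (ratfun_inv \<sigma>) \<epsilon>)"
  shows "\<tau> = \<one>\<^bsub>rat_witt_group (ratfun_inv \<sigma>) \<epsilon>\<^esub> \<longleftrightarrow>
    (\<forall>\<rho>\<in>G0. \<forall>z::complex. norm z = 1 \<and> \<not> algebraic z \<longrightarrow>
       rat_signature \<epsilon> (eval_at z \<epsilon> (embed_coeffs \<sigma> \<rho> \<epsilon> \<tau>)) = 0)"
proof -
  let ?J = "ratfun_inv \<sigma>"
  let ?W = "witt_group ?J \<epsilon>"
  interpret rational_hermitian \<sigma> \<epsilon> by unfold_locales fact+
  interpret R: comm_group rat_group by (rule comm_group_rat_group)
  have G0: "\<rho> \<in> embeddings \<sigma>" if "\<rho> \<in> G0" for \<rho>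
    using assms(4) that unfolding embeddings_up_to_cnj_def by blast
  show ?thesis
  proof (intro iffI ballI allI impI)
    fix \<rho> and z :: complex assume one: "\<tau> = \<one>\<^bsub>rat_witt_group ?J \<epsilon>\<^esub>" and \<rho>: "\<rho> \<in> G0" and z: "norm z = 1 \<and> \<not> algebraic z"
    interpret evaluation \<sigma> \<epsilon> \<rho> z by unfold_locales (use G0[OF \<rho>] z in auto)
    show "rat_signature \<epsilon> (eval_at z \<epsilon> (embed_coeffs \<sigma> \<rho> \<epsilon> \<tau>)) = 0" unfolding one by (rule signature_one)
  next
    assume zero: "\<forall>\<rho>\<in>G0. \<forall>z::complex. norm z = 1 \<and> \<not> algebraic z \<longrightarrow>
       rat_signature \<epsilon> (eval_at z \<epsilon> (embed_coeffs \<sigma> \<rho> \<epsilon> \<tau>)) = 0"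
    obtain A q where A: "A \<in> carrier ?W" "\<tau> = pure_tensor ?W rat_group A q"
      by (rule tensor_rat_pure[OF H.comm_group_witt assms(5)[unfolded rat_witt_group_def]])
    obtain ds where ds: "H.admissible ds" "A = H.diag_class ds" by (rule H.witt_group_diag_cases[OF A(1)])
    \<comment> \<open>The entries of a diagonal form are \<open>unit_elt\<close> times elements fixed by the involution.\<close>
    define as where "as = map (\<lambda>d. d / unit_elt) ds"
    note b = H.beta
    have ds_as: "ds = map (\<lambda>a. a * unit_elt) as" using b(1) by (simp add: as_def comp_def)
    have as: "set as \<subseteq> H.scalars"
    proof
      fix a assume "a \<in> set as"
      then obtain d where d: "d \<in> set ds" "a = d / unit_elt" by (auto simp: as_def)
      have dJ: "d \<noteq> 0" "?J d = of_int \<epsilon> * d" using ds(1) d(1) unfolding H.admissible_def by blast+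
      have "?J a = (of_int \<epsilon> * d) * inverse (of_int \<epsilon> * unit_elt)"
        by (simp only: d(2) divide_inverse H.J.hom_mult H.J.hom_inverse dJ(2) b(2))
      also have "\<dots> = a" using eps unfolding d(2) divide_inverse by auto
      finally show "a \<in> H.scalars" using dJ(1) b(1) by (simp add: H.scalars_def d(2))
    qed
    show "\<tau> = \<one>\<^bsub>rat_witt_group ?J \<epsilon>\<^esub>"
    proof (rule ccontr)
      assume ne: "\<tau> \<noteq> \<one>\<^bsub>rat_witt_group ?J \<epsilon>\<^esub>"
      have q: "q \<noteq> 0"
      proof
        assume "q = 0"
        have "group (tensor_product ?W rat_group)"
          by (rule comm_group.axioms(2)[OF comm_group_tensor_product[OF H.W.group_axioms R.group_axioms]])
        from hom_one[OF pure_tensor_hom_right[OF H.W.group_axioms R.group_axioms A(1)] R.group_axioms this]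
        show False using ne A(2) \<open>q = 0\<close> by (simp add: rat_witt_group_def)
      qed
      have "\<not> H.torsion A"
      proof
        assume "H.torsion A"
        then obtain n :: nat where "n > 0" "A [^]\<^bsub>?W\<^esub> n = \<one>\<^bsub>?W\<^esub>" by (auto simp: H.torsion_def)
        from pure_tensor_torsion[OF H.W.group_axioms A(1) this]
        show False using ne A(2) by (simp add: rat_witt_group_def)
      qed
      hence nt: "\<not> H.torsion (H.diag_class (map (\<lambda>a. a * unit_elt) as))" using ds(2) ds_as by simp
      from H.nontorsion_ordering[OF as nt] obtain T where T_all: "ordered_subfield {c. ?J c = c} T \<and>
        (\<forall>x. x * ?J x \<in> T) \<and> (\<Sum>a\<leftarrow>as. if a \<in> T then 1 else - 1 :: int) \<noteq> 0" ..
      note T = T_all[THEN conjunct1] T_all[THEN conjunct2, THEN conjunct1] T_all[THEN conjunct2, THEN conjunct2]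
      interpret T: ordered_subfield "{c. ?J c = c}" T by (rule T(1))
      have sh: "field_hom \<sigma>" using assms(2) by (simp add: field_involution_def)
      have alg: "algebraic x" for x :: 'f
        using assms(1)[unfolded galois_over_Rats_def, THEN conjunct1] by (rule spec)
      interpret T: rational_place "{c. ?J c = c}" T \<sigma>
        by (intro rational_place.intro real_place.intro real_place_axioms.intro)
          (rule T(1) assms(2) ratfun_inv_involution[OF assms(2)] ratconst_hom
            ratfun_inv_hom(2)[OF sh] T(2)[rule_format] alg refl)+
      define B where "B = (\<lambda>a. if a \<in> T then a else - a) ` set as"
      have B: "finite B" "B \<subseteq> T - {0}"
      proof -
        show "finite B" by (simp add: B_def)
        show "B \<subseteq> T - {0}"
        proof
          fix y assume "y \<in> B"
          then obtain a where a: "a \<in> set as" "y = (if a \<in> T then a else - a)" by (auto simp: B_def)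
          hence "a \<noteq> 0" "?J a = a" using as by (auto simp: H.scalars_def)
          thus "y \<in> T - {0}" using T.T_total[of a] a(2) by auto
        qed
      qed
      obtain \<rho> z where *: "\<rho> \<in> G0" "norm z = 1" "\<not> algebraic z"
        "\<forall>y\<in>B. \<exists>s>0. ratfun_eval z (ratfun_map \<rho> y) = complex_of_real s"
        by (rule T.positive_point_up_to_cnj[OF B assms(4)])
      interpret evaluation \<sigma> \<epsilon> \<rho> z by unfold_locales (use G0[OF *(1)] * in auto)
      define s where "s = (\<lambda>a. Re (ratfun_eval z (ratfun_map \<rho> a)))"
      have s: "ratfun_eval z (ratfun_map \<rho> a) = of_real (s a) \<and> s a \<noteq> 0 \<and> (0 < s a \<longleftrightarrow> a \<in> T)"
        if a: "a \<in> set as" for a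
      proof -
        let ?e = "\<lambda>a. ratfun_eval z (ratfun_map \<rho> a)"
        have "(if a \<in> T then a else - a) \<in> B" unfolding B_def using a by (rule imageI)
        from bspec[OF *(4) this] obtain r where r: "r > 0 \<and> ?e (if a \<in> T then a else - a) = complex_of_real r" ..
        show ?thesis
        proof (cases "a \<in> T")
          case True
          hence "?e a = of_real r" using r by (simp only: if_True simp_thms)
          thus ?thesis using r True by (simp add: s_def)
        next
          case False
          hence "- ?e a = of_real r"
            using r by (simp only: if_False simp_thms M.h.hom_uminus E.h.hom_uminus)
          hence "?e a = of_real (- r)" by (simp only: of_real_minus minus_equation_iff[of "?e a"])
          thus ?thesis using r False by (simp add: s_def)
        qed
      qed
      have "rat_signature \<epsilon> (eval_at z \<epsilon> (embed_coeffs \<sigma> \<rho> \<epsilon> \<tau>)) = 0"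
        by (rule zero[rule_format, OF *(1) conjI[OF *(2,3)]])
      hence "diag_signature \<epsilon> (map (\<lambda>d. ratfun_eval z (ratfun_map \<rho> d)) ds) = 0"
        unfolding A(2) ds(2) signature_pure[OF ds(1)] using q by simp
      hence "\<bar>\<Sum>a\<leftarrow>as. if 0 < s a then 1 else - 1 :: int\<bar> = 0"
        using signature_of_real_entries[of as s] s unfolding ds_as by simp
      moreover have "(\<Sum>a\<leftarrow>as. if 0 < s a then 1 else - 1 :: int) = (\<Sum>a\<leftarrow>as. if a \<in> T then 1 else - 1)"
        using s by (intro arg_cong[of _ _ sum_list] map_cong) auto
      ultimately show False using T(3) by simp
    qed
  qed
qed

end
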